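(* Let $(S,g_0)$ be a Riemannian manifold and let $\omega$ be a one-form on $S$ (possibly vanishing somewhere); let $S_0=\{x\in S:\ \omega_x=0\}$. Let $(\varepsilon_n)_n$ be a sequence of positive numbers converging to $0$ and, for each $n\in\mathbb N$, let $x_{\varepsilon_n}$ be a closed geodesic of the Randers metric $F_{\varepsilon_n}$, with $F_{\varepsilon_n}$-length $\Delta_{\varepsilon_n}$. Assume that $\sup_n\Delta_{\varepsilon_n}<+\infty$ and that the images of all the curves $x_{\varepsilon_n}$ are contained in a compact set $C$ which is included in an open subset $U\subset S\setminus S_0$ with compact closure, such that the curves $x_{\varepsilon_n}$ are non-contractible in $U$. Then the Kropina space $\left(S\setminus S_0,\ K\right)$, $K(v)=-\frac{g_0(v,v)}{2\omega(v)}$, admits a (non-trivial) closed geodesic.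
   Context: $S$ is a connected smooth manifold of dimension at least $2$; $g_0$ and $\omega$ are smooth. For $\varepsilon>0$, $F_\varepsilon$ is the Randers metric $$F_\varepsilon(v)=\frac1\varepsilon\left(\sqrt{\varepsilon\,g_0(v,v)+\omega^2(v)}+\omega(v)\right),\qquad v\in TS.$$ The Kropina metric $K(v)=-\frac{g_0(v,v)}{2\omega(v)}$ is defined (and positive) on $\mathcal A=\{v\in T(S\setminus S_0):\ -\omega(v)>0\}$. $\Omega(\mathcal A)$ is the set of continuous, piecewise smooth curves $\gamma:[0,1]\to S\setminus S_0$ with $\gamma(0)=\gamma(1)$ whose left and right derivatives belong to $\mathcal A$ for every $s\in[0,1]$ (at $s=0$ and $s=1$ understood periodically). A closed geodesic of $(S\setminus S_0,K)$ is a critical point of the energy $E(\gamma)=\frac12\int_0^1K^2(\dot\gamma)\,ds$ on $\Omega(\mathcal A)$. *)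

theory Defs
  imports "HOL-Analysis.Analysis"
begin

section \<open>Smooth maps between Euclidean spaces\<close>

text \<open>Only meant for open sets \<open>U\<close>. All partial derivatives of a \<open>C\<^sup>k\<^sup>+\<^sup>1\<close>
  map are obtained by evaluating its Frechet derivative in a fixed direction \<open>v\<close>.\<close>

fun Ck_on :: "nat \<Rightarrow> ('a::euclidean_space \<Rightarrow> 'b::euclidean_space) \<Rightarrow> 'a set \<Rightarrow> bool" where
  "Ck_on 0 f U \<longleftrightarrow> continuous_on U f"
| "Ck_on (Suc k) f U \<longleftrightarrow>
     (\<forall>x\<in>U. f differentiable (at x)) \<and> (\<forall>v. Ck_on k (\<lambda>x. frechet_derivative f (at x) v) U)"

definition smooth_on :: "('a::euclidean_space \<Rightarrow> 'b::euclidean_space) \<Rightarrow> 'a set \<Rightarrow> bool" where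
  "smooth_on f U \<longleftrightarrow> (\<forall>k. Ck_on k f U)"

section \<open>Smooth manifolds\<close>

text \<open>A chart is a pair of an open domain and a coordinate map; the values of the coordinate map
  outside the domain are irrelevant. The manifold is the whole type \<open>'m\<close>, its dimension is
  \<open>DIM('e)\<close>, and its smooth structure is given by an atlas that need not be maximal.\<close>

type_synonym ('m, 'e) chart = "'m set \<times> ('m \<Rightarrow> 'e)"

definition chart_inv :: "('m, 'e) chart \<Rightarrow> 'e \<Rightarrow> 'm" where
  "chart_inv c = inv_into (fst c) (snd c)"

definition transition :: "('m, 'e) chart \<Rightarrow> ('m, 'e) chart \<Rightarrow> 'e \<Rightarrow> 'e" where
  "transition c c' = snd c' \<circ> chart_inv c"

definition is_chart :: "('m::topological_space, 'e::euclidean_space) chart \<Rightarrow> bool" where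
  "is_chart c \<longleftrightarrow> open (fst c) \<and> open (snd c ` fst c) \<and>
     homeomorphism (fst c) (snd c ` fst c) (snd c) (chart_inv c)"

definition smooth_atlas :: "('m::topological_space, 'e::euclidean_space) chart set \<Rightarrow> bool" where
  "smooth_atlas \<A> \<longleftrightarrow> (\<forall>c\<in>\<A>. is_chart c) \<and> (\<Union>c\<in>\<A>. fst c) = UNIV \<and>
     (\<forall>c\<in>\<A>. \<forall>c'\<in>\<A>. smooth_on (transition c c') (snd c ` (fst c \<inter> fst c')))"

text \<open>Smoothness of a map from an arbitrary (for instance closed) subset \<open>D\<close> of a Euclidean
  space into the manifold: locally, the coordinate expression extends smoothly to an open
  neighbourhood.\<close>

definition smooth_into ::
  "('m::topological_space, 'e::euclidean_space) chart set \<Rightarrow> 'd::euclidean_space set \<Rightarrow> ('d \<Rightarrow> 'm) \<Rightarrow> bool"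
where
  "smooth_into \<A> D f \<longleftrightarrow> (\<forall>x\<in>D. \<exists>c\<in>\<A>. \<exists>W h. open W \<and> x \<in> W \<and> f ` (D \<inter> W) \<subseteq> fst c \<and>
     smooth_on h W \<and> (\<forall>y\<in>D \<inter> W. h y = snd c (f y)))"

section \<open>Tangent vectors\<close>

text \<open>A tangent vector at \<open>p\<close> is the family of its components in all charts around \<open>p\<close>,
  any two of which are related by the derivative of the transition map. It is extended by \<open>0\<close>
  to all other pairs, so that tangent vectors form a vector space under pointwise operations.
  \<open>tvec \<A> c p u\<close> is the tangent vector at \<open>p\<close> with components \<open>u\<close> in the chart \<open>c\<close>.\<close>

type_synonym ('m, 'e) tvector = "('m, 'e) chart \<Rightarrow> 'e"

definition tvec ::
  "('m, 'e::euclidean_space) chart set \<Rightarrow> ('m, 'e) chart \<Rightarrow> 'm \<Rightarrow> 'e \<Rightarrow> ('m, 'e) tvector" where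
  "tvec \<A> c p u = (\<lambda>c'. if c' \<in> \<A> \<and> p \<in> fst c'
     then frechet_derivative (transition c c') (at (snd c p)) u else 0)"

definition tangent_space ::
  "('m, 'e::euclidean_space) chart set \<Rightarrow> 'm \<Rightarrow> ('m, 'e) tvector set" where
  "tangent_space \<A> p = {v. \<forall>c\<in>\<A>. p \<in> fst c \<longrightarrow> v = tvec \<A> c p (v c)}"

definition tangent_bundle ::
  "('m, 'e::euclidean_space) chart set \<Rightarrow> ('m \<times> ('m, 'e) tvector) set" where
  "tangent_bundle \<A> = Sigma UNIV (tangent_space \<A>)"

definition tadd :: "('m, 'e::euclidean_space) tvector \<Rightarrow> ('m, 'e) tvector \<Rightarrow> ('m, 'e) tvector" where
  "tadd u v = (\<lambda>c. u c + v c)"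

definition tscale :: "real \<Rightarrow> ('m, 'e::euclidean_space) tvector \<Rightarrow> ('m, 'e) tvector" where
  "tscale a v = (\<lambda>c. a *\<^sub>R v c)"

definition tzero :: "('m, 'e::euclidean_space) tvector" where
  "tzero = (\<lambda>c. 0)"

text \<open>The argument \<open>F\<close> is \<open>at s\<close>, possibly restricted to one side.\<close>

definition velocity ::
  "('m, 'e::euclidean_space) chart set \<Rightarrow> (real \<Rightarrow> 'm) \<Rightarrow> real \<Rightarrow> real filter \<Rightarrow> ('m, 'e) tvector" where
  "velocity \<A> \<gamma> s F = (\<lambda>c. if c \<in> \<A> \<and> \<gamma> s \<in> fst c then vector_derivative (snd c \<circ> \<gamma>) F else 0)"

section \<open>Riemannian metrics and one-forms\<close>

definition tlinear_on :: "('m, 'e::euclidean_space) tvector set \<Rightarrow> (('m, 'e) tvector \<Rightarrow> real) \<Rightarrow> bool" where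
  "tlinear_on V f \<longleftrightarrow> (\<forall>u\<in>V. \<forall>v\<in>V. f (tadd u v) = f u + f v) \<and> (\<forall>a. \<forall>v\<in>V. f (tscale a v) = a * f v)"

definition one_form ::
  "('m, 'e::euclidean_space) chart set \<Rightarrow> ('m \<Rightarrow> ('m, 'e) tvector \<Rightarrow> real) \<Rightarrow> bool" where
  "one_form \<A> \<omega> \<longleftrightarrow> (\<forall>p. tlinear_on (tangent_space \<A> p) (\<omega> p)) \<and>
     (\<forall>c\<in>\<A>. \<forall>u. smooth_on (\<lambda>x. \<omega> (chart_inv c x) (tvec \<A> c (chart_inv c x) u)) (snd c ` fst c))"

definition riemannian_metric ::
  "('m, 'e::euclidean_space) chart set \<Rightarrow>
   ('m \<Rightarrow> ('m, 'e) tvector \<Rightarrow> ('m, 'e) tvector \<Rightarrow> real) \<Rightarrow> bool" where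
  "riemannian_metric \<A> g \<longleftrightarrow>
     (\<forall>p. \<forall>u\<in>tangent_space \<A> p. tlinear_on (tangent_space \<A> p) (g p u)) \<and>
     (\<forall>p. \<forall>u\<in>tangent_space \<A> p. \<forall>v\<in>tangent_space \<A> p. g p u v = g p v u) \<and>
     (\<forall>p. \<forall>v\<in>tangent_space \<A> p. v \<noteq> tzero \<longrightarrow> g p v v > 0) \<and>
     (\<forall>c\<in>\<A>. \<forall>u v. smooth_on
        (\<lambda>x. g (chart_inv c x) (tvec \<A> c (chart_inv c x) u) (tvec \<A> c (chart_inv c x) v))
        (snd c ` fst c))"

definition vanishing_set ::
  "('m, 'e::euclidean_space) chart set \<Rightarrow> ('m \<Rightarrow> ('m, 'e) tvector \<Rightarrow> real) \<Rightarrow> 'm set" where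
  "vanishing_set \<A> \<omega> = {p. \<forall>v\<in>tangent_space \<A> p. \<omega> p v = 0}"

section \<open>Closed geodesics of (conic) Finsler metrics\<close>

text \<open>For \<open>\<gamma>\<close> parametrised by \<open>[0,1]\<close>, \<open>P\<close> contains the break points: \<open>\<gamma>\<close> is smooth on every
  closed subinterval without break points in its interior.\<close>

definition piecewise_smooth ::
  "('m::topological_space, 'e::euclidean_space) chart set \<Rightarrow> (real \<Rightarrow> 'm) \<Rightarrow> bool" where
  "piecewise_smooth \<A> \<gamma> \<longleftrightarrow> continuous_on {0..1} \<gamma> \<and>
     (\<exists>P. finite P \<and> (\<forall>a b. 0 \<le> a \<and> a < b \<and> b \<le> 1 \<and> {a<..<b} \<inter> P = {} \<longrightarrow>
        smooth_into \<A> {a..b} \<gamma>))"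

text \<open>The space \<open>\<Omega>(D)\<close> of loops with all one-sided velocities in \<open>D \<subseteq> TS\<close>. The left velocity at
  \<open>0\<close> is by periodicity the one at \<open>1\<close>, and likewise for the right velocity at \<open>1\<close>, so both are
  covered.\<close>

definition loop_space ::
  "('m::topological_space, 'e::euclidean_space) chart set \<Rightarrow> ('m \<times> ('m, 'e) tvector) set \<Rightarrow>
   (real \<Rightarrow> 'm) set" where
  "loop_space \<A> D = {\<gamma>. piecewise_smooth \<A> \<gamma> \<and> \<gamma> 0 = \<gamma> 1 \<and>
     (\<forall>s\<in>{0..<1}. (\<gamma> s, velocity \<A> \<gamma> s (at s within {s..1})) \<in> D) \<and>
     (\<forall>s\<in>{0<..1}. (\<gamma> s, velocity \<A> \<gamma> s (at s within {0..s})) \<in> D)}"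

definition curve_length ::
  "('m, 'e::euclidean_space) chart set \<Rightarrow> ('m \<Rightarrow> ('m, 'e) tvector \<Rightarrow> real) \<Rightarrow> (real \<Rightarrow> 'm) \<Rightarrow> real" where
  "curve_length \<A> F \<gamma> = integral {0..1} (\<lambda>s. F (\<gamma> s) (velocity \<A> \<gamma> s (at s within {0..1})))"

definition energy ::
  "('m, 'e::euclidean_space) chart set \<Rightarrow> ('m \<Rightarrow> ('m, 'e) tvector \<Rightarrow> real) \<Rightarrow> (real \<Rightarrow> 'm) \<Rightarrow> real" where
  "energy \<A> F \<gamma> = 1/2 * integral {0..1} (\<lambda>s. (F (\<gamma> s) (velocity \<A> \<gamma> s (at s within {0..1})))\<^sup>2)"

text \<open>A variation of \<open>\<gamma>\<close> through loops of \<open>\<Omega>(D)\<close>, with variation parameter in \<open>(-\<delta>,\<delta>)\<close> and with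
  break points independent of the parameter.\<close>

definition loop_variation ::
  "('m::topological_space, 'e::euclidean_space) chart set \<Rightarrow> ('m \<times> ('m, 'e) tvector) set \<Rightarrow>
   (real \<Rightarrow> 'm) \<Rightarrow> real \<Rightarrow> (real \<Rightarrow> real \<Rightarrow> 'm) \<Rightarrow> bool" where
  "loop_variation \<A> D \<gamma> \<delta> H \<longleftrightarrow> \<delta> > 0 \<and> (\<forall>s\<in>{0..1}. H 0 s = \<gamma> s) \<and>
     (\<forall>r\<in>{-\<delta><..<\<delta>}. H r \<in> loop_space \<A> D) \<and>
     continuous_on ({-\<delta><..<\<delta>} \<times> {0..1}) (\<lambda>(r, s). H r s) \<and>
     (\<exists>P. finite P \<and> (\<forall>a b. 0 \<le> a \<and> a < b \<and> b \<le> 1 \<and> {a<..<b} \<inter> P = {} \<longrightarrow>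
        smooth_into \<A> ({-\<delta><..<\<delta>} \<times> {a..b}) (\<lambda>(r, s). H r s)))"

text \<open>Closed geodesics of the metric \<open>F\<close> with domain \<open>D\<close> are the critical points of its energy
  on \<open>\<Omega>(D)\<close>, i.e. the first variation of the energy vanishes.\<close>

definition closed_geodesic ::
  "('m::topological_space, 'e::euclidean_space) chart set \<Rightarrow> ('m \<times> ('m, 'e) tvector) set \<Rightarrow>
   ('m \<Rightarrow> ('m, 'e) tvector \<Rightarrow> real) \<Rightarrow> (real \<Rightarrow> 'm) \<Rightarrow> bool" where
  "closed_geodesic \<A> D F \<gamma> \<longleftrightarrow> \<gamma> \<in> loop_space \<A> D \<and>
     (\<forall>\<delta> H. loop_variation \<A> D \<gamma> \<delta> H \<longrightarrow>
        ((\<lambda>r. energy \<A> F (H r)) has_real_derivative 0) (at 0))"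

section \<open>Randers and Kropina metrics\<close>

definition randers ::
  "('m \<Rightarrow> ('m, 'e) tvector \<Rightarrow> ('m, 'e) tvector \<Rightarrow> real) \<Rightarrow> ('m \<Rightarrow> ('m, 'e) tvector \<Rightarrow> real) \<Rightarrow>
   real \<Rightarrow> 'm \<Rightarrow> ('m, 'e) tvector \<Rightarrow> real" where
  "randers g \<omega> \<epsilon> p v = 1 / \<epsilon> * (sqrt (\<epsilon> * g p v v + (\<omega> p v)\<^sup>2) + \<omega> p v)"

definition kropina ::
  "('m \<Rightarrow> ('m, 'e) tvector \<Rightarrow> ('m, 'e) tvector \<Rightarrow> real) \<Rightarrow> ('m \<Rightarrow> ('m, 'e) tvector \<Rightarrow> real) \<Rightarrow>
   'm \<Rightarrow> ('m, 'e) tvector \<Rightarrow> real" where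
  "kropina g \<omega> p v = - (g p v v / (2 * \<omega> p v))"

definition kropina_domain ::
  "('m, 'e::euclidean_space) chart set \<Rightarrow> ('m \<Rightarrow> ('m, 'e) tvector \<Rightarrow> real) \<Rightarrow>
   ('m \<times> ('m, 'e) tvector) set" where
  "kropina_domain \<A> \<omega> =
     {(p, v) \<in> tangent_bundle \<A>. p \<notin> vanishing_set \<A> \<omega> \<and> - \<omega> p v > 0}"

end

theory Submission
  imports Defs "HOL-Complex_Analysis.Great_Picard"
begin

text \<open>A Randers geodesic of length \<open>\<Delta>\<close> has constant speed \<open>F\<^sub>\<epsilon> = \<Delta>\<close>, which is the quadratic equation
  \<open>g\<^sub>0(v, v) + 2 \<Delta> \<omega>(v) = \<epsilon> \<Delta>\<^sup>2\<close>; at \<open>\<epsilon> = 0\<close> it says that the Kropina speed is \<open>\<Delta>\<close>. In terms of the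
  momentum \<open>p = (g\<^sub>0(v, \<cdot>) + \<Delta> \<omega>) / (\<epsilon> \<Delta> - \<omega>(v))\<close> the geodesic equations are Hamilton's equations with a
  right-hand side which is homogeneous in \<open>p\<close> and, away from the zeros of \<open>\<omega>\<close>, continuous up to \<open>\<epsilon> = 0\<close>.
  Hence the coordinate speeds of the given geodesics are bounded on \<open>C\<close>, and after rescaling of the momenta
  the theorem of Arzela and Ascoli produces a subsequence converging locally uniformly to a closed curve which solves
  the equations with \<open>\<epsilon> = 0\<close>. This curve is either constant or has \<open>\<omega>(v) < 0\<close> everywhere. If it were
  constant, the geodesics of the subsequence would eventually lie in a contractible coordinate ball inside \<open>U\<close>.
  Otherwise it is a Kropina geodesic parametrised with constant speed, and the boundary terms of
  the first variation of its energy cancel.\<close>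

section \<open>Calculus of smooth maps\<close>

text \<open>Behind the formulas stands the Lorentzian metric
  \<open>g + 2 \<omega> dt - \<epsilon> dt^2\<close>: for \<open>v \<noteq> 0\<close> the Randers
  speed is the positive \<open>F\<close> that makes \<open>(v, F)\<close> null, and this metric
  stays nondegenerate at \<open>\<epsilon> = 0\<close> wherever \<omega> does not vanish. The
  momentum is the space part of the null covector whose time component is \<open>-1\<close>. As
  nothing depends on \<open>t\<close>, the time component is conserved; rescaling turns it into
  \<open>- m n\<close>, and its limit \<open>- \<mu>\<close> is again constant along the curve. If
  \<open>\<mu> = 0\<close>, the limiting covector is a multiple of \<omega>: the null geodesic is a
  \<open>t\<close>-line and projects to a point. So on each window the limit moves everywhere or
  nowhere. The other obstacle is that a closed geodesic is only a critical point among piecewise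
  smooth loops, while the squared Randers metric is in general not twice differentiable at zero
  velocity. Regularity therefore comes from the momentum, which cannot jump, together with
  injectivity of the Legendre map, and not from inverting a Hessian.\<close>

lemma Ck_on_cong:
  assumes "open U" "\<And>x. x \<in> U \<Longrightarrow> f x = g x"
  shows "Ck_on k f U \<longleftrightarrow> Ck_on k g U"
  using assms(2)
proof (induction k arbitrary: f g)
  case 0
  then show ?case by (simp cong: continuous_on_cong)
next
  case (Suc k)
  have d: "f differentiable (at x) \<longleftrightarrow> g differentiable (at x)" if "x \<in> U" for x
  proof -
    have "(f has_derivative D) (at x) \<longleftrightarrow> (g has_derivative D) (at x)" for D
      using has_derivative_transform_within_open[OF _ \<open>open U\<close> that] Suc.prems by metis
    then show ?thesis unfolding differentiable_def by simp
  qed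
  show ?case
  proof (cases "\<forall>x\<in>U. f differentiable (at x)")
    case True
    have "frechet_derivative f (at x) v = frechet_derivative g (at x) v" if "x \<in> U" for x v
      using frechet_derivative_transform_within_open[of f x U g] True that Suc.prems \<open>open U\<close> by auto
    then have "Ck_on k (\<lambda>x. frechet_derivative f (at x) v) U \<longleftrightarrow>
        Ck_on k (\<lambda>x. frechet_derivative g (at x) v) U" for v
      by (intro Suc.IH)
    then show ?thesis using d by auto
  next
    case False
    then show ?thesis using d by auto
  qed
qed

lemma Ck_on_subset: "Ck_on k f U \<Longrightarrow> V \<subseteq> U \<Longrightarrow> Ck_on k f V"
proof (induction k arbitrary: f)
  case 0
  then show ?case by (auto intro: continuous_on_subset)
next
  case (Suc k)
  then show ?case by auto
qed

lemma Ck_on_SucD: "Ck_on (Suc k) f U \<Longrightarrow> Ck_on k f U"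
proof (induction k arbitrary: f)
  case 0
  then show ?case
    by (auto intro!: continuous_at_imp_continuous_on differentiable_imp_continuous_within)
next
  case (Suc k)
  then show ?case by (metis Ck_on.simps(2))
qed

lemma Ck_on_Suc_has_derivative:
  "Ck_on (Suc k) f U \<Longrightarrow> x \<in> U \<Longrightarrow> (f has_derivative frechet_derivative f (at x)) (at x)"
  using frechet_derivative_works by (metis Ck_on.simps(2))

text \<open>Lets inductions run on an explicit formula \<open>D\<close> for the derivative in place
  of \<open>frechet_derivative\<close>.\<close>

lemma Ck_on_SucI:
  assumes "open U" "\<And>x. x \<in> U \<Longrightarrow> (f has_derivative D x) (at x)" "\<And>v. Ck_on k (\<lambda>x. D x v) U"
  shows "Ck_on (Suc k) f U"
proof -
  have "frechet_derivative f (at x) = D x" if "x \<in> U" for x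
    using assms(2)[OF that] frechet_derivative_at by metis
  then have "Ck_on k (\<lambda>x. frechet_derivative f (at x) v) U" for v
    using Ck_on_cong[OF assms(1), of "\<lambda>x. frechet_derivative f (at x) v" "\<lambda>x. D x v" k] assms(3)
    by simp
  then show ?thesis
    using assms(2) by (auto simp: differentiable_def)
qed

lemma Ck_on_const: "Ck_on k (\<lambda>x. c) U"
  by (induction k arbitrary: c) auto

lemma Ck_on_add:
  assumes "open U" "Ck_on k f U" "Ck_on k g U"
  shows "Ck_on k (\<lambda>x. f x + g x) U"
  using assms(2,3)
proof (induction k arbitrary: f g)
  case 0
  then show ?case by (auto intro: continuous_on_add)
next
  case (Suc k)
  show ?case
  proof (rule Ck_on_SucI[OF assms(1)])
    fix x assume "x \<in> U"
    then show "((\<lambda>x. f x + g x) has_derivative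
        (\<lambda>v. frechet_derivative f (at x) v + frechet_derivative g (at x) v)) (at x)"
      using Suc.prems by (intro has_derivative_add Ck_on_Suc_has_derivative)
  qed (use Suc in auto)
qed

lemma Ck_on_linear:
  assumes "bounded_linear L" "open U" "Ck_on k f U"
  shows "Ck_on k (\<lambda>x. L (f x)) U"
  using assms(3)
proof (induction k arbitrary: f)
  case 0
  then show ?case using assms(1)
    by (auto intro: bounded_linear.continuous_on)
next
  case (Suc k)
  show ?case
  proof (rule Ck_on_SucI[OF assms(2)])
    fix x assume "x \<in> U"
    then show "((\<lambda>x. L (f x)) has_derivative (\<lambda>v. L (frechet_derivative f (at x) v))) (at x)"
      using Suc.prems by (intro bounded_linear.has_derivative[OF assms(1)] Ck_on_Suc_has_derivative)
  qed (use Suc in auto)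
qed

lemma Ck_on_bilinear:
  assumes "bounded_bilinear pr" "open U" "Ck_on k f U" "Ck_on k g U"
  shows "Ck_on k (\<lambda>x. pr (f x) (g x)) U"
  using assms(3,4)
proof (induction k arbitrary: f g)
  case 0
  then show ?case using assms(1)
    by (auto intro: bounded_bilinear.continuous_on)
next
  case (Suc k)
  show ?case
  proof (rule Ck_on_SucI[OF assms(2)])
    fix x assume "x \<in> U"
    then show "((\<lambda>x. pr (f x) (g x)) has_derivative
      (\<lambda>v. pr (f x) (frechet_derivative g (at x) v) + pr (frechet_derivative f (at x) v) (g x))) (at x)"
      using Suc.prems by (intro bounded_bilinear.FDERIV[OF assms(1)] Ck_on_Suc_has_derivative)
  next
    fix v
    have "Ck_on k f U" "Ck_on k g U" using Suc.prems Ck_on_SucD by auto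
    then show "Ck_on k (\<lambda>x. pr (f x) (frechet_derivative g (at x) v) +
        pr (frechet_derivative f (at x) v) (g x)) U"
      using Suc.prems by (intro Ck_on_add assms(2) Suc.IH) auto
  qed
qed

lemma Ck_on_sum:
  assumes "open U" "\<And>i. i \<in> I \<Longrightarrow> Ck_on k (f i) U"
  shows "Ck_on k (\<lambda>x. \<Sum>i\<in>I. f i x) U"
  using assms(2)
  by (induction I rule: infinite_finite_induct) (auto intro: Ck_on_const Ck_on_add assms(1))

lemma linear_euclidean_expand:
  assumes "linear L"
  shows "L w = (\<Sum>b\<in>Basis. (w \<bullet> b) *\<^sub>R L b)"
proof -
  have "L (\<Sum>b\<in>Basis. (w \<bullet> b) *\<^sub>R b) = (\<Sum>b\<in>Basis. (w \<bullet> b) *\<^sub>R L b)"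
    by (simp add: linear_sum[OF assms] linear_scale[OF assms])
  then show ?thesis by (simp add: euclidean_representation)
qed

lemma Ck_on_compose:
  assumes "open U" "open V" "f ` U \<subseteq> V" "Ck_on k f U" "Ck_on k g V"
  shows "Ck_on k (\<lambda>x. g (f x)) U"
  using assms(4,5)
proof (induction k arbitrary: g)
  case 0
  then show ?case using assms(3) by (auto intro: continuous_on_compose2)
next
  case (Suc k)
  show ?case
  proof (rule Ck_on_SucI[OF assms(1)])
    fix x assume x: "x \<in> U"
    then have fx: "f x \<in> V" using assms(3) by auto
    have g: "(g has_derivative frechet_derivative g (at (f x))) (at (f x))"
      by (rule Ck_on_Suc_has_derivative[OF Suc.prems(2) fx])
    have "((\<lambda>x. g (f x)) has_derivative
        (\<lambda>v. frechet_derivative g (at (f x)) (frechet_derivative f (at x) v))) (at x)"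
      using has_derivative_compose[OF Ck_on_Suc_has_derivative[OF Suc.prems(1) x] g] by simp
    \<comment> \<open>\<open>Ck_on\<close> speaks about derivatives in fixed directions only. The
      direction here moves with \<open>x\<close>, so the derivative of \<open>g\<close> is expanded
      in a basis.\<close>
    also have "(\<lambda>v. frechet_derivative g (at (f x)) (frechet_derivative f (at x) v)) = (\<lambda>v.
        \<Sum>b\<in>Basis. (frechet_derivative f (at x) v \<bullet> b) *\<^sub>R frechet_derivative g (at (f x)) b)"
      by (rule ext) (rule linear_euclidean_expand[OF has_derivative_linear[OF g]])
    finally show "((\<lambda>x. g (f x)) has_derivative (\<lambda>v.
        \<Sum>b\<in>Basis. (frechet_derivative f (at x) v \<bullet> b) *\<^sub>R frechet_derivative g (at (f x)) b)) (at x)" .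
  next
    fix v
    have "Ck_on k f U" using Suc.prems Ck_on_SucD by auto
    moreover have "Ck_on k (\<lambda>x. frechet_derivative f (at x) v) U"
      "\<And>b. Ck_on k (\<lambda>x. frechet_derivative g (at x) b) V" using Suc.prems by auto
    ultimately show "Ck_on k (\<lambda>x. \<Sum>b\<in>Basis. (frechet_derivative f (at x) v \<bullet> b) *\<^sub>R
        frechet_derivative g (at (f x)) b) U"
      by (intro Ck_on_sum[OF assms(1)] Ck_on_bilinear[OF bounded_bilinear_scaleR assms(1)]
          Ck_on_linear[OF bounded_linear_inner_left assms(1)] Suc.IH)
  qed
qed

text \<open>The derivative is a product of values of \<open>inverse\<close> and constants, so the
  induction hypothesis about \<open>inverse\<close> itself closes the induction;
  \<open>Ck_on_sqrt\<close> works the same way.\<close>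

lemma Ck_on_inverse: "Ck_on k (inverse :: real \<Rightarrow> real) (-{0})"
proof (induction k)
  case 0
  then show ?case by (auto intro!: continuous_intros)
next
  case (Suc k)
  show ?case
  proof (rule Ck_on_SucI)
    fix x :: real assume "x \<in> -{0}"
    then show "(inverse has_derivative (\<lambda>v. - (inverse x * v * inverse x))) (at x)"
      by (intro has_derivative_inverse') auto
  next
    fix v :: real
    show "Ck_on k (\<lambda>x. - (inverse x * v * inverse x)) (- {0})"
      by (intro Ck_on_linear[OF bounded_linear_minus[OF bounded_linear_ident]]
          Ck_on_bilinear[OF bounded_bilinear_mult] Suc Ck_on_const) auto
  qed auto
qed

lemma Ck_on_sqrt: "Ck_on k sqrt {0<..}"
proof (induction k)
  case 0
  then show ?case by (auto intro!: continuous_intros)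
next
  case (Suc k)
  show ?case
  proof (rule Ck_on_SucI)
    fix x :: real assume x: "x \<in> {0<..}"
    then have "(sqrt has_real_derivative inverse (sqrt x) / 2) (at x)"
      by (intro DERIV_real_sqrt) auto
    then show "(sqrt has_derivative (\<lambda>v. inverse (sqrt x) * (v / 2))) (at x)"
      by (auto simp: has_field_derivative_def elim!: back_subst[of "\<lambda>D. (sqrt has_derivative D) (at x)"])
  next
    fix v :: real
    show "Ck_on k (\<lambda>x. inverse (sqrt x) * (v / 2)) {0<..}"
      by (intro Ck_on_bilinear[OF bounded_bilinear_mult] Ck_on_const
          Ck_on_compose[OF _ _ _ Suc Ck_on_inverse]) auto
  qed auto
qed

lemma smooth_on_cong:
  "open U \<Longrightarrow> (\<And>x. x \<in> U \<Longrightarrow> f x = g x) \<Longrightarrow> smooth_on f U \<longleftrightarrow> smooth_on g U"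
  unfolding smooth_on_def using Ck_on_cong by metis

lemma smooth_on_subset: "smooth_on f U \<Longrightarrow> V \<subseteq> U \<Longrightarrow> smooth_on f V"
  unfolding smooth_on_def using Ck_on_subset by blast

lemma smooth_on_has_derivative:
  "smooth_on f U \<Longrightarrow> x \<in> U \<Longrightarrow> (f has_derivative frechet_derivative f (at x)) (at x)"
  unfolding smooth_on_def using Ck_on_Suc_has_derivative by blast

lemma smooth_on_imp_continuous_on: "smooth_on f U \<Longrightarrow> continuous_on U f"
  unfolding smooth_on_def by (metis Ck_on.simps(1))

lemma smooth_on_frechet_derivative:
  "smooth_on f U \<Longrightarrow> smooth_on (\<lambda>x. frechet_derivative f (at x) v) U"
  unfolding smooth_on_def by (metis Ck_on.simps(2))

lemma smooth_on_const: "smooth_on (\<lambda>x. c) U"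
  unfolding smooth_on_def by (simp add: Ck_on_const)

lemma smooth_on_add:
  "open U \<Longrightarrow> smooth_on f U \<Longrightarrow> smooth_on g U \<Longrightarrow> smooth_on (\<lambda>x. f x + g x) U"
  unfolding smooth_on_def by (simp add: Ck_on_add)

lemma smooth_on_linear:
  "bounded_linear L \<Longrightarrow> open U \<Longrightarrow> smooth_on f U \<Longrightarrow> smooth_on (\<lambda>x. L (f x)) U"
  unfolding smooth_on_def by (simp add: Ck_on_linear)

lemma smooth_on_bilinear:
  "bounded_bilinear pr \<Longrightarrow> open U \<Longrightarrow> smooth_on f U \<Longrightarrow> smooth_on g U \<Longrightarrow> smooth_on (\<lambda>x. pr (f x) (g x)) U"
  unfolding smooth_on_def by (simp add: Ck_on_bilinear)

lemmas smooth_on_mult = smooth_on_bilinear[OF bounded_bilinear_mult]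
lemmas smooth_on_scaleR = smooth_on_bilinear[OF bounded_bilinear_scaleR]
lemmas smooth_on_inner = smooth_on_bilinear[OF bounded_bilinear_inner]

lemma smooth_on_minus:
  "open U \<Longrightarrow> smooth_on f U \<Longrightarrow> smooth_on (\<lambda>x. - f x) U"
  by (rule smooth_on_linear[OF bounded_linear_minus[OF bounded_linear_ident]])

lemma smooth_on_sum:
  "open U \<Longrightarrow> (\<And>i. i \<in> I \<Longrightarrow> smooth_on (f i) U) \<Longrightarrow> smooth_on (\<lambda>x. \<Sum>i\<in>I. f i x) U"
  unfolding smooth_on_def by (simp add: Ck_on_sum)

lemma smooth_on_compose:
  "open U \<Longrightarrow> open V \<Longrightarrow> f ` U \<subseteq> V \<Longrightarrow> smooth_on f U \<Longrightarrow> smooth_on g V \<Longrightarrow> smooth_on (\<lambda>x. g (f x)) U"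
  unfolding smooth_on_def by (simp add: Ck_on_compose)

lemma smooth_on_ident: "smooth_on (\<lambda>x. x) U"
proof -
  have "Ck_on k (\<lambda>x::'a. x) UNIV" for k
    by (cases k) (auto simp: Ck_on_const intro: continuous_on_id)
  then show ?thesis by (meson Ck_on_subset smooth_on_def subset_UNIV)
qed

lemma smooth_on_bounded_linear: "bounded_linear L \<Longrightarrow> smooth_on L U"
  using smooth_on_linear[OF _ open_UNIV smooth_on_ident, of L] smooth_on_subset by auto

lemma smooth_on_Pair:
  assumes "open U" "smooth_on f U" "smooth_on g U"
  shows "smooth_on (\<lambda>x. (f x, g x)) U"
proof -
  have "smooth_on (\<lambda>x. (f x, 0) + (0, g x)) U"
    by (intro smooth_on_add smooth_on_linear[of "\<lambda>x. (x, 0)"] smooth_on_linear[of "\<lambda>x. (0, x)"]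
        bounded_linear_Pair bounded_linear_ident bounded_linear_zero assms)
  then show ?thesis by simp
qed

lemma smooth_on_inverse:
  "open U \<Longrightarrow> smooth_on f U \<Longrightarrow> (\<And>x. x \<in> U \<Longrightarrow> f x \<noteq> (0::real)) \<Longrightarrow> smooth_on (\<lambda>x. inverse (f x)) U"
  by (rule smooth_on_compose[where g=inverse and V="-{0}"]) (auto simp: smooth_on_def Ck_on_inverse)

lemma smooth_on_sqrt:
  "open U \<Longrightarrow> smooth_on f U \<Longrightarrow> (\<And>x. x \<in> U \<Longrightarrow> f x > 0) \<Longrightarrow> smooth_on (\<lambda>x. sqrt (f x)) U"
  by (rule smooth_on_compose[where g=sqrt and V="{0<..}"]) (auto simp: smooth_on_def Ck_on_sqrt)

lemma smooth_on_fst: "open U \<Longrightarrow> smooth_on f U \<Longrightarrow> smooth_on (\<lambda>x. fst (f x)) U"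
  by (rule smooth_on_linear[OF bounded_linear_fst])

text \<open>Bootstrap: if \<open>z\<close> is C^k, then so is \<open>X (z t)\<close>, which is the
  derivative of \<open>z\<close>; hence \<open>z\<close> is C^(k+1).\<close>

lemma smooth_on_ode:
  fixes z :: "real \<Rightarrow> 'a::euclidean_space"
  assumes "open I" "open V" "smooth_on X V" "z ` I \<subseteq> V"
    and z: "\<And>t. t \<in> I \<Longrightarrow> (z has_vector_derivative X (z t)) (at t)"
  shows "smooth_on z I"
proof -
  have "Ck_on k z I" for k
  proof (induction k)
    case 0
    then show ?case
      using z by (auto intro!: continuous_at_imp_continuous_on has_vector_derivative_continuous)
  next
    case (Suc k)
    show ?case
    proof (rule Ck_on_SucI[OF assms(1)])
      show "(z has_derivative (\<lambda>v. v *\<^sub>R X (z t))) (at t)" if "t \<in> I" for t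
        using z[OF that] by (simp add: has_vector_derivative_def)
      fix v
      show "Ck_on k (\<lambda>x. v *\<^sub>R X (z x)) I"
        by (rule Ck_on_linear[OF bounded_linear_scaleR_right assms(1)
              Ck_on_compose[OF assms(1,2,4) Suc]]) (use assms(3) in \<open>simp add: smooth_on_def\<close>)
    qed
  qed
  then show ?thesis by (simp add: smooth_on_def)
qed

lemma smooth_on_partial1:
  assumes "smooth_on f W" "(r, s) \<in> W"
  shows "((\<lambda>r. f (r, s)) has_vector_derivative frechet_derivative f (at (r, s)) (1, 0)) (at r)"
    (is ?A)
proof -
  have "((\<lambda>r. (r, s)) has_vector_derivative (1, 0)) (at r)"
    by (auto intro!: derivative_eq_intros simp: has_vector_derivative_def)
  then have "((f \<circ> (\<lambda>r. (r, s))) has_vector_derivative frechet_derivative f (at (r, s)) (1, 0)) (at r)"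
    by (rule vector_derivative_diff_chain_within)
      (rule has_derivative_at_withinI[OF smooth_on_has_derivative[OF assms]])
  then show ?A by (simp add: o_def)
qed

lemma smooth_on_partial2:
  assumes "smooth_on f W" "(r, s) \<in> W"
  shows "((\<lambda>s. f (r, s)) has_vector_derivative frechet_derivative f (at (r, s)) (0, 1)) (at s)"
    (is ?B)
proof -
  have "((\<lambda>s. (r, s)) has_vector_derivative (0, 1)) (at s)"
    by (auto intro!: derivative_eq_intros simp: has_vector_derivative_def)
  then have "((f \<circ> (\<lambda>s. (r, s))) has_vector_derivative frechet_derivative f (at (r, s)) (0, 1)) (at s)"
    by (rule vector_derivative_diff_chain_within)
      (rule has_derivative_at_withinI[OF smooth_on_has_derivative[OF assms]])
  then show ?B by (simp add: o_def)
qed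

lemma open_contains_square:
  fixes r s :: real
  assumes "open W" "(r, s) \<in> W"
  obtains d where "d > 0" "{r-d..r+d} \<times> {s-d..s+d} \<subseteq> W"
proof -
  obtain A B where AB: "open A" "open B" "r \<in> A" "s \<in> B" "A \<times> B \<subseteq> W"
    using assms open_prod_elim by (metis mem_Sigma_iff)
  obtain d1 where d1: "d1 > 0" "cball r d1 \<subseteq> A" using AB open_contains_cball by blast
  obtain d2 where d2: "d2 > 0" "cball s d2 \<subseteq> B" using AB open_contains_cball by blast
  define d where "d = min d1 d2"
  have "{r-d..r+d} \<subseteq> cball r d1" "{s-d..s+d} \<subseteq> cball s d2"
    by (auto simp: cball_eq_atLeastAtMost d_def min_def)
  then have "{r-d..r+d} \<times> {s-d..s+d} \<subseteq> W" using AB(5) d1 d2 by blast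
  then show ?thesis using that d1 d2 d_def by (metis min_less_iff_conj)
qed

text \<open>Schwarz's theorem is proved by differentiating \<open>h (r, s) = h (r, s\<^sub>0) + \<integral> \<partial>\<^sub>2 h (r, t) dt\<close>
  under the integral sign.\<close>

lemma smooth_on_mixed_partials:
  fixes h :: "real \<times> real \<Rightarrow> 'a::euclidean_space"
  assumes "open W" "smooth_on h W" "(r, s) \<in> W"
  shows "((\<lambda>s. frechet_derivative h (at (r, s)) (1, 0)) has_vector_derivative
     frechet_derivative (\<lambda>x. frechet_derivative h (at x) (0, 1)) (at (r, s)) (1, 0)) (at s)"
proof -
  define h1 where "h1 x = frechet_derivative h (at x) (1, 0)" for x
  define h2 where "h2 x = frechet_derivative h (at x) (0, 1)" for x
  define h21 where "h21 x = frechet_derivative h2 (at x) (1, 0)" for x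
  have sm: "smooth_on h1 W" "smooth_on h2 W" "smooth_on h21 W"
    unfolding h1_def h2_def h21_def by (intro smooth_on_frechet_derivative assms)+
  obtain d where d: "d > 0" "{r-d..r+d} \<times> {s-d..s+d} \<subseteq> W"
    using open_contains_square[OF assms(1,3)] .
  note Dr = smooth_on_partial1 and Ds = smooth_on_partial2
  have inW: "(r', s') \<in> W" if "r' \<in> {r-d..r+d}" "s' \<in> {s-d..s+d}" for r' s'
    using that d(2) by blast
  have I: "h (r', s') = h (r', s-d) + integral {s-d..s'} (\<lambda>t. h2 (r', t))"
    if "r' \<in> {r-d..r+d}" "s' \<in> {s-d..s+d}" for r' s'
  proof -
    have "((\<lambda>t. h2 (r', t)) has_integral h (r', s') - h (r', s-d)) {s-d..s'}"
    proof (rule fundamental_theorem_of_calculus)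
      fix t assume "t \<in> {s-d..s'}"
      then have "(r', t) \<in> W" using that by (intro inW) auto
      then show "((\<lambda>t. h (r', t)) has_vector_derivative h2 (r', t)) (at t within {s-d..s'})"
        unfolding h2_def by (rule has_vector_derivative_at_within[OF Ds[OF assms(2)]])
    qed (use that in auto)
    then show ?thesis by (simp add: integral_unique)
  qed
  have nb: "at r within {r-d..r+d} \<noteq> bot"
    using d by (simp add: trivial_limit_within)
  have *: "h1 (r, s') = h1 (r, s-d) + integral {s-d..s'} (\<lambda>t. h21 (r, t))"
    if s': "s' \<in> {s-d..s+d}" for s'
  proof -
    have "((\<lambda>x. integral (cbox (s-d) s') (\<lambda>t. h2 (x, t))) has_vector_derivative
        integral (cbox (s-d) s') (\<lambda>t. h21 (r, t))) (at r within {r-d..r+d})"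
    proof (rule leibniz_rule_vector_derivative)
      fix x t assume "x \<in> {r-d..r+d}" "t \<in> cbox (s-d) s'"
      then have "(x, t) \<in> W" using s' by (intro inW) auto
      then show "((\<lambda>x. h2 (x, t)) has_vector_derivative h21 (x, t)) (at x within {r - d..r + d})"
        unfolding h21_def by (rule has_vector_derivative_at_within[OF Dr[OF sm(2)]])
    next
      fix x assume x: "x \<in> {r-d..r+d}"
      have "(\<lambda>t. (x, t)) ` cbox (s-d) s' \<subseteq> W" using s' inW[OF x] by auto
      then have "continuous_on (cbox (s-d) s') (\<lambda>t. h2 (x, t))"
        by (intro continuous_on_compose2[OF smooth_on_imp_continuous_on[OF sm(2)]] continuous_intros)
      then show "(\<lambda>t. h2 (x, t)) integrable_on cbox (s-d) s'"
        by (rule integrable_continuous)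
    next
      have "{r - d..r + d} \<times> cbox (s - d) s' \<subseteq> W" using inW s' by auto
      then show "continuous_on ({r - d..r + d} \<times> cbox (s - d) s') (\<lambda>(x, t). h21 (x, t))"
        using smooth_on_imp_continuous_on[OF sm(3)] continuous_on_subset by simp blast
    qed (use d in auto)
    note D2 = this[unfolded cbox_interval]
    have "((\<lambda>x. h (x, s-d) + integral {s-d..s'} (\<lambda>t. h2 (x, t))) has_vector_derivative
        h1 (r, s-d) + integral {s-d..s'} (\<lambda>t. h21 (r, t))) (at r within {r-d..r+d})"
      unfolding h1_def
      by (rule has_vector_derivative_add[OF has_vector_derivative_at_within[OF Dr[OF assms(2) inW]] D2])
        (use d in auto)
    then have "((\<lambda>x. h (x, s')) has_vector_derivative
        h1 (r, s-d) + integral {s-d..s'} (\<lambda>t. h21 (r, t))) (at r within {r-d..r+d})"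
      by (rule has_vector_derivative_transform[rotated -1]) (use d I[OF _ s'] in auto)
    moreover have "((\<lambda>x. h (x, s')) has_vector_derivative h1 (r, s')) (at r within {r-d..r+d})"
      unfolding h1_def
      by (rule has_vector_derivative_at_within[OF Dr[OF assms(2) inW]]) (use s' d in auto)
    ultimately show ?thesis
      using vector_derivative_unique_within[OF nb] by metis
  qed
  have "(\<lambda>t. (r, t)) ` {s-d..s+d} \<subseteq> W" using inW d by auto
  then have "continuous_on {s-d..s+d} (\<lambda>t. h21 (r, t))"
    by (intro continuous_on_compose2[OF smooth_on_imp_continuous_on[OF sm(3)]] continuous_intros)
  then have "((\<lambda>s'. integral {s-d..s'} (\<lambda>t. h21 (r, t))) has_vector_derivative h21 (r, s)) (at s within {s-d..s+d})"
    using d by (intro integral_has_vector_derivative) auto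
  then have "((\<lambda>s'. integral {s-d..s'} (\<lambda>t. h21 (r, t))) has_vector_derivative h21 (r, s)) (at s)"
    using d at_within_Icc_at[of "s-d" s "s+d"] by simp
  then have "((\<lambda>s'. h1 (r, s-d) + integral {s-d..s'} (\<lambda>t. h21 (r, t))) has_vector_derivative 0 + h21 (r, s)) (at s)"
    by (rule has_vector_derivative_add[OF has_vector_derivative_const])
  then have "((\<lambda>s'. h1 (r, s')) has_vector_derivative 0 + h21 (r, s)) (at s)"
    by (rule has_vector_derivative_transform_within_open[where S="{s-d<..<s+d}"]) (use d in \<open>auto simp: *[symmetric]\<close>)
  then show ?thesis unfolding h1_def h21_def h2_def by simp
qed

section \<open>Charts and tangent vectors\<close>

locale manifold_atlas =
  fixes \<A> :: "('m::t2_space, 'e::euclidean_space) chart set"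
  assumes atlas: "smooth_atlas \<A>"
begin

lemma chart_at: obtains c where "c \<in> \<A>" "p \<in> fst c"
  using atlas unfolding smooth_atlas_def by blast

lemma is_chart: "c \<in> \<A> \<Longrightarrow> is_chart c"
  using atlas unfolding smooth_atlas_def by blast

lemma open_domain: "c \<in> \<A> \<Longrightarrow> open (fst c)"
  using is_chart unfolding is_chart_def by blast

lemma open_image: "c \<in> \<A> \<Longrightarrow> open (snd c ` fst c)"
  using is_chart unfolding is_chart_def by blast

lemma chart_homeomorphism:
  "c \<in> \<A> \<Longrightarrow> homeomorphism (fst c) (snd c ` fst c) (snd c) (chart_inv c)"
  using is_chart unfolding is_chart_def by blast

lemma chart_inv_left [simp]: "c \<in> \<A> \<Longrightarrow> p \<in> fst c \<Longrightarrow> chart_inv c (snd c p) = p"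
  using chart_homeomorphism by (auto simp: homeomorphism_def)

lemma chart_inv_right: "c \<in> \<A> \<Longrightarrow> x \<in> snd c ` fst c \<Longrightarrow> snd c (chart_inv c x) = x"
  using chart_homeomorphism by (auto simp: homeomorphism_def)

lemma chart_inv_in: "c \<in> \<A> \<Longrightarrow> x \<in> snd c ` fst c \<Longrightarrow> chart_inv c x \<in> fst c"
  by auto

lemma continuous_chart: "c \<in> \<A> \<Longrightarrow> continuous_on (fst c) (snd c)"
  using chart_homeomorphism by (auto simp: homeomorphism_def)

lemma continuous_chart_inv: "c \<in> \<A> \<Longrightarrow> continuous_on (snd c ` fst c) (chart_inv c)"
  using chart_homeomorphism by (auto simp: homeomorphism_def)

lemma open_chart_inv_image:
  assumes "c \<in> \<A>" "open V" "V \<subseteq> snd c ` fst c"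
  shows "open (chart_inv c ` V)"
proof -
  have "chart_inv c ` V = fst c \<inter> snd c -` V"
    using assms chart_inv_right chart_inv_in by (auto simp: image_iff subset_iff) (metis chart_inv_left)+
  then show ?thesis
    using continuous_open_preimage[OF continuous_chart open_domain] assms by simp
qed

lemma open_overlap:
  assumes "c \<in> \<A>" "c' \<in> \<A>"
  shows "open (snd c ` (fst c \<inter> fst c'))"
proof -
  have "snd c ` (fst c \<inter> fst c') = (snd c ` fst c) \<inter> chart_inv c -` fst c'"
    using assms by auto
  then show ?thesis
    using continuous_open_preimage[OF continuous_chart_inv open_image open_domain] assms by simp
qed

lemma smooth_transition:
  "c \<in> \<A> \<Longrightarrow> c' \<in> \<A> \<Longrightarrow> smooth_on (transition c c') (snd c ` (fst c \<inter> fst c'))"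
  using atlas unfolding smooth_atlas_def by blast

lemma transition_apply [simp]:
  "c \<in> \<A> \<Longrightarrow> p \<in> fst c \<Longrightarrow> transition c c' (snd c p) = snd c' p"
  by (simp add: transition_def)

definition tmap :: "('m, 'e) chart \<Rightarrow> ('m, 'e) chart \<Rightarrow> 'm \<Rightarrow> 'e \<Rightarrow> 'e" where
  "tmap c c' p = frechet_derivative (transition c c') (at (snd c p))"

lemma has_derivative_transition:
  assumes "c \<in> \<A>" "c' \<in> \<A>" "p \<in> fst c" "p \<in> fst c'"
  shows "(transition c c' has_derivative tmap c c' p) (at (snd c p))"
  unfolding tmap_def using assms
  by (intro smooth_on_has_derivative[OF smooth_transition]) auto

lemma linear_tmap:
  "c \<in> \<A> \<Longrightarrow> c' \<in> \<A> \<Longrightarrow> p \<in> fst c \<Longrightarrow> p \<in> fst c' \<Longrightarrow> linear (tmap c c' p)"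
  using has_derivative_linear[OF has_derivative_transition] .

lemma tmap_tmap:
  assumes "c \<in> \<A>" "c' \<in> \<A>" "c'' \<in> \<A>" "p \<in> fst c" "p \<in> fst c'" "p \<in> fst c''"
  shows "tmap c' c'' p (tmap c c' p u) = tmap c c'' p u"
proof -
  have "(transition c' c'' has_derivative tmap c' c'' p) (at (transition c c' (snd c p)))"
    using has_derivative_transition assms by simp
  from has_derivative_compose[OF has_derivative_transition[OF assms(1,2,4,5)] this]
  have "((\<lambda>x. transition c' c'' (transition c c' x)) has_derivative
      (\<lambda>u. tmap c' c'' p (tmap c c' p u))) (at (snd c p))" .
  then have "(transition c c'' has_derivative
      (\<lambda>u. tmap c' c'' p (tmap c c' p u))) (at (snd c p))"
    by (rule has_derivative_transform_within_open[OF _ open_overlap[OF assms(1,2)]]) (use assms in auto)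
  then have "(\<lambda>u. tmap c' c'' p (tmap c c' p u)) = tmap c c'' p"
    using has_derivative_transition[OF assms(1,3,4,6)] by (rule has_derivative_unique)
  then show ?thesis by metis
qed

lemma tmap_self:
  assumes "c \<in> \<A>" "p \<in> fst c"
  shows "tmap c c p u = u"
proof -
  have "((\<lambda>x. x) has_derivative (\<lambda>x. x)) (at (snd c p))"
    by (rule has_derivative_ident)
  then have "(transition c c has_derivative (\<lambda>x. x)) (at (snd c p))"
    by (rule has_derivative_transform_within_open[OF _ open_image[OF assms(1)]]) (use assms in auto)
  then have "tmap c c p = (\<lambda>x. x)"
    using has_derivative_transition[OF assms(1,1,2,2)] has_derivative_unique by blast
  then show ?thesis by simp
qed

lemma tvec_apply: "c' \<in> \<A> \<Longrightarrow> p \<in> fst c' \<Longrightarrow> tvec \<A> c p u c' = tmap c c' p u"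
  by (simp add: tvec_def tmap_def)

lemma tvec_self [simp]: "c \<in> \<A> \<Longrightarrow> p \<in> fst c \<Longrightarrow> tvec \<A> c p u c = u"
  by (simp add: tvec_apply tmap_self)

lemma tvec_change:
  assumes "c \<in> \<A>" "c' \<in> \<A>" "p \<in> fst c" "p \<in> fst c'"
  shows "tvec \<A> c' p (tmap c c' p u) = tvec \<A> c p u"
proof
  fix d
  show "tvec \<A> c' p (tmap c c' p u) d = tvec \<A> c p u d"
    by (cases "d \<in> \<A> \<and> p \<in> fst d") (use assms in \<open>auto simp: tvec_apply tmap_tmap\<close>, auto simp: tvec_def)
qed

lemma tvec_in_tangent_space:
  assumes "c \<in> \<A>" "p \<in> fst c"
  shows "tvec \<A> c p u \<in> tangent_space \<A> p"
  unfolding tangent_space_def using assms by (auto simp: tvec_apply tvec_change)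

lemma tvec_add:
  assumes "c \<in> \<A>" "p \<in> fst c"
  shows "tvec \<A> c p (u + v) = tadd (tvec \<A> c p u) (tvec \<A> c p v)"
  using assms linear_tmap[THEN linear_add]
  by (auto simp: tvec_def tadd_def tmap_def fun_eq_iff)

lemma tvec_scale:
  assumes "c \<in> \<A>" "p \<in> fst c"
  shows "tvec \<A> c p (a *\<^sub>R u) = tscale a (tvec \<A> c p u)"
  using assms linear_tmap[THEN linear_cmul]
  by (auto simp: tvec_def tscale_def tmap_def fun_eq_iff)

text \<open>A single chart determines the velocity in all of them: where charts overlap, the chain
  rule brings in the derivative of the transition map, and for all other pairs both sides are
  \<open>0\<close> by convention.\<close>

lemma velocity_eq:
  assumes "c \<in> \<A>" "\<gamma> s \<in> fst c" "\<forall>\<^sub>F t in at s within S. \<gamma> t \<in> fst c"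
    and "s \<in> S" and nb: "at s within S \<noteq> bot"
    and d: "((snd c \<circ> \<gamma>) has_vector_derivative u) (at s within S)"
  shows "velocity \<A> \<gamma> s (at s within S) = tvec \<A> c (\<gamma> s) u"
proof
  fix c'
  show "velocity \<A> \<gamma> s (at s within S) c' = tvec \<A> c (\<gamma> s) u c'"
  proof (cases "c' \<in> \<A> \<and> \<gamma> s \<in> fst c'")
    case True
    have "((transition c c' \<circ> (snd c \<circ> \<gamma>)) has_vector_derivative tmap c c' (\<gamma> s) u) (at s within S)"
      by (rule vector_derivative_diff_chain_within[OF d])
        (rule has_derivative_at_withinI, use has_derivative_transition assms True in simp)
    moreover have "\<forall>\<^sub>F t in at s within S. (transition c c' \<circ> (snd c \<circ> \<gamma>)) t = (snd c' \<circ> \<gamma>) t"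
      using assms(3) by (rule eventually_mono) (use assms(1) in auto)
    ultimately have "((snd c' \<circ> \<gamma>) has_vector_derivative tmap c c' (\<gamma> s) u) (at s within S)"
      unfolding has_vector_derivative_def
      by (rule has_derivative_transform_eventually) (use assms in auto)
    then have "vector_derivative (snd c' \<circ> \<gamma>) (at s within S) = tmap c c' (\<gamma> s) u"
      by (rule vector_derivative_within[OF nb])
    then show ?thesis using True by (simp add: velocity_def tvec_apply)
  qed (auto simp: velocity_def tvec_def)
qed

text \<open>\<open>smooth_into\<close> offers a chart of its own choosing. Composition with a
  transition map moves the local extension to a prescribed chart; the neighbourhood is cut down so
  that the extension stays in the image of that chart even off \<open>D\<close>.\<close>

lemma smooth_into_chart:
  assumes "smooth_into \<A> D f" "x \<in> D" "c \<in> \<A>" "f x \<in> fst c"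
  obtains W h where "open W" "x \<in> W" "f ` (D \<inter> W) \<subseteq> fst c" "smooth_on h W"
    "h ` W \<subseteq> snd c ` fst c" "\<forall>y\<in>D \<inter> W. h y = snd c (f y)"
proof -
  obtain c1 W1 h1 where 1: "c1 \<in> \<A>" "open W1" "x \<in> W1" "f ` (D \<inter> W1) \<subseteq> fst c1"
     "smooth_on h1 W1" "\<forall>y\<in>D \<inter> W1. h1 y = snd c1 (f y)"
    using bspec[OF assms(1)[unfolded smooth_into_def] assms(2)] by (elim bexE exE conjE)
  define V where "V = snd c1 ` (fst c1 \<inter> fst c)"
  have V: "open V" unfolding V_def by (rule open_overlap[OF 1(1) assms(3)])
  define W where "W = W1 \<inter> h1 -` V"
  have W: "open W" unfolding W_def
    by (rule continuous_open_preimage[OF smooth_on_imp_continuous_on[OF 1(5)] 1(2) V])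
  have fc: "f y \<in> fst c" if "y \<in> D" "y \<in> W" for y
  proof -
    have "snd c1 (f y) \<in> V" "f y \<in> fst c1" using that 1(4,6) unfolding W_def by auto
    then obtain q where q: "q \<in> fst c1" "q \<in> fst c" "snd c1 (f y) = snd c1 q" unfolding V_def by blast
    have "f y = q" using chart_inv_left[OF 1(1) q(1)] chart_inv_left[OF 1(1) \<open>f y \<in> fst c1\<close>] q(3) by simp
    then show ?thesis using q by simp
  qed
  show ?thesis
  proof (rule that[of W "\<lambda>y. transition c1 c (h1 y)"])
    show "x \<in> W" using 1 assms unfolding W_def V_def by auto
    show "smooth_on (\<lambda>y. transition c1 c (h1 y)) W"
      by (rule smooth_on_compose[OF W V _ smooth_on_subset[OF 1(5)]])
        (use smooth_transition[OF 1(1) assms(3)] in \<open>auto simp: W_def V_def\<close>)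
    show "(\<lambda>y. transition c1 c (h1 y)) ` W \<subseteq> snd c ` fst c"
      using 1(1) by (auto simp: W_def V_def)
    show "\<forall>y\<in>D \<inter> W. transition c1 c (h1 y) = snd c (f y)"
    proof
      fix y assume "y \<in> D \<inter> W"
      then have "h1 y = snd c1 (f y)" "f y \<in> fst c1" using 1(4,6) unfolding W_def by auto
      then show "transition c1 c (h1 y) = snd c (f y)" using 1(1) by simp
    qed
  qed (use W fc in auto)
qed

lemma smooth_intoI:
  assumes "\<And>x. x \<in> D \<Longrightarrow> \<exists>c\<in>\<A>. \<exists>W h. open W \<and> x \<in> W \<and> smooth_on h W \<and>
    (\<forall>y\<in>D \<inter> W. h y \<in> snd c ` fst c \<and> f y = chart_inv c (h y))"
  shows "smooth_into \<A> D f"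
  unfolding smooth_into_def
proof
  fix x assume "x \<in> D"
  from assms[OF this] obtain c W h where "c \<in> \<A>" "open W" "x \<in> W" "smooth_on h W"
    "\<forall>y\<in>D \<inter> W. h y \<in> snd c ` fst c \<and> f y = chart_inv c (h y)"
    by (elim bexE exE conjE)
  then show "\<exists>c\<in>\<A>. \<exists>W h. open W \<and> x \<in> W \<and> f ` (D \<inter> W) \<subseteq> fst c \<and>
      smooth_on h W \<and> (\<forall>y\<in>D \<inter> W. h y = snd c (f y))"
    by (intro bexI[of _ c] exI[of _ W] exI[of _ h]) (auto simp: chart_inv_right chart_inv_in)
qed

lemma smooth_into_compose:
  assumes "smooth_into \<A> D f" "smooth_on \<phi> UNIV" "\<phi> ` D' \<subseteq> D"
  shows "smooth_into \<A> D' (\<lambda>x. f (\<phi> x))"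
proof (rule smooth_intoI)
  fix x assume x: "x \<in> D'"
  obtain c where c: "c \<in> \<A>" "f (\<phi> x) \<in> fst c" using chart_at .
  have px: "\<phi> x \<in> D" using assms(3) x by blast
  obtain W h where W: "open W" "\<phi> x \<in> W" "f ` (D \<inter> W) \<subseteq> fst c" "smooth_on h W"
    "h ` W \<subseteq> snd c ` fst c" "\<forall>y\<in>D \<inter> W. h y = snd c (f y)"
    using smooth_into_chart[OF assms(1) px c] .
  have o: "open (\<phi> -` W)"
    using open_vimage[OF W(1) smooth_on_imp_continuous_on[OF assms(2)]] .
  have "smooth_on (\<lambda>y. h (\<phi> y)) (\<phi> -` W)"
    by (rule smooth_on_compose[OF o W(1) _ smooth_on_subset[OF assms(2)] W(4)]) auto
  moreover have "f (\<phi> y) \<in> fst c" "h (\<phi> y) = snd c (f (\<phi> y))" if "y \<in> D' \<inter> \<phi> -` W" for y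
    using that assms(3) W(3,6) by auto
  ultimately show "\<exists>c\<in>\<A>. \<exists>W h. open W \<and> x \<in> W \<and> smooth_on h W \<and>
    (\<forall>y\<in>D' \<inter> W. h y \<in> snd c ` fst c \<and> f (\<phi> y) = chart_inv c (h y))"
    using c o W(2)
    by (intro bexI[of _ c] exI[of _ "\<phi> -` W"] exI[of _ "\<lambda>y. h (\<phi> y)"]) auto
qed

lemma smooth_into_imp_continuous_on:
  assumes "smooth_into \<A> D f"
  shows "continuous_on D f"
  unfolding continuous_on_eq_continuous_within
proof
  fix x assume x: "x \<in> D"
  obtain c where c: "c \<in> \<A>" "f x \<in> fst c" using chart_at .
  obtain W h where W: "open W" "x \<in> W" "f ` (D \<inter> W) \<subseteq> fst c" "smooth_on h W"
    "h ` W \<subseteq> snd c ` fst c" "\<forall>y\<in>D \<inter> W. h y = snd c (f y)"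
    using smooth_into_chart[OF assms x c] .
  have "continuous_on W (\<lambda>y. chart_inv c (h y))"
    by (rule continuous_on_compose2[OF continuous_chart_inv[OF c(1)] smooth_on_imp_continuous_on[OF W(4)] W(5)])
  then have "isCont (\<lambda>y. chart_inv c (h y)) x"
    using continuous_on_eq_continuous_at[OF W(1)] W(2) by blast
  then have "continuous (at x within D) (\<lambda>y. chart_inv c (h y))"
    by (rule continuous_at_imp_continuous_at_within)
  moreover have "\<forall>\<^sub>F y in at x within D. chart_inv c (h y) = f y"
    unfolding eventually_at_topological
  proof (intro exI[of _ W] conjI ballI impI)
    fix y assume "y \<in> W" "y \<in> D"
    then have "h y = snd c (f y)" "f y \<in> fst c" using W by auto
    then show "chart_inv c (h y) = f y" using c(1) by simp
  qed (use W in auto)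
  moreover have "chart_inv c (h x) = f x" using W c x by auto
  ultimately show "continuous (at x within D) f"
    unfolding continuous_within using Lim_transform_eventually by simp
qed

end

section \<open>A metric and a one-form in coordinates\<close>

text \<open>The coefficients of metric and one-form in one chart, so that the analysis takes place
  on an open subset of a Euclidean space.\<close>

locale metric_coords =
  fixes D :: "'e::euclidean_space set"
    and G :: "'e \<Rightarrow> 'e \<Rightarrow> 'e \<Rightarrow> real" and w :: "'e \<Rightarrow> 'e \<Rightarrow> real"
  assumes D_open: "open D"
    and G_lin: "x \<in> D \<Longrightarrow> linear (G x u)"
    and G_sym: "x \<in> D \<Longrightarrow> G x u v = G x v u"
    and G_pos: "x \<in> D \<Longrightarrow> u \<noteq> 0 \<Longrightarrow> G x u u > 0"
    and G_smooth: "smooth_on (\<lambda>x. G x u v) D"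
    and w_lin: "x \<in> D \<Longrightarrow> linear (w x)"
    and w_smooth: "smooth_on (\<lambda>x. w x u) D"
begin

lemma G_lin2: "x \<in> D \<Longrightarrow> linear (\<lambda>u. G x u v)"
  using G_lin[of x v] G_sym[of x v] by (simp add: linear_iff)

lemmas G_simps = linear_add[OF G_lin] linear_scale[OF G_lin] linear_diff[OF G_lin]
  linear_neg[OF G_lin] linear_0[OF G_lin] linear_add[OF G_lin2] linear_scale[OF G_lin2]
  linear_diff[OF G_lin2] linear_neg[OF G_lin2] linear_0[OF G_lin2]

lemmas w_simps = linear_add[OF w_lin] linear_scale[OF w_lin] linear_diff[OF w_lin]
  linear_neg[OF w_lin] linear_0[OF w_lin]

definition dG :: "'e \<Rightarrow> 'e \<Rightarrow> 'e \<Rightarrow> 'e \<Rightarrow> real" where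
  "dG x \<xi> u v = frechet_derivative (\<lambda>x. G x u v) (at x) \<xi>"

definition dw :: "'e \<Rightarrow> 'e \<Rightarrow> 'e \<Rightarrow> real" where
  "dw x \<xi> u = frechet_derivative (\<lambda>x. w x u) (at x) \<xi>"

lemma G_has_derivative_base: "x \<in> D \<Longrightarrow> ((\<lambda>x. G x u v) has_derivative (\<lambda>\<xi>. dG x \<xi> u v)) (at x)"
  unfolding dG_def by (rule smooth_on_has_derivative[OF G_smooth])

lemma w_has_derivative_base: "x \<in> D \<Longrightarrow> ((\<lambda>x. w x u) has_derivative (\<lambda>\<xi>. dw x \<xi> u)) (at x)"
  unfolding dw_def by (rule smooth_on_has_derivative[OF w_smooth])

text \<open>Smoothness is assumed only with the vectors held fixed. A basis turns \<open>G\<close>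
  into a finite sum of coefficients times vector components, and this is the source of joint
  continuity and joint differentiability in all arguments.\<close>

lemma G_expand:
  assumes "x \<in> D"
  shows "G x u v = (\<Sum>i\<in>Basis. \<Sum>j\<in>Basis. (u \<bullet> i) * (v \<bullet> j) * G x i j)"
proof -
  have "G x u v = (\<Sum>i\<in>Basis. (u \<bullet> i) *\<^sub>R G x i v)"
    by (rule linear_euclidean_expand[OF G_lin2[OF assms]])
  also have "\<dots> = (\<Sum>i\<in>Basis. (u \<bullet> i) *\<^sub>R (\<Sum>j\<in>Basis. (v \<bullet> j) *\<^sub>R G x i j))"
    by (intro sum.cong arg_cong2[where f="(*\<^sub>R)"] refl linear_euclidean_expand[OF G_lin[OF assms]])
  finally show ?thesis by (simp add: sum_distrib_left mult.assoc)
qed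

lemma w_expand: "x \<in> D \<Longrightarrow> w x u = (\<Sum>i\<in>Basis. (u \<bullet> i) * w x i)"
  using linear_euclidean_expand[OF w_lin] by auto

lemma dG_expand:
  assumes "x \<in> D"
  shows "dG x \<xi> u v = (\<Sum>i\<in>Basis. \<Sum>j\<in>Basis. (u \<bullet> i) * (v \<bullet> j) * dG x \<xi> i j)"
proof -
  have "((\<lambda>x. \<Sum>i\<in>Basis. \<Sum>j\<in>Basis. (u \<bullet> i) * (v \<bullet> j) * G x i j) has_derivative
     (\<lambda>\<xi>. \<Sum>i\<in>Basis. \<Sum>j\<in>Basis. (u \<bullet> i) * (v \<bullet> j) * dG x \<xi> i j)) (at x)"
    by (intro has_derivative_sum has_derivative_mult_right G_has_derivative_base assms)
  then have "((\<lambda>x. G x u v) has_derivative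
     (\<lambda>\<xi>. \<Sum>i\<in>Basis. \<Sum>j\<in>Basis. (u \<bullet> i) * (v \<bullet> j) * dG x \<xi> i j)) (at x)"
    by (rule has_derivative_transform_within_open[OF _ D_open assms]) (rule G_expand[symmetric])
  from has_derivative_unique[OF G_has_derivative_base[OF assms] this] show ?thesis by metis
qed

lemma dw_expand:
  assumes "x \<in> D"
  shows "dw x \<xi> u = (\<Sum>i\<in>Basis. (u \<bullet> i) * dw x \<xi> i)"
proof -
  have "((\<lambda>x. \<Sum>i\<in>Basis. (u \<bullet> i) * w x i) has_derivative
     (\<lambda>\<xi>. \<Sum>i\<in>Basis. (u \<bullet> i) * dw x \<xi> i)) (at x)"
    by (intro has_derivative_sum has_derivative_mult_right w_has_derivative_base assms)
  then have "((\<lambda>x. w x u) has_derivative (\<lambda>\<xi>. \<Sum>i\<in>Basis. (u \<bullet> i) * dw x \<xi> i)) (at x)"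
    by (rule has_derivative_transform_within_open[OF _ D_open assms]) (rule w_expand[symmetric])
  from has_derivative_unique[OF w_has_derivative_base[OF assms] this] show ?thesis by metis
qed

lemma linear_dG: "x \<in> D \<Longrightarrow> linear (\<lambda>\<xi>. dG x \<xi> u v)"
  using has_derivative_linear[OF G_has_derivative_base] .

lemma linear_dw: "x \<in> D \<Longrightarrow> linear (\<lambda>\<xi>. dw x \<xi> u)"
  using has_derivative_linear[OF w_has_derivative_base] .

lemma dG_expand3:
  assumes "x \<in> D"
  shows "dG x \<xi> u v = (\<Sum>i\<in>Basis. \<Sum>j\<in>Basis. (u \<bullet> i) * (v \<bullet> j) * (\<Sum>k\<in>Basis. (\<xi> \<bullet> k) * dG x k i j))"
proof -
  have "dG x \<xi> i j = (\<Sum>k\<in>Basis. (\<xi> \<bullet> k) * dG x k i j)" for i j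
    using linear_euclidean_expand[OF linear_dG[OF assms, of i j], of \<xi>] by simp
  then show ?thesis using dG_expand[OF assms, of \<xi> u v] by simp
qed

lemma dw_expand2:
  assumes "x \<in> D"
  shows "dw x \<xi> u = (\<Sum>i\<in>Basis. (u \<bullet> i) * (\<Sum>k\<in>Basis. (\<xi> \<bullet> k) * dw x k i))"
proof -
  have "dw x \<xi> i = (\<Sum>k\<in>Basis. (\<xi> \<bullet> k) * dw x k i)" for i
    using linear_euclidean_expand[OF linear_dw[OF assms, of i], of \<xi>] by simp
  then show ?thesis using dw_expand[OF assms, of \<xi> u] by simp
qed

lemma linear_dw2: assumes "x \<in> D" shows "linear (dw x \<xi>)"
  by (subst dw_expand[OF assms, abs_def])
    (intro linear_compose_sum ballI linearI; simp add: inner_left_distrib distrib_right)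

lemma dG_scale: "x \<in> D \<Longrightarrow> dG x \<xi> (a *\<^sub>R u) (b *\<^sub>R v) = a * b * dG x \<xi> u v"
  by (simp add: dG_expand[of x \<xi> "a *\<^sub>R u"] dG_expand[of x \<xi> u] sum_distrib_left mult_ac)

lemma dG_smooth: "smooth_on (\<lambda>x. dG x k i j) D"
  unfolding dG_def by (rule smooth_on_frechet_derivative[OF G_smooth])

lemma dw_smooth: "smooth_on (\<lambda>x. dw x k i) D"
  unfolding dw_def by (rule smooth_on_frechet_derivative[OF w_smooth])

lemma continuous_on_G:
  assumes "continuous_on S f" "f ` S \<subseteq> D" "continuous_on S u" "continuous_on S v"
  shows "continuous_on S (\<lambda>s. G (f s) (u s) (v s))"
proof -
  have "continuous_on S (\<lambda>s. \<Sum>i\<in>Basis. \<Sum>j\<in>Basis. (u s \<bullet> i) * (v s \<bullet> j) * G (f s) i j)"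
    by (intro continuous_on_sum continuous_on_mult continuous_on_inner continuous_on_const assms
       continuous_on_compose2[OF smooth_on_imp_continuous_on[OF G_smooth] assms(1,2)])
  then show ?thesis by (rule continuous_on_eq) (use assms(2) G_expand in auto)
qed

lemma continuous_on_w:
  assumes "continuous_on S f" "f ` S \<subseteq> D" "continuous_on S u"
  shows "continuous_on S (\<lambda>s. w (f s) (u s))"
proof -
  have "continuous_on S (\<lambda>s. \<Sum>i\<in>Basis. (u s \<bullet> i) * w (f s) i)"
    by (intro continuous_on_sum continuous_on_mult continuous_on_inner continuous_on_const assms
       continuous_on_compose2[OF smooth_on_imp_continuous_on[OF w_smooth] assms(1,2)])
  then show ?thesis by (rule continuous_on_eq) (use assms(2) w_expand in auto)
qed

lemma continuous_on_dG:
  assumes "continuous_on S f" "f ` S \<subseteq> D" "continuous_on S \<xi>" "continuous_on S u" "continuous_on S v"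
  shows "continuous_on S (\<lambda>s. dG (f s) (\<xi> s) (u s) (v s))"
proof -
  have "continuous_on S (\<lambda>s. \<Sum>i\<in>Basis. \<Sum>j\<in>Basis. (u s \<bullet> i) * (v s \<bullet> j) *
      (\<Sum>k\<in>Basis. (\<xi> s \<bullet> k) * dG (f s) k i j))"
    by (intro continuous_on_sum continuous_on_mult continuous_on_inner continuous_on_const assms
       continuous_on_compose2[OF smooth_on_imp_continuous_on[OF dG_smooth] assms(1,2)])
  then show ?thesis by (rule continuous_on_eq) (use assms(2) dG_expand3 in auto)
qed

lemma continuous_on_dw:
  assumes "continuous_on S f" "f ` S \<subseteq> D" "continuous_on S \<xi>" "continuous_on S u"
  shows "continuous_on S (\<lambda>s. dw (f s) (\<xi> s) (u s))"
proof -
  have "continuous_on S (\<lambda>s. \<Sum>i\<in>Basis. (u s \<bullet> i) * (\<Sum>k\<in>Basis. (\<xi> s \<bullet> k) * dw (f s) k i))"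
    by (intro continuous_on_sum continuous_on_mult continuous_on_inner continuous_on_const assms
       continuous_on_compose2[OF smooth_on_imp_continuous_on[OF dw_smooth] assms(1,2)])
  then show ?thesis by (rule continuous_on_eq) (use assms(2) dw_expand2 in auto)
qed

lemma G_has_derivative:
  assumes "x \<in> D"
  shows "((\<lambda>(x, u, v). G x u v) has_derivative
    (\<lambda>(\<xi>, a, b). dG x \<xi> u v + G x a v + G x u b)) (at (x, u, v))"
proof -
  let ?Z = "(x, u, v)"
  have G': "((\<lambda>z. G (fst z) i j) has_derivative (\<lambda>h. dG x (fst h) i j)) (at ?Z)" for i j
    using has_derivative_compose[OF bounded_linear_imp_has_derivative[OF bounded_linear_fst],
        of "\<lambda>x. G x i j" "\<lambda>\<xi>. dG x \<xi> i j" ?Z UNIV] G_has_derivative_base[OF assms] by simp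
  have u': "((\<lambda>z. fst (snd z) \<bullet> i) has_derivative (\<lambda>h. fst (snd h) \<bullet> i)) (at ?Z)" for i
    by (intro bounded_linear_imp_has_derivative bounded_linear_inner_left_comp
        bounded_linear_fst_comp bounded_linear_snd)
  have v': "((\<lambda>z. snd (snd z) \<bullet> i) has_derivative (\<lambda>h. snd (snd h) \<bullet> i)) (at ?Z)" for i
    by (intro bounded_linear_imp_has_derivative bounded_linear_inner_left_comp
        bounded_linear_snd_comp bounded_linear_snd)
  have "((\<lambda>z. \<Sum>i\<in>Basis. \<Sum>j\<in>Basis. (fst (snd z) \<bullet> i) * (snd (snd z) \<bullet> j) * G (fst z) i j) has_derivative
     (\<lambda>h. \<Sum>i\<in>Basis. \<Sum>j\<in>Basis. (fst (snd ?Z) \<bullet> i) * (snd (snd ?Z) \<bullet> j) * dG x (fst h) i j +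
        ((fst (snd ?Z) \<bullet> i) * (snd (snd h) \<bullet> j) + (fst (snd h) \<bullet> i) * (snd (snd ?Z) \<bullet> j)) * G (fst ?Z) i j)) (at ?Z)"
    by (intro has_derivative_sum has_derivative_mult G' u' v')
  moreover have "(\<lambda>h. \<Sum>i\<in>Basis. \<Sum>j\<in>Basis. (fst (snd ?Z) \<bullet> i) * (snd (snd ?Z) \<bullet> j) * dG x (fst h) i j +
        ((fst (snd ?Z) \<bullet> i) * (snd (snd h) \<bullet> j) + (fst (snd h) \<bullet> i) * (snd (snd ?Z) \<bullet> j)) * G (fst ?Z) i j)
     = (\<lambda>(\<xi>, a, b). dG x \<xi> u v + G x a v + G x u b)"
    by (rule ext) (simp add: split_beta dG_expand[OF assms, of _ u] G_expand[OF assms, of _ v]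
        G_expand[OF assms, of u] sum.distrib distrib_right)
  ultimately have 1: "((\<lambda>z. \<Sum>i\<in>Basis. \<Sum>j\<in>Basis. (fst (snd z) \<bullet> i) * (snd (snd z) \<bullet> j) * G (fst z) i j) has_derivative
     (\<lambda>(\<xi>, a, b). dG x \<xi> u v + G x a v + G x u b)) (at ?Z)" by simp
  show ?thesis
    by (rule has_derivative_transform_within_open[OF 1, of "D \<times> UNIV"])
      (use D_open assms G_expand in \<open>auto intro!: open_Times\<close>)
qed

lemma w_has_derivative:
  assumes "x \<in> D"
  shows "((\<lambda>(x, u). w x u) has_derivative (\<lambda>(\<xi>, a). dw x \<xi> u + w x a)) (at (x, u))"
proof -
  let ?Z = "(x, u)"
  have G': "((\<lambda>z. w (fst z) i) has_derivative (\<lambda>h. dw x (fst h) i)) (at ?Z)" for i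
    using has_derivative_compose[OF bounded_linear_imp_has_derivative[OF bounded_linear_fst],
        of "\<lambda>x. w x i" "\<lambda>\<xi>. dw x \<xi> i" ?Z UNIV] w_has_derivative_base[OF assms] by simp
  have u': "((\<lambda>z. snd z \<bullet> i) has_derivative (\<lambda>h. snd h \<bullet> i)) (at ?Z)" for i
    by (intro bounded_linear_imp_has_derivative bounded_linear_inner_left_comp bounded_linear_snd)
  have "((\<lambda>z. \<Sum>i\<in>Basis. (snd z \<bullet> i) * w (fst z) i) has_derivative
     (\<lambda>h. \<Sum>i\<in>Basis. (snd ?Z \<bullet> i) * dw x (fst h) i + (snd h \<bullet> i) * w (fst ?Z) i)) (at ?Z)"
    by (intro has_derivative_sum has_derivative_mult G' u')
  moreover have "(\<lambda>h. \<Sum>i\<in>Basis. (snd ?Z \<bullet> i) * dw x (fst h) i + (snd h \<bullet> i) * w (fst ?Z) i)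
     = (\<lambda>(\<xi>, a). dw x \<xi> u + w x a)"
    by (rule ext) (simp add: split_beta dw_expand[OF assms, of _ u] w_expand[OF assms, of "snd _"]
        sum.distrib)
  ultimately have 1: "((\<lambda>z. \<Sum>i\<in>Basis. (snd z \<bullet> i) * w (fst z) i) has_derivative
     (\<lambda>(\<xi>, a). dw x \<xi> u + w x a)) (at ?Z)" by simp
  show ?thesis
    by (rule has_derivative_transform_within_open[OF 1, of "D \<times> UNIV"])
      (use D_open assms w_expand in \<open>auto intro!: open_Times\<close>)
qed

end

section \<open>Derivatives of the squared Randers and Kropina metrics\<close>

text \<open>For \<open>\<epsilon> > 0\<close> and \<open>a \<ge> 0\<close> this is the nonnegative
  root \<open>F\<close> of \<open>\<epsilon> F^2 - 2 b F - a = 0\<close>, to be used with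
  \<open>a = g(v, v)\<close> and \<open>b = \<omega>(v)\<close>.\<close>

definition randers_fun :: "real \<Rightarrow> real \<Rightarrow> real \<Rightarrow> real" where
  "randers_fun \<epsilon> a b = 1 / \<epsilon> * (sqrt (\<epsilon> * a + b\<^sup>2) + b)"

lemma randers_fun_bound:
  assumes "\<epsilon> > 0" "a \<ge> 0"
  shows "0 \<le> randers_fun \<epsilon> a b" "randers_fun \<epsilon> a b \<le> 2 / \<epsilon> * sqrt (\<epsilon> * a + b\<^sup>2)"
proof -
  have "\<bar>b\<bar> \<le> sqrt (\<epsilon> * a + b\<^sup>2)"
    using assms by (intro real_le_rsqrt) auto
  then show "0 \<le> randers_fun \<epsilon> a b" "randers_fun \<epsilon> a b \<le> 2 / \<epsilon> * sqrt (\<epsilon> * a + b\<^sup>2)"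
    using assms unfolding randers_fun_def by (auto simp: field_simps)
qed

lemma randers_fun_root:
  assumes "\<epsilon> > 0" "a \<ge> 0"
  shows "a + 2 * b * randers_fun \<epsilon> a b = \<epsilon> * (randers_fun \<epsilon> a b)\<^sup>2"
    and "sqrt (\<epsilon> * a + b\<^sup>2) = \<epsilon> * randers_fun \<epsilon> a b - b"
proof -
  show *: "sqrt (\<epsilon> * a + b\<^sup>2) = \<epsilon> * randers_fun \<epsilon> a b - b"
    using assms unfolding randers_fun_def by simp
  have "(sqrt (\<epsilon> * a + b\<^sup>2))\<^sup>2 = \<epsilon> * a + b\<^sup>2" using assms by simp
  then have "(\<epsilon> * randers_fun \<epsilon> a b - b)\<^sup>2 = \<epsilon> * a + b\<^sup>2" unfolding * .
  then have "\<epsilon> * (a + 2 * b * randers_fun \<epsilon> a b) = \<epsilon> * (\<epsilon> * (randers_fun \<epsilon> a b)\<^sup>2)"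
    by (simp add: power2_eq_square algebra_simps)
  then show "a + 2 * b * randers_fun \<epsilon> a b = \<epsilon> * (randers_fun \<epsilon> a b)\<^sup>2" using assms by simp
qed

lemma has_derivative_half_square:
  fixes f :: "'a::real_normed_vector \<Rightarrow> real"
  assumes "(f has_derivative f') (at p)"
  shows "((\<lambda>p. (f p)\<^sup>2 / 2) has_derivative (\<lambda>h. f p * f' h)) (at p)"
  by (auto intro!: derivative_eq_intros assms)

text \<open>Implicit differentiation of \<open>\<epsilon> F^2 - 2 B F - A = 0\<close> gives
  \<open>F' = (A' / 2 + F B') / (\<epsilon> F - B)\<close>, and \<open>\<epsilon> F - B\<close> is
  the square root in the denominator.\<close>

lemma randers_energy_has_derivative:
  fixes A B :: "'a::real_normed_vector \<Rightarrow> real"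
  assumes "\<epsilon> > 0" "(A has_derivative A') (at p)" "(B has_derivative B') (at p)"
    "\<epsilon> * A p + (B p)\<^sup>2 > 0"
  shows "((\<lambda>p. (randers_fun \<epsilon> (A p) (B p))\<^sup>2 / 2) has_derivative
    (\<lambda>h. randers_fun \<epsilon> (A p) (B p) / sqrt (\<epsilon> * A p + (B p)\<^sup>2) *
       (A' h / 2 + randers_fun \<epsilon> (A p) (B p) * B' h))) (at p)"
proof -
  define q where "q p = \<epsilon> * A p + (B p)\<^sup>2" for p
  define F where "F p = randers_fun \<epsilon> (A p) (B p)" for p
  have q': "(q has_derivative (\<lambda>h. \<epsilon> * A' h + 2 * B p * B' h)) (at p)"
    unfolding q_def by (auto intro!: derivative_eq_intros assms)
  have s: "((\<lambda>p. sqrt (q p)) has_derivative (\<lambda>h. (\<epsilon> * A' h + 2 * B p * B' h) * (inverse (sqrt (q p)) / 2))) (at p)"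
    by (rule DERIV_compose_FDERIV[OF DERIV_real_sqrt q']) (use assms(4) in \<open>simp add: q_def\<close>)
  have F': "(F has_derivative (\<lambda>h. 1/\<epsilon> * ((\<epsilon> * A' h + 2 * B p * B' h) * (inverse (sqrt (q p)) / 2) + B' h))) (at p)"
    unfolding F_def[abs_def] randers_fun_def q_def[symmetric]
    by (intro has_derivative_mult_right has_derivative_add s assms)
  have "((\<lambda>p. (F p)\<^sup>2 / 2) has_derivative (\<lambda>h. F p *
      (1/\<epsilon> * ((\<epsilon> * A' h + 2 * B p * B' h) * (inverse (sqrt (q p)) / 2) + B' h)))) (at p)"
    by (rule has_derivative_half_square[OF F'])
  moreover have *: "F p * (1/\<epsilon> * ((\<epsilon> * A' h + 2 * B p * B' h) * (inverse (sqrt (q p)) / 2) + B' h)) =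
      F p / sqrt (q p) * (A' h / 2 + F p * B' h)" for h
  proof -
    have r: "sqrt (q p) > 0" using assms(4) by (simp add: q_def)
    have Fp: "F p = (sqrt (q p) + B p) / \<epsilon>"
      using assms(1) unfolding F_def randers_fun_def q_def by simp
    have "1/\<epsilon> * ((\<epsilon> * A' h + 2 * B p * B' h) * (inverse (sqrt (q p)) / 2) + B' h) =
      (A' h / 2 + F p * B' h) / sqrt (q p)"
      unfolding Fp using r assms(1) by (simp add: field_simps)
    then show ?thesis by simp
  qed
  ultimately have "((\<lambda>p. (F p)\<^sup>2 / 2) has_derivative (\<lambda>h. F p / sqrt (q p) * (A' h / 2 + F p * B' h))) (at p)"
    by (simp only: *)
  then show ?thesis unfolding F_def q_def .
qed

lemma has_derivative_squeeze_0:
  fixes f q :: "'a::real_normed_vector \<Rightarrow> real"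
  assumes "\<forall>\<^sub>F y in at x. 0 \<le> f y \<and> f y \<le> q y" "f x = 0" "q x = 0"
    "(q has_derivative (\<lambda>h. 0)) (at x)"
  shows "(f has_derivative (\<lambda>h. 0)) (at x)"
proof -
  have "((\<lambda>y. norm (q y - q x - 0) / norm (y - x)) \<longlongrightarrow> 0) (at x)"
    using assms(4) unfolding has_derivative_iff_norm by blast
  moreover have "\<forall>\<^sub>F y in at x. norm (norm (f y - f x - 0) / norm (y - x)) \<le> norm (q y - q x - 0) / norm (y - x)"
    using assms(1) by eventually_elim (use assms(2,3) in \<open>auto intro!: divide_right_mono\<close>)
  ultimately have "((\<lambda>y. norm (f y - f x - 0) / norm (y - x)) \<longlongrightarrow> 0) (at x)"
    by (rule Lim_null_comparison[rotated])
  then show ?thesis unfolding has_derivative_iff_norm by (simp add: bounded_linear_zero)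
qed

text \<open>At zero velocity the square root need not be differentiable. But the energy lies between
  \<open>0\<close> and a multiple of \<open>\<epsilon> A + B^2\<close>, whose derivative vanishes
  there.\<close>

lemma randers_energy_has_derivative_0:
  fixes A B :: "'a::real_normed_vector \<Rightarrow> real"
  assumes "\<epsilon> > 0" "(A has_derivative (\<lambda>h. 0)) (at p)" "(B has_derivative B') (at p)"
    "A p = 0" "B p = 0" "\<forall>\<^sub>F y in at p. A y \<ge> 0"
  shows "((\<lambda>p. (randers_fun \<epsilon> (A p) (B p))\<^sup>2 / 2) has_derivative (\<lambda>h. 0)) (at p)"
proof (rule has_derivative_squeeze_0)
  show "((\<lambda>y. 2 / \<epsilon>\<^sup>2 * (\<epsilon> * A y + (B y)\<^sup>2)) has_derivative (\<lambda>h. 0)) (at p)"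
    using assms(1,4,5) by (auto intro!: derivative_eq_intros assms(2,3))
  show "\<forall>\<^sub>F y in at p. 0 \<le> (randers_fun \<epsilon> (A y) (B y))\<^sup>2 / 2 \<and>
      (randers_fun \<epsilon> (A y) (B y))\<^sup>2 / 2 \<le> 2 / \<epsilon>\<^sup>2 * (\<epsilon> * A y + (B y)\<^sup>2)"
    using assms(6)
  proof eventually_elim
    case (elim y)
    have "(randers_fun \<epsilon> (A y) (B y))\<^sup>2 \<le> (2 / \<epsilon> * sqrt (\<epsilon> * A y + (B y)\<^sup>2))\<^sup>2"
      using randers_fun_bound[OF assms(1) elim] by (intro power_mono) auto
    also have "\<dots> = 4 / \<epsilon>\<^sup>2 * (\<epsilon> * A y + (B y)\<^sup>2)"
      using elim assms(1) by (simp add: power_mult_distrib power_divide)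
    finally show ?case by simp
  qed
qed (use assms in \<open>auto simp: randers_fun_def\<close>)

text \<open>The implicit formula at \<open>\<epsilon> = 0\<close>: the root is
  \<open>- A / (2 B)\<close>, and \<open>- B\<close> takes the place of the square root.\<close>

lemma kropina_energy_has_derivative:
  fixes A B :: "'a::real_normed_vector \<Rightarrow> real"
  assumes "(A has_derivative A') (at p)" "(B has_derivative B') (at p)" "B p < 0"
  shows "((\<lambda>p. (- (A p / (2 * B p)))\<^sup>2 / 2) has_derivative
    (\<lambda>h. - (A p / (2 * B p)) / - B p * (A' h / 2 + - (A p / (2 * B p)) * B' h))) (at p)"
proof -
  have F: "((\<lambda>p. - (A p / (2 * B p))) has_derivative
     (\<lambda>h. (A' h / 2 + - (A p / (2 * B p)) * B' h) / - B p)) (at p)"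
  proof -
    have "((\<lambda>p. - (A p / (2 * B p))) has_derivative
      (\<lambda>h. - ((A' h * (2 * B p) - A p * (2 * B' h)) / (2 * B p * (2 * B p))))) (at p)"
      by (intro has_derivative_minus has_derivative_divide' has_derivative_mult_right assms(1,2))
        (use assms(3) in simp)
    also have "(\<lambda>h. - ((A' h * (2 * B p) - A p * (2 * B' h)) / (2 * B p * (2 * B p)))) =
      (\<lambda>h. (A' h / 2 + - (A p / (2 * B p)) * B' h) / - B p)"
      using assms(3) by (auto simp: field_simps)
    finally show ?thesis .
  qed
  from has_derivative_half_square[OF F] show ?thesis by simp
qed

context metric_coords
begin

text \<open>The derivative of half of the square of a metric \<open>F\<close> at \<open>(y, z)\<close> in the direction \<open>(\<xi>, \<zeta>)\<close>, where
  \<open>F\<close> is defined implicitly by \<open>\<epsilon> F\<^sup>2 - 2 w F - G = 0\<close> and \<open>R = \<epsilon> F - w\<close>; \<open>\<epsilon> = 0\<close> is the Kropina case.\<close>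

definition dL :: "real \<Rightarrow> real \<Rightarrow> 'e \<Rightarrow> 'e \<Rightarrow> 'e \<Rightarrow> 'e \<Rightarrow> real" where
  "dL F R y z \<xi> \<zeta> = F / R * ((dG y \<xi> z z + 2 * G y z \<zeta>) / 2 + F * (dw y \<xi> z + w y \<zeta>))"

definition FR :: "real \<Rightarrow> 'e \<Rightarrow> 'e \<Rightarrow> real" where
  "FR \<epsilon> y z = randers_fun \<epsilon> (G y z z) (w y z)"

definition RR :: "real \<Rightarrow> 'e \<Rightarrow> 'e \<Rightarrow> real" where
  "RR \<epsilon> y z = sqrt (\<epsilon> * G y z z + (w y z)\<^sup>2)"

definition FK :: "'e \<Rightarrow> 'e \<Rightarrow> real" where
  "FK y z = - (G y z z / (2 * w y z))"

lemma G_nonneg: "y \<in> D \<Longrightarrow> G y z z \<ge> 0"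
  using G_pos G_simps(5) by (metis less_eq_real_def)

lemma energy_arg_derivs:
  assumes "y \<in> D"
  shows "((\<lambda>q. G (fst q) (snd q) (snd q)) has_derivative
      (\<lambda>h. dG y (fst h) z z + 2 * G y z (snd h))) (at (y, z))" (is ?A)
    and "((\<lambda>q. w (fst q) (snd q)) has_derivative
      (\<lambda>h. dw y (fst h) z + w y (snd h))) (at (y, z))" (is ?B)
proof -
  have "((\<lambda>q. (fst q, snd q, snd q)) has_derivative (\<lambda>h. (fst h, snd h, snd h))) (at (y, z))"
    by (intro bounded_linear_imp_has_derivative bounded_linear_Pair bounded_linear_fst bounded_linear_snd)
  from has_derivative_compose[OF this, of "\<lambda>(x, u, v). G x u v" "\<lambda>(\<xi>, a, b). dG y \<xi> z z + G y a z + G y z b"]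
  show ?A using G_has_derivative[OF assms, of z z] by (simp add: G_sym[OF assms, of _ z] add_ac)
  show ?B using w_has_derivative[OF assms, of z] by (simp add: case_prod_unfold)
qed

lemma FR_energy_has_derivative:
  assumes "\<epsilon> > 0" "y \<in> D"
  shows "((\<lambda>q. (FR \<epsilon> (fst q) (snd q))\<^sup>2 / 2) has_derivative
    (\<lambda>h. dL (FR \<epsilon> y z) (RR \<epsilon> y z) y z (fst h) (snd h))) (at (y, z))"
proof (cases "z = 0")
  case False
  have "\<epsilon> * G (fst (y, z)) (snd (y, z)) (snd (y, z)) + (w (fst (y, z)) (snd (y, z)))\<^sup>2 > 0"
    using G_pos[OF assms(2) False] assms(1) by (simp add: add_pos_nonneg)
  from randers_energy_has_derivative[OF assms(1) energy_arg_derivs[OF assms(2), of z] this]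
  show ?thesis by (simp add: FR_def RR_def dL_def)
next
  case True
  have ev: "\<forall>\<^sub>F q in at (y, z). G (fst q) (snd q) (snd q) \<ge> 0"
    unfolding eventually_at_topological
    by (rule exI[of _ "D \<times> UNIV"]) (use D_open assms G_nonneg in \<open>auto intro: open_Times\<close>)
  have "((\<lambda>q. (randers_fun \<epsilon> (G (fst q) (snd q) (snd q)) (w (fst q) (snd q)))\<^sup>2 / 2) has_derivative (\<lambda>h. 0)) (at (y, z))"
  proof (rule randers_energy_has_derivative_0[OF assms(1) _ energy_arg_derivs(2)[OF assms(2), of z] _ _ ev])
    have "dG y \<xi> z z = 0" for \<xi>
      using dG_scale[OF assms(2), of \<xi> 0 z 0 z] True by simp
    then show "((\<lambda>q. G (fst q) (snd q) (snd q)) has_derivative (\<lambda>h. 0)) (at (y, z))"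
      using energy_arg_derivs(1)[OF assms(2), of z] True by (simp add: G_simps assms)
  qed (use assms True in \<open>simp_all add: G_simps w_simps\<close>)
  \<comment> \<open>The quotient \<open>F / R\<close> in \<open>dL\<close> is then \<open>0\<close>
    by the convention \<open>x / 0 = 0\<close>, which agrees with the vanishing derivative just
    found.\<close>
  moreover have "RR \<epsilon> y z = 0" using assms True by (simp add: RR_def G_simps w_simps)
  ultimately show ?thesis by (simp add: FR_def dL_def)
qed

lemma FK_energy_has_derivative:
  assumes "y \<in> D" "w y z < 0"
  shows "((\<lambda>q. (FK (fst q) (snd q))\<^sup>2 / 2) has_derivative
    (\<lambda>h. dL (FK y z) (- w y z) y z (fst h) (snd h))) (at (y, z))"
  using kropina_energy_has_derivative[OF energy_arg_derivs[OF assms(1), of z]] assms(2)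
  by (simp add: FK_def dL_def)

lemma RR_pos: "\<epsilon> > 0 \<Longrightarrow> y \<in> D \<Longrightarrow> z \<noteq> 0 \<Longrightarrow> RR \<epsilon> y z > 0"
  using G_pos by (simp add: RR_def add_pos_nonneg)

lemma RR_zero: "y \<in> D \<Longrightarrow> RR \<epsilon> y 0 = 0" "y \<in> D \<Longrightarrow> FR \<epsilon> y 0 = 0"
  by (simp_all add: RR_def FR_def G_simps w_simps randers_fun_def)

lemma continuous_on_FR:
  assumes "continuous_on S y" "y ` S \<subseteq> D" "continuous_on S z"
  shows "continuous_on S (\<lambda>s. FR \<epsilon> (y s) (z s))" "continuous_on S (\<lambda>s. RR \<epsilon> (y s) (z s))"
  unfolding FR_def RR_def randers_fun_def
  by (intro continuous_on_mult continuous_on_const continuous_on_add continuous_on_real_sqrt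
      continuous_on_power continuous_on_G continuous_on_w assms)+

lemma continuous_on_dL:
  assumes "continuous_on S y" "y ` S \<subseteq> D" "continuous_on S z" "continuous_on S \<xi>" "continuous_on S \<zeta>"
    "continuous_on S F" "continuous_on S R" "\<And>s. s \<in> S \<Longrightarrow> R s \<noteq> 0"
  shows "continuous_on S (\<lambda>s. dL (F s) (R s) (y s) (z s) (\<xi> s) (\<zeta> s))"
  unfolding dL_def
  by (intro continuous_on_mult continuous_on_const continuous_on_add continuous_on_divide
      continuous_on_G continuous_on_w continuous_on_dG continuous_on_dw assms) (use assms(8) in auto)

text \<open>\<open>F / R\<close> has no limit at zero velocity in general, but it is bounded by
  \<open>2 / \<epsilon>\<close>, and the other factor \<open>q\<close> tends to \<open>0\<close>
  there.\<close>

lemma continuous_on_dL_FR: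
  fixes y z \<xi> \<zeta> :: "'t::t2_space \<Rightarrow> 'e"
  assumes "\<epsilon> > 0"
    and S: "continuous_on S y" "y ` S \<subseteq> D" "continuous_on S z" "continuous_on S \<xi>" "continuous_on S \<zeta>"
  shows "continuous_on S (\<lambda>s. dL (FR \<epsilon> (y s) (z s)) (RR \<epsilon> (y s) (z s)) (y s) (z s) (\<xi> s) (\<zeta> s))"
proof -
  define q where "q s = (dG (y s) (\<xi> s) (z s) (z s) + 2 * G (y s) (z s) (\<zeta> s)) / 2 +
    FR \<epsilon> (y s) (z s) * (dw (y s) (\<xi> s) (z s) + w (y s) (\<zeta> s))" for s
  have q: "continuous_on S q" unfolding q_def
    by (intro continuous_on_mult continuous_on_const continuous_on_add continuous_on_divide
      continuous_on_G continuous_on_w continuous_on_dG continuous_on_dw continuous_on_FR S) auto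
  note F = continuous_on_FR[OF S(1-3), of \<epsilon>]
  have "continuous (at s within S) (\<lambda>s. FR \<epsilon> (y s) (z s) / RR \<epsilon> (y s) (z s) * q s)" if s: "s \<in> S" for s
  proof (cases "z s = 0")
    case False
    have "RR \<epsilon> (y s) (z s) \<noteq> 0" using RR_pos[OF assms(1) _ False, of "y s"] s S(2) by auto
    then show ?thesis
      using F q s unfolding continuous_on_eq_continuous_within continuous_within
      by (intro tendsto_intros) auto
  next
    case True
    have ys: "y s \<in> D" using s S(2) by auto
    have b: "\<bar>FR \<epsilon> (y t) (z t) / RR \<epsilon> (y t) (z t)\<bar> \<le> 2 / \<epsilon>" if "t \<in> S" for t
    proof -
      have "y t \<in> D" using that S(2) by auto
      then have "0 \<le> FR \<epsilon> (y t) (z t)" "FR \<epsilon> (y t) (z t) \<le> 2 / \<epsilon> * RR \<epsilon> (y t) (z t)" "0 \<le> RR \<epsilon> (y t) (z t)"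
        using randers_fun_bound[OF assms(1) G_nonneg] G_nonneg assms(1) by (auto simp: FR_def RR_def)
      then show ?thesis using assms(1)
        by (cases "RR \<epsilon> (y t) (z t) = 0") (auto simp: divide_le_eq)
    qed
    have "q s = 0" using True ys dG_scale[OF ys, of "\<xi> s" 0 0 0 0]
      by (simp add: q_def RR_zero G_simps)
    then have q0: "(q \<longlongrightarrow> 0) (at s within S)"
      using q s unfolding continuous_on_def by force
    have "((\<lambda>s. FR \<epsilon> (y s) (z s) / RR \<epsilon> (y s) (z s) * q s) \<longlongrightarrow> 0) (at s within S)"
    proof (rule Lim_null_comparison)
      show "((\<lambda>t. 2 / \<epsilon> * norm (q t)) \<longlongrightarrow> 0) (at s within S)"
        using tendsto_mult_right_zero[OF tendsto_norm_zero[OF q0]] .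
      show "\<forall>\<^sub>F t in at s within S. norm (FR \<epsilon> (y t) (z t) / RR \<epsilon> (y t) (z t) * q t) \<le> 2 / \<epsilon> * norm (q t)"
        unfolding eventually_at_filter
      proof (rule always_eventually, intro allI impI)
        fix t assume "t \<in> S"
        show "norm (FR \<epsilon> (y t) (z t) / RR \<epsilon> (y t) (z t) * q t) \<le> 2 / \<epsilon> * norm (q t)"
          unfolding real_norm_def abs_mult by (rule mult_right_mono[OF b[OF \<open>t \<in> S\<close>] abs_ge_zero])
      qed
    qed
    then show ?thesis using \<open>q s = 0\<close> by (simp add: continuous_within)
  qed
  then show ?thesis
    unfolding continuous_on_eq_continuous_within dL_def q_def by blast
qed

end

lemma smooth_on_transform:
  "open U \<Longrightarrow> smooth_on g U \<Longrightarrow> (\<And>x. x \<in> U \<Longrightarrow> f x = g x) \<Longrightarrow> smooth_on f U"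
  using smooth_on_cong[of U f g] by simp

section \<open>Musical isomorphisms and the Legendre transform\<close>

context metric_coords
begin

text \<open>Covectors are stored as vectors by means of the Euclidean inner product. In this sense
  \<open>flat\<close> and \<open>sharp\<close> are the musical isomorphisms of \<open>G\<close>, and
  \<open>wv\<close> is the one-form.\<close>

definition flat :: "'e \<Rightarrow> 'e \<Rightarrow> 'e" where
  "flat x u = (\<Sum>i\<in>Basis. G x u i *\<^sub>R i)"

definition wv :: "'e \<Rightarrow> 'e" where
  "wv x = (\<Sum>i\<in>Basis. w x i *\<^sub>R i)"

definition sharp :: "'e \<Rightarrow> 'e \<Rightarrow> 'e" where
  "sharp x = inv (flat x)"

lemma flat_inner: "x \<in> D \<Longrightarrow> flat x u \<bullet> v = G x u v"
  unfolding linear_euclidean_expand[OF G_lin, of x u v] flat_def inner_sum_left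
  by (intro sum.cong) (simp_all add: inner_commute)

lemma wv_inner: "x \<in> D \<Longrightarrow> wv x \<bullet> v = w x v"
  unfolding linear_euclidean_expand[OF w_lin, of x v] wv_def inner_sum_left
  by (intro sum.cong) (simp_all add: inner_commute)

lemma linear_flat: "x \<in> D \<Longrightarrow> linear (flat x)"
  unfolding flat_def by (intro linear_compose_sum ballI linearI)
    (simp_all add: G_simps scaleR_left_distrib)

lemma bij_flat: assumes "x \<in> D" shows "bij (flat x)"
proof -
  have "u = 0" if "flat x u = 0" for u
    using flat_inner[OF assms, of u u] G_pos[OF assms, of u] that by force
  then have "inj (flat x)"
    using linear_flat[OF assms] by (simp add: linear_injective_0)
  then show ?thesis
    using linear_injective_imp_surjective[OF linear_flat[OF assms]] by (simp add: bij_def)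
qed

lemma flat_sharp: "x \<in> D \<Longrightarrow> flat x (sharp x a) = a"
  unfolding sharp_def using bij_flat by (simp add: bij_is_surj surj_f_inv_f)

lemma sharp_flat: "x \<in> D \<Longrightarrow> sharp x (flat x u) = u"
  unfolding sharp_def using bij_flat by (simp add: bij_is_inj)

lemma G_sharp: "x \<in> D \<Longrightarrow> G x (sharp x a) b = a \<bullet> b"
  using flat_inner flat_sharp by metis

lemma linear_sharp: assumes "x \<in> D" shows "linear (sharp x)"
proof (rule linearI)
  show "sharp x (a + b) = sharp x a + sharp x b" for a b
    using sharp_flat[OF assms, of "sharp x a + sharp x b"]
    by (simp add: linear_add[OF linear_flat[OF assms]] flat_sharp assms)
  show "sharp x (r *\<^sub>R a) = r *\<^sub>R sharp x a" for r a
    using sharp_flat[OF assms, of "r *\<^sub>R sharp x a"]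
    by (simp add: linear_scale[OF linear_flat[OF assms]] flat_sharp assms)
qed

definition dflat :: "'e \<Rightarrow> 'e \<Rightarrow> 'e \<Rightarrow> 'e" where
  "dflat x \<xi> u = (\<Sum>i\<in>Basis. dG x \<xi> u i *\<^sub>R i)"

lemma flat_has_derivative:
  assumes "x \<in> D"
  shows "((\<lambda>q. flat (fst q) (snd q)) has_derivative (\<lambda>h. dflat x (fst h) u + flat x (snd h))) (at (x, u))"
proof -
  have *: "((\<lambda>q. G (fst q) (snd q) i) has_derivative (\<lambda>h. dG x (fst h) u i + G x (snd h) i)) (at (x, u))" for i
  proof -
    have "((\<lambda>q. (fst q, snd q, i)) has_derivative (\<lambda>h. (fst h, snd h, 0))) (at (x, u))"
      by (intro has_derivative_Pair has_derivative_const bounded_linear_imp_has_derivative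
          bounded_linear_fst bounded_linear_snd)
    from has_derivative_compose[OF this, of "\<lambda>(x, u, v). G x u v" "\<lambda>(\<xi>, a, b). dG x \<xi> u i + G x a i + G x u b"]
    show ?thesis using G_has_derivative[OF assms, of u i] by (simp add: G_simps assms)
  qed
  have "((\<lambda>q. flat (fst q) (snd q)) has_derivative
      (\<lambda>h. \<Sum>i\<in>Basis. (dG x (fst h) u i + G x (snd h) i) *\<^sub>R i)) (at (x, u))"
    unfolding flat_def by (intro has_derivative_sum has_derivative_scaleR_left *)
  then show ?thesis
    by (simp add: dflat_def flat_def scaleR_left_distrib sum.distrib)
qed

text \<open>From the inverse function theorem for the map \<open>(x, u) \<mapsto> (x, flat x u)\<close>.\<close>

lemma sharp_has_derivative:
  assumes "x \<in> D"
  shows "((\<lambda>q. sharp (fst q) (snd q)) has_derivative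
     (\<lambda>h. sharp x (snd h - dflat x (fst h) (sharp x a)))) (at (x, a))"
proof -
  define f where "f q = (fst q, flat (fst q) (snd q))" for q
  define g where "g q = (fst q, sharp (fst q) (snd q))" for q
  define u where "u = sharp x a"
  have "(g has_derivative (\<lambda>h. (fst h, sharp x (snd h - dflat x (fst h) u)))) (at (f (x, u)))"
  proof (rule has_derivative_inverse_on[where S="D \<times> UNIV"
      and f'="\<lambda>q h. (fst h, dflat (fst q) (fst h) (snd q) + flat (fst q) (snd h))"
      and g'="\<lambda>q h. (fst h, sharp (fst q) (snd h - dflat (fst q) (fst h) (snd q)))" and x="(x, u)", simplified])
    show "open (D \<times> (UNIV :: 'e set))" using D_open by (intro open_Times) auto
    show "(f has_derivative (\<lambda>h. (fst h, dflat (fst q) (fst h) (snd q) + flat (fst q) (snd h)))) (at q)"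
      if "q \<in> D \<times> UNIV" for q
      unfolding f_def
      using flat_has_derivative[of "fst q" "snd q"] that
      by (intro has_derivative_Pair has_derivative_fst has_derivative_ident) auto
    show "g (f q) = q" if "q \<in> D \<times> UNIV" for q
      using that by (auto simp: f_def g_def sharp_flat)
    show "(\<lambda>h. (fst h, dflat x (fst h) u + flat x (snd h))) \<circ>
        (\<lambda>h. (fst h, sharp x (snd h - dflat x (fst h) u))) = id"
      using assms by (auto simp: flat_sharp)
  qed (use assms in auto)
  then have "(g has_derivative (\<lambda>h. (fst h, sharp x (snd h - dflat x (fst h) u)))) (at (x, a))"
    using assms by (simp add: f_def u_def flat_sharp)
  from has_derivative_snd[OF this] show ?thesis by (simp add: g_def u_def)
qed

text \<open>As for the inverse of a matrix, the derivative of \<open>sharp\<close> is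
  \<open>- sharp o dflat o sharp\<close>. A basis expansion leaves only values of
  \<open>sharp\<close> at fixed vectors, to which the induction hypothesis applies.\<close>

lemma sharp_smooth: "smooth_on (\<lambda>x. sharp x a) D"
proof -
  have "Ck_on k (\<lambda>x. sharp x a) D" for k
  proof (induction k arbitrary: a)
    case 0
    have "isCont (\<lambda>x. sharp x a) x" if "x \<in> D" for x
    proof -
      have "isCont (\<lambda>q. sharp (fst q) (snd q)) (x, a)"
        by (rule has_derivative_continuous[OF sharp_has_derivative[OF that]])
      then show ?thesis
        using isCont_o2[of x "\<lambda>x. (x, a)" "\<lambda>q. sharp (fst q) (snd q)"] by (simp add: isCont_Pair)
    qed
    then show ?case by (simp add: continuous_at_imp_continuous_on)
  next
    case (Suc k)
    show ?case
    proof (rule Ck_on_SucI[OF D_open])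
      fix x assume x: "x \<in> D"
      have "((\<lambda>x. (x, a)) has_derivative (\<lambda>h. (h, 0))) (at x)"
        by (intro has_derivative_Pair has_derivative_const has_derivative_ident)
      from has_derivative_compose[OF this sharp_has_derivative[OF x]]
      have "((\<lambda>x. sharp x a) has_derivative (\<lambda>\<xi>. sharp x (- dflat x \<xi> (sharp x a)))) (at x)"
        by simp
      also have "(\<lambda>\<xi>. sharp x (- dflat x \<xi> (sharp x a))) = (\<lambda>\<xi>. - (\<Sum>i\<in>Basis.
          (\<Sum>j\<in>Basis. (sharp x a \<bullet> j) * dG x \<xi> j i) *\<^sub>R sharp x i))"
      proof
        fix \<xi>
        have "dG x \<xi> (sharp x a) i = (\<Sum>j\<in>Basis. (sharp x a \<bullet> j) * dG x \<xi> j i)" if "i \<in> Basis" for i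
        proof -
          have "(\<Sum>l\<in>Basis. (sharp x a \<bullet> j) * (i \<bullet> l) * dG x \<xi> j l) = (sharp x a \<bullet> j) * dG x \<xi> j i" for j
            using that by (simp add: inner_Basis if_distrib if_distribR sum.delta cong: if_cong)
          then show ?thesis using dG_expand[OF x, of \<xi> "sharp x a" i] by simp
        qed
        then show "sharp x (- dflat x \<xi> (sharp x a)) = - (\<Sum>i\<in>Basis.
          (\<Sum>j\<in>Basis. (sharp x a \<bullet> j) * dG x \<xi> j i) *\<^sub>R sharp x i)"
          using linear_sharp[OF x]
          by (simp add: dflat_def linear_neg linear_sum linear_scale)
      qed
      finally show "((\<lambda>x. sharp x a) has_derivative (\<lambda>\<xi>. - (\<Sum>i\<in>Basis.
          (\<Sum>j\<in>Basis. (sharp x a \<bullet> j) * dG x \<xi> j i) *\<^sub>R sharp x i))) (at x)" .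
    next
      fix v
      have dG: "Ck_on k (\<lambda>x. dG x v j i) D" for i j
        using dG_smooth by (simp add: smooth_on_def)
      show "Ck_on k (\<lambda>x. - (\<Sum>i\<in>Basis. (\<Sum>j\<in>Basis. (sharp x a \<bullet> j) * dG x v j i) *\<^sub>R sharp x i)) D"
        by (intro Ck_on_linear[OF bounded_linear_minus[OF bounded_linear_ident] D_open]
            Ck_on_sum[OF D_open] Ck_on_bilinear[OF bounded_bilinear_scaleR D_open]
            Ck_on_bilinear[OF bounded_bilinear_mult D_open]
            Ck_on_linear[OF bounded_linear_inner_left D_open] Suc dG)
    qed
  qed
  then show ?thesis by (simp add: smooth_on_def)
qed

lemma wv_smooth: "smooth_on wv D"
proof -
  have "smooth_on (\<lambda>x. \<Sum>i\<in>Basis. w x i *\<^sub>R i) D"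
    by (intro smooth_on_sum smooth_on_scaleR D_open w_smooth smooth_on_const)
  then show ?thesis by (simp add: wv_def[abs_def])
qed

lemma sharp_expand: "x \<in> D \<Longrightarrow> sharp x a = (\<Sum>i\<in>Basis. (a \<bullet> i) *\<^sub>R sharp x i)"
  by (rule linear_euclidean_expand[OF linear_sharp])

lemma smooth_on_sharp:
  assumes "open S" "smooth_on f S" "f ` S \<subseteq> D" "smooth_on a S"
  shows "smooth_on (\<lambda>s. sharp (f s) (a s)) S"
proof -
  have *: "smooth_on (\<lambda>s. sharp (f s) i) S" for i
    by (rule smooth_on_compose[OF assms(1) D_open assms(3,2) sharp_smooth])
  have "smooth_on (\<lambda>s. \<Sum>i\<in>Basis. (a s \<bullet> i) *\<^sub>R sharp (f s) i) S"
    by (intro smooth_on_sum[OF assms(1)] smooth_on_scaleR[OF assms(1)] smooth_on_inner[OF assms(1)]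
        smooth_on_const assms(4) *)
  then show ?thesis
    by (rule smooth_on_transform[OF assms(1)]) (rule sharp_expand, use assms(3) in auto)
qed

lemma continuous_on_sharp:
  assumes "continuous_on S f" "f ` S \<subseteq> D" "continuous_on S a"
  shows "continuous_on S (\<lambda>s. sharp (f s) (a s))"
proof -
  have "continuous_on S (\<lambda>s. \<Sum>i\<in>Basis. (a s \<bullet> i) *\<^sub>R sharp (f s) i)"
    by (intro continuous_on_sum continuous_on_scaleR continuous_on_inner continuous_on_const assms
       continuous_on_compose2[OF smooth_on_imp_continuous_on[OF sharp_smooth] assms(1,2)])
  then show ?thesis by (rule continuous_on_eq) (use assms(2) sharp_expand in auto)
qed

text \<open>In the Hamiltonian form of the geodesic equations for a Randers geodesic of length \<open>\<Delta>\<close>, position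
  and momentum satisfy \<open>y' = \<Delta> nu \<epsilon> y p\<close> and \<open>p' = \<Delta> psi \<epsilon> y p\<close>. Both right-hand sides remain
  continuous at \<open>\<epsilon> = 0\<close> as long as the one-form does not vanish, and they are homogeneous in \<open>p\<close>.\<close>

definition nrm :: "'e \<Rightarrow> 'e \<Rightarrow> real" where
  "nrm x p = sqrt (p \<bullet> sharp x p)"

text \<open>Up to the factor \<open>det G\<close>, \<open>- rho^2\<close> is the determinant of
  \<open>G + 2 w dt - \<epsilon> dt^2\<close>. It stays nonzero at \<open>\<epsilon> = 0\<close> as
  long as the one-form does not vanish.\<close>

definition rho :: "real \<Rightarrow> 'e \<Rightarrow> real" where
  "rho \<epsilon> x = sqrt (\<epsilon> + wv x \<bullet> sharp x (wv x))"

definition nu :: "real \<Rightarrow> 'e \<Rightarrow> 'e \<Rightarrow> 'e" where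
  "nu \<epsilon> x p = - sharp x (wv x) + (rho \<epsilon> x / nrm x p) *\<^sub>R sharp x p"

text \<open>The differential in the base point of \<open>G v v / 2 + \<Delta> w v\<close> with
  \<open>v\<close> held fixed: the force term of its Euler-Lagrange equation.\<close>

definition force :: "real \<Rightarrow> 'e \<Rightarrow> 'e \<Rightarrow> 'e" where
  "force \<Delta> x v = (\<Sum>k\<in>Basis. (dG x k v v / 2 + \<Delta> * dw x k v) *\<^sub>R k)"

definition psi :: "real \<Rightarrow> 'e \<Rightarrow> 'e \<Rightarrow> 'e" where
  "psi \<epsilon> x p = (nrm x p / rho \<epsilon> x) *\<^sub>R force 1 x (nu \<epsilon> x p)"

lemma sharp_pos: assumes "x \<in> D" "p \<noteq> 0" shows "p \<bullet> sharp x p > 0"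
proof -
  have "sharp x p \<noteq> 0" using flat_sharp[OF assms(1), of p] assms linear_0[OF linear_flat] by metis
  then show ?thesis using G_pos[OF assms(1), of "sharp x p"] G_sharp[OF assms(1), of p "sharp x p"] by simp
qed

lemma nrm_pos: "x \<in> D \<Longrightarrow> p \<noteq> 0 \<Longrightarrow> nrm x p > 0"
  using sharp_pos by (simp add: nrm_def)

lemma rho_pos: "x \<in> D \<Longrightarrow> \<epsilon> \<ge> 0 \<Longrightarrow> wv x \<noteq> 0 \<Longrightarrow> rho \<epsilon> x > 0"
  using sharp_pos[of x "wv x"] by (simp add: rho_def add_nonneg_pos)

lemma force_scale: "x \<in> D \<Longrightarrow> force \<Delta> x (\<Delta> *\<^sub>R v) = \<Delta>\<^sup>2 *\<^sub>R force 1 x v"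
  by (simp add: force_def scaleR_sum_right dG_scale linear_scale[OF linear_dw2] power2_eq_square
      algebra_simps)

lemma nrm_scale: "x \<in> D \<Longrightarrow> c > 0 \<Longrightarrow> nrm x (c *\<^sub>R p) = c * nrm x p"
  by (simp add: nrm_def linear_scale[OF linear_sharp] real_sqrt_mult)

lemma nu_scale: "x \<in> D \<Longrightarrow> c > 0 \<Longrightarrow> nu \<epsilon> x (c *\<^sub>R p) = nu \<epsilon> x p"
  by (simp add: nu_def nrm_scale linear_scale[OF linear_sharp])

lemma psi_scale: "x \<in> D \<Longrightarrow> c > 0 \<Longrightarrow> psi \<epsilon> x (c *\<^sub>R p) = c *\<^sub>R psi \<epsilon> x p"
  by (simp add: psi_def nu_scale nrm_scale)

text \<open>Raising the index in the formula for \<open>p\<close> gives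
  \<open>R sharp p = v + \<Delta> sharp wv\<close>, and the quadratic equation says that this vector
  has length \<open>\<Delta> rho\<close>. Hence \<open>R = \<Delta> rho / nrm p\<close>, so
  \<open>R\<close> and \<open>v\<close> are functions of \<open>p\<close> alone; inserting them in
  the force term gives \<open>psi\<close>.\<close>

lemma legendre:
  assumes x: "x \<in> D" and "\<Delta> > 0" "\<epsilon> \<ge> 0" "wv x \<noteq> 0"
    and v: "G x v v + 2 * \<Delta> * w x v = \<epsilon> * \<Delta>\<^sup>2"
    and R: "R = \<epsilon> * \<Delta> - w x v" "R > 0"
    and p: "p = (1 / R) *\<^sub>R (flat x v + \<Delta> *\<^sub>R wv x)"
  shows "p \<noteq> 0" "R * nrm x p = \<Delta> * rho \<epsilon> x" "v = \<Delta> *\<^sub>R nu \<epsilon> x p"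
    "(1 / R) *\<^sub>R force \<Delta> x v = \<Delta> *\<^sub>R psi \<epsilon> x p"
proof -
  note s = linear_add[OF linear_sharp[OF x]] linear_scale[OF linear_sharp[OF x]]
  have rho: "rho \<epsilon> x > 0" by (rule rho_pos[OF x assms(3,4)])
  have Rp: "R *\<^sub>R p = flat x v + \<Delta> *\<^sub>R wv x" using R p by simp
  have sp: "R *\<^sub>R sharp x p = v + \<Delta> *\<^sub>R sharp x (wv x)"
    using arg_cong[OF Rp, of "sharp x"] by (simp add: s sharp_flat x)
  have fw: "flat x v \<bullet> sharp x (wv x) = w x v"
    using G_sharp[OF x, of "wv x" v] by (simp add: flat_inner x G_sym[OF x, of v] wv_inner)
  have "R\<^sup>2 * (p \<bullet> sharp x p) = (R *\<^sub>R p) \<bullet> (R *\<^sub>R sharp x p)" by (simp add: power2_eq_square)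
  also have "\<dots> = G x v v + 2 * \<Delta> * w x v + \<Delta>\<^sup>2 * (wv x \<bullet> sharp x (wv x))"
    unfolding Rp sp using x
    by (simp add: inner_add_left inner_add_right flat_inner fw wv_inner power2_eq_square algebra_simps)
  also have "\<dots> = \<Delta>\<^sup>2 * (\<epsilon> + wv x \<bullet> sharp x (wv x))" using v by (simp add: algebra_simps)
  finally have eq: "R\<^sup>2 * (p \<bullet> sharp x p) = \<Delta>\<^sup>2 * (\<epsilon> + wv x \<bullet> sharp x (wv x))" .
  from arg_cong[OF eq, of sqrt] show Rn: "R * nrm x p = \<Delta> * rho \<epsilon> x"
    using R(2) assms(2) by (simp add: real_sqrt_mult nrm_def rho_def)
  then show p0: "p \<noteq> 0" using rho assms(2) by (auto simp: nrm_def)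
  have n: "nrm x p > 0" by (rule nrm_pos[OF x p0])
  have Rr: "R = \<Delta> * rho \<epsilon> x / nrm x p" using Rn n by (simp add: field_simps)
  have "\<Delta> *\<^sub>R nu \<epsilon> x p = - (\<Delta> *\<^sub>R sharp x (wv x)) + R *\<^sub>R sharp x p"
    by (simp add: nu_def Rr scaleR_right_distrib scaleR_right_diff_distrib)
  then show veq: "v = \<Delta> *\<^sub>R nu \<epsilon> x p" using sp by simp
  have "(1 / R) *\<^sub>R force \<Delta> x v = (1 / R) *\<^sub>R (\<Delta>\<^sup>2 *\<^sub>R force 1 x (nu \<epsilon> x p))"
    using force_scale[OF x, of \<Delta> "nu \<epsilon> x p"] veq by simp
  also have "\<dots> = \<Delta> *\<^sub>R psi \<epsilon> x p"
    using n rho assms(2) by (simp add: psi_def Rr power2_eq_square field_simps)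
  finally show "(1 / R) *\<^sub>R force \<Delta> x v = \<Delta> *\<^sub>R psi \<epsilon> x p" .
qed

text \<open>A limit of rescaled momenta need not be the momentum of any velocity, but every nonzero
  covector still yields a null vector: \<open>flat \<nu> + wv\<close> is the multiple of
  \<open>p\<close> with the same norm as \<open>wv\<close>, and expanding the square of that norm
  leaves the quadratic equation.\<close>

lemma legendre_inverse:
  assumes x: "x \<in> D" and "wv x \<noteq> 0" "p \<noteq> 0" and \<nu>: "\<nu> = nu 0 x p"
  shows "G x \<nu> \<nu> + 2 * w x \<nu> = 0" "flat x \<nu> + wv x = (rho 0 x / nrm x p) *\<^sub>R p"
proof -
  note s = linear_add[OF linear_flat[OF x]] linear_scale[OF linear_flat[OF x]] linear_neg[OF linear_flat[OF x]]
    linear_diff[OF linear_flat[OF x]]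
  have n: "nrm x p > 0" by (rule nrm_pos[OF x assms(3)])
  show *: "flat x \<nu> + wv x = (rho 0 x / nrm x p) *\<^sub>R p"
    unfolding \<nu> nu_def by (simp add: s flat_sharp x)
  have e: "\<nu> + sharp x (wv x) = (rho 0 x / nrm x p) *\<^sub>R sharp x p" unfolding \<nu> nu_def by simp
  have fw: "flat x \<nu> \<bullet> sharp x (wv x) = w x \<nu>"
    using G_sharp[OF x, of "wv x" \<nu>] by (simp add: flat_inner x G_sym[OF x, of \<nu>] wv_inner)
  have "(flat x \<nu> + wv x) \<bullet> (\<nu> + sharp x (wv x)) = (rho 0 x / nrm x p)\<^sup>2 * (p \<bullet> sharp x p)"
    unfolding * e by (simp add: power2_eq_square)
  also have "p \<bullet> sharp x p = (nrm x p)\<^sup>2" using sharp_pos[OF x assms(3)] by (simp add: nrm_def)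
  also have "(rho 0 x / nrm x p)\<^sup>2 * (nrm x p)\<^sup>2 = (rho 0 x)\<^sup>2" using n by (simp add: power_divide)
  also have "(rho 0 x)\<^sup>2 = wv x \<bullet> sharp x (wv x)" using sharp_pos[OF x assms(2)] by (simp add: rho_def)
  finally show "G x \<nu> \<nu> + 2 * w x \<nu> = 0"
    using x by (simp add: inner_add_left inner_add_right flat_inner fw wv_inner)
qed

lemma continuous_on_force:
  assumes "continuous_on S f" "f ` S \<subseteq> D" "continuous_on S v"
  shows "continuous_on S (\<lambda>s. force \<Delta> (f s) (v s))"
  unfolding force_def
  by (intro continuous_on_sum continuous_on_scaleR continuous_on_add continuous_on_divide continuous_on_mult
      continuous_on_dG continuous_on_dw continuous_on_const assms) auto

lemma continuous_on_wv: "continuous_on S f \<Longrightarrow> f ` S \<subseteq> D \<Longrightarrow> continuous_on S (\<lambda>s. wv (f s))"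
  by (rule continuous_on_compose2[OF smooth_on_imp_continuous_on[OF wv_smooth]])

lemma continuous_on_nrm_rho:
  assumes "continuous_on S f" "f ` S \<subseteq> D"
  shows "continuous_on S p \<Longrightarrow> continuous_on S (\<lambda>s. nrm (f s) (p s))"
    "continuous_on S e \<Longrightarrow> continuous_on S (\<lambda>s. rho (e s) (f s))"
  unfolding nrm_def rho_def
  by (intro continuous_on_real_sqrt continuous_on_inner continuous_on_add continuous_on_sharp
      continuous_on_wv assms; simp)+

lemma continuous_on_nu_psi:
  assumes "continuous_on S e" "continuous_on S f" "f ` S \<subseteq> D" "continuous_on S p"
    and "\<And>s. s \<in> S \<Longrightarrow> e s \<ge> 0 \<and> wv (f s) \<noteq> 0 \<and> p s \<noteq> 0"
  shows "continuous_on S (\<lambda>s. nu (e s) (f s) (p s))" "continuous_on S (\<lambda>s. psi (e s) (f s) (p s))"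
proof -
  have n: "nrm (f s) (p s) \<noteq> 0" "rho (e s) (f s) \<noteq> 0" if "s \<in> S" for s
  proof -
    have "f s \<in> D" "p s \<noteq> 0" "e s \<ge> 0" "wv (f s) \<noteq> 0" using that assms(3,5) by auto
    then show "nrm (f s) (p s) \<noteq> 0" "rho (e s) (f s) \<noteq> 0"
      using nrm_pos[of "f s" "p s"] rho_pos[of "f s" "e s"] by auto
  qed
  show 1: "continuous_on S (\<lambda>s. nu (e s) (f s) (p s))"
    unfolding nu_def
    by (intro continuous_on_add continuous_on_minus continuous_on_scaleR continuous_on_divide
        continuous_on_nrm_rho continuous_on_sharp continuous_on_wv assms) (use n in auto)
  show "continuous_on S (\<lambda>s. psi (e s) (f s) (p s))"
    unfolding psi_def
    by (intro continuous_on_scaleR continuous_on_divide continuous_on_nrm_rho continuous_on_force 1 assms)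
      (use n in auto)
qed

text \<open>Smoothness of the limiting vector field, from which its integral curves inherit
  theirs.\<close>

lemma smooth_on_nu_psi:
  defines "S \<equiv> {q. fst q \<in> D \<and> wv (fst q) \<noteq> 0 \<and> snd q \<noteq> 0}"
  shows "open S" "smooth_on (\<lambda>q. (nu 0 (fst q) (snd q), psi 0 (fst q) (snd q))) S"
proof -
  have "open (D \<inter> wv -` (-{0}))"
    by (intro continuous_open_preimage smooth_on_imp_continuous_on wv_smooth D_open) auto
  then have "open ((D \<inter> wv -` (-{0})) \<times> (-{0} :: 'e set))" by (intro open_Times) auto
  moreover have "S = (D \<inter> wv -` (-{0})) \<times> -{0}" unfolding S_def by auto
  ultimately show o: "open S" by simp
  have f: "smooth_on fst S" "fst ` S \<subseteq> D" "smooth_on snd S"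
    unfolding S_def by (auto intro: smooth_on_bounded_linear bounded_linear_fst bounded_linear_snd)
  have c: "smooth_on (\<lambda>q. h (fst q)) S" if "smooth_on h D" for h :: "'e \<Rightarrow> 'b::euclidean_space"
    by (rule smooth_on_compose[OF o D_open f(2,1) that])
  have nrm: "smooth_on (\<lambda>q. nrm (fst q) (snd q)) S"
    unfolding nrm_def
    by (intro smooth_on_sqrt[OF o] smooth_on_inner[OF o] smooth_on_sharp[OF o] f)
      (auto simp: S_def sharp_pos)
  have wv': "smooth_on (\<lambda>q. wv (fst q)) S" by (rule c[OF wv_smooth])
  have rho: "smooth_on (\<lambda>q. rho 0 (fst q)) S"
    unfolding rho_def
    by (intro smooth_on_sqrt[OF o] smooth_on_add[OF o] smooth_on_const smooth_on_inner[OF o]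
       smooth_on_sharp[OF o] f wv') (auto simp: S_def sharp_pos)
  have inrm: "smooth_on (\<lambda>q. inverse (nrm (fst q) (snd q))) S"
    by (rule smooth_on_inverse[OF o nrm]) (auto simp: S_def dest: nrm_pos)
  have irho: "smooth_on (\<lambda>q. inverse (rho 0 (fst q))) S"
    by (rule smooth_on_inverse[OF o rho]) (auto simp: S_def dest: rho_pos[of _ 0])
  have nu: "smooth_on (\<lambda>q. nu 0 (fst q) (snd q)) S"
    unfolding nu_def divide_inverse
    by (intro smooth_on_add[OF o] smooth_on_minus[OF o] smooth_on_scaleR[OF o] smooth_on_mult[OF o]
        smooth_on_sharp[OF o] f rho inrm wv')
  define n where "n q = nu 0 (fst q) (snd q)" for q
  have n: "smooth_on n S" using nu by (simp add: n_def[abs_def])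
  have "smooth_on (\<lambda>q. dG (fst q) k (n q) (n q)) S" for k
  proof -
    have "smooth_on (\<lambda>q. \<Sum>i\<in>Basis. \<Sum>j\<in>Basis. (n q \<bullet> i) * (n q \<bullet> j) * dG (fst q) k i j) S"
      by (intro smooth_on_sum[OF o] smooth_on_mult[OF o] smooth_on_inner[OF o] smooth_on_const n c[OF dG_smooth])
    then show ?thesis
      by (rule smooth_on_transform[OF o]) (rule dG_expand, use f(2) in auto)
  qed
  moreover have "smooth_on (\<lambda>q. dw (fst q) k (n q)) S" for k
  proof -
    have "smooth_on (\<lambda>q. \<Sum>i\<in>Basis. (n q \<bullet> i) * dw (fst q) k i) S"
      by (intro smooth_on_sum[OF o] smooth_on_mult[OF o] smooth_on_inner[OF o] smooth_on_const n c[OF dw_smooth])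
    then show ?thesis
      by (rule smooth_on_transform[OF o]) (rule dw_expand, use f(2) in auto)
  qed
  ultimately have "smooth_on (\<lambda>q. force 1 (fst q) (n q)) S"
    unfolding force_def divide_inverse
    by (intro smooth_on_sum[OF o] smooth_on_scaleR[OF o] smooth_on_add[OF o] smooth_on_mult[OF o] smooth_on_const)
  then have "smooth_on (\<lambda>q. psi 0 (fst q) (snd q)) S"
    unfolding psi_def divide_inverse n_def
    by (intro smooth_on_scaleR[OF o] smooth_on_mult[OF o] nrm irho)
  with nu show "smooth_on (\<lambda>q. (nu 0 (fst q) (snd q), psi 0 (fst q) (snd q))) S"
    by (intro smooth_on_Pair[OF o])
qed

end

section \<open>The first variation of the energy\<close>

text \<open>Differentiation under the integral sign over a small rectangle on which curve and
  velocity stay in \<open>\<Omega>\<close>. For the Randers metric \<open>\<Omega>\<close> will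
  consist of all vectors over the chart, for the Kropina metric of an open cone bundle.
  \<open>L\<close> need only be C^1; continuity of \<open>L'\<close> is phrased along arbitrary
  continuous maps because that is how it is known for the two metrics.\<close>

lemma first_variation_euclidean:
  fixes h :: "real \<times> real \<Rightarrow> 'e::euclidean_space" and L :: "'e \<times> 'e \<Rightarrow> real"
  defines "h1 \<equiv> \<lambda>q. frechet_derivative h (at q) (1, 0)"
    and "h2 \<equiv> \<lambda>q. frechet_derivative h (at q) (0, 1)"
  defines "h12 \<equiv> \<lambda>q. frechet_derivative h2 (at q) (1, 0)"
  assumes W: "open W" "smooth_on h W" "(0, s0) \<in> W" and \<Omega>: "open \<Omega>" "(h (0, s0), h2 (0, s0)) \<in> \<Omega>"
    and L: "\<And>y z. (y, z) \<in> \<Omega> \<Longrightarrow> (L has_derivative (\<lambda>v. L' y z (fst v) (snd v))) (at (y, z))"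
    and L': "\<And>S (y :: real \<times> real \<Rightarrow> 'e) z \<xi> \<zeta>. continuous_on S y \<Longrightarrow> continuous_on S z \<Longrightarrow>
       continuous_on S \<xi> \<Longrightarrow> continuous_on S \<zeta> \<Longrightarrow> \<forall>s\<in>S. (y s, z s) \<in> \<Omega> \<Longrightarrow>
       continuous_on S (\<lambda>s. L' (y s) (z s) (\<xi> s) (\<zeta> s))"
  obtains d where "d > 0" "{-d..d} \<times> {s0-d..s0+d} \<subseteq> W"
    "\<And>q. q \<in> {-d..d} \<times> {s0-d..s0+d} \<Longrightarrow> (h q, h2 q) \<in> \<Omega>"
    "\<And>a b. s0 - d \<le> a \<Longrightarrow> b \<le> s0 + d \<Longrightarrow>
      ((\<lambda>r. integral {a..b} (\<lambda>s. L (h (r, s), h2 (r, s)))) has_real_derivative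
        integral {a..b} (\<lambda>s. L' (h (0, s)) (h2 (0, s)) (h1 (0, s)) (h12 (0, s)))) (at 0)"
    "\<And>a b r. s0 - d \<le> a \<Longrightarrow> b \<le> s0 + d \<Longrightarrow> r \<in> {-d..d} \<Longrightarrow>
      (\<lambda>s. L (h (r, s), h2 (r, s))) integrable_on {a..b}"
    "\<And>a b. s0 - d \<le> a \<Longrightarrow> b \<le> s0 + d \<Longrightarrow>
      (\<lambda>s. L' (h (0, s)) (h2 (0, s)) (h1 (0, s)) (h12 (0, s))) integrable_on {a..b}"
proof -
  have sm: "smooth_on h1 W" "smooth_on h2 W" "smooth_on h12 W"
    unfolding h1_def h2_def h12_def by (intro smooth_on_frechet_derivative W)+
  note cont = smooth_on_imp_continuous_on[OF W(2)] sm[THEN smooth_on_imp_continuous_on]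
  define W' where "W' = W \<inter> (\<lambda>q. (h q, h2 q)) -` \<Omega>"
  have "open W'" unfolding W'_def
    by (intro continuous_open_preimage continuous_on_Pair cont W(1) \<Omega>(1))
  moreover have "(0, s0) \<in> W'" using W(3) \<Omega>(2) by (simp add: W'_def)
  ultimately obtain d where d: "d > 0" "{0-d..0+d} \<times> {s0-d..s0+d} \<subseteq> W'"
    by (rule open_contains_square)
  define Q where "Q = {-d..d} \<times> {s0-d..s0+d}"
  have Q: "Q \<subseteq> W'" "Q \<subseteq> W" using d(2) by (auto simp: Q_def W'_def)
  have cQ: "continuous_on Q h" "continuous_on Q h1" "continuous_on Q h2" "continuous_on Q h12"
    using cont continuous_on_subset Q(2) by blast+
  have \<Omega>Q: "(h q, h2 q) \<in> \<Omega>" if "q \<in> Q" for q using that Q(1) by (auto simp: W'_def)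
  have LQ: "continuous_on Q (\<lambda>q. L (h q, h2 q))"
  proof -
    have "continuous_on \<Omega> L"
      using L has_derivative_continuous by (fastforce intro: continuous_at_imp_continuous_on)
    then show ?thesis
      by (rule continuous_on_compose2) (use \<Omega>Q in \<open>auto intro!: continuous_on_Pair cQ\<close>)
  qed
  have L'Q: "continuous_on Q (\<lambda>q. L' (h q) (h2 q) (h1 q) (h12 q))"
    by (rule L'[OF cQ(1,3,2,4)]) (use \<Omega>Q in blast)
  have dr: "((\<lambda>r. L (h (r, s), h2 (r, s))) has_real_derivative
      L' (h (r, s)) (h2 (r, s)) (h1 (r, s)) (h12 (r, s))) (at r)" if "(r, s) \<in> Q" for r s
  proof -
    have w: "(r, s) \<in> W" using that Q by blast
    have "((\<lambda>r. (h (r, s), h2 (r, s))) has_vector_derivative (h1 (r, s), h12 (r, s))) (at r)"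
      using smooth_on_partial1[OF W(2) w] smooth_on_partial1[OF sm(2) w]
      by (auto simp: h1_def h12_def has_vector_derivative_def intro!: has_derivative_Pair)
    from vector_derivative_diff_chain_within[OF this has_derivative_at_withinI[OF L[OF \<Omega>Q[OF that]]]]
    show ?thesis by (simp add: o_def has_real_derivative_iff_has_vector_derivative)
  qed
  have sub: "(\<lambda>s. (r, s)) ` {a..b} \<subseteq> Q" if "s0 - d \<le> a" "b \<le> s0 + d" "r \<in> {-d..d}" for a b r
    using that by (auto simp: Q_def)
  have int: "(\<lambda>s. f (r, s)) integrable_on {a..b}"
    if "s0 - d \<le> a" "b \<le> s0 + d" "r \<in> {-d..d}" "continuous_on Q f"
    for a b r and f :: "real \<times> real \<Rightarrow> real"
    by (intro integrable_continuous_interval continuous_on_compose2[OF that(4) _ sub[OF that(1-3)]]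
        continuous_intros)
  show ?thesis
  proof (rule that[OF d(1)])
    show "{-d..d} \<times> {s0-d..s0+d} \<subseteq> W" using Q(2) by (simp add: Q_def)
    show "(h q, h2 q) \<in> \<Omega>" if "q \<in> {-d..d} \<times> {s0-d..s0+d}" for q using \<Omega>Q that by (simp add: Q_def)
    fix a b assume ab: "s0 - d \<le> a" "b \<le> s0 + d"
    show "(\<lambda>s. L (h (r, s), h2 (r, s))) integrable_on {a..b}" if "r \<in> {-d..d}" for r
      using int[OF ab that LQ] .
    show "(\<lambda>s. L' (h (0, s)) (h2 (0, s)) (h1 (0, s)) (h12 (0, s))) integrable_on {a..b}"
      using int[OF ab _ L'Q, of 0] d(1) by simp
    have "((\<lambda>r. integral (cbox a b) (\<lambda>s. L (h (r, s), h2 (r, s)))) has_field_derivative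
        integral (cbox a b) (\<lambda>s. L' (h (0, s)) (h2 (0, s)) (h1 (0, s)) (h12 (0, s)))) (at 0 within {-d..d})"
    proof (rule leibniz_rule_field_derivative)
      fix r s assume "r \<in> {-d..d}" "s \<in> cbox a b"
      then have "(r, s) \<in> Q" using ab by (auto simp: Q_def)
      from has_field_derivative_at_within[OF dr[OF this]]
      show "((\<lambda>r. L (h (r, s), h2 (r, s))) has_field_derivative
        L' (h (r, s)) (h2 (r, s)) (h1 (r, s)) (h12 (r, s))) (at r within {-d..d})" .
    next
      show "(\<lambda>s. L (h (r, s), h2 (r, s))) integrable_on cbox a b" if "r \<in> {-d..d}" for r
        using int[OF ab that LQ] by simp
    next
      have "{-d..d} \<times> cbox a b \<subseteq> Q" using ab by (auto simp: Q_def)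
      from continuous_on_subset[OF L'Q this]
      show "continuous_on ({-d..d} \<times> cbox a b) (\<lambda>(r, s). L' (h (r, s)) (h2 (r, s)) (h1 (r, s)) (h12 (r, s)))"
        by (simp add: case_prod_unfold)
    qed (use d in auto)
    then show "((\<lambda>r. integral {a..b} (\<lambda>s. L (h (r, s), h2 (r, s)))) has_real_derivative
        integral {a..b} (\<lambda>s. L' (h (0, s)) (h2 (0, s)) (h1 (0, s)) (h12 (0, s)))) (at 0)"
      using at_within_Icc_at[of "-d" 0 d] d(1) by simp
  qed
qed

section \<open>The first variation on the manifold, interval by interval\<close>

context manifold_atlas
begin

text \<open>\<open>var_deriv F H a b D\<close>: the contribution of \<open>[a, b]\<close> to the first variation of the
  energy of \<open>F\<close> along \<open>H\<close> exists and equals \<open>D\<close>.\<close>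

definition var_deriv ::
  "('m \<Rightarrow> ('m, 'e) tvector \<Rightarrow> real) \<Rightarrow> (real \<Rightarrow> real \<Rightarrow> 'm) \<Rightarrow> real \<Rightarrow> real \<Rightarrow> real \<Rightarrow> bool" where
  "var_deriv F H a b D \<longleftrightarrow>
    ((\<lambda>r. integral {a..b} (\<lambda>s. (F (H r s) (velocity \<A> (H r) s (at s within {0..1})))\<^sup>2 / 2))
      has_real_derivative D) (at 0) \<and>
    (\<forall>\<^sub>F r in nhds 0. (\<lambda>s. (F (H r s) (velocity \<A> (H r) s (at s within {0..1})))\<^sup>2 / 2) integrable_on {a..b})"

text \<open>Splitting the integral requires integrability for all parameters near \<open>0\<close>;
  this is why \<open>var_deriv\<close> records it besides the derivative.\<close>

lemma var_deriv_add:
  assumes "var_deriv F H a b D1" "var_deriv F H b c D2" "a \<le> b" "b \<le> c"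
  shows "var_deriv F H a c (D1 + D2)"
proof -
  let ?f = "\<lambda>r s. (F (H r s) (velocity \<A> (H r) s (at s within {0..1})))\<^sup>2 / 2"
  have i: "\<forall>\<^sub>F r in nhds 0. ?f r integrable_on {a..b}" "\<forall>\<^sub>F r in nhds 0. ?f r integrable_on {b..c}"
    using assms unfolding var_deriv_def by auto
  then have i2: "\<forall>\<^sub>F r in nhds 0. ?f r integrable_on {a..c}"
    by eventually_elim (rule Henstock_Kurzweil_Integration.integrable_combine[OF assms(3,4)])
  have "((\<lambda>r. integral {a..b} (?f r) + integral {b..c} (?f r)) has_real_derivative D1 + D2) (at 0)"
    using assms unfolding var_deriv_def by (intro DERIV_add) auto
  moreover have "\<forall>\<^sub>F r in nhds 0. integral {a..b} (?f r) + integral {b..c} (?f r) = integral {a..c} (?f r)"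
    using i2 by eventually_elim (rule Henstock_Kurzweil_Integration.integral_combine[OF assms(3,4)])
  ultimately have "((\<lambda>r. integral {a..c} (?f r)) has_real_derivative D1 + D2) (at 0)"
    using DERIV_cong_ev[OF refl _ refl] by fastforce
  then show ?thesis using i2 unfolding var_deriv_def by simp
qed

lemma first_variation_chart:
  fixes L :: "'e \<times> 'e \<Rightarrow> real"
  assumes c: "c \<in> \<A>" and H: "smooth_into \<A> ({-\<delta><..<\<delta>} \<times> {a..b}) (\<lambda>(r, s). H r s)"
    and ab: "\<delta> > 0" "0 \<le> a" "a < b" "b \<le> 1" "s0 \<in> {a..b}" and Hc: "H 0 s0 \<in> fst c"
    and FL: "\<And>p u. p \<in> fst c \<Longrightarrow> (F p (tvec \<A> c p u))\<^sup>2 / 2 = L (snd c p, u)"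
    and \<Omega>: "open \<Omega>" "(snd c (H 0 s0), vector_derivative (\<lambda>s. snd c (H 0 s)) (at s0 within {a..b})) \<in> \<Omega>"
    and L: "\<And>y z. (y, z) \<in> \<Omega> \<Longrightarrow> (L has_derivative (\<lambda>v. L' y z (fst v) (snd v))) (at (y, z))"
    and L': "\<And>S (y :: real \<times> real \<Rightarrow> 'e) z \<xi> \<zeta>. continuous_on S y \<Longrightarrow> continuous_on S z \<Longrightarrow>
       continuous_on S \<xi> \<Longrightarrow> continuous_on S \<zeta> \<Longrightarrow> \<forall>s\<in>S. (y s, z s) \<in> \<Omega> \<Longrightarrow>
       continuous_on S (\<lambda>s. L' (y s) (z s) (\<xi> s) (\<zeta> s))"
  obtains d W h where "d > 0" "d < \<delta>" "open W" "smooth_on h W" "{-d..d} \<times> {s0-d..s0+d} \<subseteq> W"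
    "\<And>r s. r \<in> {-d..d} \<Longrightarrow> s \<in> {a..b} \<Longrightarrow> s \<in> {s0-d..s0+d} \<Longrightarrow> H r s \<in> fst c \<and> snd c (H r s) = h (r, s)"
    "\<And>a' b'. a \<le> a' \<Longrightarrow> s0 - d \<le> a' \<Longrightarrow> b' \<le> b \<Longrightarrow> b' \<le> s0 + d \<Longrightarrow>
      var_deriv F H a' b' (integral {a'..b'} (\<lambda>s.
        L' (h (0, s)) (frechet_derivative h (at (0, s)) (0, 1))
          (frechet_derivative h (at (0, s)) (1, 0))
          (frechet_derivative (\<lambda>q. frechet_derivative h (at q) (0, 1)) (at (0, s)) (1, 0))))"
    "\<And>a' b'. a \<le> a' \<Longrightarrow> s0 - d \<le> a' \<Longrightarrow> b' \<le> b \<Longrightarrow> b' \<le> s0 + d \<Longrightarrow> (\<lambda>s.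
        L' (h (0, s)) (frechet_derivative h (at (0, s)) (0, 1))
          (frechet_derivative h (at (0, s)) (1, 0))
          (frechet_derivative (\<lambda>q. frechet_derivative h (at q) (0, 1)) (at (0, s)) (1, 0))) integrable_on {a'..b'}"
proof -
  let ?D = "{-\<delta><..<\<delta>} \<times> {a..b}"
  have in_D: "(0, s0) \<in> ?D" using ab by auto
  obtain W0 h where W0: "open W0" "(0, s0) \<in> W0" "(\<lambda>(r, s). H r s) ` (?D \<inter> W0) \<subseteq> fst c" "smooth_on h W0"
    "h ` W0 \<subseteq> snd c ` fst c" "\<forall>y\<in>?D \<inter> W0. h y = snd c ((\<lambda>(r, s). H r s) y)"
    using smooth_into_chart[OF H in_D c] Hc by auto
  \<comment> \<open>Cutting down to the strip makes each rectangle inside \<open>W\<close> respect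
    the parameter range, whence \<open>d < \<delta>\<close> below.\<close>
  define W where "W = W0 \<inter> ({-\<delta><..<\<delta>} \<times> UNIV)"
  have W: "open W" "smooth_on h W" "(0, s0) \<in> W"
  proof -
    show "open W" unfolding W_def
      by (intro open_Int W0(1) open_Times open_greaterThanLessThan open_UNIV)
  qed (use W0 ab(1) in \<open>auto simp: W_def intro: smooth_on_subset\<close>)
  have Hh: "H r s \<in> fst c" "snd c (H r s) = h (r, s)" if "(r, s) \<in> W" "s \<in> {a..b}" for r s
  proof -
    have rs: "(r, s) \<in> ?D \<inter> W0" using that by (auto simp: W_def)
    show "H r s \<in> fst c" using imageI[OF rs, of "\<lambda>(r, s). H r s"] W0(3) by auto
    show "snd c (H r s) = h (r, s)" using bspec[OF W0(6) rs] by simp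
  qed
  let ?h2 = "\<lambda>q. frechet_derivative h (at q) (0, 1)"
  have "((\<lambda>s. h (0, s)) has_vector_derivative ?h2 (0, s0)) (at s0 within {a..b})"
    using smooth_on_partial2[OF W(2,3)] by (rule has_vector_derivative_at_within)
  moreover have "\<forall>\<^sub>F s in at s0 within {a..b}. h (0, s) = snd c (H 0 s)"
  proof -
    have "continuous_on UNIV (\<lambda>s::real. (0::real, s))" by (intro continuous_intros)
    from open_vimage[OF W(1) this] have o: "open ((\<lambda>s. (0, s)) -` W)" .
    show ?thesis unfolding eventually_at_topological
    proof (intro exI conjI ballI impI)
      show "open ((\<lambda>s. (0, s)) -` W)" by (rule o)
      show "h (0, s) = snd c (H 0 s)" if "s \<in> (\<lambda>s. (0, s)) -` W" "s \<in> {a..b}" for s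
        using Hh(2)[of 0 s] that by simp
    qed (use W(3) in auto)
  qed
  ultimately have "((\<lambda>s. snd c (H 0 s)) has_vector_derivative ?h2 (0, s0)) (at s0 within {a..b})"
    unfolding has_vector_derivative_def
    by (rule has_derivative_transform_eventually) (use Hh(2)[OF W(3) ab(5)] ab(5) in auto)
  moreover have "at s0 within {a..b} \<noteq> bot" using ab by (simp add: trivial_limit_within islimpt_Icc)
  ultimately have "vector_derivative (\<lambda>s. snd c (H 0 s)) (at s0 within {a..b}) = ?h2 (0, s0)"
    using vector_derivative_within by blast
  then have \<Omega>0: "(h (0, s0), ?h2 (0, s0)) \<in> \<Omega>" using \<Omega>(2) Hh(2)[OF W(3) ab(5)] by simp
  obtain d where d: "d > 0" "{-d..d} \<times> {s0-d..s0+d} \<subseteq> W"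
    and d1: "\<And>a b. s0 - d \<le> a \<Longrightarrow> b \<le> s0 + d \<Longrightarrow>
      ((\<lambda>r. integral {a..b} (\<lambda>s. L (h (r, s), ?h2 (r, s)))) has_real_derivative
        integral {a..b} (\<lambda>s. L' (h (0, s)) (?h2 (0, s)) (frechet_derivative h (at (0, s)) (1, 0))
          (frechet_derivative ?h2 (at (0, s)) (1, 0)))) (at 0)"
    and d2: "\<And>a b r. s0 - d \<le> a \<Longrightarrow> b \<le> s0 + d \<Longrightarrow> r \<in> {-d..d} \<Longrightarrow>
      (\<lambda>s. L (h (r, s), ?h2 (r, s))) integrable_on {a..b}"
    and d3: "\<And>a b. s0 - d \<le> a \<Longrightarrow> b \<le> s0 + d \<Longrightarrow>
      (\<lambda>s. L' (h (0, s)) (?h2 (0, s)) (frechet_derivative h (at (0, s)) (1, 0))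
          (frechet_derivative ?h2 (at (0, s)) (1, 0))) integrable_on {a..b}"
    by (rule first_variation_euclidean[OF W \<Omega>(1) \<Omega>0 L L']) blast+
  have "(d, s0) \<in> W" using d by auto
  then have "d < \<delta>" by (auto simp: W_def)
  \<comment> \<open>The endpoints are left out: they may be break points, where the velocity within
    [0,1] need not be the one-sided one. They form a null set for the integrals.\<close>
  have vel: "(F (H r s) (velocity \<A> (H r) s (at s within {0..1})))\<^sup>2 / 2 = L (h (r, s), ?h2 (r, s))"
    if "r \<in> {-d..d}" "s \<in> {a'<..<b'}" "a \<le> a'" "s0 - d \<le> a'" "b' \<le> b" "b' \<le> s0 + d" for r s a' b'
  proof -
    have inW: "(r, t) \<in> W" "t \<in> {a..b}" "t \<in> {0..1}" if "t \<in> {a'<..<b'}" for t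
      using that d(2) \<open>r \<in> {-d..d}\<close> \<open>a \<le> a'\<close> \<open>s0 - d \<le> a'\<close> \<open>b' \<le> b\<close> \<open>b' \<le> s0 + d\<close> ab by auto
    have ev: "\<forall>\<^sub>F t in nhds s. t \<in> {a'<..<b'}"
      by (rule eventually_nhds_in_open) (use that in auto)
    have "((\<lambda>s. h (r, s)) has_vector_derivative ?h2 (r, s)) (at s)"
      using smooth_on_partial2[OF W(2) inW(1)[OF that(2)]] .
    then have "((snd c \<circ> H r) has_vector_derivative ?h2 (r, s)) (at s)"
      by (rule has_vector_derivative_transform_within_open[where S="{a'<..<b'}"])
        (use that inW Hh in auto)
    then have "velocity \<A> (H r) s (at s within {0..1}) = tvec \<A> c (H r s) (?h2 (r, s))"
    proof (intro velocity_eq[OF c])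
      show "H r s \<in> fst c" using Hh(1) inW that(2) by blast
      show "\<forall>\<^sub>F t in at s within {0..1}. H r t \<in> fst c"
        unfolding eventually_at_filter using ev by eventually_elim (use Hh(1) inW in blast)
      show "s \<in> {0..1}" using inW that(2) by blast
      show "at s within {0..1} \<noteq> bot" using inW that(2) by (simp add: trivial_limit_within islimpt_Icc)
    qed (rule has_vector_derivative_at_within)
    then show ?thesis
      using FL[OF Hh(1)[OF inW(1,2)[OF that(2)]]] Hh(2)[OF inW(1,2)[OF that(2)]] by simp
  qed
  show ?thesis
  proof (rule that[OF d(1) \<open>d < \<delta>\<close> W(1,2) d(2)])
    show "H r s \<in> fst c \<and> snd c (H r s) = h (r, s)"
      if "r \<in> {-d..d}" "s \<in> {a..b}" "s \<in> {s0-d..s0+d}" for r s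
    proof -
      have "(r, s) \<in> W" using that by (intro subsetD[OF d(2)]) auto
      then show ?thesis using Hh[of r s] that by blast
    qed
    fix a' b' assume a'b': "a \<le> a'" "s0 - d \<le> a'" "b' \<le> b" "b' \<le> s0 + d"
    show "(\<lambda>s. L' (h (0, s)) (?h2 (0, s)) (frechet_derivative h (at (0, s)) (1, 0))
          (frechet_derivative ?h2 (at (0, s)) (1, 0))) integrable_on {a'..b'}"
      by (rule d3[OF a'b'(2,4)])
    let ?f = "\<lambda>r s. (F (H r s) (velocity \<A> (H r) s (at s within {0..1})))\<^sup>2 / 2"
    have ie: "integral {a'..b'} (?f r) = integral {a'..b'} (\<lambda>s. L (h (r, s), ?h2 (r, s)))"
      "?f r integrable_on {a'..b'}" if "r \<in> {-d..d}" for r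
    proof -
      have eq: "?f r s = L (h (r, s), ?h2 (r, s))" if "s \<in> {a'..b'} - {a', b'}" for s
        by (rule vel[OF \<open>r \<in> {-d..d}\<close> _ a'b']) (use that in auto)
      show "integral {a'..b'} (?f r) = integral {a'..b'} (\<lambda>s. L (h (r, s), ?h2 (r, s)))"
        by (rule integral_spike[of "{a', b'}"]) (use eq in auto)
      show "?f r integrable_on {a'..b'}"
        by (rule integrable_spike[OF d2[OF a'b'(2,4) that], of "{a', b'}"]) (use eq in auto)
    qed
    have ev: "\<forall>\<^sub>F r in nhds 0. r \<in> {-d<..<d}"
      by (rule eventually_nhds_in_open) (use d in auto)
    then have ev2: "\<forall>\<^sub>F r in nhds 0. ?f r integrable_on {a'..b'}"
      by eventually_elim (rule ie(2), simp)
    from ev have "\<forall>\<^sub>F r in nhds 0. integral {a'..b'} (\<lambda>s. L (h (r, s), ?h2 (r, s))) = integral {a'..b'} (?f r)"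
      by eventually_elim (use ie(1) in auto)
    from DERIV_cong_ev[OF refl this refl] d1[OF a'b'(2,4)]
    show "var_deriv F H a' b' (integral {a'..b'} (\<lambda>s. L' (h (0, s)) (?h2 (0, s)) (frechet_derivative h (at (0, s)) (1, 0))
          (frechet_derivative ?h2 (at (0, s)) (1, 0))))"
      unfolding var_deriv_def using ev2 by blast
  qed
qed

end

locale riemannian_atlas = manifold_atlas \<A> for \<A> :: "('m::t2_space, 'e::euclidean_space) chart set" +
  fixes g :: "'m \<Rightarrow> ('m, 'e) tvector \<Rightarrow> ('m, 'e) tvector \<Rightarrow> real"
    and \<omega> :: "'m \<Rightarrow> ('m, 'e) tvector \<Rightarrow> real"
  assumes metric: "riemannian_metric \<A> g" and form: "one_form \<A> \<omega>"
begin

definition Gc :: "('m, 'e) chart \<Rightarrow> 'e \<Rightarrow> 'e \<Rightarrow> 'e \<Rightarrow> real" where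
  "Gc c x u v = g (chart_inv c x) (tvec \<A> c (chart_inv c x) u) (tvec \<A> c (chart_inv c x) v)"

definition wc :: "('m, 'e) chart \<Rightarrow> 'e \<Rightarrow> 'e \<Rightarrow> real" where
  "wc c x u = \<omega> (chart_inv c x) (tvec \<A> c (chart_inv c x) u)"

lemma g_tvec: "c \<in> \<A> \<Longrightarrow> p \<in> fst c \<Longrightarrow> g p (tvec \<A> c p u) (tvec \<A> c p v) = Gc c (snd c p) u v"
  by (simp add: Gc_def)

lemma w_tvec: "c \<in> \<A> \<Longrightarrow> p \<in> fst c \<Longrightarrow> \<omega> p (tvec \<A> c p u) = wc c (snd c p) u"
  by (simp add: wc_def)

lemma metric_coords: assumes c: "c \<in> \<A>" shows "metric_coords (snd c ` fst c) (Gc c) (wc c)"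
proof (rule metric_coords.intro)
  note tv = tvec_in_tangent_space[OF c]
  have g1: "g p u (tadd v v') = g p u v + g p u v'"
    if "u \<in> tangent_space \<A> p" "v \<in> tangent_space \<A> p" "v' \<in> tangent_space \<A> p" for p u v v'
    using metric that unfolding riemannian_metric_def tlinear_on_def by blast
  have g2: "g p u (tscale a v) = a * g p u v" "g p u v = g p v u" "v \<noteq> tzero \<Longrightarrow> g p v v > 0"
    if "u \<in> tangent_space \<A> p" "v \<in> tangent_space \<A> p" for p u v a
    using metric that unfolding riemannian_metric_def tlinear_on_def by blast+
  have w1: "\<omega> p (tadd v v') = \<omega> p v + \<omega> p v'"
    if "v \<in> tangent_space \<A> p" "v' \<in> tangent_space \<A> p" for p v v'
    using form that unfolding one_form_def tlinear_on_def by blast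
  have w2: "\<omega> p (tscale a v) = a * \<omega> p v" if "v \<in> tangent_space \<A> p" for p v a
    using form that unfolding one_form_def tlinear_on_def by blast
  show "open (snd c ` fst c)" by (rule open_image[OF c])
  show "smooth_on (\<lambda>x. Gc c x u v) (snd c ` fst c)" for u v
    using metric c unfolding riemannian_metric_def Gc_def by blast
  show "smooth_on (\<lambda>x. wc c x u) (snd c ` fst c)" for u
    using form c unfolding one_form_def wc_def by blast
  fix x assume x: "x \<in> snd c ` fst c"
  note p = chart_inv_in[OF c x]
  note tv = tvec_in_tangent_space[OF c p]
  show "linear (Gc c x u)" for u
    by (rule linearI) (simp_all add: Gc_def tvec_add[OF c p] tvec_scale[OF c p] g1 g2(1) tv)
  show "Gc c x u v = Gc c x v u" for u v
    using g2(2)[OF tv tv] unfolding Gc_def by blast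
  show "linear (wc c x)"
    by (rule linearI) (simp_all add: wc_def tvec_add[OF c p] tvec_scale[OF c p] w1 w2 tv)
  show "0 < Gc c x u u" if "u \<noteq> 0" for u
  proof -
    have "tvec \<A> c (chart_inv c x) u \<noteq> tzero"
      using tvec_self[OF c p, of u] that by (metis tzero_def)
    then show ?thesis using g2(3)[OF tv tv] unfolding Gc_def by blast
  qed
qed

end

text \<open>Compactness by bisection. The local hypothesis concerns only intervals with
  \<open>s\<close> as an endpoint, because at a break point curves are smooth on either side but not
  across.\<close>

lemma interval_gluing:
  fixes P :: "real \<Rightarrow> real \<Rightarrow> bool"
  assumes "a < b"
    and trans: "\<And>u v t. a \<le> u \<Longrightarrow> u < v \<Longrightarrow> v < t \<Longrightarrow> t \<le> b \<Longrightarrow> P u v \<Longrightarrow> P v t \<Longrightarrow> P u t"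
    and local: "\<And>s. a \<le> s \<Longrightarrow> s \<le> b \<Longrightarrow> \<exists>d>0. (\<forall>t. s < t \<and> t \<le> b \<and> t < s + d \<longrightarrow> P s t) \<and>
      (\<forall>t. a \<le> t \<and> t < s \<and> s - d < t \<longrightarrow> P t s)"
  shows "P a b"
proof -
  \<comment> \<open>Degenerate intervals and intervals leaving [a,b] satisfy \<open>Q\<close>
    vacuously, which brings \<open>P\<close> into the form that \<open>Bolzano\<close>
    expects.\<close>
  define Q where "Q u v \<longleftrightarrow> (a \<le> u \<and> v \<le> b \<and> u < v \<longrightarrow> P u v)" for u v
  have "Q a b"
  proof (rule Bolzano[where P=Q])
    show "a \<le> b" using assms(1) by simp
    show "Q u t" if "Q u v" "Q v t" "u \<le> v" "v \<le> t" for u v t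
    proof (cases "u = v \<or> v = t")
      case False
      then show ?thesis using that trans[of u v t] unfolding Q_def by auto
    qed (use that in auto)
    fix s assume s: "a \<le> s" "s \<le> b"
    obtain d where d: "d > 0" "\<And>t. s < t \<Longrightarrow> t \<le> b \<Longrightarrow> t < s + d \<Longrightarrow> P s t"
      "\<And>t. a \<le> t \<Longrightarrow> t < s \<Longrightarrow> s - d < t \<Longrightarrow> P t s"
      using local[OF s] by blast
    have "Q u v" if "u \<le> s" "s \<le> v" "v - u < d" for u v
      unfolding Q_def
    proof
      assume uv: "a \<le> u \<and> v \<le> b \<and> u < v"
      show "P u v"
      proof (cases "u = s \<or> s = v")
        case True
        then show ?thesis using uv that d(2)[of v] d(3)[of u] by auto
      next
        case False
        have "P u s" by (rule d(3)) (use False uv that in auto)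
        moreover have "P s v" by (rule d(2)) (use False uv that in auto)
        ultimately show ?thesis using trans[of u s v] False uv that by auto
      qed
    qed
    then show "\<exists>d>0. \<forall>u v. u \<le> s \<and> s \<le> v \<and> v - u < d \<longrightarrow> Q u v" using d(1) by blast
  qed
  then show ?thesis using assms(1) by (simp add: Q_def)
qed

lemma finite_gaps:
  fixes s :: real
  assumes "finite P"
  obtains d where "d > 0" "\<forall>t\<le>s+d. {s<..<t} \<inter> P = {}" "\<forall>t\<ge>s-d. {t<..<s} \<inter> P = {}"
proof -
  have "closed (P - {s})" using assms by (intro finite_imp_closed) auto
  then have "open (- (P - {s}))" by (rule open_Compl)
  then obtain d where d: "d > 0" "ball s d \<subseteq> - (P - {s})"
    using open_contains_ball[of "- (P - {s})"] by blast
  have "{s<..<t} \<subseteq> ball s d - {s}" if "t \<le> s + d" for t using that by (auto simp: dist_real_def)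
  moreover have "{t<..<s} \<subseteq> ball s d - {s}" if "t \<ge> s - d" for t using that by (auto simp: dist_real_def)
  ultimately show ?thesis using that[OF d(1)] d(2) by blast
qed

lemma smooth_on_has_vector_derivative:
  fixes h :: "real \<Rightarrow> 'a::euclidean_space"
  assumes "smooth_on h W" "s \<in> W"
  shows "(h has_vector_derivative frechet_derivative h (at s) 1) (at s)"
proof -
  note d = smooth_on_has_derivative[OF assms]
  have "frechet_derivative h (at s) = (\<lambda>r. r *\<^sub>R frechet_derivative h (at s) 1)"
  proof
    show "frechet_derivative h (at s) r = r *\<^sub>R frechet_derivative h (at s) 1" for r
      using linear_scale[OF has_derivative_linear[OF d], of r 1] by simp
  qed
  with d show ?thesis unfolding has_vector_derivative_def by metis
qed

context manifold_atlas
begin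

lemma energy_eq: "energy \<A> F \<gamma> = integral {0..1} (\<lambda>s. (F (\<gamma> s) (velocity \<A> \<gamma> s (at s within {0..1})))\<^sup>2 / 2)"
  by (simp add: energy_def)

lemma energy_has_derivative:
  "var_deriv F H 0 1 D \<Longrightarrow> ((\<lambda>r. energy \<A> F (H r)) has_real_derivative D) (at 0)"
  by (simp add: var_deriv_def energy_eq)

lemma velocity_in_tangent_bundle:
  assumes "smooth_into \<A> {a..b} \<gamma>" "a < b" "s \<in> {a..b}" "s \<in> S"
    and S: "at s within S = at s within {a..b}"
  shows "(\<gamma> s, velocity \<A> \<gamma> s (at s within S)) \<in> tangent_bundle \<A>"
proof -
  obtain c where c: "c \<in> \<A>" "\<gamma> s \<in> fst c" using chart_at .
  obtain W h where W: "open W" "s \<in> W" "\<gamma> ` ({a..b} \<inter> W) \<subseteq> fst c" "smooth_on h W"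
    "h ` W \<subseteq> snd c ` fst c" "\<forall>y\<in>{a..b} \<inter> W. h y = snd c (\<gamma> y)"
    using smooth_into_chart[OF assms(1,3) c] .
  have ev: "\<forall>\<^sub>F t in at s within {a..b}. t \<in> W \<and> t \<in> {a..b}"
    unfolding eventually_at_topological using W by blast
  have "(h has_vector_derivative frechet_derivative h (at s) 1) (at s)"
    by (rule smooth_on_has_vector_derivative[OF W(4,2)])
  then have "(h has_vector_derivative frechet_derivative h (at s) 1) (at s within {a..b})"
    by (rule has_vector_derivative_at_within)
  then have "((snd c \<circ> \<gamma>) has_vector_derivative frechet_derivative h (at s) 1) (at s within {a..b})"
    unfolding has_vector_derivative_def
    by (rule has_derivative_transform_eventually)
      (use ev W assms(3) in \<open>auto elim!: eventually_mono\<close>)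
  moreover have "at s within {a..b} \<noteq> bot"
    using assms by (simp add: trivial_limit_within islimpt_Icc)
  moreover have "\<forall>\<^sub>F t in at s within {a..b}. \<gamma> t \<in> fst c"
    using ev by eventually_elim (use W(3) in auto)
  ultimately have "velocity \<A> \<gamma> s (at s within S) = tvec \<A> c (\<gamma> s) (frechet_derivative h (at s) 1)"
    using velocity_eq[of c \<gamma> s "{a..b}", OF c] assms(3) unfolding S by blast
  then show ?thesis
    using tvec_in_tangent_space[OF c] by (simp add: tangent_bundle_def)
qed

text \<open>With the whole tangent bundle as domain the velocity conditions hold automatically, so
  membership of test variations reduces to regularity and closedness.\<close>

lemma loop_space_tangent_bundleI:
  assumes "piecewise_smooth \<A> \<gamma>" "\<gamma> 0 = \<gamma> 1"
  shows "\<gamma> \<in> loop_space \<A> (tangent_bundle \<A>)"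
proof -
  obtain P where P: "finite P" "\<And>a b. 0 \<le> a \<Longrightarrow> a < b \<Longrightarrow> b \<le> 1 \<Longrightarrow> {a<..<b} \<inter> P = {} \<Longrightarrow>
        smooth_into \<A> {a..b} \<gamma>"
    using assms(1) unfolding piecewise_smooth_def by blast
  have "(\<gamma> s, velocity \<A> \<gamma> s (at s within {s..1})) \<in> tangent_bundle \<A>" if "s \<in> {0..<1}" for s
  proof -
    obtain d where d: "d > 0" "\<forall>t\<le>s+d. {s<..<t} \<inter> P = {}" using finite_gaps[OF P(1)] .
    define b where "b = min 1 (s + d)"
    have b: "s < b" "b \<le> 1" "b \<le> s + d" using that d by (auto simp: b_def)
    have "smooth_into \<A> {s..b} \<gamma>" using that d b by (intro P(2)) auto
    then show ?thesis
    proof (rule velocity_in_tangent_bundle)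
      show "at s within {s..1} = at s within {s..b}"
        by (rule at_within_nhd[of _ "{..<b}"]) (use b in auto)
    qed (use b in auto)
  qed
  moreover have "(\<gamma> s, velocity \<A> \<gamma> s (at s within {0..s})) \<in> tangent_bundle \<A>" if "s \<in> {0<..1}" for s
  proof -
    obtain d where d: "d > 0" "\<forall>t\<ge>s-d. {t<..<s} \<inter> P = {}" using finite_gaps[OF P(1)] .
    define a where "a = max 0 (s - d)"
    have a: "a < s" "0 \<le> a" "s - d \<le> a" using that d by (auto simp: a_def)
    have "smooth_into \<A> {a..s} \<gamma>" using that d a by (intro P(2)) auto
    then show ?thesis
    proof (rule velocity_in_tangent_bundle)
      show "at s within {0..s} = at s within {a..s}"
        by (rule at_within_nhd[of _ "{a<..}"]) (use a in auto)
    qed (use a in auto)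
  qed
  ultimately show ?thesis using assms unfolding loop_space_def by auto
qed

lemma piecewise_smooth_imp_continuous:
  fixes H :: "real \<Rightarrow> real \<Rightarrow> 'm"
  assumes "finite P" "\<And>a b. 0 \<le> a \<Longrightarrow> a < b \<Longrightarrow> b \<le> 1 \<Longrightarrow> {a<..<b} \<inter> P = {} \<Longrightarrow>
        smooth_into \<A> (I \<times> {a..b}) (\<lambda>(r, s). H r s)"
  shows "continuous_on (I \<times> {0..1}) (\<lambda>(r, s). H r s)"
proof (rule interval_gluing[of 0 1 "\<lambda>a b. continuous_on (I \<times> {a..b}) (\<lambda>(r, s). H r s)"])
  fix u v t :: real assume uvt: "u < v" "v < t"
    and c: "continuous_on (I \<times> {u..v}) (\<lambda>(r, s). H r s)" "continuous_on (I \<times> {v..t}) (\<lambda>(r, s). H r s)"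
  have e: "I \<times> {u..t} = I \<times> {u..v} \<union> I \<times> {v..t}" using uvt by auto
  have "I \<times> {u..v} = (I \<times> {u..t}) \<inter> (UNIV \<times> {u..v})" "I \<times> {v..t} = (I \<times> {u..t}) \<inter> (UNIV \<times> {v..t})"
    using uvt by auto
  then have "closedin (top_of_set (I \<times> {u..t})) (I \<times> {u..v})"
    "closedin (top_of_set (I \<times> {u..t})) (I \<times> {v..t})"
    by (metis closedin_closed_Int closed_Times closed_UNIV closed_atLeastAtMost)+
  then show "continuous_on (I \<times> {u..t}) (\<lambda>(r, s). H r s)"
    using continuous_on_Un_local c unfolding e by blast
next
  fix s :: real assume s: "0 \<le> s" "s \<le> 1"
  obtain d where d: "d > 0" "\<forall>t\<le>s+d. {s<..<t} \<inter> P = {}" "\<forall>t\<ge>s-d. {t<..<s} \<inter> P = {}"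
    using finite_gaps[OF assms(1)] .
  show "\<exists>d>0. (\<forall>t. s < t \<and> t \<le> 1 \<and> t < s + d \<longrightarrow> continuous_on (I \<times> {s..t}) (\<lambda>(r, s). H r s)) \<and>
      (\<forall>t. 0 \<le> t \<and> t < s \<and> s - d < t \<longrightarrow> continuous_on (I \<times> {t..s}) (\<lambda>(r, s). H r s))"
  proof (intro exI[of _ d] conjI allI impI d(1))
    fix t assume "s < t \<and> t \<le> 1 \<and> t < s + d"
    then show "continuous_on (I \<times> {s..t}) (\<lambda>(r, s). H r s)"
      using s d by (intro smooth_into_imp_continuous_on assms(2)) auto
  next
    fix t assume "0 \<le> t \<and> t < s \<and> s - d < t"
    then show "continuous_on (I \<times> {t..s}) (\<lambda>(r, s). H r s)"
      using s d by (intro smooth_into_imp_continuous_on assms(2)) auto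
  qed
qed simp

section \<open>Test variations and the weak Euler-Lagrange equation\<close>

text \<open>\<open>J\<close> will be a compact set of parameters outside which \<eta> vanishes and
  whose image lies in the chart, so coordinates of \<gamma> are used only where they exist.\<close>

definition test_var where
  "test_var c J \<gamma> \<eta> r s = (if s \<in> J then chart_inv c (snd c (\<gamma> s) + r *\<^sub>R \<eta> s) else \<gamma> s)"

text \<open>Near a parameter in \<open>J\<close> the variation is smooth in the chart
  \<open>c\<close>, being the coordinates of \<gamma> plus \<open>r\<close> times an affine field.
  The complement of \<open>J\<close> is open, and there the variation is \<gamma> itself, smooth in
  any chart. The two descriptions agree where both make sense, because \<eta> vanishes off
  \<open>J\<close>.\<close>

lemma test_variation:
  assumes c: "c \<in> \<A>" and \<gamma>: "\<gamma> \<in> loop_space \<A> (tangent_bundle \<A>)"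
    and B: "finite B" "\<And>a b. 0 \<le> a \<Longrightarrow> a < b \<Longrightarrow> b \<le> 1 \<Longrightarrow> {a<..<b} \<inter> B = {} \<Longrightarrow>
        \<exists>\<alpha> \<beta>. \<forall>s\<in>{a..b}. \<eta> s = \<alpha> + s *\<^sub>R \<beta>"
    and \<eta>: "continuous_on {0..1} \<eta>" "\<eta> 0 = \<eta> 1"
    and J: "compact J" "J \<subseteq> {0..1}" "\<gamma> ` J \<subseteq> fst c" "\<And>s. s \<in> {0..1} \<Longrightarrow> s \<notin> J \<Longrightarrow> \<eta> s = 0"
  obtains \<delta> where "\<delta> > 0" "loop_variation \<A> (tangent_bundle \<A>) \<gamma> \<delta> (test_var c J \<gamma> \<eta>)"
    "\<And>r s. r \<in> {-\<delta><..<\<delta>} \<Longrightarrow> s \<in> {0..1} \<Longrightarrow> \<gamma> s \<in> fst c \<Longrightarrow> snd c (test_var c J \<gamma> \<eta> r s) = snd c (\<gamma> s) + r *\<^sub>R \<eta> s"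
    "\<And>r s. r \<in> {-\<delta><..<\<delta>} \<Longrightarrow> s \<in> {0..1} \<Longrightarrow> \<gamma> s \<in> fst c \<Longrightarrow> test_var c J \<gamma> \<eta> r s \<in> fst c"
proof -
  let ?H = "test_var c J \<gamma> \<eta>"
  have \<gamma>': "piecewise_smooth \<A> \<gamma>" "\<gamma> 0 = \<gamma> 1" "continuous_on {0..1} \<gamma>"
    using \<gamma> unfolding loop_space_def piecewise_smooth_def by auto
  obtain P where P: "finite P" "\<And>a b. 0 \<le> a \<Longrightarrow> a < b \<Longrightarrow> b \<le> 1 \<Longrightarrow> {a<..<b} \<inter> P = {} \<Longrightarrow>
        smooth_into \<A> {a..b} \<gamma>"
    using \<gamma>'(1) unfolding piecewise_smooth_def by blast
  let ?K = "(snd c \<circ> \<gamma>) ` J"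
  have "compact ?K"
    by (intro compact_continuous_image J continuous_on_compose continuous_on_subset[OF \<gamma>'(3)]
        continuous_on_subset[OF continuous_chart[OF c]])
  moreover have "?K \<subseteq> snd c ` fst c" using J(3) by auto
  ultimately obtain e where e: "e > 0" "(\<Union>x\<in>?K. ball x e) \<subseteq> snd c ` fst c"
    using compact_subset_open_imp_ball_epsilon_subset[OF _ open_image[OF c]] by blast
  have "bounded (\<eta> ` {0..1})"
    by (intro compact_imp_bounded compact_continuous_image \<eta>) auto
  then obtain M where M: "M > 0" "\<And>s. s \<in> {0..1} \<Longrightarrow> norm (\<eta> s) \<le> M"
    by (auto simp: bounded_pos)
  \<comment> \<open>For \<open>\<bar>r\<bar> < \<delta>\<close> the displacement
    \<open>r \<eta>\<close> is shorter than \<open>e\<close>, the margin around the coordinate image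
    of \<open>J\<close> inside the chart.\<close>
  define \<delta> where "\<delta> = e / M"
  have \<delta>: "\<delta> > 0" using e M by (simp add: \<delta>_def)
  have Hc: "snd c (\<gamma> s) + r *\<^sub>R \<eta> s \<in> snd c ` fst c" "?H r s = chart_inv c (snd c (\<gamma> s) + r *\<^sub>R \<eta> s)"
    if "r \<in> {-\<delta><..<\<delta>}" "s \<in> {0..1}" "\<gamma> s \<in> fst c" for r s
  proof -
    show "?H r s = chart_inv c (snd c (\<gamma> s) + r *\<^sub>R \<eta> s)"
      using J(4)[OF that(2)] that(3) c by (auto simp: test_var_def)
    show "snd c (\<gamma> s) + r *\<^sub>R \<eta> s \<in> snd c ` fst c"
    proof (cases "s \<in> J")
      case True
      have "norm (r *\<^sub>R \<eta> s) \<le> \<bar>r\<bar> * M" using M(2)[OF that(2)] by (simp add: mult_left_mono)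
      also have "\<dots> < \<delta> * M" using that(1) M(1) by (intro mult_strict_right_mono) auto
      also have "\<dots> = e" using M(1) by (simp add: \<delta>_def)
      finally have "snd c (\<gamma> s) + r *\<^sub>R \<eta> s \<in> ball (snd c (\<gamma> s)) e" by (simp add: dist_norm)
      moreover have "snd c (\<gamma> s) \<in> ?K" using True by (auto simp: image_iff)
      ultimately show ?thesis using e(2) by blast
    next
      case False
      then show ?thesis using J(4)[OF that(2)] that(3) by simp
    qed
  qed
  have sm: "smooth_into \<A> ({-\<delta><..<\<delta>} \<times> {a..b}) (\<lambda>(r, s). ?H r s)"
    if ab: "0 \<le> a" "a < b" "b \<le> 1" "{a<..<b} \<inter> (P \<union> B) = {}" for a b
  proof (rule smooth_intoI)
    fix x assume "x \<in> {-\<delta><..<\<delta>} \<times> {a..b}"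
    then obtain r0 s0 where x: "x = (r0, s0)" "r0 \<in> {-\<delta><..<\<delta>}" "s0 \<in> {a..b}" by auto
    have s01: "s0 \<in> {0..1}" using x(3) ab by auto
    have sm\<gamma>: "smooth_into \<A> {a..b} \<gamma>" using ab by (intro P(2)) auto
    show "\<exists>c\<in>\<A>. \<exists>W h. open W \<and> x \<in> W \<and> smooth_on h W \<and>
      (\<forall>y\<in>({-\<delta><..<\<delta>} \<times> {a..b}) \<inter> W. h y \<in> snd c ` fst c \<and> (case y of (r, s) \<Rightarrow> ?H r s) = chart_inv c (h y))"
    proof (cases "s0 \<in> J")
      case True
      then have c0: "\<gamma> s0 \<in> fst c" using J(3) by auto
      obtain W1 h1 where W1: "open W1" "s0 \<in> W1" "\<gamma> ` ({a..b} \<inter> W1) \<subseteq> fst c" "smooth_on h1 W1"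
        "h1 ` W1 \<subseteq> snd c ` fst c" "\<forall>y\<in>{a..b} \<inter> W1. h1 y = snd c (\<gamma> y)"
        using smooth_into_chart[OF sm\<gamma> x(3) c c0] .
      obtain \<alpha> \<beta> where \<alpha>: "\<forall>s\<in>{a..b}. \<eta> s = \<alpha> + s *\<^sub>R \<beta>" using B(2)[of a b] ab by blast
      define h where "h q = h1 (snd q) + fst q *\<^sub>R (\<alpha> + snd q *\<^sub>R \<beta>)" for q :: "real \<times> real"
      have o: "open (UNIV \<times> W1)" using W1(1) by (intro open_Times) auto
      have A: "smooth_on (\<lambda>q. h1 (snd q)) (UNIV \<times> W1)"
        by (rule smooth_on_compose[OF o W1(1) _ smooth_on_bounded_linear[OF bounded_linear_snd] W1(4)]) auto
      have "smooth_on (\<lambda>q. fst q *\<^sub>R (\<alpha> + snd q *\<^sub>R \<beta>)) (UNIV \<times> W1)"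
        by (intro smooth_on_add[OF o] smooth_on_scaleR[OF o] smooth_on_const
            smooth_on_bounded_linear bounded_linear_fst bounded_linear_snd)
      from smooth_on_add[OF o A this] have "smooth_on h (UNIV \<times> W1)"
        by (simp add: h_def[abs_def])
      moreover have "h q = snd c (\<gamma> (snd q)) + fst q *\<^sub>R \<eta> (snd q)" "\<gamma> (snd q) \<in> fst c"
        if "q \<in> {-\<delta><..<\<delta>} \<times> {a..b}" "q \<in> UNIV \<times> W1" for q
        using that W1(3,6) \<alpha> by (auto simp: h_def)
      ultimately show ?thesis
        using o W1(2) x(1) Hc ab
        by (intro bexI[OF _ c] exI[of _ "UNIV \<times> W1"] exI[of _ h]) auto
    next
      case False
      obtain c' where c': "c' \<in> \<A>" "\<gamma> s0 \<in> fst c'" using chart_at .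
      obtain W1 h1 where W1: "open W1" "s0 \<in> W1" "\<gamma> ` ({a..b} \<inter> W1) \<subseteq> fst c'" "smooth_on h1 W1"
        "h1 ` W1 \<subseteq> snd c' ` fst c'" "\<forall>y\<in>{a..b} \<inter> W1. h1 y = snd c' (\<gamma> y)"
        using smooth_into_chart[OF sm\<gamma> x(3) c'] .
      have o1: "open (W1 - J)" using W1(1) compact_imp_closed[OF J(1)] by (rule open_Diff)
      then have o: "open (UNIV \<times> (W1 - J))" by (intro open_Times) auto
      have "smooth_on (\<lambda>q::real \<times> real. h1 (snd q)) (UNIV \<times> (W1 - J))"
        by (rule smooth_on_compose[OF o o1 _ smooth_on_bounded_linear[OF bounded_linear_snd]
              smooth_on_subset[OF W1(4)]]) auto
      moreover have "h1 (snd q) \<in> snd c' ` fst c' \<and> (case q of (r, s) \<Rightarrow> ?H r s) = chart_inv c' (h1 (snd q))"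
        if "q \<in> {-\<delta><..<\<delta>} \<times> {a..b}" "q \<in> UNIV \<times> (W1 - J)" for q
        using that W1(3,6) c'(1) by (auto simp: test_var_def)
      ultimately show ?thesis
        using o W1(2) x(1) False
        by (intro bexI[OF _ c'(1)] exI[of _ "UNIV \<times> (W1 - J)"] exI[of _ "\<lambda>q. h1 (snd q)"]) auto
    qed
  qed
  have fin: "finite (P \<union> B)" using P(1) B(1) by simp
  have cont: "continuous_on ({-\<delta><..<\<delta>} \<times> {0..1}) (\<lambda>(r, s). ?H r s)"
    by (rule piecewise_smooth_imp_continuous[OF fin sm])
  have H0: "?H 0 s = \<gamma> s" if "s \<in> {0..1}" for s
    using J(3) c by (auto simp: test_var_def)
  have loop: "?H r \<in> loop_space \<A> (tangent_bundle \<A>)" if r: "r \<in> {-\<delta><..<\<delta>}" for r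
  proof (rule loop_space_tangent_bundleI)
    have "continuous_on {0..1} (\<lambda>s. case (r, s) of (r, s) \<Rightarrow> ?H r s)"
      by (rule continuous_on_compose2[OF cont]) (use r in \<open>auto intro!: continuous_intros\<close>)
    moreover have "smooth_into \<A> {a..b} (?H r)"
      if ab: "0 \<le> a" "a < b" "b \<le> 1" "{a<..<b} \<inter> (P \<union> B) = {}" for a b
    proof -
      have "smooth_on (\<lambda>s::real. (r, s)) UNIV"
        by (intro smooth_on_Pair smooth_on_const smooth_on_ident open_UNIV)
      moreover have "(\<lambda>s. (r, s)) ` {a..b} \<subseteq> {-\<delta><..<\<delta>} \<times> {a..b}" using r by auto
      ultimately show ?thesis using smooth_into_compose[OF sm[OF ab]] by fastforce
    qed
    ultimately show "piecewise_smooth \<A> (?H r)" unfolding piecewise_smooth_def using fin by auto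
    \<comment> \<open>\<open>J\<close> may contain only one of the parameters \<open>0\<close> and
      \<open>1\<close>. In that case \<eta> vanishes at both, and the displacement at the base point
      is zero.\<close>
    have "?H r 0 = (if 0 \<in> J \<or> 1 \<in> J then chart_inv c (snd c (\<gamma> 0) + r *\<^sub>R \<eta> 0) else \<gamma> 0)"
      using J(3,4) \<gamma>'(2) \<eta>(2) c by (auto simp: test_var_def)
    moreover have "?H r 1 = (if 0 \<in> J \<or> 1 \<in> J then chart_inv c (snd c (\<gamma> 0) + r *\<^sub>R \<eta> 0) else \<gamma> 0)"
      using J(3,4) \<gamma>'(2) \<eta>(2) c by (auto simp: test_var_def image_subset_iff)
    ultimately show "?H r 0 = ?H r 1" by simp
  qed
  show ?thesis
  proof (rule that[OF \<delta>])
    show "loop_variation \<A> (tangent_bundle \<A>) \<gamma> \<delta> ?H"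
      unfolding loop_variation_def
    proof (intro conjI ballI exI[of _ "P \<union> B"] allI impI \<delta> fin cont)
      show "?H 0 s = \<gamma> s" if "s \<in> {0..1}" for s by (rule H0[OF that])
      show "?H r \<in> loop_space \<A> (tangent_bundle \<A>)" if "r \<in> {-\<delta><..<\<delta>}" for r by (rule loop[OF that])
      show "smooth_into \<A> ({-\<delta><..<\<delta>} \<times> {a..b}) (\<lambda>(r, s). ?H r s)"
        if "0 \<le> a \<and> a < b \<and> b \<le> 1 \<and> {a<..<b} \<inter> (P \<union> B) = {}" for a b
        by (rule sm) (use that in auto)
    qed
    show "snd c (?H r s) = snd c (\<gamma> s) + r *\<^sub>R \<eta> s"
      if "r \<in> {-\<delta><..<\<delta>}" "s \<in> {0..1}" "\<gamma> s \<in> fst c" for r s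
      unfolding Hc(2)[OF that] by (rule chart_inv_right[OF c Hc(1)[OF that]])
    show "?H r s \<in> fst c" if "r \<in> {-\<delta><..<\<delta>}" "s \<in> {0..1}" "\<gamma> s \<in> fst c" for r s
      unfolding Hc(2)[OF that] by (rule chart_inv_in[OF c Hc(1)[OF that]])
  qed
qed

end

lemma (in metric_coords) dL_0: "y \<in> D \<Longrightarrow> dL F R y z 0 0 = 0"
  by (simp add: dL_def linear_0[OF linear_dG] linear_0[OF linear_dw] G_simps w_simps)

context riemannian_atlas
begin

lemma randers_tvec:
  assumes "c \<in> \<A>" "p \<in> fst c"
  shows "randers g \<omega> \<epsilon> p (tvec \<A> c p u) = metric_coords.FR (Gc c) (wc c) \<epsilon> (snd c p) u"
  by (simp add: randers_def metric_coords.FR_def[OF metric_coords[OF assms(1)]] randers_fun_def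
      g_tvec[OF assms] w_tvec[OF assms])

text \<open>The derivative of half the squared Randers metric at \<open>(y, v)\<close>, as a
  function of a direction \<open>(\<xi>, \<zeta>)\<close>. With a variation field and its derivative
  as direction it is the integrand of the first variation.\<close>

definition el_integrand where
  "el_integrand c \<epsilon> y v = metric_coords.dL (Gc c) (wc c) (metric_coords.FR (Gc c) (wc c) \<epsilon> y v)
     (metric_coords.RR (Gc c) (wc c) \<epsilon> y v) y v"

lemma randers_first_variation_chart:
  assumes \<epsilon>: "\<epsilon> > 0" and c: "c \<in> \<A>"
    and H: "smooth_into \<A> ({-\<delta><..<\<delta>} \<times> {a..b}) (\<lambda>(r, s). H r s)"
    and ab: "\<delta> > 0" "0 \<le> a" "a < b" "b \<le> 1" "s0 \<in> {a..b}" and Hc: "H 0 s0 \<in> fst c"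
  obtains d W h where "d > 0" "d < \<delta>" "open W" "smooth_on h W" "{-d..d} \<times> {s0-d..s0+d} \<subseteq> W"
    "\<And>r s. r \<in> {-d..d} \<Longrightarrow> s \<in> {a..b} \<Longrightarrow> s \<in> {s0-d..s0+d} \<Longrightarrow> H r s \<in> fst c \<and> snd c (H r s) = h (r, s)"
    "\<And>a' b'. a \<le> a' \<Longrightarrow> s0 - d \<le> a' \<Longrightarrow> b' \<le> b \<Longrightarrow> b' \<le> s0 + d \<Longrightarrow>
      var_deriv (randers g \<omega> \<epsilon>) H a' b' (integral {a'..b'} (\<lambda>s.
        el_integrand c \<epsilon> (h (0, s)) (frechet_derivative h (at (0, s)) (0, 1))
          (frechet_derivative h (at (0, s)) (1, 0))
          (frechet_derivative (\<lambda>q. frechet_derivative h (at q) (0, 1)) (at (0, s)) (1, 0))))"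
    "\<And>a' b'. a \<le> a' \<Longrightarrow> s0 - d \<le> a' \<Longrightarrow> b' \<le> b \<Longrightarrow> b' \<le> s0 + d \<Longrightarrow> (\<lambda>s.
        el_integrand c \<epsilon> (h (0, s)) (frechet_derivative h (at (0, s)) (0, 1))
          (frechet_derivative h (at (0, s)) (1, 0))
          (frechet_derivative (\<lambda>q. frechet_derivative h (at q) (0, 1)) (at (0, s)) (1, 0))) integrable_on {a'..b'}"
proof -
  interpret M: metric_coords "snd c ` fst c" "Gc c" "wc c" by (rule metric_coords[OF c])
  let ?L = "\<lambda>q. (M.FR \<epsilon> (fst q) (snd q))\<^sup>2 / 2"
  let ?\<Omega> = "(snd c ` fst c) \<times> (UNIV :: 'e set)"
  have 1: "(randers g \<omega> \<epsilon> p (tvec \<A> c p u))\<^sup>2 / 2 = ?L (snd c p, u)" if "p \<in> fst c" for p u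
    by (simp add: randers_tvec[OF c that])
  have 2: "open ?\<Omega>" using M.D_open by (intro open_Times) auto
  have 3: "(snd c (H 0 s0), vector_derivative (\<lambda>s. snd c (H 0 s)) (at s0 within {a..b})) \<in> ?\<Omega>"
    using Hc by auto
  have 4: "(?L has_derivative (\<lambda>v. el_integrand c \<epsilon> y z (fst v) (snd v))) (at (y, z))"
    if "(y, z) \<in> ?\<Omega>" for y z
    unfolding el_integrand_def using that by (intro M.FR_energy_has_derivative[OF \<epsilon>]) auto
  have 5: "continuous_on S (\<lambda>s. el_integrand c \<epsilon> (y s) (z s) (\<xi> s) (\<zeta> s))"
    if "continuous_on S y" "continuous_on S z" "continuous_on S \<xi>" "continuous_on S \<zeta>" "\<forall>s\<in>S. (y s, z s) \<in> ?\<Omega>"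
    for S and y z \<xi> \<zeta> :: "real \<times> real \<Rightarrow> 'e"
    unfolding el_integrand_def using that by (intro M.continuous_on_dL_FR[OF \<epsilon>]) auto
  show ?thesis
    by (rule first_variation_chart[where F="randers g \<omega> \<epsilon>" and L="?L" and \<Omega>="?\<Omega>" and L'="el_integrand c \<epsilon>",
          OF c H ab Hc 1 2 3 4 5]) (assumption | rule that; assumption)+
qed

text \<open>Criticality says that the first variation along \<open>test_var\<close> vanishes. It is
  computed near each parameter in a suitable chart, the local results are glued, and
  \<open>E\<close> absorbs the parameters where \<gamma> or \<eta> has a corner.\<close>

lemma randers_test_integral:
  assumes \<gamma>: "closed_geodesic \<A> (tangent_bundle \<A>) (randers g \<omega> \<epsilon>) \<gamma>" and \<epsilon>: "\<epsilon> > 0" and c: "c \<in> \<A>"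
    and B: "finite B" "\<And>a b. 0 \<le> a \<Longrightarrow> a < b \<Longrightarrow> b \<le> 1 \<Longrightarrow> {a<..<b} \<inter> B = {} \<Longrightarrow>
        \<exists>\<alpha> \<beta>. \<forall>s\<in>{a..b}. \<eta> s = \<alpha> + s *\<^sub>R \<beta>"
    and \<eta>: "continuous_on {0..1} \<eta>" "\<eta> 0 = \<eta> 1"
    and J: "compact J" "J \<subseteq> {0..1}" "\<gamma> ` J \<subseteq> fst c" "\<And>s. s \<in> {0..1} \<Longrightarrow> s \<notin> J \<Longrightarrow> \<eta> s = 0"
    and E: "finite E" "\<And>s. s \<in> {0..1} - E \<Longrightarrow> \<gamma> s \<in> fst c \<Longrightarrow> ((snd c \<circ> \<gamma>) has_vector_derivative v s) (at s)"
      "\<And>s. s \<in> {0..1} - E \<Longrightarrow> (\<eta> has_vector_derivative \<eta>' s) (at s)"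
  shows "((\<lambda>s. if \<gamma> s \<in> fst c then el_integrand c \<epsilon> (snd c (\<gamma> s)) (v s) (\<eta> s) (\<eta>' s) else 0) has_integral 0) {0..1}"
    (is "(?i has_integral 0) {0..1}")
proof -
  have loop: "\<gamma> \<in> loop_space \<A> (tangent_bundle \<A>)"
    and crit: "\<And>\<delta> H. loop_variation \<A> (tangent_bundle \<A>) \<gamma> \<delta> H \<Longrightarrow>
        ((\<lambda>r. energy \<A> (randers g \<omega> \<epsilon>) (H r)) has_real_derivative 0) (at 0)"
    using \<gamma> unfolding closed_geodesic_def by blast+
  define H where "H = test_var c J \<gamma> \<eta>"
  obtain \<delta> where \<delta>: "\<delta> > 0" "loop_variation \<A> (tangent_bundle \<A>) \<gamma> \<delta> H"
    and Hc: "\<And>r s. r \<in> {-\<delta><..<\<delta>} \<Longrightarrow> s \<in> {0..1} \<Longrightarrow> \<gamma> s \<in> fst c \<Longrightarrow> snd c (H r s) = snd c (\<gamma> s) + r *\<^sub>R \<eta> s"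
  proof -
    have "\<exists>\<delta>>0. loop_variation \<A> (tangent_bundle \<A>) \<gamma> \<delta> H \<and>
      (\<forall>r\<in>{-\<delta><..<\<delta>}. \<forall>s\<in>{0..1}. \<gamma> s \<in> fst c \<longrightarrow> snd c (H r s) = snd c (\<gamma> s) + r *\<^sub>R \<eta> s)"
      unfolding H_def by (rule test_variation[OF c loop B(1) B(2) \<eta> J(1-3) J(4)]) blast+
    then show ?thesis using that by blast
  qed
  have H0: "H 0 s = \<gamma> s" if "s \<in> {0..1}" for s
    using \<delta>(2) that unfolding loop_variation_def by blast
  obtain P where P: "finite P" "\<And>a b. 0 \<le> a \<Longrightarrow> a < b \<Longrightarrow> b \<le> 1 \<Longrightarrow> {a<..<b} \<inter> P = {} \<Longrightarrow>
        smooth_into \<A> ({-\<delta><..<\<delta>} \<times> {a..b}) (\<lambda>(r, s). H r s)"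
    using \<delta>(2) unfolding loop_variation_def by metis
  define Q where "Q a b \<longleftrightarrow> var_deriv (randers g \<omega> \<epsilon>) H a b (integral {a..b} ?i) \<and> ?i integrable_on {a..b}" for a b
  have side: "\<exists>d>0. \<forall>a' b'. a \<le> a' \<longrightarrow> s0 - d \<le> a' \<longrightarrow> b' \<le> b \<longrightarrow> b' \<le> s0 + d \<longrightarrow> Q a' b'"
    if ab: "0 \<le> a" "a < b" "b \<le> 1" "s0 \<in> {a..b}" "{a<..<b} \<inter> P = {}" for a b s0
  proof -
    have sm: "smooth_into \<A> ({-\<delta><..<\<delta>} \<times> {a..b}) (\<lambda>(r, s). H r s)" by (rule P(2)[OF ab(1-3,5)])
    have s0: "s0 \<in> {0..1}" using ab by auto
    \<comment> \<open>The given chart is used whenever it contains the point, so that a different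
      chart occurs only where the variation is trivial.\<close>
    obtain c' where c': "c' \<in> \<A>" "\<gamma> s0 \<in> fst c'" "\<gamma> s0 \<in> fst c \<Longrightarrow> c' = c"
      using chart_at c by metis
    \<comment> \<open>A parameter whose point lies outside the chart has positive distance from the
      closed set \<open>J\<close>. On the resulting neighbourhood the variation does not move and
      \<eta> is zero.\<close>
    have "\<exists>d1>0. \<forall>s\<in>{0..1}. \<gamma> s0 \<notin> fst c \<longrightarrow> \<bar>s - s0\<bar> \<le> d1 \<longrightarrow> s \<notin> J"
    proof (cases "\<gamma> s0 \<in> fst c")
      case False
      then have "s0 \<in> - J" using J(3) by auto
      moreover have "open (- J)" using compact_imp_closed[OF J(1)] by (rule open_Compl)
      ultimately obtain e where "e > 0" "cball s0 e \<subseteq> - J" using open_contains_cball by metis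
      then show ?thesis by (intro exI[of _ e]) (auto simp: dist_real_def abs_minus_commute subset_iff)
    qed (use zero_less_one in blast)
    then obtain d1 where d1: "d1 > 0" "\<forall>s\<in>{0..1}. \<gamma> s0 \<notin> fst c \<longrightarrow> \<bar>s - s0\<bar> \<le> d1 \<longrightarrow> s \<notin> J"
      by (elim exE conjE)
    show ?thesis
    proof (rule randers_first_variation_chart[OF \<epsilon> c'(1) sm \<delta>(1) ab(1-4)])
      show "H 0 s0 \<in> fst c'" using H0[OF s0] c'(2) by simp
    next
    fix d W h
    assume d: "d > 0" "d < \<delta>" "open W" "smooth_on h W" "{-d..d} \<times> {s0-d..s0+d} \<subseteq> W"
      and h: "\<And>r s. r \<in> {-d..d} \<Longrightarrow> s \<in> {a..b} \<Longrightarrow> s \<in> {s0-d..s0+d} \<Longrightarrow> H r s \<in> fst c' \<and> snd c' (H r s) = h (r, s)"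
      and vd: "\<And>a' b'. a \<le> a' \<Longrightarrow> s0 - d \<le> a' \<Longrightarrow> b' \<le> b \<Longrightarrow> b' \<le> s0 + d \<Longrightarrow>
        var_deriv (randers g \<omega> \<epsilon>) H a' b' (integral {a'..b'} (\<lambda>s.
        el_integrand c' \<epsilon> (h (0, s)) (frechet_derivative h (at (0, s)) (0, 1))
          (frechet_derivative h (at (0, s)) (1, 0))
          (frechet_derivative (\<lambda>q. frechet_derivative h (at q) (0, 1)) (at (0, s)) (1, 0))))"
      and int: "\<And>a' b'. a \<le> a' \<Longrightarrow> s0 - d \<le> a' \<Longrightarrow> b' \<le> b \<Longrightarrow> b' \<le> s0 + d \<Longrightarrow> (\<lambda>s.
        el_integrand c' \<epsilon> (h (0, s)) (frechet_derivative h (at (0, s)) (0, 1))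
          (frechet_derivative h (at (0, s)) (1, 0))
          (frechet_derivative (\<lambda>q. frechet_derivative h (at q) (0, 1)) (at (0, s)) (1, 0))) integrable_on {a'..b'}"
    let ?h1 = "\<lambda>q. frechet_derivative h (at q) (1, 0)" and ?h2 = "\<lambda>q. frechet_derivative h (at q) (0, 1)"
    let ?h12 = "\<lambda>q. frechet_derivative ?h2 (at q) (1, 0)"
    define d' where "d' = min d d1"
    have "Q a' b'" if a'b': "a \<le> a'" "s0 - d' \<le> a'" "b' \<le> b" "b' \<le> s0 + d'" for a' b'
    proof -
      have t: "t \<in> {0..1}" "t \<in> {a..b}" "t \<in> {s0-d..s0+d}" "\<bar>t - s0\<bar> \<le> d1" if "t \<in> {a'..b'}" for t
        using that a'b' ab unfolding d'_def by auto
      have inW: "(0, t) \<in> W" if "t \<in> {a'..b'}" for t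
        using t[OF that] d(1) by (intro subsetD[OF d(5)]) auto
      have \<eta>0: "\<eta> t = 0" "H r t = \<gamma> t" if "\<gamma> s0 \<notin> fst c" "t \<in> {a'..b'}" for t r
        using J(4)[OF t(1)[OF that(2)]] bspec[OF d1(2) t(1)[OF that(2)]] that(1) t(4)[OF that(2)]
        by (auto simp: H_def test_var_def)
      have hval: "h (r, t) = snd c' (\<gamma> t) + r *\<^sub>R \<eta> t" "\<gamma> t \<in> fst c'" if "r \<in> {-d..d}" "t \<in> {a'..b'}" for r t
      proof -
        have 0: "H 0 t \<in> fst c'" using h[of 0 t] t[OF that(2)] d(1) by auto
        then show g: "\<gamma> t \<in> fst c'" using H0[OF t(1)[OF that(2)]] by simp
        have "h (r, t) = snd c' (H r t)" using h[OF that(1)] t[OF that(2)] by simp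
        also have "\<dots> = snd c' (\<gamma> t) + r *\<^sub>R \<eta> t"
        proof (cases "\<gamma> s0 \<in> fst c")
          case True
          then show ?thesis using c'(3) Hc[of r t] t(1)[OF that(2)] g that(1) d(2) by auto
        next
          case False
          then show ?thesis using \<eta>0[OF False that(2)] by simp
        qed
        finally show "h (r, t) = snd c' (\<gamma> t) + r *\<^sub>R \<eta> t" .
      qed
      have h1: "?h1 (0, t) = \<eta> t" if "t \<in> {a'..b'}" for t
      proof -
        have "((\<lambda>r. snd c' (\<gamma> t) + r *\<^sub>R \<eta> t) has_vector_derivative \<eta> t) (at 0)"
          by (auto intro!: derivative_eq_intros)
        then have "((\<lambda>r. h (r, t)) has_vector_derivative \<eta> t) (at 0)"
          by (rule has_vector_derivative_transform_within_open[where S="{-d<..<d}"])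
            (use d(1) hval(1)[OF _ that] in auto)
        with smooth_on_partial1[OF d(4) inW[OF that]] show ?thesis
          using vector_derivative_unique_at by blast
      qed
      \<comment> \<open>By equality of mixed partials \<open>?h12\<close> is the derivative in
        \<open>s\<close> of \<open>?h1\<close>, which is \<eta>. So the integrand has \<eta> and its
        derivative as direction.\<close>
      have eq: "el_integrand c' \<epsilon> (h (0, t)) (?h2 (0, t)) (?h1 (0, t)) (?h12 (0, t)) = ?i t"
        if "t \<in> {a'..b'} - ({a', b'} \<union> E)" for t
      proof -
        have tt: "t \<in> {a'..b'}" "t \<in> {a'<..<b'}" "t \<in> {0..1} - E" using that t(1)[of t] by auto
        have "((\<lambda>s. ?h1 (0, s)) has_vector_derivative ?h12 (0, t)) (at t)"
          by (rule smooth_on_mixed_partials[OF d(3,4) inW[OF tt(1)]])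
        then have "(\<eta> has_vector_derivative ?h12 (0, t)) (at t)"
          by (rule has_vector_derivative_transform_within_open[where S="{a'<..<b'}"])
            (use tt h1 in auto)
        then have h12: "?h12 (0, t) = \<eta>' t" using E(3)[OF tt(3)] vector_derivative_unique_at by blast
        show ?thesis
        proof (cases "\<gamma> s0 \<in> fst c")
          case True
          then have cc: "c' = c" using c'(3) by simp
          have g: "\<gamma> t \<in> fst c" using hval(2)[of 0 t] tt d(1) cc by simp
          have "((\<lambda>s. h (0, s)) has_vector_derivative ?h2 (0, t)) (at t)"
            by (rule smooth_on_partial2[OF d(4) inW[OF tt(1)]])
          then have "((snd c \<circ> \<gamma>) has_vector_derivative ?h2 (0, t)) (at t)"
            by (rule has_vector_derivative_transform_within_open[where S="{a'<..<b'}"])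
              (use tt hval(1)[of 0] d(1) cc in auto)
          then have "?h2 (0, t) = v t" using E(2)[OF tt(3) g] vector_derivative_unique_at by blast
          then show ?thesis using h12 h1[OF tt(1)] hval(1)[of 0 t] tt d(1) cc g by simp
        next
          case False
          have "((\<lambda>s. 0) has_vector_derivative 0) (at t)" by (rule has_vector_derivative_const)
          then have "(\<eta> has_vector_derivative 0) (at t)"
            by (rule has_vector_derivative_transform_within_open[where S="{a'<..<b'}"])
              (use tt \<eta>0(1)[OF False] in auto)
          then have z: "\<eta>' t = 0" using E(3)[OF tt(3)] vector_derivative_unique_at by blast
          have hin: "h (0, t) \<in> snd c' ` fst c'" using hval[of 0 t] tt d(1) by auto
          show ?thesis
            unfolding h12 h1[OF tt(1)] z \<eta>0(1)[OF False tt(1)]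
            using metric_coords.dL_0[OF metric_coords[OF c'(1)] hin]
              metric_coords.dL_0[OF metric_coords[OF c]]
            by (simp add: el_integrand_def)
        qed
      qed
      have ab2: "a \<le> a'" "s0 - d \<le> a'" "b' \<le> b" "b' \<le> s0 + d" using a'b' unfolding d'_def by auto
      have neg: "negligible ({a', b'} \<union> E)" using E(1) by (intro negligible_finite) auto
      have "integral {a'..b'} ?i = integral {a'..b'} (\<lambda>t. el_integrand c' \<epsilon> (h (0, t)) (?h2 (0, t)) (?h1 (0, t)) (?h12 (0, t)))"
        by (rule integral_spike[OF neg]) (use eq in auto)
      moreover have "?i integrable_on {a'..b'}"
        by (rule integrable_spike[OF int[OF ab2] neg]) (use eq in auto)
      ultimately show ?thesis using vd[OF ab2] unfolding Q_def by simp
    qed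
    moreover have "d' > 0" using d(1) d1(1) by (simp add: d'_def)
    ultimately show ?thesis by blast
    qed
  qed
  have "Q 0 1"
  proof (rule interval_gluing)
    fix u v t assume uvt: "u < v" "v < t" "Q u v" "Q v t"
    then have i: "?i integrable_on {u..t}"
      unfolding Q_def by (intro Henstock_Kurzweil_Integration.integrable_combine[of u v t]) auto
    have "integral {u..v} ?i + integral {v..t} ?i = integral {u..t} ?i"
      using uvt i by (intro Henstock_Kurzweil_Integration.integral_combine) auto
    then show "Q u t" using i uvt var_deriv_add[of "randers g \<omega> \<epsilon>" H u v _ t] unfolding Q_def by fastforce
  next
    fix s :: real assume s: "0 \<le> s" "s \<le> 1"
    obtain d where d: "d > 0" "\<forall>t\<le>s+d. {s<..<t} \<inter> P = {}" "\<forall>t\<ge>s-d. {t<..<s} \<inter> P = {}"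
      using finite_gaps[OF P(1)] .
    have r: "\<exists>e>0. \<forall>t. s < t \<and> t \<le> 1 \<and> t < s + e \<longrightarrow> Q s t"
    proof (cases "s < 1")
      case True
      define b where "b = min 1 (s + d)"
      have b: "s < b" "b \<le> 1" "b \<le> s + d" using True d(1) by (auto simp: b_def)
      obtain e where e: "e > 0" "\<And>a' b'. s \<le> a' \<Longrightarrow> s - e \<le> a' \<Longrightarrow> b' \<le> b \<Longrightarrow> b' \<le> s + e \<Longrightarrow> Q a' b'"
        using side[of s b s] s b d(2) by auto
      then show ?thesis using b d(1) by (intro exI[of _ "min e (b - s)"]) auto
    qed (auto intro: zero_less_one)
    have l: "\<exists>e>0. \<forall>t. 0 \<le> t \<and> t < s \<and> s - e < t \<longrightarrow> Q t s"
    proof (cases "0 < s")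
      case True
      define a where "a = max 0 (s - d)"
      have a: "a < s" "0 \<le> a" "s - d \<le> a" using True d(1) by (auto simp: a_def)
      obtain e where e: "e > 0" "\<And>a' b'. a \<le> a' \<Longrightarrow> s - e \<le> a' \<Longrightarrow> b' \<le> s \<Longrightarrow> b' \<le> s + e \<Longrightarrow> Q a' b'"
        using side[of a s s] s a d(3) by auto
      then show ?thesis using a d(1) by (intro exI[of _ "min e (s - a)"]) auto
    qed (auto intro: zero_less_one)
    from r l obtain e1 e2 where "e1 > 0" "\<forall>t. s < t \<and> t \<le> 1 \<and> t < s + e1 \<longrightarrow> Q s t"
      "e2 > 0" "\<forall>t. 0 \<le> t \<and> t < s \<and> s - e2 < t \<longrightarrow> Q t s" by blast
    then show "\<exists>d>0. (\<forall>t. s < t \<and> t \<le> 1 \<and> t < s + d \<longrightarrow> Q s t) \<and> (\<forall>t. 0 \<le> t \<and> t < s \<and> s - d < t \<longrightarrow> Q t s)"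
      by (intro exI[of _ "min e1 e2"]) auto
  qed simp
  then have "((\<lambda>r. energy \<A> (randers g \<omega> \<epsilon>) (H r)) has_real_derivative integral {0..1} ?i) (at 0)"
    and i: "?i integrable_on {0..1}"
    unfolding Q_def using energy_has_derivative by blast+
  then have "integral {0..1} ?i = 0" using crit[OF \<delta>(2)] DERIV_unique by blast
  then show ?thesis using i by (simp add: has_integral_integral)
qed

end

section \<open>Regularity of closed Randers geodesics\<close>

definition ramp :: "real \<Rightarrow> real \<Rightarrow> real" where "ramp k x = max 0 (min 1 (x / k))"

definition ramp' :: "real \<Rightarrow> real \<Rightarrow> real" where "ramp' k x = (if 0 < x \<and> x < k then 1 / k else 0)"

text \<open>For \<open>t1 + k \<le> t2\<close> it climbs to \<open>1\<close> on
  \<open>[t1, t1 + k]\<close> and descends on \<open>[t2, t2 + k]\<close>. Testing with its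
  derivative compares two averages over intervals of length \<open>k\<close>, which in the limit
  \<open>k \<rightarrow> 0\<close> compares two values.\<close>

definition trapezoid :: "real \<Rightarrow> real \<Rightarrow> real \<Rightarrow> real \<Rightarrow> real" where
  "trapezoid t1 t2 k s = ramp k (s - t1) - ramp k (s - t2)"

definition trapezoid' :: "real \<Rightarrow> real \<Rightarrow> real \<Rightarrow> real \<Rightarrow> real" where
  "trapezoid' t1 t2 k s = ramp' k (s - t1) - ramp' k (s - t2)"

lemma continuous_on_ramp: "continuous_on S (\<lambda>s. ramp k (s - t))"
  unfolding ramp_def divide_inverse by (intro continuous_intros)

lemma ramp_has_derivative:
  assumes "k > 0" "s \<noteq> t" "s \<noteq> t + k"
  shows "((\<lambda>s. ramp k (s - t)) has_real_derivative ramp' k (s - t)) (at s)"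
proof -
  consider "s < t" | "t < s" "s < t + k" | "t + k < s" using assms by linarith
  then show ?thesis
  proof cases
    case 1
    have "((\<lambda>s. 0) has_real_derivative ramp' k (s - t)) (at s)" using 1 by (simp add: ramp'_def)
    then show ?thesis
      by (rule has_field_derivative_transform_within_open[where S="{..<t}"])
        (use 1 assms(1) in \<open>auto simp: ramp_def max_def min_def divide_simps\<close>)
  next
    case 2
    have "((\<lambda>s. (s - t) / k) has_real_derivative ramp' k (s - t)) (at s)"
      using 2 assms(1) by (auto simp: ramp'_def intro!: derivative_eq_intros)
    then show ?thesis
      by (rule has_field_derivative_transform_within_open[where S="{t<..<t+k}"])
        (use 2 assms(1) in \<open>auto simp: ramp_def max_def min_def divide_simps\<close>)
  next
    case 3
    have "((\<lambda>s. 1) has_real_derivative ramp' k (s - t)) (at s)" using 3 by (simp add: ramp'_def)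
    then show ?thesis
      by (rule has_field_derivative_transform_within_open[where S="{t+k<..}"])
        (use 3 assms(1) in \<open>auto simp: ramp_def max_def min_def divide_simps\<close>)
  qed
qed

lemma ramp_affine:
  assumes "k > 0" "t \<notin> {a<..<b}" "t + k \<notin> {a<..<b}" "a < b"
  shows "\<exists>\<alpha> \<beta>. \<forall>s\<in>{a..b}. ramp k (s - t) = \<alpha> + s * \<beta>"
proof -
  consider "b \<le> t" | "t \<le> a" "b \<le> t + k" | "t + k \<le> a" using assms by force
  then show ?thesis
  proof cases
    case 1
    then show ?thesis using assms(1)
      by (intro exI[of _ 0]) (auto simp: ramp_def max_def min_def divide_simps)
  next
    case 2
    then show ?thesis using assms(1)
      by (intro exI[of _ "- t / k"] exI[of _ "1 / k"]) (auto simp: ramp_def max_def min_def field_simps)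
  next
    case 3
    then show ?thesis using assms(1)
      by (intro exI[of _ 1] exI[of _ 0]) (auto simp: ramp_def max_def min_def divide_simps)
  qed
qed

lemma trapezoid_zero:
  assumes "k > 0" "t1 + k \<le> t2" "s \<le> t1 \<or> t2 + k \<le> s"
  shows "trapezoid t1 t2 k s = 0" "trapezoid' t1 t2 k s = 0"
  using assms by (auto simp: trapezoid_def trapezoid'_def ramp_def ramp'_def max_def min_def divide_simps)

lemma trapezoid_affine:
  assumes "k > 0" "{t1, t1 + k, t2, t2 + k} \<inter> {a<..<b} = {}" "a < b"
  shows "\<exists>\<alpha> \<beta>. \<forall>s\<in>{a..b}. trapezoid t1 t2 k s = \<alpha> + s * \<beta>"
proof -
  obtain \<alpha> \<beta> where 1: "\<forall>s\<in>{a..b}. ramp k (s - t1) = \<alpha> + s * \<beta>"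
    using ramp_affine[of k t1 a b] assms by auto
  obtain \<alpha>' \<beta>' where 2: "\<forall>s\<in>{a..b}. ramp k (s - t2) = \<alpha>' + s * \<beta>'"
    using ramp_affine[of k t2 a b] assms by auto
  have "\<forall>s\<in>{a..b}. trapezoid t1 t2 k s = (\<alpha> - \<alpha>') + s * (\<beta> - \<beta>')"
    using 1 2 by (simp add: trapezoid_def algebra_simps)
  then show ?thesis by blast
qed

lemma trapezoid_has_derivative:
  assumes "k > 0" "s \<notin> {t1, t1 + k, t2, t2 + k}"
  shows "(trapezoid t1 t2 k has_real_derivative trapezoid' t1 t2 k s) (at s)"
  unfolding trapezoid_def[abs_def] trapezoid'_def
  by (intro DERIV_diff ramp_has_derivative) (use assms in auto)

lemma integral_right_derivative:
  fixes q :: "real \<Rightarrow> real"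
  assumes "e > 0" "continuous_on {t..t+e} q"
  shows "((\<lambda>k. integral {t..t+k} q) has_vector_derivative q t) (at 0 within {0..e})"
proof -
  have 1: "((\<lambda>k. t + k) has_vector_derivative 1) (at 0 within {0..e})"
    by (auto intro!: derivative_eq_intros)
  have im: "(\<lambda>k. t + k) ` {0..e} = {t..t+e}" by simp
  have "((\<lambda>u. integral {t..u} q) has_vector_derivative q t) (at t within {t..t+e})"
    using assms by (intro integral_has_vector_derivative) auto
  then have "((\<lambda>u. integral {t..u} q) has_vector_derivative q t) (at (t + 0) within (\<lambda>k. t + k) ` {0..e})"
    unfolding im by simp
  from vector_diff_chain_within[OF 1 this] show ?thesis by (simp add: o_def)
qed

text \<open>At \<open>t\<close> the functions \<open>f\<close> and \<open>h\<close> may jump, as they do along a curve with a break point.\<close>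

lemma du_bois_reymond:
  fixes f h :: "real \<Rightarrow> real"
  assumes d: "d > 0"
    and cont: "continuous_on {t..t+d} f" "continuous_on {t..t+d} h"
      "continuous_on {t-d..t} f'" "continuous_on {t-d..t} h'"
    and eq: "\<And>s. s \<in> {t-d..<t} \<Longrightarrow> f s = f' s" "\<And>s. s \<in> {t-d..<t} \<Longrightarrow> h s = h' s"
    and test: "\<And>t1 t2 k. k > 0 \<Longrightarrow> t - d < t1 \<Longrightarrow> t1 + k \<le> t2 \<Longrightarrow> t2 + k < t + d \<Longrightarrow>
      ((\<lambda>s. trapezoid t1 t2 k s * f s + trapezoid' t1 t2 k s * h s) has_integral 0) {t-d..t+d}"
    and t12: "t - d < t1" "t1 < t2" "t2 < t + d"
  shows "h t2 - h t1 = integral {t1..t2} f" "f integrable_on {t-d..t+d}"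
proof -
  have int: "p integrable_on {t-d..t+d}"
    if "continuous_on {t..t+d} p" "continuous_on {t-d..t} p'" "\<And>s. s \<in> {t-d..<t} \<Longrightarrow> p s = p' s"
    for p p' :: "real \<Rightarrow> real"
  proof (rule Henstock_Kurzweil_Integration.integrable_combine[of "t-d" t "t+d"])
    show "p integrable_on {t..t+d}" using that(1) by (rule integrable_continuous_interval)
    have "p' integrable_on {t-d..t}" using that(2) by (rule integrable_continuous_interval)
    then show "p integrable_on {t-d..t}"
      by (rule integrable_spike[of _ _ "{t}"]) (use that(3) in auto)
  qed (use d in auto)
  show fi: "f integrable_on {t-d..t+d}" by (rule int[OF cont(1,3) eq(1)])
  define F where "F s = integral {t-d..s} f" for s
  have Fc: "continuous_on {t-d..t+d} F" unfolding F_def by (rule indefinite_integral_continuous_1[OF fi])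
  have F': "(F has_vector_derivative f s) (at s)" if "s \<in> {t-d<..<t+d}" "s \<noteq> t" for s
  proof -
    have "isCont f s"
    proof (cases "s > t")
      case True
      then show ?thesis
        using continuous_on_interior[OF cont(1), of s] that by simp
    next
      case False
      have "isCont f' s" using continuous_on_interior[OF cont(3), of s] that False by simp
      moreover have "\<forall>\<^sub>F x in nhds s. f x = f' x"
        by (rule eventually_nhds_in_open[of "{t-d<..<t}", THEN eventually_mono])
          (use that False eq(1) in auto)
      ultimately show ?thesis using isCont_cong by blast
    qed
    then have "continuous (at s within {t-d..t+d}) f" by (rule continuous_at_imp_continuous_at_within)
    from integral_has_vector_derivative_continuous_at[OF fi _ finite.emptyI, of s] this that
    have "(F has_vector_derivative f s) (at s within {t-d..t+d})" unfolding F_def by simp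
    then show ?thesis using that at_within_Icc_at[of "t-d" s "t+d"] by simp
  qed
  \<comment> \<open>The claim is that \<open>q\<close> takes the same value at \<open>t1\<close> and
    \<open>t2\<close>.\<close>
  define q where "q s = h s - F s" for s
  have qc: "continuous_on {t..t+d} q" "continuous_on {t-d..t} (\<lambda>s. h' s - F s)"
    unfolding q_def using d
    by (auto intro!: continuous_on_diff cont continuous_on_subset[OF Fc])
  have qi: "q integrable_on {t-d..t+d}" by (rule int[OF qc]) (simp add: q_def eq)
  \<comment> \<open>Integrating the test identity by parts against the primitive \<open>F\<close>
    leaves only the derivative of the trapezoid times \<open>q\<close>, that is, the difference of
    two averages of \<open>q\<close>.\<close>
  have qint: "integral {t1..t1+k} q = integral {t2..t2+k} q"
    if k: "k > 0" "t1 + k \<le> t2" "t2 + k < t + d" for k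
  proof -
    let ?\<tau> = "trapezoid t1 t2 k" and ?\<tau>' = "trapezoid' t1 t2 k"
    have "((\<lambda>s. ?\<tau> s * f s + ?\<tau>' s * F s) has_integral (?\<tau> (t+d) * F (t+d) - ?\<tau> (t-d) * F (t-d))) {t-d..t+d}"
    proof (rule fundamental_theorem_of_calculus_interior_strong[of "{t, t1, t1 + k, t2, t2 + k}"])
      fix s assume s: "s \<in> {t-d<..<t+d} - {t, t1, t1 + k, t2, t2 + k}"
      have a: "(?\<tau> has_vector_derivative ?\<tau>' s) (at s)"
        using trapezoid_has_derivative[OF k(1), of s t1 t2] s
        by (auto simp: has_real_derivative_iff_has_vector_derivative)
      have b: "(F has_vector_derivative f s) (at s)" by (rule F') (use s in auto)
      show "((\<lambda>s. ?\<tau> s * F s) has_vector_derivative ?\<tau> s * f s + ?\<tau>' s * F s) (at s)"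
        by (rule has_vector_derivative_mult[OF a b])
    next
      show "continuous_on {t-d..t+d} (\<lambda>s. ?\<tau> s * F s)"
        unfolding trapezoid_def by (intro continuous_on_mult continuous_on_diff continuous_on_ramp Fc)
    qed (use d in auto)
    moreover have "?\<tau> (t+d) = 0" "?\<tau> (t-d) = 0" using trapezoid_zero[OF k(1,2)] t12 k by auto
    ultimately have "((\<lambda>s. ?\<tau> s * f s + ?\<tau>' s * F s) has_integral 0) {t-d..t+d}" by simp
    from has_integral_diff[OF test[OF k(1) t12(1) k(2,3)] this]
    have z: "((\<lambda>s. ?\<tau>' s * q s) has_integral 0) {t-d..t+d}"
      by (simp add: q_def algebra_simps)
    have r: "((\<lambda>s. ramp' k (s - r) * q s) has_integral (1 / k * integral {r..r+k} q)) {t-d..t+d}"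
      if "t - d < r" "r + k < t + d" for r
    proof -
      have sub: "{r..r+k} \<subseteq> {t-d..t+d}" using that by auto
      have "q integrable_on {r..r+k}" by (rule integrable_subinterval_real[OF qi sub])
      then have "((\<lambda>s. 1 / k * q s) has_integral (1 / k * integral {r..r+k} q)) {r..r+k}"
        by (intro has_integral_mult_right integrable_integral)
      then have "((\<lambda>s. ramp' k (s - r) * q s) has_integral (1 / k * integral {r..r+k} q)) {r..r+k}"
        by (rule has_integral_spike_finite[of "{r, r+k}", rotated -1]) (auto simp: ramp'_def)
      then have "((\<lambda>s. if s \<in> {r..r+k} then ramp' k (s - r) * q s else 0) has_integral (1 / k * integral {r..r+k} q)) {t-d..t+d}"
        unfolding has_integral_restrict[OF sub] .
      then show ?thesis
        by (rule has_integral_eq[rotated]) (auto simp: ramp'_def)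
    qed
    have "((\<lambda>s. ?\<tau>' s * q s) has_integral (1 / k * integral {t1..t1+k} q - 1 / k * integral {t2..t2+k} q)) {t-d..t+d}"
      using has_integral_diff[OF r[of t1] r[of t2]] t12 k by (simp add: trapezoid'_def left_diff_distrib)
    from has_integral_unique[OF this z] show ?thesis using k(1) by simp
  qed
  have rc: "\<exists>e>0. r + e < t + d \<and> continuous_on {r..r+e} q" if "t - d < r" "r < t + d" for r
  proof (cases "t \<le> r")
    case True
    have "r + (t + d - r) / 2 < t + d" "(t + d - r) / 2 > 0" using that by (simp_all add: field_simps)
    moreover from this have "continuous_on {r..r + (t + d - r) / 2} q"
      by (intro continuous_on_subset[OF qc(1)]) (use True in auto)
    ultimately show ?thesis by blast
  next
    case False
    have *: "r + (t - r) / 2 < t" "(t - r) / 2 > 0" using False by (simp_all add: field_simps)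
    then have "continuous_on {r..r + (t - r) / 2} (\<lambda>s. h' s - F s)"
      by (intro continuous_on_subset[OF qc(2)]) (use that in auto)
    then have "continuous_on {r..r + (t - r) / 2} q"
      by (rule continuous_on_eq) (use * that eq(2) in \<open>auto simp: q_def\<close>)
    moreover have "r + (t - r) / 2 < t + d" using * d by simp
    ultimately show ?thesis using * by blast
  qed
  obtain e1 where e1: "e1 > 0" "continuous_on {t1..t1+e1} q" using rc[of t1] t12 by auto
  obtain e2 where e2: "e2 > 0" "t2 + e2 < t + d" "continuous_on {t2..t2+e2} q" using rc[of t2] t12 by auto
  define e where "e = min (min e1 e2) (t2 - t1)"
  have e: "e > 0" "e \<le> e1" "e \<le> e2" "t1 + e \<le> t2" using e1 e2 t12 by (auto simp: e_def)
  \<comment> \<open>Divided by \<open>k\<close>, the integrals tend to \<open>q t1\<close> and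
    \<open>q t2\<close>, expressed here as right derivatives at \<open>0\<close>. They exist because
    \<open>q\<close> is continuous from the right everywhere, also at \<open>t\<close>, where
    \<open>f\<close> and \<open>h\<close> carry their right-hand values.\<close>
  have D1: "((\<lambda>k. integral {t1..t1+k} q) has_vector_derivative q t1) (at 0 within {0..e})"
    by (rule integral_right_derivative[OF e(1)]) (use e in \<open>auto intro: continuous_on_subset[OF e1(2)]\<close>)
  have D2: "((\<lambda>k. integral {t2..t2+k} q) has_vector_derivative q t2) (at 0 within {0..e})"
    by (rule integral_right_derivative[OF e(1)]) (use e in \<open>auto intro: continuous_on_subset[OF e2(3)]\<close>)
  have ie: "integral {t1..t1+k} q = integral {t2..t2+k} q" if "k \<in> {0..e}" for k
    using qint[of k] that e e2(2) by (cases "k = 0") auto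
  have "((\<lambda>k. integral {t2..t2+k} q) has_vector_derivative q t1) (at 0 within {0..e})"
    by (rule has_vector_derivative_transform[OF _ _ D1]) (use ie e in auto)
  moreover have "at 0 within {0..e} \<noteq> bot" using e by (simp add: trivial_limit_within islimpt_Icc)
  ultimately have "q t1 = q t2" using D2 vector_derivative_unique_within by blast
  moreover have "integral {t-d..t1} f + integral {t1..t2} f = integral {t-d..t2} f"
    using t12 d by (intro Henstock_Kurzweil_Integration.integral_combine integrable_subinterval_real[OF fi]) auto
  ultimately show "h t2 - h t1 = integral {t1..t2} f" by (simp add: q_def F_def)
qed

section \<open>Injectivity of the Legendre map and conservation of speed\<close>

context metric_coords
begin

lemma dL_add: "y \<in> D \<Longrightarrow> dL F R y z (\<xi> + \<xi>') (\<zeta> + \<zeta>') = dL F R y z \<xi> \<zeta> + dL F R y z \<xi>' \<zeta>'"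
  by (simp add: dL_def linear_add[OF linear_dG] linear_add[OF linear_dw] G_simps w_simps
      add_divide_distrib distrib_left)

lemma dL_scale: "y \<in> D \<Longrightarrow> dL F R y z (a *\<^sub>R \<xi>) (a *\<^sub>R \<zeta>) = a * dL F R y z \<xi> \<zeta>"
  by (simp add: dL_def linear_scale[OF linear_dG] linear_scale[OF linear_dw] G_simps w_simps
      add_divide_distrib distrib_left mult_ac)

lemma dL_split: "y \<in> D \<Longrightarrow> dL F R y z (a *\<^sub>R u) (b *\<^sub>R u) = a * dL F R y z u 0 + b * dL F R y z 0 u"
  using dL_add[of y F R z "a *\<^sub>R u" 0 0 "b *\<^sub>R u"] dL_scale[of y F R z a u 0] dL_scale[of y F R z b 0 u]
  by simp

lemma FR_root:
  assumes "\<epsilon> > 0" "y \<in> D"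
  shows "G y z z + 2 * w y z * FR \<epsilon> y z = \<epsilon> * (FR \<epsilon> y z)\<^sup>2" "RR \<epsilon> y z = \<epsilon> * FR \<epsilon> y z - w y z"
    "FR \<epsilon> y z \<ge> 0"
  using randers_fun_root[OF assms(1) G_nonneg[OF assms(2)]] randers_fun_bound(1)[OF assms(1) G_nonneg[OF assms(2)]]
  by (auto simp: FR_def RR_def)

lemma FR_eq_0: "\<epsilon> > 0 \<Longrightarrow> y \<in> D \<Longrightarrow> FR \<epsilon> y z = 0 \<longleftrightarrow> z = 0"
  using FR_root(1)[of \<epsilon> y z] G_pos[of y z] RR_zero(2)[of y \<epsilon>] by (cases "z = 0") auto

text \<open>Euler's relation for half the squared metric, which is homogeneous of degree two in the
  velocity.\<close>

lemma dL_self: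
  assumes "\<epsilon> > 0" "y \<in> D"
  shows "dL (FR \<epsilon> y z) (RR \<epsilon> y z) y z 0 z = (FR \<epsilon> y z)\<^sup>2"
proof (cases "z = 0")
  case True
  then show ?thesis using assms by (simp add: RR_zero dL_0)
next
  case False
  have R: "RR \<epsilon> y z > 0" using RR_pos[OF assms False] .
  have e: "G y z z + FR \<epsilon> y z * w y z = FR \<epsilon> y z * RR \<epsilon> y z"
    unfolding FR_root(2)[OF assms]
    using FR_root(1)[OF assms, of z] by (simp add: power2_eq_square algebra_simps)
  have "dL (FR \<epsilon> y z) (RR \<epsilon> y z) y z 0 z = FR \<epsilon> y z / RR \<epsilon> y z * (G y z z + FR \<epsilon> y z * w y z)"
    by (simp add: dL_def linear_0[OF linear_dG[OF assms(2)]] linear_0[OF linear_dw[OF assms(2)]])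
  also have "\<dots> = (FR \<epsilon> y z)\<^sup>2" unfolding e using R by (simp add: power2_eq_square)
  finally show ?thesis .
qed

text \<open>Reverse Cauchy-Schwarz for the null vectors \<open>(z, F)\<close>, \<open>(z', F')\<close> of the
  Lorentzian metric \<open>g + 2 \<omega> dt - \<epsilon> dt\<^sup>2\<close>.\<close>

lemma reverse_cauchy_schwarz:
  assumes "y \<in> D" "F > 0" "F' > 0"
    and "G y z z + 2 * w y z * F = \<epsilon> * F\<^sup>2" "G y z' z' + 2 * w y z' * F' = \<epsilon> * F'\<^sup>2"
  shows "G y z z' + F * w y z' \<le> F' * (\<epsilon> * F - w y z)"
    and "G y z z' + F * w y z' = F' * (\<epsilon> * F - w y z) \<Longrightarrow> F *\<^sub>R z' = F' *\<^sub>R z"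
proof -
  \<comment> \<open>This combination of \<open>(z, F)\<close> and \<open>(z', F')\<close> has no
    time component. Its square is therefore nonnegative, and since both vectors are null it is a
    negative multiple of their Lorentzian product.\<close>
  define u where "u = F *\<^sub>R z' - F' *\<^sub>R z"
  have "G y u u = F\<^sup>2 * G y z' z' + F'\<^sup>2 * G y z z - 2 * F * F' * G y z z'"
    unfolding u_def using assms(1)
    by (simp add: G_simps G_sym[OF assms(1), of z' z] power2_eq_square algebra_simps)
  also have "\<dots> = F\<^sup>2 * (\<epsilon> * F'\<^sup>2 - 2 * w y z' * F') + F'\<^sup>2 * (\<epsilon> * F\<^sup>2 - 2 * w y z * F) - 2 * F * F' * G y z z'"
  proof -
    have "G y z z = \<epsilon> * F\<^sup>2 - 2 * w y z * F" "G y z' z' = \<epsilon> * F'\<^sup>2 - 2 * w y z' * F'"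
      using assms(4,5) by linarith+
    then show ?thesis by simp
  qed
  also have "\<dots> = 2 * (F * F') * (F' * (\<epsilon> * F - w y z) - (G y z z' + F * w y z'))"
    by (simp add: power2_eq_square algebra_simps)
  finally have eq: "G y u u = 2 * (F * F') * (F' * (\<epsilon> * F - w y z) - (G y z z' + F * w y z'))" .
  have "0 \<le> (F * F') * (F' * (\<epsilon> * F - w y z) - (G y z z' + F * w y z'))"
    using eq G_nonneg[OF assms(1), of u] by simp
  then show "G y z z' + F * w y z' \<le> F' * (\<epsilon> * F - w y z)"
    using mult_pos_pos[OF assms(2,3)] by (auto simp: zero_le_mult_iff)
  assume "G y z z' + F * w y z' = F' * (\<epsilon> * F - w y z)"
  then have "G y u u = 0" using eq by simp
  then have "u = 0" using G_pos[OF assms(1), of u] by auto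
  then show "F *\<^sub>R z' = F' *\<^sub>R z" by (simp add: u_def)
qed

text \<open>Suppose nonzero \<open>a\<close> and \<open>b\<close> have the same momentum. Evaluated
  on \<open>a\<close> it gives \<open>F(a)^2\<close> by Euler's relation and at most
  \<open>F(a) F(b)\<close> by the reverse Cauchy-Schwarz inequality. By symmetry
  \<open>F(a) = F(b)\<close>, and then the equality case gives \<open>a = b\<close>. The zero
  vector, where \<open>F / R\<close> degenerates, is treated separately.\<close>

lemma dL_inj:
  assumes "\<epsilon> > 0" "y \<in> D"
    and eq: "\<And>u. dL (FR \<epsilon> y z) (RR \<epsilon> y z) y z 0 u = dL (FR \<epsilon> y z') (RR \<epsilon> y z') y z' 0 u"
  shows "z = z'"
proof -
  have le: "FR \<epsilon> y a \<le> FR \<epsilon> y b \<and> (FR \<epsilon> y a = FR \<epsilon> y b \<longrightarrow> a = b)"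
    if e: "\<And>u. dL (FR \<epsilon> y a) (RR \<epsilon> y a) y a 0 u = dL (FR \<epsilon> y b) (RR \<epsilon> y b) y b 0 u"
      and n: "a \<noteq> 0" "b \<noteq> 0" for a b
  proof -
    have F: "FR \<epsilon> y a > 0" "FR \<epsilon> y b > 0"
      using FR_root(3)[OF assms(1,2), of a] FR_eq_0[OF assms(1,2), of a]
        FR_root(3)[OF assms(1,2), of b] FR_eq_0[OF assms(1,2), of b] n by auto
    have R: "RR \<epsilon> y b > 0" using RR_pos[OF assms(1,2) n(2)] .
    note rc = reverse_cauchy_schwarz[OF assms(2) F(2,1) FR_root(1)[OF assms(1,2)] FR_root(1)[OF assms(1,2)]]
    have "(FR \<epsilon> y a)\<^sup>2 = dL (FR \<epsilon> y b) (RR \<epsilon> y b) y b 0 a"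
      using dL_self[OF assms(1,2)] e by metis
    also have "\<dots> = FR \<epsilon> y b / RR \<epsilon> y b * (G y b a + FR \<epsilon> y b * w y a)"
      by (simp add: dL_def linear_0[OF linear_dG[OF assms(2)]] linear_0[OF linear_dw[OF assms(2)]])
    finally have s: "(FR \<epsilon> y a)\<^sup>2 * RR \<epsilon> y b = FR \<epsilon> y b * (G y b a + FR \<epsilon> y b * w y a)"
      using R by (simp add: field_simps)
    have r: "\<epsilon> * FR \<epsilon> y b - w y b = RR \<epsilon> y b" using FR_root(2)[OF assms(1,2), of b] by simp
    have "(FR \<epsilon> y a)\<^sup>2 * RR \<epsilon> y b \<le> FR \<epsilon> y b * (FR \<epsilon> y a * RR \<epsilon> y b)"
      unfolding s using rc(1) F(2) unfolding r by (intro mult_left_mono) auto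
    then have "FR \<epsilon> y a \<le> FR \<epsilon> y b" using F R by (simp add: power2_eq_square)
    moreover have "a = b" if "FR \<epsilon> y a = FR \<epsilon> y b"
    proof -
      have "G y b a + FR \<epsilon> y b * w y a = FR \<epsilon> y a * RR \<epsilon> y b"
        using s that F by (simp add: power2_eq_square)
      then have "FR \<epsilon> y b *\<^sub>R a = FR \<epsilon> y a *\<^sub>R b" using rc(2) unfolding r by simp
      then show ?thesis using that F by simp
    qed
    ultimately show ?thesis by blast
  qed
  have zero: "b = 0" if e: "\<And>u. dL (FR \<epsilon> y 0) (RR \<epsilon> y 0) y 0 0 u = dL (FR \<epsilon> y b) (RR \<epsilon> y b) y b 0 u" for b
  proof -
    have "(FR \<epsilon> y b)\<^sup>2 = dL (FR \<epsilon> y 0) (RR \<epsilon> y 0) y 0 0 b"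
      using dL_self[OF assms(1,2), of b] e by simp
    also have "\<dots> = 0" using assms by (simp add: dL_def RR_zero)
    finally show ?thesis using FR_eq_0[OF assms(1,2)] by simp
  qed
  show ?thesis
  proof (cases "z = 0 \<or> z' = 0")
    case True
    then show ?thesis
    proof
      assume "z = 0"
      with zero[of z'] eq show ?thesis by simp
    next
      assume "z' = 0"
      with zero[of z] eq show ?thesis by simp
    qed
  next
    case False
    then have "FR \<epsilon> y z \<le> FR \<epsilon> y z' \<and> (FR \<epsilon> y z = FR \<epsilon> y z' \<longrightarrow> z = z')"
      by (intro le[OF eq]) auto
    moreover have "FR \<epsilon> y z' \<le> FR \<epsilon> y z \<and> (FR \<epsilon> y z' = FR \<epsilon> y z \<longrightarrow> z' = z)"
      by (rule le[OF eq[symmetric]]) (use False in auto)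
    ultimately show ?thesis by simp
  qed
qed

end

lemma has_vector_derivative_shift:
  assumes "(f has_vector_derivative f') (at (s - k))"
  shows "((\<lambda>s. f (s - k)) has_vector_derivative f') (at (s :: real))"
proof -
  have "((\<lambda>s. s - k) has_vector_derivative 1) (at s)"
    by (auto intro!: derivative_eq_intros)
  from vector_diff_chain_at[OF this assms] show ?thesis by (simp add: o_def)
qed

lemma has_vector_derivative_Un:
  assumes "(f has_vector_derivative f') (at x within S)" "(f has_vector_derivative f') (at x within T)"
  shows "(f has_vector_derivative f') (at x within (S \<union> T))"
  using assms unfolding has_vector_derivative_def has_derivative_within
  by (auto intro: Lim_Un)

context metric_coords
begin

lemma linear_dL2: "y \<in> D \<Longrightarrow> linear (dL F R y z 0)"
  using dL_add[of y F R z 0 0] dL_scale[of y F R z _ 0] by (intro linearI) auto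

lemma linear_dL1: "y \<in> D \<Longrightarrow> linear (\<lambda>u. dL F R y z u 0)"
  using dL_add[of y F R z _ _ 0 0] dL_scale[of y F R z _ _ 0] by (intro linearI) auto

text \<open>Conservation of energy: the Lagrangian is half of the momentum paired with the velocity,
  by homogeneity.\<close>

lemma FR_square_derivative_zero:
  assumes \<epsilon>: "\<epsilon> > 0" and D: "\<forall>\<^sub>F t in nhds s. y t \<in> D"
    and y: "(y has_vector_derivative v s) (at s)" and v: "(v has_vector_derivative a) (at s)"
    and el: "\<And>u. ((\<lambda>s. dL (FR \<epsilon> (y s) (v s)) (RR \<epsilon> (y s) (v s)) (y s) (v s) 0 u) has_real_derivative
      dL (FR \<epsilon> (y s) (v s)) (RR \<epsilon> (y s) (v s)) (y s) (v s) u 0) (at s)"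
  shows "((\<lambda>s. (FR \<epsilon> (y s) (v s))\<^sup>2) has_real_derivative 0) (at s)"
proof -
  have ys: "y s \<in> D" using D eventually_nhds_x_imp_x by blast
  define M where "M t u = dL (FR \<epsilon> (y t) (v t)) (RR \<epsilon> (y t) (v t)) (y t) (v t) 0 u" for t u
  define N where "N u w = dL (FR \<epsilon> (y s) (v s)) (RR \<epsilon> (y s) (v s)) (y s) (v s) u w" for u w
  have yv: "((\<lambda>t. (y t, v t)) has_vector_derivative (v s, a)) (at s)"
    using y v by (auto simp: has_vector_derivative_def intro!: has_derivative_Pair)
  from vector_derivative_diff_chain_within[OF yv has_derivative_at_withinI[OF FR_energy_has_derivative[OF \<epsilon> ys]]]
  have 1: "((\<lambda>s. (FR \<epsilon> (y s) (v s))\<^sup>2 / 2) has_real_derivative N (v s) a) (at s)"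
    by (simp add: o_def has_real_derivative_iff_has_vector_derivative N_def)
  \<comment> \<open>The Euler-Lagrange equation differentiates the momentum along fixed directions,
    so its pairing with the moving velocity is differentiated component by component.\<close>
  have "((\<lambda>t. \<Sum>i\<in>Basis. (v t \<bullet> i) * M t i) has_real_derivative
      (\<Sum>i\<in>Basis. (v s \<bullet> i) * N i 0 + (a \<bullet> i) * N 0 i)) (at s)"
  proof (rule DERIV_sum)
    fix i :: 'e
    have "((\<lambda>t. v t \<bullet> i) has_real_derivative a \<bullet> i) (at s)"
      using bounded_linear.has_vector_derivative[OF bounded_linear_inner_left v]
      by (simp add: has_real_derivative_iff_has_vector_derivative)
    from DERIV_mult'[OF this el[of i]]
    show "((\<lambda>t. (v t \<bullet> i) * M t i) has_real_derivative (v s \<bullet> i) * N i 0 + (a \<bullet> i) * N 0 i) (at s)"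
      by (simp add: M_def N_def)
  qed
  also have "(\<Sum>i\<in>Basis. (v s \<bullet> i) * N i 0 + (a \<bullet> i) * N 0 i) = N (v s) 0 + N 0 a"
    using linear_euclidean_expand[OF linear_dL2[OF ys], of _ _ _ a]
      linear_euclidean_expand[OF linear_dL1[OF ys], of _ _ _ "v s"]
    by (simp add: N_def sum.distrib)
  also have "\<dots> = N (v s) a" unfolding N_def using dL_add[OF ys, of _ _ _ "v s" 0 0 a] by simp
  finally have A: "((\<lambda>t. \<Sum>i\<in>Basis. (v t \<bullet> i) * M t i) has_real_derivative N (v s) a) (at s)" .
  have ev: "\<forall>\<^sub>F t in nhds s. (\<Sum>i\<in>Basis. (v t \<bullet> i) * M t i) = (FR \<epsilon> (y t) (v t))\<^sup>2"
    using D
  proof eventually_elim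
    case (elim t)
    have "M t (v t) = (\<Sum>i\<in>Basis. (v t \<bullet> i) * M t i)"
      using linear_euclidean_expand[OF linear_dL2[OF elim], of _ _ _ "v t"] by (simp add: M_def)
    then show ?case using dL_self[OF \<epsilon> elim] by (simp add: M_def)
  qed
  have 2: "((\<lambda>t. (FR \<epsilon> (y t) (v t))\<^sup>2) has_real_derivative N (v s) a) (at s)"
    using A DERIV_cong_ev[OF refl ev refl] by simp
  \<comment> \<open>Homogeneity gives \<open>N (v s) a\<close> as derivative of the square, the
    chain rule gives the same number as derivative of half of the square; so it is zero.\<close>
  from DERIV_cdivide[OF this, of 2] have "N (v s) a / 2 = N (v s) a"
    using 1 DERIV_unique by blast
  then show ?thesis using 2 by simp
qed

end

section \<open>Periodic extension of loops and regularity at every parameter\<close>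

context manifold_atlas
begin

definition per :: "(real \<Rightarrow> 'm) \<Rightarrow> real \<Rightarrow> 'm" where "per \<gamma> t = \<gamma> (frac t)"

lemma per_add_int: "per \<gamma> (t + of_int k) = per \<gamma> t"
  by (simp add: per_def frac_def)

lemma per_eq:
  assumes "\<gamma> 0 = \<gamma> 1" "of_int k \<le> t" "t \<le> of_int k + 1"
  shows "per \<gamma> t = \<gamma> (t - of_int k)"
proof (cases "t = of_int k + 1")
  case True
  then show ?thesis using assms(1) by (simp add: per_def frac_def)
next
  case False
  then have "\<lfloor>t\<rfloor> = k" using assms by (intro floor_unique) auto
  then show ?thesis by (simp add: per_def frac_def)
qed

lemma smooth_into_shift:
  fixes s0 k :: real
  assumes "smooth_into \<A> {a..b} \<gamma>" "s0 \<in> {a..b}" "c \<in> \<A>" "\<gamma> s0 \<in> fst c"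
  shows "\<exists>e>0. \<exists>h. smooth_on h (ball (s0 + k) e) \<and>
    (\<forall>s\<in>ball (s0 + k) e. s - k \<in> {a..b} \<longrightarrow> \<gamma> (s - k) \<in> fst c \<and> snd c (\<gamma> (s - k)) = h s)"
proof -
  obtain W h where W: "open W" "s0 \<in> W" "\<gamma> ` ({a..b} \<inter> W) \<subseteq> fst c" "smooth_on h W"
    "h ` W \<subseteq> snd c ` fst c" "\<forall>y\<in>{a..b} \<inter> W. h y = snd c (\<gamma> y)"
    using smooth_into_chart[OF assms] .
  obtain e where e: "e > 0" "ball s0 e \<subseteq> W" using open_contains_ball W(1,2) by blast
  have in_W: "s - k \<in> W" if "s \<in> ball (s0 + k) e" for s
    using that by (intro subsetD[OF e(2)]) (auto simp: dist_real_def abs_if split: if_splits)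
  have "smooth_on (\<lambda>s. s + (- k)) (ball (s0 + k) e)"
    by (intro smooth_on_add smooth_on_ident smooth_on_const) auto
  moreover have "(\<lambda>s. s + (- k)) ` ball (s0 + k) e \<subseteq> W" using in_W by (simp add: image_subset_iff)
  ultimately have "smooth_on (\<lambda>s. h (s + (- k))) (ball (s0 + k) e)"
    by (intro smooth_on_compose[OF open_ball W(1) _ _ W(4)])
  then have "smooth_on (\<lambda>s. h (s - k)) (ball (s0 + k) e)" by simp
  then show ?thesis using e(1) in_W W(3,6) by (intro exI[of _ e] conjI exI[of _ "\<lambda>s. h (s - k)"]) auto
qed

lemma per_one_sided:
  assumes "piecewise_smooth \<A> \<gamma>" "\<gamma> 0 = \<gamma> 1" "c \<in> \<A>" "per \<gamma> t \<in> fst c"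
  obtains d hp hm where "d > 0" "smooth_on hp (ball t d)" "smooth_on hm (ball t d)"
    "\<forall>s\<in>{t..<t+d}. per \<gamma> s \<in> fst c \<and> snd c (per \<gamma> s) = hp s"
    "\<forall>s\<in>{t-d<..t}. per \<gamma> s \<in> fst c \<and> snd c (per \<gamma> s) = hm s"
proof -
  obtain P where P: "finite P" "\<And>a b. 0 \<le> a \<Longrightarrow> a < b \<Longrightarrow> b \<le> 1 \<Longrightarrow> {a<..<b} \<inter> P = {} \<Longrightarrow>
        smooth_into \<A> {a..b} \<gamma>"
    using assms(1) unfolding piecewise_smooth_def by blast
  have "\<exists>d>0. \<exists>hp. smooth_on hp (ball t d) \<and> (\<forall>s\<in>{t..<t+d}. per \<gamma> s \<in> fst c \<and> snd c (per \<gamma> s) = hp s)"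
  proof -
    define k s0 where "k = \<lfloor>t\<rfloor>" and "s0 = t - of_int \<lfloor>t\<rfloor>"
    have s0: "0 \<le> s0" "s0 < 1" "t = s0 + of_int k" unfolding k_def s0_def by linarith+
    have g: "\<gamma> s0 \<in> fst c" using assms(4) by (simp add: per_def frac_def s0_def)
    obtain e where e: "e > 0" "\<forall>t\<le>s0+e. {s0<..<t} \<inter> P = {}" using finite_gaps[OF P(1)] .
    define b where "b = min 1 (s0 + e)"
    have b: "s0 < b" "b \<le> 1" "b \<le> s0 + e" using s0 e by (auto simp: b_def)
    have "smooth_into \<A> {s0..b} \<gamma>" using s0 b e(2) by (intro P(2)) auto
    from smooth_into_shift[OF this _ assms(3) g, of "of_int k"] b
    obtain e' h where h: "e' > 0" "smooth_on h (ball t e')"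
      "\<forall>s\<in>ball t e'. s - of_int k \<in> {s0..b} \<longrightarrow> \<gamma> (s - of_int k) \<in> fst c \<and> snd c (\<gamma> (s - of_int k)) = h s"
      unfolding s0(3) by auto
    define d where "d = min e' (b - s0)"
    have d: "d > 0" "d \<le> e'" "d \<le> b - s0" using h(1) b by (auto simp: d_def)
    have "per \<gamma> s \<in> fst c \<and> snd c (per \<gamma> s) = h s" if "s \<in> {t..<t+d}" for s
    proof -
      have "per \<gamma> s = \<gamma> (s - of_int k)" using that d s0 b by (intro per_eq[OF assms(2)]) auto
      moreover have "s \<in> ball t e'" "s - of_int k \<in> {s0..b}" using that d s0 by (auto simp: dist_real_def)
      ultimately show ?thesis using h(3) by simp
    qed
    moreover have "smooth_on h (ball t d)" using h(2) d by (elim smooth_on_subset) auto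
    ultimately show ?thesis using d(1) by blast
  qed
  then obtain d1 hp where 1: "d1 > 0" "smooth_on hp (ball t d1)"
    "\<forall>s\<in>{t..<t+d1}. per \<gamma> s \<in> fst c \<and> snd c (per \<gamma> s) = hp s" by blast
  have "\<exists>d>0. \<exists>hm. smooth_on hm (ball t d) \<and> (\<forall>s\<in>{t-d<..t}. per \<gamma> s \<in> fst c \<and> snd c (per \<gamma> s) = hm s)"
  proof -
    \<comment> \<open>The ceiling minus one and not the floor: to the left of an integer
      \<open>t\<close> runs the final piece of the loop, so \<open>t\<close> must correspond to the
      parameter \<open>1\<close>.\<close>
    define k s0 where "k = \<lceil>t\<rceil> - 1" and "s0 = t - of_int (\<lceil>t\<rceil> - 1)"
    have s0: "0 < s0" "s0 \<le> 1" "t = s0 + of_int k" unfolding k_def s0_def by linarith+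
    have "per \<gamma> t = \<gamma> (t - of_int k)" using s0 by (intro per_eq[OF assms(2)]) auto
    then have g: "\<gamma> s0 \<in> fst c" using assms(4) s0 by simp
    obtain e where e: "e > 0" "\<forall>t\<ge>s0-e. {t<..<s0} \<inter> P = {}" using finite_gaps[OF P(1)] .
    define a where "a = max 0 (s0 - e)"
    have a: "a < s0" "0 \<le> a" "s0 - e \<le> a" using s0 e by (auto simp: a_def)
    have "smooth_into \<A> {a..s0} \<gamma>" using s0 a e(2) by (intro P(2)) auto
    from smooth_into_shift[OF this _ assms(3) g, of "of_int k"] a
    obtain e' h where h: "e' > 0" "smooth_on h (ball t e')"
      "\<forall>s\<in>ball t e'. s - of_int k \<in> {a..s0} \<longrightarrow> \<gamma> (s - of_int k) \<in> fst c \<and> snd c (\<gamma> (s - of_int k)) = h s"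
      unfolding s0(3) by auto
    define d where "d = min e' (s0 - a)"
    have d: "d > 0" "d \<le> e'" "d \<le> s0 - a" using h(1) a by (auto simp: d_def)
    have "per \<gamma> s \<in> fst c \<and> snd c (per \<gamma> s) = h s" if "s \<in> {t-d<..t}" for s
    proof -
      have "per \<gamma> s = \<gamma> (s - of_int k)" using that d s0 a by (intro per_eq[OF assms(2)]) auto
      moreover have "s \<in> ball t e'" "s - of_int k \<in> {a..s0}" using that d s0 by (auto simp: dist_real_def)
      ultimately show ?thesis using h(3) by simp
    qed
    moreover have "smooth_on h (ball t d)" using h(2) d by (elim smooth_on_subset) auto
    ultimately show ?thesis using d(1) by blast
  qed
  then obtain d2 hm where 2: "d2 > 0" "smooth_on hm (ball t d2)"
    "\<forall>s\<in>{t-d2<..t}. per \<gamma> s \<in> fst c \<and> snd c (per \<gamma> s) = hm s" by blast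
  show ?thesis
  proof (rule that[of "min d1 d2" hp hm])
    show "smooth_on hp (ball t (min d1 d2))" "smooth_on hm (ball t (min d1 d2))"
      using 1(2) 2(2) by (auto elim!: smooth_on_subset)
  qed (use 1 2 in auto)
qed

end

context riemannian_atlas
begin

lemma el_split:
  assumes "c \<in> \<A>" "y \<in> snd c ` fst c"
  shows "el_integrand c \<epsilon> y v (a *\<^sub>R u) (b *\<^sub>R u) = a * el_integrand c \<epsilon> y v u 0 + b * el_integrand c \<epsilon> y v 0 u"
  unfolding el_integrand_def by (rule metric_coords.dL_split[OF metric_coords[OF assms(1)] assms(2)])

lemma el_zero:
  assumes "c \<in> \<A>" "y \<in> snd c ` fst c"
  shows "el_integrand c \<epsilon> y v 0 0 = 0"
  unfolding el_integrand_def by (rule metric_coords.dL_0[OF metric_coords[OF assms(1)] assms(2)])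

text \<open>The window may contain the base point \<open>0\<close> of the loop, so that regularity holds there as well.\<close>

lemma randers_window_integral:
  assumes \<gamma>: "closed_geodesic \<A> (tangent_bundle \<A>) (randers g \<omega> \<epsilon>) \<gamma>" and \<epsilon>: "\<epsilon> > 0" and c: "c \<in> \<A>"
    and t: "0 \<le> t" "t + d < 1" "0 < d" "d < 1/2"
    and win: "\<And>s. s \<in> {t-d..t+d} \<Longrightarrow> per \<gamma> s \<in> fst c"
    and v: "\<And>s. s \<in> {t-d..t+d} \<Longrightarrow> s \<noteq> t \<Longrightarrow> ((\<lambda>s. snd c (per \<gamma> s)) has_vector_derivative v s) (at s)"
    and k: "k > 0" "t - d < t1" "t1 + k \<le> t2" "t2 + k < t + d"
  shows "((\<lambda>s. trapezoid t1 t2 k s * el_integrand c \<epsilon> (snd c (per \<gamma> s)) (v s) u 0 +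
     trapezoid' t1 t2 k s * el_integrand c \<epsilon> (snd c (per \<gamma> s)) (v s) 0 u) has_integral 0) {t-d..t+d}"
proof -
  have loop: "piecewise_smooth \<A> \<gamma>" "\<gamma> 0 = \<gamma> 1" "continuous_on {0..1} \<gamma>"
    using \<gamma> unfolding closed_geodesic_def loop_space_def piecewise_smooth_def by auto
  obtain P where P: "finite P" "\<And>a b. 0 \<le> a \<Longrightarrow> a < b \<Longrightarrow> b \<le> 1 \<Longrightarrow> {a<..<b} \<inter> P = {} \<Longrightarrow>
        smooth_into \<A> {a..b} \<gamma>"
    using loop(1) unfolding piecewise_smooth_def by blast
  let ?\<tau> = "trapezoid t1 t2 k" and ?\<tau>' = "trapezoid' t1 t2 k"
  let ?C = "{t1, t1 + k, t2, t2 + k}"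
  define B where "B = ?C \<union> (\<lambda>s. s + 1) ` ?C"
  define E where "E = P \<union> {0, 1, t} \<union> B"
  \<comment> \<open>For \<open>t < d\<close> the window reaches below \<open>0\<close>. The
    translated summand places that part of the test function near the end of [0,1], which makes the
    field periodic.\<close>
  define \<eta> where "\<eta> s = (?\<tau> s + ?\<tau> (s - 1)) *\<^sub>R u" for s
  define \<eta>' where "\<eta>' s = (?\<tau>' s + ?\<tau>' (s - 1)) *\<^sub>R u" for s
  define J where "J = ({t-d..t+d} \<inter> {0..1}) \<union> ({t-d+1..t+d+1} \<inter> {0..1})"
  define V where "V s = vector_derivative (snd c \<circ> \<gamma>) (at s)" for s
  note \<tau>0 = trapezoid_zero[OF k(1,3)]
  have \<tau>out: "?\<tau> s = 0" "?\<tau>' s = 0" if "s \<notin> {t-d..t+d}" for s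
    using \<tau>0[of s] that k by auto
  have perg: "per \<gamma> s = \<gamma> s" if "s \<in> {0..1}" for s using per_eq[OF loop(2), of 0 s] that by simp
  have per1: "per \<gamma> (s - 1) = \<gamma> s" if "s \<in> {0..1}" for s using per_eq[OF loop(2), of "-1" "s - 1"] that by simp
  have I: "((\<lambda>s. if \<gamma> s \<in> fst c then el_integrand c \<epsilon> (snd c (\<gamma> s)) (V s) (\<eta> s) (\<eta>' s) else 0) has_integral 0) {0..1}"
    (is "(?i has_integral 0) {0..1}")
  proof (rule randers_test_integral[OF \<gamma> \<epsilon> c, where B=B and J=J and E=E])
    show "finite B" "finite E" using P(1) by (auto simp: B_def E_def)
    show "\<exists>\<alpha> \<beta>. \<forall>s\<in>{a..b}. \<eta> s = \<alpha> + s *\<^sub>R \<beta>" if ab: "a < b" "{a<..<b} \<inter> B = {}" for a b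
    proof -
      have "?C \<inter> {a<..<b} = {}" using ab(2) unfolding B_def by blast
      from trapezoid_affine[OF k(1) this ab(1)] obtain \<alpha> \<beta> where 1: "\<forall>s\<in>{a..b}. ?\<tau> s = \<alpha> + s * \<beta>" by blast
      have "?C \<inter> {a-1<..<b-1} = {}"
      proof -
        have "x + 1 \<in> {a<..<b} \<inter> B" if "x \<in> ?C" "x \<in> {a-1<..<b-1}" for x using that unfolding B_def by auto
        then show ?thesis using ab(2) by blast
      qed
      from trapezoid_affine[OF k(1) this] ab(1) obtain \<alpha>' \<beta>' where 2: "\<forall>s\<in>{a-1..b-1}. ?\<tau> s = \<alpha>' + s * \<beta>'" by auto
      have "\<eta> s = (\<alpha> + \<alpha>' - \<beta>') *\<^sub>R u + s *\<^sub>R ((\<beta> + \<beta>') *\<^sub>R u)" if "s \<in> {a..b}" for s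
      proof -
        have *: "?\<tau> s = \<alpha> + s * \<beta>" "?\<tau> (s - 1) = \<alpha>' + (s - 1) * \<beta>'" using 1 2 that by auto
        show ?thesis unfolding \<eta>_def * by (simp add: algebra_simps)
      qed
      then show ?thesis by blast
    qed
    show "continuous_on {0..1} \<eta>"
    proof -
      have *: "trapezoid t1 t2 k (s - 1) = ramp k (s - (t1 + 1)) - ramp k (s - (t2 + 1))" for s
        by (simp add: trapezoid_def algebra_simps)
      show ?thesis unfolding \<eta>_def * unfolding trapezoid_def
        by (intro continuous_on_scaleR continuous_on_add continuous_on_diff continuous_on_ramp continuous_on_const)
    qed
    show "\<eta> 0 = \<eta> 1" using \<tau>out[of "-1"] \<tau>out[of 1] t by (simp add: \<eta>_def)
    show "compact J" "J \<subseteq> {0..1}" unfolding J_def by (auto intro!: compact_Un closed_Int_compact)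
    show "\<gamma> ` J \<subseteq> fst c"
    proof
      fix p assume "p \<in> \<gamma> ` J"
      then obtain s where s: "p = \<gamma> s" "s \<in> {0..1}" "s \<in> {t-d..t+d} \<or> s - 1 \<in> {t-d..t+d}" by (auto simp: J_def)
      then show "p \<in> fst c" using win[of s] win[of "s - 1"] perg per1 by auto
    qed
    show "\<eta> s = 0" if "s \<in> {0..1}" "s \<notin> J" for s
    proof -
      have "s \<notin> {t-d..t+d}" "s - 1 \<notin> {t-d..t+d}" using that by (auto simp: J_def)
      then show ?thesis using \<tau>out by (simp add: \<eta>_def)
    qed
    show "((snd c \<circ> \<gamma>) has_vector_derivative V s) (at s)" if s: "s \<in> {0..1} - E" "\<gamma> s \<in> fst c" for s
    proof -
      obtain e where e: "e > 0" "\<forall>t\<le>s+e. {s<..<t} \<inter> P = {}" "\<forall>t\<ge>s-e. {t<..<s} \<inter> P = {}"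
        using finite_gaps[OF P(1)] .
      have s01: "0 < s" "s < 1" "s \<notin> P" using s by (auto simp: E_def)
      define a b where "a = max 0 (s - e)" and "b = min 1 (s + e)"
      have ab: "0 \<le> a" "a < s" "s < b" "b \<le> 1" "s - e \<le> a" "b \<le> s + e" using s01 e(1) by (auto simp: a_def b_def)
      have "{a<..<b} \<inter> P = {}"
      proof -
        have "{a<..<b} = {a<..<s} \<union> {s} \<union> {s<..<b}" using ab by auto
        then show ?thesis using e(2,3) ab s01(3) by auto
      qed
      then have "smooth_into \<A> {a..b} \<gamma>" using ab by (intro P(2)) auto
      from smooth_into_shift[OF this _ c s(2), of 0] ab
      obtain e' h where h: "e' > 0" "smooth_on h (ball s e')"
        "\<forall>t\<in>ball s e'. t \<in> {a..b} \<longrightarrow> snd c (\<gamma> t) = h t" by auto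
      have "(h has_vector_derivative frechet_derivative h (at s) 1) (at s)"
        using h(1) by (intro smooth_on_has_vector_derivative[OF h(2)]) auto
      then have "((snd c \<circ> \<gamma>) has_vector_derivative frechet_derivative h (at s) 1) (at s)"
        by (rule has_vector_derivative_transform_within_open[where S="ball s e' \<inter> {a<..<b}"])
          (use h ab in auto)
      then show ?thesis unfolding V_def using vector_derivative_at by metis
    qed
    show "(\<eta> has_vector_derivative \<eta>' s) (at s)" if s: "s \<in> {0..1} - E" for s
    proof -
      have "s \<notin> ?C" "s - 1 \<notin> ?C"
        using s unfolding E_def B_def by (auto simp: image_iff algebra_simps)
      then have "(?\<tau> has_vector_derivative ?\<tau>' s) (at s)" "(?\<tau> has_vector_derivative ?\<tau>' (s - 1)) (at (s - 1))"
        using trapezoid_has_derivative[OF k(1)] by (auto simp: has_real_derivative_iff_has_vector_derivative)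
      then have "((\<lambda>s. ?\<tau> s + ?\<tau> (s - 1)) has_vector_derivative ?\<tau>' s + ?\<tau>' (s - 1)) (at s)"
        by (intro has_vector_derivative_add has_vector_derivative_shift)
      from bounded_linear.has_vector_derivative[OF bounded_linear_scaleR_left this, of u]
      show ?thesis by (simp add: \<eta>_def[abs_def] \<eta>'_def)
    qed
  qed
  define f where "f s = ?\<tau> s * el_integrand c \<epsilon> (snd c (per \<gamma> s)) (v s) u 0 +
     ?\<tau>' s * el_integrand c \<epsilon> (snd c (per \<gamma> s)) (v s) 0 u" for s
  define F where "F s = (if s \<in> {t-d..t+d} then f s else 0)" for s
  \<comment> \<open>A cut in the gap between the window and its translate by \<open>1\<close>.
    Moving \<open>[m, 1]\<close> back by \<open>1\<close> turns [0,1] into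
    \<open>[m - 1, m]\<close>, which contains the whole window.\<close>
  define m where "m = (max (t + d) 0 + min 1 (1 + t - d)) / 2"
  have m: "t + d < m" "0 < m" "m < 1" "m < 1 + t - d"
    using t unfolding m_def by (auto simp: max_def min_def field_simps)
  have Fi: "F s' = ?i s" if s: "s \<in> {0..1} - E" and s': "(s' = s \<and> s \<le> m) \<or> (s' = s - 1 \<and> m \<le> s)" for s s'
  proof -
    have s01: "0 < s" "s < 1" "s \<noteq> t" using s by (auto simp: E_def)
    have pers: "per \<gamma> s' = \<gamma> s" using s' s perg per1 by auto
    have e: "\<eta> s = ?\<tau> s' *\<^sub>R u" "\<eta>' s = ?\<tau>' s' *\<^sub>R u"
      using s' \<tau>out[of s] \<tau>out[of "s - 1"] m by (auto simp: \<eta>_def \<eta>'_def)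
    show ?thesis
    proof (cases "s' \<in> {t-d..t+d}")
      case True
      then have g: "\<gamma> s \<in> fst c" using win pers by metis
      have "s' \<noteq> t" using s' s01 t by auto
      note dv = v[OF True this]
      have "((snd c \<circ> \<gamma>) has_vector_derivative v s') (at s)"
        using s'
      proof
        assume a: "s' = s \<and> s \<le> m"
        with dv have "((\<lambda>s. snd c (per \<gamma> s)) has_vector_derivative v s') (at s)" by simp
        then show ?thesis
          by (rule has_vector_derivative_transform_within_open[where S="{0<..<1}"]) (use s01 perg in auto)
      next
        assume a: "s' = s - 1 \<and> m \<le> s"
        with dv have "((\<lambda>s. snd c (per \<gamma> s)) has_vector_derivative v s') (at (s - 1))" by simp
        from has_vector_derivative_shift[OF this] show ?thesis
          by (rule has_vector_derivative_transform_within_open[where S="{0<..<1}"]) (use s01 per1 in auto)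
      qed
      then have "V s = v s'" unfolding V_def by (rule vector_derivative_at)
      then show ?thesis
        using True g el_split[OF c, of "snd c (\<gamma> s)"] by (simp add: F_def f_def pers e)
    next
      case False
      then show ?thesis using \<tau>out[OF False] el_zero[OF c, of "snd c (\<gamma> s)"] by (auto simp: F_def e)
    qed
  qed
  have Efin: "negligible E" using P(1) by (intro negligible_finite) (auto simp: E_def B_def)
  have Ii: "?i integrable_on {0..1}" using I by blast
  have I1: "(?i has_integral integral {0..m} ?i) {0..m}" and I2: "(?i has_integral integral {m..1} ?i) {m..1}"
    using m by (auto intro!: integrable_integral integrable_subinterval_real[OF Ii])
  have sum0: "integral {0..m} ?i + integral {m..1} ?i = 0"
    using Henstock_Kurzweil_Integration.integral_combine[OF _ _ Ii, of m] m integral_unique[OF I] by simp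
  have F1: "(F has_integral integral {0..m} ?i) {0..m}"
    by (rule has_integral_spike[OF Efin _ I1]) (use m Fi in auto)
  have "((\<lambda>s. F (s - 1)) has_integral integral {m..1} ?i) {m..1}"
    by (rule has_integral_spike[OF Efin _ I2]) (use m Fi in auto)
  from has_integral_affinity[where m=1 and c=1, OF this[folded cbox_interval]]
  have F2: "(F has_integral integral {m..1} ?i) {m-1..0}"
    by (simp add: image_add_atLeastAtMost[of "-1"] algebra_simps)
  have "(F has_integral (integral {m..1} ?i + integral {0..m} ?i)) {m-1..m}"
    by (rule has_integral_combine[OF _ _ F2 F1]) (use m in auto)
  then have "(F has_integral 0) {m-1..m}" using sum0 by (simp add: add.commute)
  moreover have "{t-d..t+d} \<subseteq> {m-1..m}" using m by auto
  ultimately have "(f has_integral 0) {t-d..t+d}"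
    using has_integral_restrict[of "{t-d..t+d}" "{m-1..m}" f 0] unfolding F_def by blast
  then show ?thesis by (simp add: f_def[abs_def])
qed

text \<open>Du Bois-Reymond, applied in every direction \<open>u\<close>, shows that the momentum
  does not jump at \<open>t\<close> and obeys the Euler-Lagrange equation. By \<open>dL_inj\<close>
  the velocity does not jump either, so the curve is C^1 across \<open>t\<close> and its speed is
  conserved.\<close>

lemma randers_regular_local:
  assumes \<gamma>: "closed_geodesic \<A> (tangent_bundle \<A>) (randers g \<omega> \<epsilon>) \<gamma>" and \<epsilon>: "\<epsilon> > 0" and c: "c \<in> \<A>"
    and t: "0 \<le> t" "t < 1" and ct: "per \<gamma> t \<in> fst c"
  defines "Y \<equiv> \<lambda>s. snd c (per \<gamma> s)"
  shows "\<exists>d>0. \<exists>v. \<forall>s\<in>{t-d<..<t+d}. per \<gamma> s \<in> fst c \<and> (Y has_vector_derivative v s) (at s) \<and>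
    metric_coords.FR (Gc c) (wc c) \<epsilon> (Y s) (v s) = metric_coords.FR (Gc c) (wc c) \<epsilon> (Y t) (v t) \<and>
    (\<forall>u. ((\<lambda>s. el_integrand c \<epsilon> (Y s) (v s) 0 u) has_real_derivative el_integrand c \<epsilon> (Y s) (v s) u 0) (at s))"
proof -
  interpret M: metric_coords "snd c ` fst c" "Gc c" "wc c" by (rule metric_coords[OF c])
  have loop: "piecewise_smooth \<A> \<gamma>" "\<gamma> 0 = \<gamma> 1"
    using \<gamma> unfolding closed_geodesic_def loop_space_def by auto
  obtain d0 hp hm where d0: "d0 > 0" and sm: "smooth_on hp (ball t d0)" "smooth_on hm (ball t d0)"
    and hp: "\<forall>s\<in>{t..<t+d0}. per \<gamma> s \<in> fst c \<and> snd c (per \<gamma> s) = hp s"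
    and hm: "\<forall>s\<in>{t-d0<..t}. per \<gamma> s \<in> fst c \<and> snd c (per \<gamma> s) = hm s"
    using per_one_sided[OF loop c ct] .
  define d where "d = min (d0 / 2) (min (1/4) ((1 - t) / 2))"
  have d: "0 < d" "d < d0" "d < 1/2" "t + d < 1" using d0 t unfolding d_def by (auto simp: min_def field_simps)
  define hp' where "hp' s = frechet_derivative hp (at s) 1" for s
  define hm' where "hm' s = frechet_derivative hm (at s) 1" for s
  \<comment> \<open>At \<open>t\<close> the right-hand velocity is taken until the two one-sided
    velocities are known to agree.\<close>
  define v where "v s = (if s < t then hm' s else hp' s)" for s
  have sm': "smooth_on hp' (ball t d0)" "smooth_on hm' (ball t d0)"
    unfolding hp'_def hm'_def by (intro smooth_on_frechet_derivative sm)+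
  have in_ball: "s \<in> ball t d0" if "s \<in> {t-d..t+d}" for s using that d by (auto simp: dist_real_def)
  have win: "per \<gamma> s \<in> fst c" if "s \<in> {t-d..t+d}" for s
    using bspec[OF hp, of s] bspec[OF hm, of s] that d by (cases "s < t") auto
  have YD: "Y s \<in> snd c ` fst c" if "s \<in> {t-d..t+d}" for s unfolding Y_def using win[OF that] by simp
  have Yp: "Y s = hp s" "v s = hp' s" if "s \<in> {t..t+d}" for s
    using bspec[OF hp, of s] that d by (auto simp: Y_def v_def)
  have Ym: "Y s = hm s" if "s \<in> {t-d..t}" for s
    using bspec[OF hm, of s] that d by (auto simp: Y_def)
  have vm: "v s = hm' s" if "s \<in> {t-d..<t}" for s using that by (auto simp: v_def)
  have hpd: "(hp has_vector_derivative hp' s) (at s)" "(hm has_vector_derivative hm' s) (at s)"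
    if "s \<in> {t-d..t+d}" for s
    unfolding hp'_def hm'_def
    by (rule smooth_on_has_vector_derivative[OF sm(1) in_ball[OF that]])
      (rule smooth_on_has_vector_derivative[OF sm(2) in_ball[OF that]])
  have Yd: "(Y has_vector_derivative v s) (at s)" if "s \<in> {t-d..t+d}" "s \<noteq> t" for s
  proof (cases "s < t")
    case True
    have "(hm has_vector_derivative hm' s) (at s)" using hpd that by blast
    then have "(Y has_vector_derivative hm' s) (at s)"
      by (rule has_vector_derivative_transform_within_open[where S="{t-d0<..<t}"])
        (use True that d hm in \<open>auto simp: Y_def\<close>)
    then show ?thesis using True by (simp add: v_def)
  next
    case False
    have "(hp has_vector_derivative hp' s) (at s)" using hpd that by blast
    then have "(Y has_vector_derivative hp' s) (at s)"
      by (rule has_vector_derivative_transform_within_open[where S="{t<..<t+d0}"])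
        (use False that d hp in \<open>auto simp: Y_def\<close>)
    then show ?thesis using False by (simp add: v_def)
  qed
  have sub: "{t..t+d} \<subseteq> ball t d0" "{t-d..t} \<subseteq> ball t d0" using in_ball d(1) by auto
  note ch = smooth_on_imp_continuous_on[OF sm(1)] smooth_on_imp_continuous_on[OF sm(2)]
    smooth_on_imp_continuous_on[OF sm'(1)] smooth_on_imp_continuous_on[OF sm'(2)]
  note chp = continuous_on_subset[OF ch(1) sub(1)] continuous_on_subset[OF ch(3) sub(1)]
  note chm = continuous_on_subset[OF ch(2) sub(2)] continuous_on_subset[OF ch(4) sub(2)]
  have hpD: "hp ` {t..t+d} \<subseteq> snd c ` fst c" and hmD: "hm ` {t-d..t} \<subseteq> snd c ` fst c"
  proof -
    have "hp s \<in> snd c ` fst c" if "s \<in> {t..t+d}" for s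
      using Yp(1)[OF that] YD[of s] that d(1) by auto
    then show "hp ` {t..t+d} \<subseteq> snd c ` fst c" by blast
    have "hm s \<in> snd c ` fst c" if "s \<in> {t-d..t}" for s
      using Ym[OF that] YD[of s] that d(1) by auto
    then show "hm ` {t-d..t} \<subseteq> snd c ` fst c" by blast
  qed
  have cp: "continuous_on {t..t+d} (\<lambda>s. el_integrand c \<epsilon> (hp s) (hp' s) a b)" for a b
    unfolding el_integrand_def by (intro M.continuous_on_dL_FR[OF \<epsilon> chp(1) hpD chp(2)] continuous_on_const)
  have cm: "continuous_on {t-d..t} (\<lambda>s. el_integrand c \<epsilon> (hm s) (hm' s) a b)" for a b
    unfolding el_integrand_def by (intro M.continuous_on_dL_FR[OF \<epsilon> chm(1) hmD chm(2)] continuous_on_const)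
  have cp': "continuous_on {t..t+d} (\<lambda>s. el_integrand c \<epsilon> (Y s) (v s) a b)" for a b
    by (rule continuous_on_eq[OF cp]) (simp add: Yp)
  define f where "f u s = el_integrand c \<epsilon> (Y s) (v s) u 0" for u s
  define h where "h u s = el_integrand c \<epsilon> (Y s) (v s) 0 u" for u s
  have DB: "h u t2 - h u t1 = integral {t1..t2} (f u)" "f u integrable_on {t-d..t+d}"
    if "t - d < t1" "t1 < t2" "t2 < t + d" for u t1 t2
  proof -
    have test: "((\<lambda>s. trapezoid t1 t2 k s * f u s + trapezoid' t1 t2 k s * h u s) has_integral 0) {t-d..t+d}"
      if "k > 0" "t - d < t1" "t1 + k \<le> t2" "t2 + k < t + d" for t1 t2 k
      unfolding f_def h_def Y_def
      by (rule randers_window_integral[OF \<gamma> \<epsilon> c t(1) d(4,1,3) win _ that]) (use Yd in \<open>auto simp: Y_def\<close>)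
    have c1: "continuous_on {t..t+d} (f u)" "continuous_on {t..t+d} (h u)"
      unfolding f_def[abs_def] h_def[abs_def] by (rule cp')+
    have e: "f u s = el_integrand c \<epsilon> (hm s) (hm' s) u 0" "h u s = el_integrand c \<epsilon> (hm s) (hm' s) 0 u"
      if "s \<in> {t-d..<t}" for s
      using Ym[of s] vm[OF that] that by (auto simp: f_def h_def)
    show "h u t2 - h u t1 = integral {t1..t2} (f u)"
      by (rule du_bois_reymond(1)[OF d(1) c1 cm cm e(1) e(2) test that])
    show "f u integrable_on {t-d..t+d}"
      by (rule du_bois_reymond(2)[OF d(1) c1 cm cm e(1) e(2) test that])
  qed
  have fi: "f u integrable_on {t-d..t+d}" for u
    using DB(2)[of "t - d/2" t u] d(1) by simp
  \<comment> \<open>To the left of \<open>t\<close> the sum \<open>q\<close> is constantly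
    \<open>h u t\<close>. Being built from the left-hand extensions it is continuous up to
    \<open>t\<close>, where the integral disappears and the left-hand momentum remains.\<close>
  have jump: "el_integrand c \<epsilon> (Y t) (hm' t) 0 u = el_integrand c \<epsilon> (Y t) (hp' t) 0 u" for u
  proof -
    define q where "q s = el_integrand c \<epsilon> (hm s) (hm' s) 0 u + integral {s..t} (f u)" for s
    have "f u integrable_on {t-d..t}" by (rule integrable_subinterval_real[OF fi]) (use d(1) in auto)
    then have "continuous_on {t-d..t} q"
      unfolding q_def by (intro continuous_on_add cm indefinite_integral_continuous_1')
    then have "continuous_on (closure {t-d<..<t}) q" using d(1) by simp
    moreover have "q s = h u t" if "s \<in> {t-d<..<t}" for s
      using DB(1)[of s t u] that d(1) Ym[of s] vm[of s] by (simp add: q_def h_def)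
    moreover have "t \<in> closure {t-d<..<t}" using d(1) by simp
    ultimately have "q t = h u t" by (rule continuous_constant_on_closure)
    then show ?thesis using Ym[of t] Yp(2)[of t] d(1) by (simp add: q_def h_def)
  qed
  have vt: "hm' t = hp' t"
    by (rule M.dL_inj[OF \<epsilon> YD[of t]]) (use jump d(1) in \<open>auto simp: el_integrand_def\<close>)
  have vm': "v s = hm' s" if "s \<in> {t-d..t}" for s using that vt by (cases "s = t") (auto simp: v_def)
  have win_Un: "{t-d..t+d} = {t-d..t} \<union> {t..t+d}" using d(1) by auto
  have cY: "continuous_on {t-d..t+d} Y" unfolding win_Un
    by (intro continuous_on_closed_Un closed_atLeastAtMost continuous_on_eq[OF chm(1)] continuous_on_eq[OF chp(1)])
      (simp_all add: Ym Yp)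
  have cv: "continuous_on {t-d..t+d} v" unfolding win_Un
    by (intro continuous_on_closed_Un closed_atLeastAtMost continuous_on_eq[OF chm(2)] continuous_on_eq[OF chp(2)])
      (simp_all add: vm' Yp)
  have YDi: "Y ` {t-d..t+d} \<subseteq> snd c ` fst c" using YD by blast
  have Ydt: "(Y has_vector_derivative v t) (at t)"
  proof -
    have tw: "t \<in> {t-d..t+d}" using d(1) by simp
    have "(hm has_vector_derivative v t) (at t within {t-d..t})"
      using has_vector_derivative_at_within[OF hpd(2)[OF tw]] vt by (simp add: v_def)
    then have 1: "(Y has_vector_derivative v t) (at t within {t-d..t})"
      by (rule has_vector_derivative_transform[rotated -1]) (use Ym d(1) in auto)
    have "(hp has_vector_derivative v t) (at t within {t..t+d})"
      using has_vector_derivative_at_within[OF hpd(1)[OF tw]] by (simp add: v_def)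
    then have 2: "(Y has_vector_derivative v t) (at t within {t..t+d})"
      by (rule has_vector_derivative_transform[rotated -1]) (use Yp d(1) in auto)
    from has_vector_derivative_Un[OF 1 2] show ?thesis
      unfolding win_Un[symmetric] using at_within_Icc_at[of "t-d" t "t+d"] d(1) by simp
  qed
  have Yd': "(Y has_vector_derivative v s) (at s)" if "s \<in> {t-d..t+d}" for s
    using Yd[OF that] Ydt by (cases "s = t") auto
  have cf: "continuous_on {t-d..t+d} (f u)" for u
    unfolding f_def el_integrand_def
    by (intro M.continuous_on_dL_FR[OF \<epsilon> cY YDi cv] continuous_on_const)
  have hd: "(h u has_real_derivative f u s) (at s)" if s: "s \<in> {t-d<..<t+d}" for s u
  proof -
    define t1 where "t1 = (t - d + s) / 2"
    have t1: "t - d < t1" "t1 < s" using s unfolding t1_def by (auto simp: field_simps)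
    have "continuous_on {t1..t+d} (f u)" using t1 by (intro continuous_on_subset[OF cf]) auto
    then have "((\<lambda>x. integral {t1..x} (f u)) has_real_derivative f u s) (at s within {t1..t+d})"
      using s t1 by (intro integral_has_real_derivative) auto
    then have "((\<lambda>x. integral {t1..x} (f u)) has_real_derivative f u s) (at s)"
      using at_within_Icc_at[of t1 s "t+d"] s t1 by simp
    from DERIV_add[OF DERIV_const[of "h u t1"] this]
    have "((\<lambda>x. h u t1 + integral {t1..x} (f u)) has_real_derivative f u s) (at s)" by simp
    then show ?thesis
      by (rule has_field_derivative_transform_within_open[where S="{t1<..<t+d}"])
        (use s t1 DB(1)[of t1 _ u] in \<open>auto simp: algebra_simps\<close>)
  qed
  have F: "M.FR \<epsilon> (Y s) (v s) = M.FR \<epsilon> (Y t) (v t)" if s: "s \<in> {t-d..t+d}" for s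
  proof -
    define E where "E s = (M.FR \<epsilon> (Y s) (v s))\<^sup>2" for s
    have cE: "continuous_on {t-d..t+d} E"
      unfolding E_def by (intro continuous_on_power M.continuous_on_FR cY cv YDi)
    \<comment> \<open>At \<open>t\<close> itself the velocity is known to be continuous but not
      differentiable. Constancy of \<open>E\<close> across \<open>t\<close> comes from
      continuity.\<close>
    have dE: "(E has_real_derivative 0) (at r)" if r: "r \<in> {t-d<..<t+d}" "r \<noteq> t" for r
      unfolding E_def
    proof (rule M.FR_square_derivative_zero[OF \<epsilon>])
      have rr: "r \<in> {t-d..t+d}" using r by auto
      show "\<forall>\<^sub>F s in nhds r. Y s \<in> snd c ` fst c"
        by (rule eventually_mono[OF eventually_nhds_in_open[of "{t-d<..<t+d}"]]) (use r YD in auto)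
      show "(Y has_vector_derivative v r) (at r)" by (rule Yd'[OF rr])
      show "(v has_vector_derivative
          (if r < t then frechet_derivative hm' (at r) 1 else frechet_derivative hp' (at r) 1)) (at r)"
      proof (cases "r < t")
        case True
        have "(hm' has_vector_derivative frechet_derivative hm' (at r) 1) (at r)"
          by (rule smooth_on_has_vector_derivative[OF sm'(2) in_ball[OF rr]])
        then have "(v has_vector_derivative frechet_derivative hm' (at r) 1) (at r)"
          by (rule has_vector_derivative_transform_within_open[where S="{..<t}"]) (use True in \<open>auto simp: v_def\<close>)
        then show ?thesis using True by simp
      next
        case False
        have "(hp' has_vector_derivative frechet_derivative hp' (at r) 1) (at r)"
          by (rule smooth_on_has_vector_derivative[OF sm'(1) in_ball[OF rr]])
        then have "(v has_vector_derivative frechet_derivative hp' (at r) 1) (at r)"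
          by (rule has_vector_derivative_transform_within_open[where S="{t<..}"]) (use False r in \<open>auto simp: v_def\<close>)
        then show ?thesis using False by simp
      qed
      show "((\<lambda>s. M.dL (M.FR \<epsilon> (Y s) (v s)) (M.RR \<epsilon> (Y s) (v s)) (Y s) (v s) 0 u) has_real_derivative
        M.dL (M.FR \<epsilon> (Y r) (v r)) (M.RR \<epsilon> (Y r) (v r)) (Y r) (v r) u 0) (at r)" for u
        using hd[OF r(1), of u] by (simp add: h_def[abs_def] f_def el_integrand_def)
    qed
    have const: "E x = E (t - d)" if "x \<in> {t-d..t+d}" for x
    proof (rule has_derivative_zero_unique_strong_interval[of "{t-d, t, t+d}" "t-d" "t+d" E])
      show "(E has_derivative (\<lambda>h. 0)) (at r within {t-d..t+d})" if "r \<in> {t-d..t+d} - {t-d, t, t+d}" for r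
      proof -
        have "(E has_derivative (*) 0) (at r)" using dE[of r] that by (auto simp: has_field_derivative_def)
        moreover have "(*) (0::real) = (\<lambda>h. 0)" by (rule ext) simp
        ultimately show ?thesis by (metis has_derivative_at_withinI)
      qed
    qed (use cE that in auto)
    have "E s = E t" using const[OF s] const[of t] d(1) by simp
    moreover have "M.FR \<epsilon> (Y s) (v s) \<ge> 0" "M.FR \<epsilon> (Y t) (v t) \<ge> 0"
      using M.FR_root(3)[OF \<epsilon> YD] s d(1) by auto
    ultimately show ?thesis unfolding E_def by (simp add: power2_eq_iff_nonneg)
  qed
  show ?thesis
  proof (rule exI[of _ d], rule conjI[OF d(1)], rule exI[of _ v], rule ballI, intro conjI allI)
    fix s assume s: "s \<in> {t-d<..<t+d}"
    then have s': "s \<in> {t-d..t+d}" by simp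
    show "per \<gamma> s \<in> fst c" by (rule win[OF s'])
    show "(Y has_vector_derivative v s) (at s)" by (rule Yd'[OF s'])
    show "M.FR \<epsilon> (Y s) (v s) = M.FR \<epsilon> (Y t) (v t)" by (rule F[OF s'])
    show "((\<lambda>s. el_integrand c \<epsilon> (Y s) (v s) 0 u) has_real_derivative el_integrand c \<epsilon> (Y s) (v s) u 0) (at s)" for u
      using hd[OF s, of u] unfolding h_def[abs_def] f_def .
  qed
qed

definition FRc where "FRc c = metric_coords.FR (Gc c) (wc c)"

lemma per_velocity:
  assumes c: "c \<in> \<A>" and s: "s \<in> {a<..<b}" "\<And>r. r \<in> {a<..<b} \<Longrightarrow> per \<gamma> r \<in> fst c"
    and v: "((\<lambda>s. snd c (per \<gamma> s)) has_vector_derivative v) (at s)"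
  shows "velocity \<A> (per \<gamma>) s (at s) = tvec \<A> c (per \<gamma> s) v"
proof (rule velocity_eq[OF c])
  show "\<forall>\<^sub>F t in at s. per \<gamma> t \<in> fst c"
    by (rule eventually_at_filter[THEN iffD2], rule eventually_mono[OF eventually_nhds_in_open[of "{a<..<b}"]])
      (use s in auto)
qed (use s v in \<open>auto simp: o_def\<close>)

text \<open>Integer shifts reduce every parameter to [0,1), where the local result applies. The
  speed \<open>Sp\<close>, written without charts, is then locally constant on the line, hence
  constant, and equals its integral over [0,1], which is the length.\<close>

lemma randers_regular:
  assumes \<gamma>: "closed_geodesic \<A> (tangent_bundle \<A>) (randers g \<omega> \<epsilon>) \<gamma>" and \<epsilon>: "\<epsilon> > 0"
  defines "\<Delta> \<equiv> curve_length \<A> (randers g \<omega> \<epsilon>) \<gamma>"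
  shows "\<Delta> \<ge> 0"
    and "\<And>c t. c \<in> \<A> \<Longrightarrow> per \<gamma> t \<in> fst c \<Longrightarrow>
      \<exists>d>0. \<exists>v. \<forall>s\<in>{t-d<..<t+d}. per \<gamma> s \<in> fst c \<and> ((\<lambda>s. snd c (per \<gamma> s)) has_vector_derivative v s) (at s) \<and>
      FRc c \<epsilon> (snd c (per \<gamma> s)) (v s) = \<Delta> \<and>
      (\<forall>u. ((\<lambda>s. el_integrand c \<epsilon> (snd c (per \<gamma> s)) (v s) 0 u) has_real_derivative
         el_integrand c \<epsilon> (snd c (per \<gamma> s)) (v s) u 0) (at s))"
proof -
  have loop: "piecewise_smooth \<A> \<gamma>" "\<gamma> 0 = \<gamma> 1"
    using \<gamma> unfolding closed_geodesic_def loop_space_def by auto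
  have local: "\<exists>d>0. \<exists>v. \<forall>s\<in>{t-d<..<t+d}. per \<gamma> s \<in> fst c \<and>
      ((\<lambda>s. snd c (per \<gamma> s)) has_vector_derivative v s) (at s) \<and>
      FRc c \<epsilon> (snd c (per \<gamma> s)) (v s) = FRc c \<epsilon> (snd c (per \<gamma> t)) (v t) \<and>
      (\<forall>u. ((\<lambda>s. el_integrand c \<epsilon> (snd c (per \<gamma> s)) (v s) 0 u) has_real_derivative
         el_integrand c \<epsilon> (snd c (per \<gamma> s)) (v s) u 0) (at s))"
    if c: "c \<in> \<A>" and ct: "per \<gamma> t \<in> fst c" for c t
  proof -
    define k where "k = \<lfloor>t\<rfloor>"
    define t' where "t' = t - of_int k"
    have t': "0 \<le> t'" "t' < 1" "t = t' + of_int k" unfolding t'_def k_def by linarith+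
    have pk: "per \<gamma> (s - of_int k) = per \<gamma> s" for s using per_add_int[of \<gamma> s "-k"] by simp
    have "per \<gamma> t' \<in> fst c" using ct pk[of t] by (simp add: t'_def)
    from randers_regular_local[OF \<gamma> \<epsilon> c t'(1,2) this]
    obtain d v where d: "d > 0" and v: "\<forall>s\<in>{t'-d<..<t'+d}. per \<gamma> s \<in> fst c \<and>
      ((\<lambda>s. snd c (per \<gamma> s)) has_vector_derivative v s) (at s) \<and>
      metric_coords.FR (Gc c) (wc c) \<epsilon> (snd c (per \<gamma> s)) (v s) = metric_coords.FR (Gc c) (wc c) \<epsilon> (snd c (per \<gamma> t')) (v t') \<and>
      (\<forall>u. ((\<lambda>s. el_integrand c \<epsilon> (snd c (per \<gamma> s)) (v s) 0 u) has_real_derivative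
         el_integrand c \<epsilon> (snd c (per \<gamma> s)) (v s) u 0) (at s))"
      by (elim exE conjE)
    show ?thesis
    proof (rule exI[of _ d], rule conjI[OF d], rule exI[of _ "\<lambda>s. v (s - of_int k)"], rule ballI)
      fix s assume "s \<in> {t-d<..<t+d}"
      then have "s - of_int k \<in> {t'-d<..<t'+d}" using t'(3) by auto
      note vs = bspec[OF v this]
      have 1: "((\<lambda>s. snd c (per \<gamma> s)) has_vector_derivative v (s - of_int k)) (at s)"
        using has_vector_derivative_shift[OF conjunct1[OF conjunct2[OF vs]]] by (simp add: pk)
      have 2: "((\<lambda>s. el_integrand c \<epsilon> (snd c (per \<gamma> s)) (v (s - of_int k)) 0 u) has_real_derivative
         el_integrand c \<epsilon> (snd c (per \<gamma> s)) (v (s - of_int k)) u 0) (at s)" for u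
      proof -
        have "((\<lambda>s. el_integrand c \<epsilon> (snd c (per \<gamma> s)) (v s) 0 u) has_vector_derivative
         el_integrand c \<epsilon> (snd c (per \<gamma> (s - of_int k))) (v (s - of_int k)) u 0) (at (s - of_int k))"
          using vs by (simp add: has_real_derivative_iff_has_vector_derivative)
        from has_vector_derivative_shift[OF this] show ?thesis
          by (simp add: pk has_real_derivative_iff_has_vector_derivative)
      qed
      show "per \<gamma> s \<in> fst c \<and>
        ((\<lambda>s. snd c (per \<gamma> s)) has_vector_derivative v (s - of_int k)) (at s) \<and>
        FRc c \<epsilon> (snd c (per \<gamma> s)) (v (s - of_int k)) = FRc c \<epsilon> (snd c (per \<gamma> t)) (v (t - of_int k)) \<and>
        (\<forall>u. ((\<lambda>s. el_integrand c \<epsilon> (snd c (per \<gamma> s)) (v (s - of_int k)) 0 u) has_real_derivative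
         el_integrand c \<epsilon> (snd c (per \<gamma> s)) (v (s - of_int k)) u 0) (at s))"
        using vs 1 2 pk[of t] by (simp add: pk FRc_def t'_def)
    qed
  qed
  define Sp where "Sp t = randers g \<omega> \<epsilon> (per \<gamma> t) (velocity \<A> (per \<gamma>) t (at t))" for t
  have SpF: "Sp s = FRc c \<epsilon> (snd c (per \<gamma> s)) v"
    if "c \<in> \<A>" "s \<in> {a<..<b}" "\<And>r. r \<in> {a<..<b} \<Longrightarrow> per \<gamma> r \<in> fst c"
      "((\<lambda>s. snd c (per \<gamma> s)) has_vector_derivative v) (at s)" for c s v a b
  proof -
    have "velocity \<A> (per \<gamma>) s (at s) = tvec \<A> c (per \<gamma> s) v"
      by (rule per_velocity[OF that(1,2) _ that(4)]) (rule that(3))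
    then show ?thesis
      unfolding Sp_def FRc_def using randers_tvec[OF that(1) that(3)[OF that(2)]] by simp
  qed
  have "(Sp has_real_derivative 0) (at t)" for t
  proof -
    obtain c where c: "c \<in> \<A>" "per \<gamma> t \<in> fst c" using chart_at .
    from local[OF c] obtain d v where d: "d > 0" and v: "\<forall>s\<in>{t-d<..<t+d}. per \<gamma> s \<in> fst c \<and>
      ((\<lambda>s. snd c (per \<gamma> s)) has_vector_derivative v s) (at s) \<and>
      FRc c \<epsilon> (snd c (per \<gamma> s)) (v s) = FRc c \<epsilon> (snd c (per \<gamma> t)) (v t) \<and>
      (\<forall>u. ((\<lambda>s. el_integrand c \<epsilon> (snd c (per \<gamma> s)) (v s) 0 u) has_real_derivative
         el_integrand c \<epsilon> (snd c (per \<gamma> s)) (v s) u 0) (at s))" by (elim exE conjE)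
    have "((\<lambda>s. FRc c \<epsilon> (snd c (per \<gamma> t)) (v t)) has_real_derivative 0) (at t)" by simp
    then show ?thesis
    proof (rule has_field_derivative_transform_within_open[where S="{t-d<..<t+d}"])
      fix s assume s: "s \<in> {t-d<..<t+d}"
      show "FRc c \<epsilon> (snd c (per \<gamma> t)) (v t) = Sp s"
        using SpF[OF c(1) s, of "v s"] v bspec[OF v s] by simp
    qed (use d in auto)
  qed
  then have const: "Sp t = Sp 0" for t using DERIV_isconst_all by blast
  have len: "curve_length \<A> (randers g \<omega> \<epsilon>) \<gamma> = Sp 0"
  proof -
    have "randers g \<omega> \<epsilon> (\<gamma> s) (velocity \<A> \<gamma> s (at s within {0..1})) = Sp s" if s: "s \<in> {0..1} - {0, 1}" for s
    proof -
      obtain c where c: "c \<in> \<A>" "per \<gamma> s \<in> fst c" using chart_at .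
      from local[OF c] obtain d v where d: "d > 0" and v: "\<forall>r\<in>{s-d<..<s+d}. per \<gamma> r \<in> fst c \<and>
        ((\<lambda>s. snd c (per \<gamma> s)) has_vector_derivative v r) (at r) \<and>
        FRc c \<epsilon> (snd c (per \<gamma> r)) (v r) = FRc c \<epsilon> (snd c (per \<gamma> s)) (v s) \<and>
        (\<forall>u. ((\<lambda>s. el_integrand c \<epsilon> (snd c (per \<gamma> s)) (v s) 0 u) has_real_derivative
         el_integrand c \<epsilon> (snd c (per \<gamma> r)) (v r) u 0) (at r))" by (elim exE conjE)
      have perg: "per \<gamma> r = \<gamma> r" if "r \<in> {0..1}" for r using per_eq[OF loop(2), of 0 r] that by simp
      have sin: "s \<in> {s-d<..<s+d}" using d by simp
      have yd: "((\<lambda>s. snd c (per \<gamma> s)) has_vector_derivative v s) (at s)" using bspec[OF v sin] by simp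
      have "velocity \<A> \<gamma> s (at s within {0..1}) = tvec \<A> c (\<gamma> s) (v s)"
      proof (rule velocity_eq[OF c(1)])
        show "\<gamma> s \<in> fst c" using c(2) perg[of s] s by simp
        show "\<forall>\<^sub>F t in at s within {0..1}. \<gamma> t \<in> fst c"
          unfolding eventually_at_filter
        proof (rule eventually_mono[OF eventually_nhds_in_open[of "{s-d<..<s+d}"]])
          show "x \<noteq> s \<longrightarrow> x \<in> {0..1} \<longrightarrow> \<gamma> x \<in> fst c" if "x \<in> {s-d<..<s+d}" for x
            using conjunct1[OF bspec[OF v that]] perg[of x] by auto
        qed (use d in auto)
        show "at s within {0..1} \<noteq> bot" using s by (simp add: trivial_limit_within islimpt_Icc)
        have "((snd c \<circ> \<gamma>) has_vector_derivative v s) (at s)"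
          by (rule has_vector_derivative_transform_within_open[OF yd, of "{0<..<1}"]) (use s perg in auto)
        then show "((snd c \<circ> \<gamma>) has_vector_derivative v s) (at s within {0..1})"
          by (rule has_vector_derivative_at_within)
      qed (use s in auto)
      moreover have "Sp s = FRc c \<epsilon> (snd c (per \<gamma> s)) (v s)"
        by (rule SpF[OF c(1) sin _ yd]) (use v in auto)
      ultimately show ?thesis using randers_tvec[OF c(1), of "\<gamma> s" \<epsilon> "v s"] c(2) perg[of s] s by (simp add: FRc_def)
    qed
    then have eq: "Sp 0 = randers g \<omega> \<epsilon> (\<gamma> s) (velocity \<A> \<gamma> s (at s within {0..1}))" if "s \<in> {0..1} - {0, 1}" for s
      using const[of s] that by simp
    have "negligible {0, 1::real}" by (intro negligible_finite) auto
    then have "curve_length \<A> (randers g \<omega> \<epsilon>) \<gamma> = integral {0..1} (\<lambda>s::real. Sp 0)"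
      unfolding curve_length_def by (rule integral_spike) (rule eq)
    then show ?thesis by simp
  qed
  then have Sp\<Delta>: "Sp t = \<Delta>" for t using const by (simp add: \<Delta>_def)
  show 2: "\<exists>d>0. \<exists>v. \<forall>s\<in>{t-d<..<t+d}. per \<gamma> s \<in> fst c \<and> ((\<lambda>s. snd c (per \<gamma> s)) has_vector_derivative v s) (at s) \<and>
      FRc c \<epsilon> (snd c (per \<gamma> s)) (v s) = \<Delta> \<and>
      (\<forall>u. ((\<lambda>s. el_integrand c \<epsilon> (snd c (per \<gamma> s)) (v s) 0 u) has_real_derivative
         el_integrand c \<epsilon> (snd c (per \<gamma> s)) (v s) u 0) (at s))"
    if c: "c \<in> \<A>" "per \<gamma> t \<in> fst c" for c t
  proof -
    from local[OF c] obtain d v where d: "d > 0" and v: "\<forall>s\<in>{t-d<..<t+d}. per \<gamma> s \<in> fst c \<and>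
      ((\<lambda>s. snd c (per \<gamma> s)) has_vector_derivative v s) (at s) \<and>
      FRc c \<epsilon> (snd c (per \<gamma> s)) (v s) = FRc c \<epsilon> (snd c (per \<gamma> t)) (v t) \<and>
      (\<forall>u. ((\<lambda>s. el_integrand c \<epsilon> (snd c (per \<gamma> s)) (v s) 0 u) has_real_derivative
         el_integrand c \<epsilon> (snd c (per \<gamma> s)) (v s) u 0) (at s))" by (elim exE conjE)
    have "FRc c \<epsilon> (snd c (per \<gamma> s)) (v s) = \<Delta>" if s: "s \<in> {t-d<..<t+d}" for s
    proof -
      have "Sp s = FRc c \<epsilon> (snd c (per \<gamma> s)) (v s)"
        by (rule SpF[OF c(1) s _ conjunct1[OF conjunct2[OF bspec[OF v s]]]]) (use v in blast)
      then show ?thesis using Sp\<Delta> by metis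
    qed
    then show ?thesis using d v by (intro exI[of _ d] conjI exI[of _ v]) blast+
  qed
  show "\<Delta> \<ge> 0"
  proof -
    obtain c where c: "c \<in> \<A>" "per \<gamma> 0 \<in> fst c" using chart_at .
    from 2[OF c] obtain d v where "d > 0" "\<forall>s\<in>{0-d<..<0+d}. per \<gamma> s \<in> fst c \<and>
       ((\<lambda>s. snd c (per \<gamma> s)) has_vector_derivative v s) (at s) \<and> FRc c \<epsilon> (snd c (per \<gamma> s)) (v s) = \<Delta> \<and>
      (\<forall>u. ((\<lambda>s. el_integrand c \<epsilon> (snd c (per \<gamma> s)) (v s) 0 u) has_real_derivative
         el_integrand c \<epsilon> (snd c (per \<gamma> s)) (v s) u 0) (at s))" by (elim exE conjE)
    then have "FRc c \<epsilon> (snd c (per \<gamma> 0)) (v 0) = \<Delta>" by simp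
    then show ?thesis
      using metric_coords.FR_root(3)[OF metric_coords[OF c(1)] \<epsilon>, of "snd c (per \<gamma> 0)" "v 0"] c(2)
      by (simp add: FRc_def)
  qed
qed

text \<open>The derivative of the Randers metric with respect to the velocity, for vectors of length \<open>\<Delta>\<close>.\<close>

definition mom where
  "mom c \<epsilon> \<Delta> y v = (1 / (\<epsilon> * \<Delta> - wc c y v)) *\<^sub>R
     (metric_coords.flat (Gc c) y v + \<Delta> *\<^sub>R metric_coords.wv (wc c) y)"

text \<open>At constant speed \<Delta> the velocity derivative of the energy is
  \<open>\<Delta> p\<close> and the position derivative is \<Delta> times the force divided by
  \<open>R\<close>. The Euler-Lagrange equation thus says that \<open>p'\<close> is the force
  divided by \<open>R\<close>, and \<open>legendre\<close> eliminates the velocity in favour of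
  \<open>p\<close>.\<close>

lemma randers_hamilton:
  assumes \<gamma>: "closed_geodesic \<A> (tangent_bundle \<A>) (randers g \<omega> \<epsilon>) \<gamma>" and \<epsilon>: "\<epsilon> > 0"
  defines "\<Delta> \<equiv> curve_length \<A> (randers g \<omega> \<epsilon>) \<gamma>"
  assumes \<Delta>: "\<Delta> > 0" and c: "c \<in> \<A>" "per \<gamma> t \<in> fst c"
  defines "Y \<equiv> \<lambda>s. snd c (per \<gamma> s)"
  defines "v \<equiv> \<lambda>s. vector_derivative Y (at s)"
  defines "p \<equiv> \<lambda>s. mom c \<epsilon> \<Delta> (Y s) (v s)"
  assumes wv: "metric_coords.wv (wc c) (Y t) \<noteq> 0"
  shows "(Y has_vector_derivative v t) (at t)"
    "v t = \<Delta> *\<^sub>R metric_coords.nu (Gc c) (wc c) \<epsilon> (Y t) (p t)"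
    "(p has_vector_derivative \<Delta> *\<^sub>R metric_coords.psi (Gc c) (wc c) \<epsilon> (Y t) (p t)) (at t)"
    "p t \<noteq> 0"
    "(\<epsilon> * \<Delta> - wc c (Y t) (v t)) * metric_coords.nrm (Gc c) (Y t) (p t) = \<Delta> * metric_coords.rho (Gc c) (wc c) \<epsilon> (Y t)"
    "Gc c (Y t) (v t) (v t) + 2 * \<Delta> * wc c (Y t) (v t) = \<epsilon> * \<Delta>\<^sup>2"
proof -
  interpret M: metric_coords "snd c ` fst c" "Gc c" "wc c" by (rule metric_coords[OF c(1)])
  from randers_regular(2)[OF \<gamma> \<epsilon> c, folded \<Delta>_def]
  obtain d v' where d: "d > 0" and v': "\<forall>s\<in>{t-d<..<t+d}. per \<gamma> s \<in> fst c \<and>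
       (Y has_vector_derivative v' s) (at s) \<and> FRc c \<epsilon> (Y s) (v' s) = \<Delta> \<and>
      (\<forall>u. ((\<lambda>s. el_integrand c \<epsilon> (Y s) (v' s) 0 u) has_real_derivative
         el_integrand c \<epsilon> (Y s) (v' s) u 0) (at s))" unfolding Y_def by (elim exE conjE)
  have tin: "t \<in> {t-d<..<t+d}" using d by simp
  have vv: "v s = v' s" if "s \<in> {t-d<..<t+d}" for s
    using bspec[OF v' that] unfolding v_def by (auto intro: vector_derivative_at)
  show Yd: "(Y has_vector_derivative v t) (at t)" using bspec[OF v' tin] vv[OF tin] by simp
  have YD: "Y s \<in> snd c ` fst c" if "s \<in> {t-d<..<t+d}" for s using bspec[OF v' that] by (simp add: Y_def)
  have F: "M.FR \<epsilon> (Y s) (v s) = \<Delta>" if "s \<in> {t-d<..<t+d}" for s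
    using bspec[OF v' that] vv[OF that] by (simp add: FRc_def)
  have root: "Gc c (Y s) (v s) (v s) + 2 * \<Delta> * wc c (Y s) (v s) = \<epsilon> * \<Delta>\<^sup>2"
    "M.RR \<epsilon> (Y s) (v s) = \<epsilon> * \<Delta> - wc c (Y s) (v s)" "M.RR \<epsilon> (Y s) (v s) > 0" if s: "s \<in> {t-d<..<t+d}" for s
  proof -
    show "Gc c (Y s) (v s) (v s) + 2 * \<Delta> * wc c (Y s) (v s) = \<epsilon> * \<Delta>\<^sup>2"
      using M.FR_root(1)[OF \<epsilon> YD[OF s], of "v s"] F[OF s] by (simp add: mult_ac)
    show "M.RR \<epsilon> (Y s) (v s) = \<epsilon> * \<Delta> - wc c (Y s) (v s)"
      using M.FR_root(2)[OF \<epsilon> YD[OF s], of "v s"] F[OF s] by simp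
    have "v s \<noteq> 0" using F[OF s] \<Delta> M.FR_eq_0[OF \<epsilon> YD[OF s], of "v s"] by simp
    then show "M.RR \<epsilon> (Y s) (v s) > 0" by (rule M.RR_pos[OF \<epsilon> YD[OF s]])
  qed
  have el2: "el_integrand c \<epsilon> (Y s) (v s) 0 u = \<Delta> * (p s \<bullet> u)" if s: "s \<in> {t-d<..<t+d}" for s u
    using YD[OF s]
    by (simp add: el_integrand_def M.dL_def F[OF s] root(2)[OF s] linear_0[OF M.linear_dG[OF YD[OF s]]]
        linear_0[OF M.linear_dw[OF YD[OF s]]] p_def mom_def inner_add_left M.flat_inner M.wv_inner)
  have el1: "el_integrand c \<epsilon> (Y s) (v s) u 0 = \<Delta> * (((1 / (\<epsilon> * \<Delta> - wc c (Y s) (v s))) *\<^sub>R M.force \<Delta> (Y s) (v s)) \<bullet> u)"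
    if s: "s \<in> {t-d<..<t+d}" and u: "u \<in> Basis" for s u
    using YD[OF s] u
    by (simp add: el_integrand_def M.dL_def F[OF s] root(2)[OF s] M.force_def M.G_simps M.w_simps
        inner_sum_left inner_Basis if_distrib if_distribR cong: if_cong)
  let ?f = "(1 / (\<epsilon> * \<Delta> - wc c (Y t) (v t))) *\<^sub>R M.force \<Delta> (Y t) (v t)"
  have pd: "(p has_vector_derivative ?f) (at t)"
  proof -
    have "((\<lambda>s. p s \<bullet> u) has_real_derivative ?f \<bullet> u) (at t)" if u: "u \<in> Basis" for u
    proof -
      have "((\<lambda>s. el_integrand c \<epsilon> (Y s) (v' s) 0 u) has_real_derivative el_integrand c \<epsilon> (Y t) (v' t) u 0) (at t)"
        using bspec[OF v' tin] by blast
      then have "((\<lambda>s. el_integrand c \<epsilon> (Y s) (v' s) 0 u) has_real_derivative \<Delta> * (?f \<bullet> u)) (at t)"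
        using el1[OF tin u] vv[OF tin] by simp
      then have "((\<lambda>s. \<Delta> * (p s \<bullet> u)) has_real_derivative \<Delta> * (?f \<bullet> u)) (at t)"
        by (rule has_field_derivative_transform_within_open[where S="{t-d<..<t+d}"]) (use d el2 vv in auto)
      from DERIV_cmult[OF this, of "1 / \<Delta>"] show ?thesis using \<Delta> by simp
    qed
    then have "((\<lambda>s. \<Sum>u\<in>Basis. (p s \<bullet> u) *\<^sub>R u) has_vector_derivative (\<Sum>u\<in>Basis. (?f \<bullet> u) *\<^sub>R u)) (at t)"
      by (intro has_vector_derivative_sum bounded_linear.has_vector_derivative[OF bounded_linear_scaleR_left])
        (simp add: has_real_derivative_iff_has_vector_derivative)
    then show ?thesis by (simp only: euclidean_representation)
  qed
  note leg = M.legendre[OF YD[OF tin] \<Delta> less_imp_le[OF \<epsilon>] wv root(1)[OF tin] refl, of "p t"]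
  have R: "\<epsilon> * \<Delta> - wc c (Y t) (v t) > 0" using root(2,3)[OF tin] by simp
  have pt: "p t = (1 / (\<epsilon> * \<Delta> - wc c (Y t) (v t))) *\<^sub>R (M.flat (Y t) (v t) + \<Delta> *\<^sub>R M.wv (Y t))"
    by (simp add: p_def mom_def)
  show "p t \<noteq> 0" "v t = \<Delta> *\<^sub>R M.nu \<epsilon> (Y t) (p t)"
    "(\<epsilon> * \<Delta> - wc c (Y t) (v t)) * M.nrm (Y t) (p t) = \<Delta> * M.rho \<epsilon> (Y t)"
    using leg[OF R pt] by simp_all
  show "(p has_vector_derivative \<Delta> *\<^sub>R M.psi \<epsilon> (Y t) (p t)) (at t)"
    using pd unfolding leg(4)[OF R pt] .
  show "Gc c (Y t) (v t) (v t) + 2 * \<Delta> * wc c (Y t) (v t) = \<epsilon> * \<Delta>\<^sup>2" by (rule root(1)[OF tin])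
qed

end

section \<open>The limit of Hamilton's equations\<close>

lemma vector_derivative_bound:
  fixes f :: "real \<Rightarrow> 'a::real_normed_vector"
  assumes "convex S" "\<And>s. s \<in> S \<Longrightarrow> (f has_vector_derivative f' s) (at s)" "\<And>s. s \<in> S \<Longrightarrow> norm (f' s) \<le> B"
    "0 \<le> B" "x \<in> S" "y \<in> S"
  shows "norm (f x - f y) \<le> B * \<bar>x - y\<bar>"
proof -
  have "norm (f x - f y) \<le> B * norm (x - y)"
  proof (rule differentiable_bound[OF assms(1)])
    show "(f has_derivative (\<lambda>h. h *\<^sub>R f' s)) (at s within S)" if "s \<in> S" for s
      using assms(2)[OF that] unfolding has_vector_derivative_def by (rule has_derivative_at_withinI)
    show "onorm (\<lambda>h. h *\<^sub>R f' s) \<le> B" if "s \<in> S" for s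
    proof (rule onorm_bound[OF assms(4)])
      fix h :: real
      have "\<bar>h\<bar> * norm (f' s) \<le> \<bar>h\<bar> * B" by (rule mult_left_mono[OF assms(3)[OF that]]) simp
      then show "norm (h *\<^sub>R f' s) \<le> B * norm h" by (simp add: mult.commute)
    qed
  qed (use assms in auto)
  then show ?thesis by simp
qed

context metric_coords
begin

text \<open>Homogeneity reduces the bounds to unit covectors, where compactness applies uniformly in
  \<open>\<epsilon> \<in> [0, 1]\<close>, including \<open>\<epsilon> = 0\<close>.\<close>

lemma hamilton_bounds:
  assumes K: "compact K" "K \<subseteq> D" "\<And>x. x \<in> K \<Longrightarrow> wv x \<noteq> 0"
  obtains C where "C \<ge> 0" "\<forall>e\<in>{0..1}. \<forall>x\<in>K. \<forall>p. p \<noteq> 0 \<longrightarrow> norm (nu e x p) \<le> C \<and> norm (psi e x p) \<le> C * norm p"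
proof -
  define T where "T = ({0..1::real} \<times> K) \<times> sphere (0::'e) 1"
  have T: "compact T" unfolding T_def by (intro compact_Times K(1)) auto
  have c: "continuous_on T (\<lambda>q. nu (fst (fst q)) (snd (fst q)) (snd q))"
    "continuous_on T (\<lambda>q. psi (fst (fst q)) (snd (fst q)) (snd q))"
    by (intro continuous_on_nu_psi continuous_intros; use K(2,3) in \<open>auto simp: T_def\<close>)+
  have "bounded ((\<lambda>q. nu (fst (fst q)) (snd (fst q)) (snd q)) ` T)"
    by (rule compact_imp_bounded[OF compact_continuous_image[OF c(1) T]])
  then obtain C1 where C1: "\<forall>x\<in>(\<lambda>q. nu (fst (fst q)) (snd (fst q)) (snd q)) ` T. norm x \<le> C1"
    unfolding bounded_iff by blast
  have "bounded ((\<lambda>q. psi (fst (fst q)) (snd (fst q)) (snd q)) ` T)"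
    by (rule compact_imp_bounded[OF compact_continuous_image[OF c(2) T]])
  then obtain C2 where C2: "\<forall>x\<in>(\<lambda>q. psi (fst (fst q)) (snd (fst q)) (snd q)) ` T. norm x \<le> C2"
    unfolding bounded_iff by blast
  have C: "norm (nu (fst (fst q)) (snd (fst q)) (snd q)) \<le> C1"
    "norm (psi (fst (fst q)) (snd (fst q)) (snd q)) \<le> C2" if "q \<in> T" for q
    using C1 C2 that by blast+
  define C where "C = max 0 (max C1 C2)"
  have "norm (nu e x p) \<le> C \<and> norm (psi e x p) \<le> C * norm p" if "e \<in> {0..1}" "x \<in> K" "p \<noteq> 0" for e x p
  proof -
    define p1 where "p1 = (1 / norm p) *\<^sub>R p"
    have p: "p = norm p *\<^sub>R p1" "norm p > 0" using that by (auto simp: p1_def)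
    have "((e, x), p1) \<in> T" using that by (auto simp: T_def p1_def)
    from C[OF this] have n: "norm (nu e x p1) \<le> C" "norm (psi e x p1) \<le> C" by (auto simp: C_def)
    have x: "x \<in> D" using that K(2) by auto
    have "nu e x p = nu e x p1" using nu_scale[OF x p(2), of e p1] p(1) by simp
    moreover have "psi e x p = norm p *\<^sub>R psi e x p1" using psi_scale[OF x p(2), of e p1] p(1) by simp
    ultimately show ?thesis using n p(2) by (simp add: mult.commute mult_left_mono)
  qed
  then show ?thesis using that[of C] by (simp add: C_def)
qed

text \<open>The momenta need not be bounded. By homogeneity they may be rescaled to norm \<open>1\<close> at time \<open>t\<close>, and then
  \<open>|P'| \<le> C |P|\<close> gives bounds from above and below. The factor \<open>\<epsilon> n - w\<close> of the rescaled equations has a limit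
  which is either zero throughout or positive throughout the window: this is the final alternative.\<close>

lemma hamilton_limit:
  fixes Y P :: "nat \<Rightarrow> real \<Rightarrow> 'e"
  assumes K: "compact K" "K \<subseteq> D" "\<And>x. x \<in> K \<Longrightarrow> wv x \<noteq> 0" and \<tau>: "\<tau> > 0"
    and \<epsilon>: "\<And>n. 0 < \<epsilon> n" "\<And>n. \<epsilon> n \<le> 1" "\<epsilon> \<longlonglongrightarrow> 0" and \<Delta>: "\<And>n. \<Delta> n > 0" "\<Delta> \<longlonglongrightarrow> \<Delta>'"
    and H: "\<And>n s. s \<in> {t-\<tau><..<t+\<tau>} \<Longrightarrow> Y n s \<in> K" "\<And>n s. s \<in> {t-\<tau><..<t+\<tau>} \<Longrightarrow> P n s \<noteq> 0"
      "\<And>n s. s \<in> {t-\<tau><..<t+\<tau>} \<Longrightarrow> (Y n has_vector_derivative \<Delta> n *\<^sub>R nu (\<epsilon> n) (Y n s) (P n s)) (at s)"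
      "\<And>n s. s \<in> {t-\<tau><..<t+\<tau>} \<Longrightarrow> (P n has_vector_derivative \<Delta> n *\<^sub>R psi (\<epsilon> n) (Y n s) (P n s)) (at s)"
      "\<And>n s. s \<in> {t-\<tau><..<t+\<tau>} \<Longrightarrow> (\<epsilon> n - w (Y n s) (nu (\<epsilon> n) (Y n s) (P n s))) * nrm (Y n s) (P n s) = rho (\<epsilon> n) (Y n s)"
  defines "\<sigma> \<equiv> \<tau> / 2"
  shows "\<exists>r y v. strict_mono (r :: nat \<Rightarrow> nat) \<and> (\<forall>e>0. \<exists>N. \<forall>n\<ge>N. \<forall>s\<in>{t-\<sigma>..t+\<sigma>}. norm (Y (r n) s - y s) < e) \<and>
    y ` {t-\<sigma>..t+\<sigma>} \<subseteq> K \<and> smooth_on y {t-\<sigma><..<t+\<sigma>} \<and>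
    (\<forall>s\<in>{t-\<sigma><..<t+\<sigma>}. (y has_vector_derivative v s) (at s) \<and> G (y s) (v s) (v s) + 2 * \<Delta>' * w (y s) (v s) = 0) \<and>
    ((\<forall>s\<in>{t-\<sigma><..<t+\<sigma>}. v s = 0) \<or>
     \<Delta>' > 0 \<and> (\<forall>s\<in>{t-\<sigma><..<t+\<sigma>}. w (y s) (v s) < 0 \<and>
       ((\<lambda>s. (1 / - w (y s) (v s)) *\<^sub>R (flat (y s) (v s) + \<Delta>' *\<^sub>R wv (y s))) has_vector_derivative
          (1 / - w (y s) (v s)) *\<^sub>R force \<Delta>' (y s) (v s)) (at s)))"
proof -
  obtain C where C: "C \<ge> 0" "\<forall>e\<in>{0..1}. \<forall>x\<in>K. \<forall>p. p \<noteq> 0 \<longrightarrow> norm (nu e x p) \<le> C \<and> norm (psi e x p) \<le> C * norm p"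
    using hamilton_bounds[OF K] .
  obtain M where M: "M > 0" "\<And>n. \<Delta> n \<le> M"
  proof -
    have "Bseq \<Delta>" using \<Delta>(2) by (intro convergent_imp_Bseq convergentI)
    then obtain B where "B > 0" "\<And>n. norm (\<Delta> n) \<le> B" by (rule BseqE) blast
    then show ?thesis using that[of B] by (simp add: abs_le_iff)
  qed
  let ?I = "{t-\<tau><..<t+\<tau>}" and ?J = "{t-\<sigma>..t+\<sigma>}"
  have \<sigma>: "0 < \<sigma>" "\<sigma> < \<tau>" and JI: "?J \<subseteq> ?I" using \<tau> by (auto simp: \<sigma>_def)
  have tI: "t \<in> ?I" using \<tau> by simp
  have YD: "Y n s \<in> D" if "s \<in> ?I" for n s using H(1)[OF that] K(2) by blast
  have \<epsilon>01: "\<epsilon> n \<in> {0..1}" for n using \<epsilon>(1,2)[of n] by auto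
  have Cn: "norm (nu (\<epsilon> n) (Y n s) p) \<le> C" "norm (psi (\<epsilon> n) (Y n s) p) \<le> C * norm p"
    if "s \<in> ?I" "p \<noteq> 0" for n s p
    using C(2) \<epsilon>01 H(1)[OF that(1)] that(2) by blast+
  \<comment> \<open>The factor by which the norm of a momentum can grow or shrink in a time less
    than \<tau>.\<close>
  define A where "A = exp (C * M * \<tau>)"
  have A: "A > 0" by (simp add: A_def)
  \<comment> \<open>Gronwall's estimate in both directions at once: the logarithm of the squared
    norm has a bounded derivative.\<close>
  have ln_bound: "\<bar>ln (P n s \<bullet> P n s) - ln (P n t \<bullet> P n t)\<bar> \<le> 2 * C * M * \<bar>s - t\<bar>" if s: "s \<in> ?I" for n s
  proof -
    have "norm (ln (P n s \<bullet> P n s) - ln (P n t \<bullet> P n t)) \<le> 2 * C * M * \<bar>s - t\<bar>"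
    proof (rule vector_derivative_bound[where S="?I"])
      fix r assume r: "r \<in> ?I"
      let ?p = "\<Delta> n *\<^sub>R psi (\<epsilon> n) (Y n r) (P n r)"
      have pos: "P n r \<bullet> P n r > 0" using H(2)[OF r] by simp
      have "((\<lambda>s. P n s \<bullet> P n s) has_vector_derivative P n r \<bullet> ?p + ?p \<bullet> P n r) (at r)"
        by (rule bounded_bilinear.has_vector_derivative[OF bounded_bilinear_inner H(4)[OF r] H(4)[OF r]])
      then have "((\<lambda>s. P n s \<bullet> P n s) has_real_derivative 2 * (P n r \<bullet> ?p)) (at r)"
        by (simp add: has_real_derivative_iff_has_vector_derivative inner_commute)
      from DERIV_chain2[OF DERIV_ln_divide[OF pos] this]
      show "((\<lambda>s. ln (P n s \<bullet> P n s)) has_vector_derivative 2 * (P n r \<bullet> ?p) / (P n r \<bullet> P n r)) (at r)"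
        by (simp add: has_real_derivative_iff_has_vector_derivative)
      have b: "norm ?p \<le> M * (C * norm (P n r))"
      proof -
        have "norm ?p = \<Delta> n * norm (psi (\<epsilon> n) (Y n r) (P n r))" using \<Delta>(1)[of n] by simp
        also have "\<dots> \<le> M * (C * norm (P n r))"
          by (rule mult_mono[OF M(2) Cn(2)[OF r H(2)[OF r]]]) (use M(1) in auto)
        finally show ?thesis .
      qed
      have "\<bar>P n r \<bullet> ?p\<bar> \<le> norm (P n r) * norm ?p" by (rule Cauchy_Schwarz_ineq2)
      also have "\<dots> \<le> norm (P n r) * (M * (C * norm (P n r)))" by (rule mult_left_mono[OF b]) simp
      also have "\<dots> = M * C * (P n r \<bullet> P n r)" by (simp add: dot_square_norm power2_eq_square)
      finally have x: "\<bar>P n r \<bullet> ?p\<bar> \<le> M * C * (P n r \<bullet> P n r)" .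
      have "norm (2 * (P n r \<bullet> ?p) / (P n r \<bullet> P n r)) = 2 * \<bar>P n r \<bullet> ?p\<bar> / (P n r \<bullet> P n r)"
        using pos by (simp add: abs_mult)
      also have "\<dots> \<le> 2 * (M * C * (P n r \<bullet> P n r)) / (P n r \<bullet> P n r)"
        by (intro divide_right_mono mult_left_mono x) (use pos in auto)
      also have "\<dots> = 2 * C * M" using pos by simp
      finally show "norm (2 * (P n r \<bullet> ?p) / (P n r \<bullet> P n r)) \<le> 2 * C * M" .
    next
      show "0 \<le> 2 * C * M" using C(1) M(1) by simp
    qed (use s tI in auto)
    then show ?thesis by simp
  qed
  define m where "m n = 1 / norm (P n t)" for n
  have m: "m n > 0" for n using H(2)[OF tI] by (simp add: m_def)
  define Q where "Q n s = m n *\<^sub>R P n s" for n s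
  have Q0: "Q n s \<noteq> 0" if "s \<in> ?I" for n s using H(2)[OF that] m[of n] by (simp add: Q_def)
  have Qn: "1 / A \<le> norm (Q n s)" "norm (Q n s) \<le> A" if s: "s \<in> ?I" for n s
  proof -
    have p: "norm (P n s) > 0" "norm (P n t) > 0" using H(2) s tI by auto
    have "ln (P n r \<bullet> P n r) = 2 * ln (norm (P n r))" if "norm (P n r) > 0" for r
      using that by (simp add: dot_square_norm ln_realpow)
    then have "\<bar>2 * ln (norm (P n s)) - 2 * ln (norm (P n t))\<bar> \<le> 2 * C * M * \<bar>s - t\<bar>"
      using ln_bound[OF s, of n] p by simp
    also have "\<dots> \<le> 2 * C * M * \<tau>" using s C(1) M(1) by (intro mult_left_mono) auto
    finally have "\<bar>ln (norm (P n s) / norm (P n t))\<bar> \<le> C * M * \<tau>" using p by (simp add: ln_div)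
    then have "- (C * M * \<tau>) \<le> ln (norm (Q n s))" "ln (norm (Q n s)) \<le> C * M * \<tau>"
      using p by (auto simp: Q_def m_def abs_le_iff)
    then have "exp (- (C * M * \<tau>)) \<le> exp (ln (norm (Q n s)))" "exp (ln (norm (Q n s))) \<le> exp (C * M * \<tau>)"
      by auto
    then show "1 / A \<le> norm (Q n s)" "norm (Q n s) \<le> A"
      using Q0[OF s, of n] by (auto simp: A_def exp_minus divide_inverse)
  qed
  have Yd: "(Y n has_vector_derivative \<Delta> n *\<^sub>R nu (\<epsilon> n) (Y n s) (Q n s)) (at s)" if s: "s \<in> ?I" for n s
    using H(3)[OF s] by (simp add: Q_def nu_scale[OF YD[OF s] m])
  have Qd: "(Q n has_vector_derivative \<Delta> n *\<^sub>R psi (\<epsilon> n) (Y n s) (Q n s)) (at s)" if s: "s \<in> ?I" for n s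
    using bounded_linear.has_vector_derivative[OF bounded_linear_scaleR_right H(4)[OF s], of "m n"]
    by (simp add: Q_def[abs_def] psi_scale[OF YD[OF s] m] mult.commute)
  define Z where "Z n s = (Y n s, Q n s)" for n s
  define X where "X e z = (nu e (fst z) (snd z), psi e (fst z) (snd z))" for e and z :: "'e \<times> 'e"
  have Zd: "(Z n has_vector_derivative \<Delta> n *\<^sub>R X (\<epsilon> n) (Z n s)) (at s)" if s: "s \<in> ?I" for n s
    using Yd[OF s, of n] Qd[OF s, of n]
    by (auto simp: Z_def[abs_def] X_def has_vector_derivative_def intro!: has_derivative_Pair)
  define B where "B = M * (C + C * A)"
  have B: "B \<ge> 0" using M C A by (simp add: B_def)
  have XB: "norm (\<Delta> n *\<^sub>R X (\<epsilon> n) (Z n s)) \<le> B" if s: "s \<in> ?I" for n s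
  proof -
    have "norm (X (\<epsilon> n) (Z n s)) \<le> norm (nu (\<epsilon> n) (Y n s) (Q n s)) + norm (psi (\<epsilon> n) (Y n s) (Q n s))"
      unfolding X_def Z_def by (simp add: norm_Pair_le)
    also have "\<dots> \<le> C + C * A"
      using Cn[OF s Q0[OF s, of n], of n] Qn(2)[OF s, of n] C(1)
      by (meson add_mono mult_left_mono order_trans)
    finally have "norm (X (\<epsilon> n) (Z n s)) \<le> C + C * A" .
    then show ?thesis using \<Delta>(1)[of n] M(2)[of n] by (simp add: B_def mult_mono)
  qed
  have lip: "norm (Z n a - Z n b) \<le> B * \<bar>a - b\<bar>" if "a \<in> ?J" "b \<in> ?J" for n a b
    by (rule vector_derivative_bound[where S="?J" and f'="\<lambda>s. \<Delta> n *\<^sub>R X (\<epsilon> n) (Z n s)"])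
      (use that Zd XB B JI in auto)
  obtain MK where MK: "\<And>x. x \<in> K \<Longrightarrow> norm x \<le> MK" using compact_imp_bounded[OF K(1)] unfolding bounded_iff by blast
  obtain z r where z: "continuous_on ?J z" "strict_mono (r :: nat \<Rightarrow> nat)"
    and conv: "\<And>e. 0 < e \<Longrightarrow> \<exists>N. \<forall>n s. n \<ge> N \<and> s \<in> ?J \<longrightarrow> norm (Z (r n) s - z s) < e"
  proof (rule Arzela_Ascoli[of ?J Z "MK + A"])
    show "norm (Z n s) \<le> MK + A" if "s \<in> ?J" for n s
    proof -
      have "s \<in> ?I" using that JI by blast
      have "norm (Z n s) \<le> norm (Y n s) + norm (Q n s)" by (simp add: Z_def norm_Pair_le)
      also have "\<dots> \<le> MK + A" using MK[OF H(1)[OF \<open>s \<in> ?I\<close>]] Qn(2)[OF \<open>s \<in> ?I\<close>] by (intro add_mono) auto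
      finally show ?thesis .
    qed
    show "\<exists>d>0. \<forall>n y. y \<in> ?J \<and> norm (s - y) < d \<longrightarrow> norm (Z n s - Z n y) < e" if "s \<in> ?J" "e > 0" for s e
    proof (intro exI[of _ "e / (B + 1)"] conjI allI impI)
      show "e / (B + 1) > 0" using that B by simp
      fix n y assume y: "y \<in> ?J \<and> norm (s - y) < e / (B + 1)"
      have "norm (Z n s - Z n y) \<le> B * \<bar>s - y\<bar>" using lip that y by blast
      also have "\<dots> \<le> (B + 1) * \<bar>s - y\<bar>" by (simp add: mult_right_mono)
      also have "\<dots> < e" using y B by (simp add: field_simps)
      finally show "norm (Z n s - Z n y) < e" .
    qed
  qed auto
  have pt: "(\<lambda>n. Z (r n) s) \<longlonglongrightarrow> z s" if "s \<in> ?J" for s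
    unfolding LIMSEQ_iff using conv that by blast
  define y q where "y s = fst (z s)" and "q s = snd (z s)" for s
  have py: "(\<lambda>n. Y (r n) s) \<longlonglongrightarrow> y s" "(\<lambda>n. Q (r n) s) \<longlonglongrightarrow> q s" if "s \<in> ?J" for s
    using tendsto_fst[OF pt[OF that]] tendsto_snd[OF pt[OF that]] by (auto simp: Z_def y_def q_def)
  have yK: "y s \<in> K" if s: "s \<in> ?J" for s
    by (rule closed_sequentially[OF compact_imp_closed[OF K(1)] _ py(1)[OF s]]) (use H(1) s JI in auto)
  have yD: "y s \<in> D" if s: "s \<in> ?J" for s using yK[OF s] K(2) by blast
  have qA: "1 / A \<le> norm (q s)" "norm (q s) \<le> A" if s: "s \<in> ?J" for s
    using LIMSEQ_le_const[OF tendsto_norm[OF py(2)[OF s]], of "1/A"]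
      LIMSEQ_le_const2[OF tendsto_norm[OF py(2)[OF s]], of A] Qn[of s] s JI by blast+
  have q0: "q s \<noteq> 0" if "s \<in> ?J" for s
  proof
    assume "q s = 0"
    then have "1 / A \<le> 0" using qA(1)[OF that] by simp
    then show False using A by simp
  qed
  \<comment> \<open>On this set the vector field is jointly continuous in \<epsilon> and the phase
    point, up to and including the value \<open>0\<close> of \<epsilon>.\<close>
  define T where "T = {e. 0 \<le> (e::real)} \<times> {p. fst p \<in> D \<and> wv (fst p) \<noteq> 0 \<and> snd p \<noteq> (0 :: 'e)}"
  have TX: "continuous_on T (\<lambda>q. X (fst q) (snd q))"
    unfolding X_def
    by (intro continuous_on_Pair continuous_on_nu_psi continuous_intros) (auto simp: T_def)
  have \<epsilon>r: "(\<lambda>n. \<epsilon> (r n)) \<longlonglongrightarrow> 0" "(\<lambda>n. \<Delta> (r n)) \<longlonglongrightarrow> \<Delta>'"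
    using LIMSEQ_subseq_LIMSEQ[OF \<epsilon>(3) z(2)] LIMSEQ_subseq_LIMSEQ[OF \<Delta>(2) z(2)] by (auto simp: o_def)
  have inT: "(\<epsilon> (r n), Z (r n) s) \<in> T" "(0, z s) \<in> T" if s: "s \<in> ?J" for n s
  proof -
    have "s \<in> ?I" using s JI by blast
    then show "(\<epsilon> (r n), Z (r n) s) \<in> T" using \<epsilon>(1)[of "r n"] YD K(3)[OF H(1)] Q0 by (auto simp: T_def Z_def less_imp_le)
    show "(0, z s) \<in> T" using yD[OF s] K(3)[OF yK[OF s]] q0[OF s] by (auto simp: T_def y_def q_def)
  qed
  have Xlim: "(\<lambda>n. X (\<epsilon> (r n)) (Z (r n) s)) \<longlonglongrightarrow> X 0 (z s)" if s: "s \<in> ?J" for s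
  proof -
    have "(\<lambda>n. (\<epsilon> (r n), Z (r n) s)) \<longlonglongrightarrow> (0, z s)" by (intro tendsto_Pair \<epsilon>r pt s)
    from continuous_on_tendsto_compose[OF TX this inT(2)[OF s]] inT(1)[OF s] show ?thesis by simp
  qed
  let ?a = "t - \<sigma>"
  have zX: "continuous_on ?J (\<lambda>s. X 0 (z s))"
  proof -
    have im: "(\<lambda>s. (0::real, z s)) ` ?J \<subseteq> T" using inT(2) by blast
    have cc: "continuous_on ?J (\<lambda>s. (0::real, z s))" by (intro continuous_on_Pair continuous_on_const z(1))
    from continuous_on_compose2[OF TX cc im] show ?thesis by simp
  qed
  \<comment> \<open>The limit is taken in the integrated equations, since it is \<open>Z\<close> and
    not its derivative that is known to converge uniformly.\<close>
  have inteq: "z s = z ?a + integral {?a..s} (\<lambda>s. \<Delta>' *\<^sub>R X 0 (z s))" if s: "s \<in> ?J" for s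
  proof -
    have sub: "{?a..s} \<subseteq> ?J" using s by auto
    have ft: "((\<lambda>u. \<Delta> n *\<^sub>R X (\<epsilon> n) (Z n u)) has_integral (Z n s - Z n ?a)) {?a..s}" for n
    proof (rule fundamental_theorem_of_calculus)
      fix u assume "u \<in> {?a..s}"
      then have "u \<in> ?I" using sub JI by blast
      from has_vector_derivative_at_within[OF Zd[OF this]]
      show "(Z n has_vector_derivative \<Delta> n *\<^sub>R X (\<epsilon> n) (Z n u)) (at u within {?a..s})" .
    qed (use s in auto)
    have "(\<lambda>n. integral {?a..s} (\<lambda>u. \<Delta> (r n) *\<^sub>R X (\<epsilon> (r n)) (Z (r n) u))) \<longlonglongrightarrow> integral {?a..s} (\<lambda>u. \<Delta>' *\<^sub>R X 0 (z u))"
    proof (rule dominated_convergence(2)[where h="\<lambda>_. B"])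
      show "norm (\<Delta> (r n) *\<^sub>R X (\<epsilon> (r n)) (Z (r n) u)) \<le> B" if "u \<in> {?a..s}" for n u
        by (rule XB) (use that sub JI in blast)
      show "(\<lambda>n. \<Delta> (r n) *\<^sub>R X (\<epsilon> (r n)) (Z (r n) u)) \<longlonglongrightarrow> \<Delta>' *\<^sub>R X 0 (z u)" if "u \<in> {?a..s}" for u
        using that sub by (intro tendsto_scaleR \<epsilon>r Xlim) auto
    next
      show "(\<lambda>u. \<Delta> (r n) *\<^sub>R X (\<epsilon> (r n)) (Z (r n) u)) integrable_on {?a..s}" for n
        by (rule has_integral_integrable[OF ft])
    qed (rule integrable_const_ivl)
    then have "(\<lambda>n. Z (r n) s - Z (r n) ?a) \<longlonglongrightarrow> integral {?a..s} (\<lambda>u. \<Delta>' *\<^sub>R X 0 (z u))"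
      using integral_unique[OF ft] by simp
    moreover have "(\<lambda>n. Z (r n) s - Z (r n) ?a) \<longlonglongrightarrow> z s - z ?a"
      using s \<sigma> by (intro tendsto_diff pt) auto
    ultimately have "z s - z ?a = integral {?a..s} (\<lambda>u. \<Delta>' *\<^sub>R X 0 (z u))" by (rule LIMSEQ_unique[rotated])
    then show ?thesis by (simp add: algebra_simps)
  qed
  let ?O = "{t-\<sigma><..<t+\<sigma>}"
  have OJ: "?O \<subseteq> ?J" by auto
  have zd: "(z has_vector_derivative \<Delta>' *\<^sub>R X 0 (z s)) (at s)" if s: "s \<in> ?O" for s
  proof -
    have "((\<lambda>u. integral {?a..u} (\<lambda>s. \<Delta>' *\<^sub>R X 0 (z s))) has_vector_derivative \<Delta>' *\<^sub>R X 0 (z s)) (at s within ?J)"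
      using s zX by (intro integral_has_vector_derivative continuous_on_scaleR continuous_on_const) auto
    then have "((\<lambda>u. integral {?a..u} (\<lambda>s. \<Delta>' *\<^sub>R X 0 (z s))) has_vector_derivative \<Delta>' *\<^sub>R X 0 (z s)) (at s)"
      using s at_within_Icc_at[of "t-\<sigma>" s "t+\<sigma>"] by simp
    from has_vector_derivative_add[OF has_vector_derivative_const this]
    have "((\<lambda>u. z ?a + integral {?a..u} (\<lambda>s. \<Delta>' *\<^sub>R X 0 (z s))) has_vector_derivative \<Delta>' *\<^sub>R X 0 (z s)) (at s)"
      by simp
    then show ?thesis
      by (rule has_vector_derivative_transform_within_open[where S="?O"]) (use s inteq[symmetric] in auto)
  qed
  have smz: "smooth_on z ?O"
  proof (rule smooth_on_ode[where X="\<lambda>p. \<Delta>' *\<^sub>R X 0 p"])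
    show "open {p. fst p \<in> D \<and> wv (fst p) \<noteq> 0 \<and> snd p \<noteq> (0 :: 'e)}" by (rule smooth_on_nu_psi(1))
    show "smooth_on (\<lambda>p. \<Delta>' *\<^sub>R X 0 p) {p. fst p \<in> D \<and> wv (fst p) \<noteq> 0 \<and> snd p \<noteq> (0 :: 'e)}"
      unfolding X_def by (rule smooth_on_linear[OF bounded_linear_scaleR_right smooth_on_nu_psi])
    show "z ` ?O \<subseteq> {p. fst p \<in> D \<and> wv (fst p) \<noteq> 0 \<and> snd p \<noteq> 0}"
      using inT(2) OJ by (auto simp: T_def)
  qed (use zd in auto)
  have smy: "smooth_on y ?O" unfolding y_def by (rule smooth_on_fst[OF _ smz]) auto
  define \<nu> where "\<nu> s = nu 0 (y s) (q s)" for s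
  define v where "v s = \<Delta>' *\<^sub>R \<nu> s" for s
  have yd: "(y has_vector_derivative v s) (at s)" "(q has_vector_derivative \<Delta>' *\<^sub>R psi 0 (y s) (q s)) (at s)"
    if s: "s \<in> ?O" for s
    using bounded_linear.has_vector_derivative[OF bounded_linear_fst zd[OF s]]
      bounded_linear.has_vector_derivative[OF bounded_linear_snd zd[OF s]]
    by (simp_all add: y_def[abs_def] q_def[abs_def] v_def \<nu>_def X_def)
  have \<nu>G: "G (y s) (\<nu> s) (\<nu> s) + 2 * w (y s) (\<nu> s) = 0"
    "flat (y s) (\<nu> s) + wv (y s) = (rho 0 (y s) / nrm (y s) (q s)) *\<^sub>R q s" if s: "s \<in> ?J" for s
    using legendre_inverse[OF yD[OF s] K(3)[OF yK[OF s]] q0[OF s] \<nu>_def] by auto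
  have pos: "rho 0 (y s) > 0" "nrm (y s) (q s) > 0" if s: "s \<in> ?J" for s
    using rho_pos[OF yD[OF s] _ K(3)[OF yK[OF s]], of 0] nrm_pos[OF yD[OF s] q0[OF s]] by auto
  \<comment> \<open>The last hypothesis, rewritten for the rescaled momenta, expresses the scaling
    factor \<open>m n\<close> through position and momentum at an arbitrary time. So
    \<open>m (r n)\<close> converges along the same subsequence, and the limiting expression has the
    same value at all times.\<close>
  have mlim: "(\<lambda>n. m (r n)) \<longlonglongrightarrow> (- w (y s) (\<nu> s)) * nrm (y s) (q s) / rho 0 (y s)" if s: "s \<in> ?J" for s
  proof -
    have sI: "s \<in> ?I" using s JI by blast
    have eq: "m n = (\<epsilon> n - w (Y n s) (nu (\<epsilon> n) (Y n s) (Q n s))) * nrm (Y n s) (Q n s) / rho (\<epsilon> n) (Y n s)" for n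
      using H(5)[OF sI, of n] rho_pos[OF YD[OF sI] _ K(3)[OF H(1)[OF sI]], of "\<epsilon> n" n] \<epsilon>(1)[of n]
      by (simp add: Q_def nu_scale[OF YD[OF sI] m] nrm_scale[OF YD[OF sI] m] field_simps)
    have cT: "continuous_on T (\<lambda>p. (fst p - w (fst (snd p)) (nu (fst p) (fst (snd p)) (snd (snd p)))) *
        nrm (fst (snd p)) (snd (snd p)) / rho (fst p) (fst (snd p)))"
    proof (intro continuous_on_divide continuous_on_mult continuous_on_diff continuous_on_w continuous_on_nu_psi
        continuous_on_nrm_rho continuous_on_fst continuous_on_snd continuous_on_id ballI)
      show "rho (fst p) (fst (snd p)) \<noteq> 0" if "p \<in> T" for p
        using that rho_pos[of "fst (snd p)" "fst p"] by (force simp: T_def)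
    qed (auto simp: T_def)
    have "(\<lambda>n. (\<epsilon> (r n), Z (r n) s)) \<longlonglongrightarrow> (0, z s)" by (intro tendsto_Pair \<epsilon>r pt s)
    from continuous_on_tendsto_compose[OF cT this inT(2)[OF s]] inT(1)[OF s]
    show ?thesis unfolding eq by (simp add: Z_def y_def q_def \<nu>_def)
  qed
  define \<mu> where "\<mu> = lim (\<lambda>n. m (r n))"
  have \<mu>: "(- w (y s) (\<nu> s)) * nrm (y s) (q s) / rho 0 (y s) = \<mu>" if "s \<in> ?J" for s
    using limI[OF mlim[OF that]] by (simp add: \<mu>_def)
  have tJ: "t \<in> ?J" using \<sigma> by simp
  have \<mu>0: "\<mu> \<ge> 0" using LIMSEQ_le_const[OF mlim[OF tJ], of 0] m \<mu>[OF tJ] by (auto simp: less_imp_le)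
  have \<Delta>0: "\<Delta>' \<ge> 0" using LIMSEQ_le_const[OF \<Delta>(2), of 0] \<Delta>(1) by (auto simp: less_imp_le)
  have w\<nu>: "w (y s) (\<nu> s) = - (\<mu> * rho 0 (y s) / nrm (y s) (q s))" if s: "s \<in> ?J" for s
    using \<mu>[OF s] pos[OF s] by (simp add: field_simps)
  have wv': "w (y s) (v s) = \<Delta>' * w (y s) (\<nu> s)" if s: "s \<in> ?J" for s
    unfolding v_def using w_simps(2)[OF yD[OF s]] by simp
  have Gv: "G (y s) (v s) (v s) + 2 * \<Delta>' * w (y s) (v s) = 0" if s: "s \<in> ?J" for s
  proof -
    have "G (y s) (v s) (v s) + 2 * \<Delta>' * w (y s) (v s) = \<Delta>'\<^sup>2 * (G (y s) (\<nu> s) (\<nu> s) + 2 * w (y s) (\<nu> s))"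
      unfolding wv'[OF s] unfolding v_def using yD[OF s]
      by (simp add: G_simps power2_eq_square algebra_simps)
    then show ?thesis using \<nu>G(1)[OF s] by simp
  qed
  have dich: "(\<forall>s\<in>?O. v s = 0) \<or> \<Delta>' > 0 \<and> (\<forall>s\<in>?O. w (y s) (v s) < 0 \<and>
       ((\<lambda>s. (1 / - w (y s) (v s)) *\<^sub>R (flat (y s) (v s) + \<Delta>' *\<^sub>R wv (y s))) has_vector_derivative
          (1 / - w (y s) (v s)) *\<^sub>R force \<Delta>' (y s) (v s)) (at s))"
  \<comment> \<open>If \<open>\<mu> = 0\<close>, the one-form vanishes on \<nu>, and then the null
    condition forces \<open>\<nu> = 0\<close>. If both numbers are positive, \<open>w\<close> is
    negative on the velocity throughout, and the momentum of the limit curve is \<open>q\<close>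
    divided by \<mu>.\<close>
  proof (cases "\<Delta>' = 0 \<or> \<mu> = 0")
    case True
    have "v s = 0" if s: "s \<in> ?O" for s
    proof (cases "\<Delta>' = 0")
      case False
      then have "w (y s) (\<nu> s) = 0" using w\<nu>[of s] True s by auto
      then have "G (y s) (\<nu> s) (\<nu> s) = 0" using \<nu>G(1)[of s] s by auto
      then have "\<nu> s = 0" using G_pos[OF yD[of s], of "\<nu> s"] s by force
      then show ?thesis by (simp add: v_def)
    qed (simp add: v_def)
    then show ?thesis by blast
  next
    case False
    then have \<Delta>\<mu>: "\<Delta>' > 0" "\<mu> > 0" using \<Delta>0 \<mu>0 by auto
    have neg: "- w (y s) (v s) = \<Delta>' * (\<mu> * rho 0 (y s) / nrm (y s) (q s))" if s: "s \<in> ?J" for s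
      unfolding wv'[OF s] w\<nu>[OF s] by simp
    have flatv: "flat (y s) (v s) + \<Delta>' *\<^sub>R wv (y s) = (\<Delta>' * (rho 0 (y s) / nrm (y s) (q s))) *\<^sub>R q s" if s: "s \<in> ?J" for s
    proof -
      have "flat (y s) (v s) + \<Delta>' *\<^sub>R wv (y s) = \<Delta>' *\<^sub>R (flat (y s) (\<nu> s) + wv (y s))"
        unfolding v_def by (simp add: linear_scale[OF linear_flat[OF yD[OF s]]] scaleR_right_distrib)
      then show ?thesis unfolding \<nu>G(2)[OF s] by simp
    qed
    have peq: "(1 / - w (y s) (v s)) *\<^sub>R (flat (y s) (v s) + \<Delta>' *\<^sub>R wv (y s)) = (1 / \<mu>) *\<^sub>R q s" if s: "s \<in> ?J" for s
      unfolding flatv[OF s] neg[OF s] using \<Delta>\<mu> pos[OF s] by (simp add: field_simps)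
    have feq: "(1 / - w (y s) (v s)) *\<^sub>R force \<Delta>' (y s) (v s) = (1 / \<mu>) *\<^sub>R (\<Delta>' *\<^sub>R psi 0 (y s) (q s))" if s: "s \<in> ?J" for s
    proof -
      have "force \<Delta>' (y s) (v s) = \<Delta>'\<^sup>2 *\<^sub>R force 1 (y s) (\<nu> s)"
        unfolding v_def by (rule force_scale[OF yD[OF s]])
      then show ?thesis
        unfolding neg[OF s] psi_def \<nu>_def using \<Delta>\<mu> pos[OF s] by (simp add: field_simps power2_eq_square)
    qed
    have "w (y s) (v s) < 0 \<and>
       ((\<lambda>s. (1 / - w (y s) (v s)) *\<^sub>R (flat (y s) (v s) + \<Delta>' *\<^sub>R wv (y s))) has_vector_derivative
          (1 / - w (y s) (v s)) *\<^sub>R force \<Delta>' (y s) (v s)) (at s)" if s: "s \<in> ?O" for s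
    proof
      have sJ: "s \<in> ?J" using s by auto
      have "- w (y s) (v s) > 0" unfolding neg[OF sJ] using \<Delta>\<mu> pos[OF sJ] by simp
      then show "w (y s) (v s) < 0" by simp
      have "((\<lambda>s. (1 / \<mu>) *\<^sub>R q s) has_vector_derivative (1 / \<mu>) *\<^sub>R (\<Delta>' *\<^sub>R psi 0 (y s) (q s))) (at s)"
        by (rule bounded_linear.has_vector_derivative[OF bounded_linear_scaleR_right yd(2)[OF s]])
      then show "((\<lambda>s. (1 / - w (y s) (v s)) *\<^sub>R (flat (y s) (v s) + \<Delta>' *\<^sub>R wv (y s))) has_vector_derivative
          (1 / - w (y s) (v s)) *\<^sub>R force \<Delta>' (y s) (v s)) (at s)"
        unfolding feq[OF sJ]
        by (rule has_vector_derivative_transform_within_open[where S="?O"]) (use s peq[symmetric] OJ in auto)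
    qed
    then show ?thesis using \<Delta>\<mu> by blast
  qed
  have unif: "\<forall>e>0. \<exists>N. \<forall>n\<ge>N. \<forall>s\<in>?J. norm (Y (r n) s - y s) < e"
  proof (intro allI impI)
    fix e :: real assume "e > 0"
    then obtain N where N: "\<forall>n s. n \<ge> N \<and> s \<in> ?J \<longrightarrow> norm (Z (r n) s - z s) < e" using conv by blast
    have "norm (Y (r n) s - y s) < e" if "n \<ge> N" "s \<in> ?J" for n s
    proof -
      have "norm (Y (r n) s - y s) \<le> norm (Z (r n) s - z s)"
        using norm_fst_le[of "Y (r n) s - y s" "Q (r n) s - q s"] by (simp add: Z_def y_def q_def minus_prod_def)
      then show ?thesis using N that by fastforce
    qed
    then show "\<exists>N. \<forall>n\<ge>N. \<forall>s\<in>?J. norm (Y (r n) s - y s) < e" by blast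
  qed
  show ?thesis
    by (rule exI[of _ r], rule exI[of _ y], rule exI[of _ v], intro conjI z(2) unif smy dich)
      (use yK yd(1) Gv OJ in auto)
qed

end

section \<open>Critical points of the Kropina energy\<close>

context riemannian_atlas
begin

text \<open>The quadratic equation says that the Kropina speed is \<open>\<Delta>\<close>; the covector being differentiated is the
  derivative of the Kropina metric with respect to the velocity, and the last condition is Hamilton's equation for it.\<close>

definition kropina_window where
  "kropina_window \<Delta> \<gamma> t c d y v \<longleftrightarrow> c \<in> \<A> \<and> d > 0 \<and> smooth_on y {t-d<..<t+d} \<and>
    (\<forall>s\<in>{t-d<..<t+d}. \<gamma> s \<in> fst c \<and> snd c (\<gamma> s) = y s \<and> (y has_vector_derivative v s) (at s) \<and>
      Gc c (y s) (v s) (v s) + 2 * \<Delta> * wc c (y s) (v s) = 0 \<and> wc c (y s) (v s) < 0 \<and>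
      ((\<lambda>s. (1 / - wc c (y s) (v s)) *\<^sub>R (metric_coords.flat (Gc c) (y s) (v s) +
          \<Delta> *\<^sub>R metric_coords.wv (wc c) (y s))) has_vector_derivative
        (1 / - wc c (y s) (v s)) *\<^sub>R metric_coords.force (Gc c) (wc c) \<Delta> (y s) (v s)) (at s))"

lemma kropina_tvec:
  assumes "c \<in> \<A>" "p \<in> fst c"
  shows "kropina g \<omega> p (tvec \<A> c p u) = metric_coords.FK (Gc c) (wc c) (snd c p) u"
  by (simp add: kropina_def metric_coords.FK_def[OF metric_coords[OF assms(1)]] g_tvec[OF assms] w_tvec[OF assms])

lemma window_velocity:
  assumes "kropina_window \<Delta> \<gamma> t c d y v" "s \<in> {t-d<..<t+d}" "s \<in> S" "at s within S \<noteq> bot"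
  shows "velocity \<A> \<gamma> s (at s within S) = tvec \<A> c (\<gamma> s) (v s)"
proof (rule velocity_eq)
  have w: "c \<in> \<A>" "\<And>s. s \<in> {t-d<..<t+d} \<Longrightarrow> \<gamma> s \<in> fst c"
    "\<And>s. s \<in> {t-d<..<t+d} \<Longrightarrow> snd c (\<gamma> s) = y s" "(y has_vector_derivative v s) (at s)"
    using assms(1,2) unfolding kropina_window_def by auto
  show "c \<in> \<A>" "\<gamma> s \<in> fst c" using w(1,2) assms(2) by auto
  show "\<forall>\<^sub>F t in at s within S. \<gamma> t \<in> fst c"
    unfolding eventually_at_filter
    by (rule eventually_mono[OF eventually_nhds_in_open[of "{t-d<..<t+d}"]]) (use w(2) assms(2) in auto)
  have "((snd c \<circ> \<gamma>) has_vector_derivative v s) (at s)"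
    by (rule has_vector_derivative_transform_within_open[OF w(4), of "{t-d<..<t+d}"]) (use w(3) assms(2) in auto)
  then show "((snd c \<circ> \<gamma>) has_vector_derivative v s) (at s within S)"
    by (rule has_vector_derivative_at_within)
qed (use assms in auto)

lemma window_smooth_into:
  assumes "\<And>t. t \<in> {a..b} \<Longrightarrow> \<exists>c d y v. kropina_window \<Delta> \<gamma> t c d y v"
  shows "smooth_into \<A> {a..b} \<gamma>"
proof (rule smooth_intoI)
  fix t assume "t \<in> {a..b}"
  then obtain c d y v where w: "kropina_window \<Delta> \<gamma> t c d y v" using assms by blast
  then have "y s \<in> snd c ` fst c \<and> \<gamma> s = chart_inv c (y s)" if "s \<in> {t-d<..<t+d}" for s
    using that unfolding kropina_window_def by (metis chart_inv_left imageI)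
  then show "\<exists>c\<in>\<A>. \<exists>W h. open W \<and> t \<in> W \<and> smooth_on h W \<and>
    (\<forall>y\<in>{a..b} \<inter> W. h y \<in> snd c ` fst c \<and> \<gamma> y = chart_inv c (h y))"
    using w unfolding kropina_window_def
    by (intro bexI[of _ c] exI[of _ "{t-d<..<t+d}"] exI[of _ y]) auto
qed

text \<open>Negativity of the one-form on the velocity does double duty: it puts the velocity in the
  cone and keeps the curve off the zeros of the form.\<close>

lemma kropina_loop:
  assumes "\<And>t. t \<in> {0..1} \<Longrightarrow> \<exists>c d y v. kropina_window \<Delta> \<gamma> t c d y v" "\<gamma> 0 = \<gamma> 1"
  shows "\<gamma> \<in> loop_space \<A> (kropina_domain \<A> \<omega>)"
proof -
  have sm: "smooth_into \<A> {a..b} \<gamma>" if "0 \<le> a" "b \<le> 1" for a b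
    by (rule window_smooth_into[of a b \<Delta>]) (use assms(1) that in auto)
  have "piecewise_smooth \<A> \<gamma>"
    unfolding piecewise_smooth_def using sm smooth_into_imp_continuous_on[OF sm[of 0 1]] by auto
  moreover have dom: "(\<gamma> s, velocity \<A> \<gamma> s (at s within S)) \<in> kropina_domain \<A> \<omega>"
    if s: "s \<in> {0..1}" "s \<in> S" "at s within S \<noteq> bot" for s S
  proof -
    obtain c d y v where w: "kropina_window \<Delta> \<gamma> s c d y v" using assms(1)[OF s(1)] by blast
    then have c: "c \<in> \<A>" "s \<in> {s-d<..<s+d}" "\<gamma> s \<in> fst c" "wc c (snd c (\<gamma> s)) (v s) < 0"
      unfolding kropina_window_def by auto
    have t: "tvec \<A> c (\<gamma> s) (v s) \<in> tangent_space \<A> (\<gamma> s)" by (rule tvec_in_tangent_space[OF c(1,3)])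
    moreover have "\<omega> (\<gamma> s) (tvec \<A> c (\<gamma> s) (v s)) < 0" using c by (simp add: w_tvec)
    ultimately show ?thesis
      unfolding window_velocity[OF w c(2) s(2,3)] kropina_domain_def vanishing_set_def tangent_bundle_def
      by force
  qed
  ultimately show ?thesis
    unfolding loop_space_def using assms(2)
    by (auto intro!: dom simp: trivial_limit_within islimpt_Icc)
qed

text \<open>By Hamilton's equation the integrand is the total derivative of \<Delta> times the
  pairing of the momentum with the variation field, so only boundary terms remain.
  \<open>\<Phi>\<close> writes them without charts; this lets the contributions of neighbouring
  windows telescope.\<close>

lemma kropina_variation_window:
  assumes w: "kropina_window \<Delta> \<gamma> s0 c d0 y v" and \<Delta>: "\<Delta> > 0"
    and H: "smooth_into \<A> ({-\<delta><..<\<delta>} \<times> {a..b}) (\<lambda>(r, s). H r s)"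
    and H0: "\<And>s. s \<in> {0..1} \<Longrightarrow> H 0 s = \<gamma> s"
    and ab: "\<delta> > 0" "0 \<le> a" "a < b" "b \<le> 1" "s0 \<in> {a..b}"
  defines "\<Phi> \<equiv> \<lambda>s. \<Delta> * (g (\<gamma> s) (velocity \<A> \<gamma> s (at s)) (velocity \<A> (\<lambda>r. H r s) 0 (at 0)) +
      \<Delta> * \<omega> (\<gamma> s) (velocity \<A> (\<lambda>r. H r s) 0 (at 0))) / - \<omega> (\<gamma> s) (velocity \<A> \<gamma> s (at s))"
  shows "\<exists>d>0. \<forall>a' b'. a \<le> a' \<longrightarrow> s0 - d \<le> a' \<longrightarrow> a' \<le> b' \<longrightarrow> b' \<le> b \<longrightarrow> b' \<le> s0 + d \<longrightarrow>
    var_deriv (kropina g \<omega>) H a' b' (\<Phi> b' - \<Phi> a')"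
proof -
  have c: "c \<in> \<A>" and d0: "d0 > 0" using w unfolding kropina_window_def by auto
  have win: "\<gamma> s \<in> fst c" "snd c (\<gamma> s) = y s"
    "(y has_vector_derivative v s) (at s)" "Gc c (y s) (v s) (v s) + 2 * \<Delta> * wc c (y s) (v s) = 0"
    "wc c (y s) (v s) < 0"
    and pd: "((\<lambda>s. (1 / - wc c (y s) (v s)) *\<^sub>R (metric_coords.flat (Gc c) (y s) (v s) +
          \<Delta> *\<^sub>R metric_coords.wv (wc c) (y s))) has_vector_derivative
        (1 / - wc c (y s) (v s)) *\<^sub>R metric_coords.force (Gc c) (wc c) \<Delta> (y s) (v s)) (at s)"
    if "s \<in> {s0-d0<..<s0+d0}" for s
    using w that unfolding kropina_window_def by auto
  interpret M: metric_coords "snd c ` fst c" "Gc c" "wc c" by (rule metric_coords[OF c])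
  have s0in: "s0 \<in> {s0-d0<..<s0+d0}" using d0 by simp
  have s01: "s0 \<in> {0..1}" using ab by auto
  let ?L = "\<lambda>q. (M.FK (fst q) (snd q))\<^sup>2 / 2"
  let ?L' = "\<lambda>y z. M.dL (M.FK y z) (- wc c y z) y z"
  \<comment> \<open>The open set on which the Kropina energy is differentiated; by openness it also
    contains the velocities of nearby curves of the variation.\<close>
  let ?\<Omega> = "((snd c ` fst c) \<times> UNIV) \<inter> (\<lambda>q. wc c (fst q) (snd q)) -` {..<0}"
  have yD: "y s \<in> snd c ` fst c" if "s \<in> {s0-d0<..<s0+d0}" for s using imageI[OF win(1)[OF that], of "snd c"] win(2)[OF that] by simp
  have 0: "H 0 s0 \<in> fst c" using H0[OF s01] win(1)[OF s0in] by simp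
  have 1: "(kropina g \<omega> p (tvec \<A> c p u))\<^sup>2 / 2 = ?L (snd c p, u)" if "p \<in> fst c" for p u
    by (simp add: kropina_tvec[OF c that])
  have 2: "open ?\<Omega>"
    by (intro continuous_open_preimage M.continuous_on_w continuous_intros open_Times M.D_open) auto
  have 3: "(snd c (H 0 s0), vector_derivative (\<lambda>s. snd c (H 0 s)) (at s0 within {a..b})) \<in> ?\<Omega>"
  proof -
    have "(y has_vector_derivative v s0) (at s0 within {a..b})"
      using win(3)[OF s0in] by (rule has_vector_derivative_at_within)
    moreover have "\<forall>\<^sub>F s in at s0 within {a..b}. y s = snd c (H 0 s)"
      unfolding eventually_at_filter
      by (rule eventually_mono[OF eventually_nhds_in_open[of "{s0-d0<..<s0+d0}"]])
        (use win(2) H0 ab d0 in auto)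
    ultimately have "((\<lambda>s. snd c (H 0 s)) has_vector_derivative v s0) (at s0 within {a..b})"
      unfolding has_vector_derivative_def
      by (rule has_derivative_transform_eventually) (use win(2)[OF s0in] H0[OF s01] ab(5) in auto)
    moreover have "at s0 within {a..b} \<noteq> bot" using ab by (simp add: trivial_limit_within islimpt_Icc)
    ultimately have "vector_derivative (\<lambda>s. snd c (H 0 s)) (at s0 within {a..b}) = v s0"
      by (rule vector_derivative_within[rotated])
    then show ?thesis using win(2,5)[OF s0in] yD[OF s0in] H0[OF s01] by simp
  qed
  have 4: "(?L has_derivative (\<lambda>h. ?L' x z (fst h) (snd h))) (at (x, z))" if "(x, z) \<in> ?\<Omega>" for x z
    by (rule M.FK_energy_has_derivative) (use that in auto)
  have 5: "continuous_on S (\<lambda>s. ?L' (x s) (z s) (\<xi> s) (\<zeta> s))"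
    if "continuous_on S x" "continuous_on S z" "continuous_on S \<xi>" "continuous_on S \<zeta>" "\<forall>s\<in>S. (x s, z s) \<in> ?\<Omega>"
    for S and x z \<xi> \<zeta> :: "real \<times> real \<Rightarrow> 'e"
  proof -
    have x: "x ` S \<subseteq> snd c ` fst c" using that(5) by auto
    have n: "wc c (x s) (z s) < 0" if "s \<in> S" for s using \<open>\<forall>s\<in>S. _\<close> that by auto
    note wcont = M.continuous_on_w[OF that(1) x that(2)]
    show ?thesis
    proof (rule M.continuous_on_dL[OF that(1) x that(2-4)])
      show "continuous_on S (\<lambda>s. M.FK (x s) (z s))"
        unfolding M.FK_def
        by (intro continuous_on_minus continuous_on_divide continuous_on_mult continuous_on_const wcont
            M.continuous_on_G[OF that(1) x that(2) that(2)]) (use n in force)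
      show "continuous_on S (\<lambda>s. - wc c (x s) (z s))" by (intro continuous_on_minus wcont)
      show "- wc c (x s) (z s) \<noteq> 0" if "s \<in> S" for s using n[OF that] by simp
    qed
  qed
  show ?thesis
  proof (rule first_variation_chart[where F="kropina g \<omega>" and L="?L" and \<Omega>="?\<Omega>" and L'="?L'",
          OF c H ab 0 1 2 3 4 5])
    fix d W and h :: "real \<times> real \<Rightarrow> 'e"
    let ?h1 = "\<lambda>q. frechet_derivative h (at q) (1, 0)" and ?h2 = "\<lambda>q. frechet_derivative h (at q) (0, 1)"
    let ?h12 = "\<lambda>q. frechet_derivative ?h2 (at q) (1, 0)"
    assume d: "0 < d" "d < \<delta>" "open W" "smooth_on h W" "{-d..d} \<times> {s0-d..s0+d} \<subseteq> W"
      and h: "\<And>r s. r \<in> {-d..d} \<Longrightarrow> s \<in> {a..b} \<Longrightarrow> s \<in> {s0-d..s0+d} \<Longrightarrow> H r s \<in> fst c \<and> snd c (H r s) = h (r, s)"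
      and vd: "\<And>a' b'. a \<le> a' \<Longrightarrow> s0 - d \<le> a' \<Longrightarrow> b' \<le> b \<Longrightarrow> b' \<le> s0 + d \<Longrightarrow>
        var_deriv (kropina g \<omega>) H a' b' (integral {a'..b'} (\<lambda>s.
          ?L' (h (0, s)) (?h2 (0, s)) (?h1 (0, s)) (?h12 (0, s))))"
    define d' where "d' = min d (d0 / 2)"
    have d': "0 < d'" "d' \<le> d" "d' < d0" using d(1) d0 by (auto simp: d'_def)
    have "var_deriv (kropina g \<omega>) H a' b' (\<Phi> b' - \<Phi> a')"
      if a'b': "a \<le> a'" "s0 - d' \<le> a'" "a' \<le> b'" "b' \<le> b" "b' \<le> s0 + d'" for a' b'
    proof -
      have t: "t \<in> {s0-d0<..<s0+d0}" "t \<in> {a..b}" "t \<in> {s0-d..s0+d}" "t \<in> {0..1}" if "t \<in> {a'..b'}" for t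
        using that a'b' d' ab by auto
      have inW: "(r, t) \<in> W" if "r \<in> {-d..d}" "t \<in> {a'..b'}" for r t
        using t[OF that(2)] that(1) by (intro subsetD[OF d(5)]) auto
      have inW0: "(0, t) \<in> W" if "t \<in> {a'..b'}" for t using inW[OF _ that, of 0] d(1) by simp
      have h0: "h (0, t) = y t" if "t \<in> {a'..b'}" for t
        using h[of 0 t] t[OF that] d(1) H0[of t] win(2)[of t] by auto
      define p where "p s = (1 / - wc c (y s) (v s)) *\<^sub>R (M.flat (y s) (v s) + \<Delta> *\<^sub>R M.wv (y s))" for s
      define p' where "p' s = (1 / - wc c (y s) (v s)) *\<^sub>R M.force \<Delta> (y s) (v s)" for s
      have V: "velocity \<A> (\<lambda>r. H r t) 0 (at 0) = tvec \<A> c (\<gamma> t) (?h1 (0, t))" if tt: "t \<in> {a'..b'}" for t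
      proof -
        have "velocity \<A> (\<lambda>r. H r t) 0 (at 0) = tvec \<A> c (H 0 t) (?h1 (0, t))"
        proof (rule velocity_eq[OF c])
          show "H 0 t \<in> fst c" using h[of 0 t] t[OF tt] d(1) by auto
          show "\<forall>\<^sub>F r in at 0. H r t \<in> fst c"
            unfolding eventually_at_filter
            by (rule eventually_mono[OF eventually_nhds_in_open[of "{-d<..<d}"]]) (use h t[OF tt] d(1) in auto)
          have "((\<lambda>r. h (r, t)) has_vector_derivative ?h1 (0, t)) (at 0)"
            by (rule smooth_on_partial1[OF d(4) inW0[OF tt]])
          then show "((snd c \<circ> (\<lambda>r. H r t)) has_vector_derivative ?h1 (0, t)) (at 0)"
            by (rule has_vector_derivative_transform_within_open[where S="{-d<..<d}"])
              (use d(1) h t[OF tt] in auto)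
        qed auto
        then show ?thesis using H0[OF t(4)[OF tt]] by simp
      qed
      have \<Phi>p: "\<Phi> t = \<Delta> * (p t \<bullet> ?h1 (0, t))" if tt: "t \<in> {a'..b'}" for t
      proof -
        note tw = t(1)[OF tt]
        have vel: "velocity \<A> \<gamma> t (at t) = tvec \<A> c (\<gamma> t) (v t)" by (rule window_velocity[OF w tw]) auto
        show ?thesis
          unfolding \<Phi>_def V[OF tt] vel g_tvec[OF c win(1)[OF tw]] w_tvec[OF c win(1)[OF tw]] win(2)[OF tw] p_def
          using yD[OF tw] by (simp add: inner_add_left M.flat_inner M.wv_inner)
      qed
      have dpsi: "((\<lambda>s. \<Delta> * (p s \<bullet> ?h1 (0, s))) has_vector_derivative
          \<Delta> * (p t \<bullet> ?h12 (0, t) + p' t \<bullet> ?h1 (0, t))) (at t)" if tt: "t \<in> {a'..b'}" for t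
      proof -
        have 1: "(p has_vector_derivative p' t) (at t)"
          unfolding p_def[abs_def] p'_def by (rule pd[OF t(1)[OF tt]])
        have 2: "((\<lambda>s. ?h1 (0, s)) has_vector_derivative ?h12 (0, t)) (at t)"
          by (rule smooth_on_mixed_partials[OF d(3,4) inW0[OF tt]])
        from bounded_bilinear.has_vector_derivative[OF bounded_bilinear_inner 1 2]
        have "((\<lambda>s. p s \<bullet> ?h1 (0, s)) has_vector_derivative p t \<bullet> ?h12 (0, t) + p' t \<bullet> ?h1 (0, t)) (at t)" .
        from has_vector_derivative_mult_right[OF this, of \<Delta>] show ?thesis .
      qed
      have ftc: "((\<lambda>t. \<Delta> * (p t \<bullet> ?h12 (0, t) + p' t \<bullet> ?h1 (0, t))) has_integral (\<Phi> b' - \<Phi> a')) {a'..b'}"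
      proof -
        have "((\<lambda>t. \<Delta> * (p t \<bullet> ?h12 (0, t) + p' t \<bullet> ?h1 (0, t))) has_integral
          (\<Delta> * (p b' \<bullet> ?h1 (0, b')) - \<Delta> * (p a' \<bullet> ?h1 (0, a')))) {a'..b'}"
          by (rule fundamental_theorem_of_calculus[OF a'b'(3)]) (rule has_vector_derivative_at_within[OF dpsi])
        then show ?thesis using \<Phi>p[of a'] \<Phi>p[of b'] a'b'(3) by simp
      qed
      have eq: "?L' (h (0, t)) (?h2 (0, t)) (?h1 (0, t)) (?h12 (0, t)) =
          \<Delta> * (p t \<bullet> ?h12 (0, t) + p' t \<bullet> ?h1 (0, t))" if tt: "t \<in> {a'..b'} - {a', b'}" for t
      proof -
        have ti: "t \<in> {a'..b'}" "t \<in> {a'<..<b'}" using tt by auto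
        note tw = t(1)[OF ti(1)]
        have "((\<lambda>s. h (0, s)) has_vector_derivative ?h2 (0, t)) (at t)"
          by (rule smooth_on_partial2[OF d(4) inW0[OF ti(1)]])
        then have "(y has_vector_derivative ?h2 (0, t)) (at t)"
          by (rule has_vector_derivative_transform_within_open[where S="{a'<..<b'}"]) (use ti h0 in auto)
        then have h2: "?h2 (0, t) = v t" using win(3)[OF tw] vector_derivative_unique_at by blast
        have n: "wc c (y t) (v t) \<noteq> 0" using win(5)[OF tw] by simp
        have "Gc c (y t) (v t) (v t) = - (2 * \<Delta> * wc c (y t) (v t))" using win(4)[OF tw] by simp
        then have FK: "M.FK (y t) (v t) = \<Delta>" unfolding M.FK_def using n by simp
        have pz: "p t \<bullet> \<zeta> = (Gc c (y t) (v t) \<zeta> + \<Delta> * wc c (y t) \<zeta>) / - wc c (y t) (v t)" for \<zeta>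
          using yD[OF tw] by (simp add: p_def inner_add_left M.flat_inner M.wv_inner)
        have fz: "M.force \<Delta> (y t) (v t) \<bullet> \<xi> = M.dG (y t) \<xi> (v t) (v t) / 2 + \<Delta> * M.dw (y t) \<xi> (v t)" for \<xi>
        proof -
          have "M.dG (y t) \<xi> (v t) (v t) / 2 + \<Delta> * M.dw (y t) \<xi> (v t) =
            (\<Sum>k\<in>Basis. (\<xi> \<bullet> k) * (M.dG (y t) k (v t) (v t) / 2 + \<Delta> * M.dw (y t) k (v t)))"
            using linear_euclidean_expand[OF M.linear_dG[OF yD[OF tw]], of \<xi> "v t" "v t"]
              linear_euclidean_expand[OF M.linear_dw[OF yD[OF tw]], of \<xi> "v t"]
            by (simp add: sum_divide_distrib sum_distrib_left sum.distrib[symmetric] algebra_simps)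
          then show ?thesis
            by (simp only: M.force_def inner_sum_left inner_scaleR_left) (simp add: inner_commute mult.commute)
        qed
        have p'z: "p' t \<bullet> \<xi> = (M.dG (y t) \<xi> (v t) (v t) / 2 + \<Delta> * M.dw (y t) \<xi> (v t)) / - wc c (y t) (v t)" for \<xi>
          by (simp add: p'_def fz)
        show ?thesis
          unfolding h0[OF ti(1)] h2 M.dL_def FK pz p'z using n by (simp add: field_simps)
      qed
      have "integral {a'..b'} (\<lambda>s. ?L' (h (0, s)) (?h2 (0, s)) (?h1 (0, s)) (?h12 (0, s))) =
          integral {a'..b'} (\<lambda>t. \<Delta> * (p t \<bullet> ?h12 (0, t) + p' t \<bullet> ?h1 (0, t)))"
        by (rule integral_spike[of "{a', b'}"]) (use eq in auto)
      then have "integral {a'..b'} (\<lambda>s. ?L' (h (0, s)) (?h2 (0, s)) (?h1 (0, s)) (?h12 (0, s))) = \<Phi> b' - \<Phi> a'"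
        using integral_unique[OF ftc] by simp
      then show ?thesis using vd[of a' b'] a'b' d' by simp
    qed
    then show ?thesis using d'(1) by blast
  qed
qed

text \<open>The boundary terms telescope to \<open>\<Phi> 1 - \<Phi> 0\<close>. Periodicity is
  required on the whole line because \<open>\<Phi>\<close> contains two-sided velocities, which at
  \<open>0\<close> and \<open>1\<close> look beyond [0,1].\<close>

lemma kropina_closed_geodesic:
  assumes win: "\<And>t. t \<in> {0..1} \<Longrightarrow> \<exists>c d y v. kropina_window \<Delta> \<gamma> t c d y v"
    and per: "\<And>t. \<gamma> (t + 1) = \<gamma> t" and \<Delta>: "\<Delta> > 0"
  shows "closed_geodesic \<A> (kropina_domain \<A> \<omega>) (kropina g \<omega>) \<gamma>"
  unfolding closed_geodesic_def
proof (intro conjI allI impI)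
  have \<gamma>01: "\<gamma> 0 = \<gamma> 1" using per[of 0] by simp
  show "\<gamma> \<in> loop_space \<A> (kropina_domain \<A> \<omega>)" by (rule kropina_loop[OF win \<gamma>01])
  fix \<delta> H assume lv: "loop_variation \<A> (kropina_domain \<A> \<omega>) \<gamma> \<delta> H"
  then have \<delta>: "\<delta> > 0" and H0: "\<And>s. s \<in> {0..1} \<Longrightarrow> H 0 s = \<gamma> s"
    and loops: "\<And>r. r \<in> {-\<delta><..<\<delta>} \<Longrightarrow> H r 0 = H r 1"
    unfolding loop_variation_def loop_space_def by auto
  obtain P where P: "finite P" "\<And>a b. 0 \<le> a \<Longrightarrow> a < b \<Longrightarrow> b \<le> 1 \<Longrightarrow> {a<..<b} \<inter> P = {} \<Longrightarrow>
        smooth_into \<A> ({-\<delta><..<\<delta>} \<times> {a..b}) (\<lambda>(r, s). H r s)"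
    using lv unfolding loop_variation_def by metis
  define \<Phi> where "\<Phi> s = \<Delta> * (g (\<gamma> s) (velocity \<A> \<gamma> s (at s)) (velocity \<A> (\<lambda>r. H r s) 0 (at 0)) +
      \<Delta> * \<omega> (\<gamma> s) (velocity \<A> (\<lambda>r. H r s) 0 (at 0))) / - \<omega> (\<gamma> s) (velocity \<A> \<gamma> s (at s))" for s
  have side: "\<exists>d>0. \<forall>a' b'. a \<le> a' \<longrightarrow> s0 - d \<le> a' \<longrightarrow> a' \<le> b' \<longrightarrow> b' \<le> b \<longrightarrow> b' \<le> s0 + d \<longrightarrow>
    var_deriv (kropina g \<omega>) H a' b' (\<Phi> b' - \<Phi> a')"
    if ab: "0 \<le> a" "a < b" "b \<le> 1" "s0 \<in> {a..b}" "{a<..<b} \<inter> P = {}" for a b s0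
  proof -
    have "s0 \<in> {0..1}" using ab by auto
    then obtain c d y v where w: "kropina_window \<Delta> \<gamma> s0 c d y v" using win by blast
    show ?thesis
      unfolding \<Phi>_def by (rule kropina_variation_window[OF w \<Delta> P(2)[OF ab(1-3,5)] H0 \<delta> ab(1-4)])
  qed
  let ?Q = "\<lambda>a b. var_deriv (kropina g \<omega>) H a b (\<Phi> b - \<Phi> a)"
  have "?Q 0 1"
  proof (rule interval_gluing[where P="?Q"])
    fix u v t :: real assume "u < v" "v < t" "?Q u v" "?Q v t"
    then show "?Q u t" using var_deriv_add[of "kropina g \<omega>" H u v "\<Phi> v - \<Phi> u" t "\<Phi> t - \<Phi> v"] by simp
  next
    fix s :: real assume s: "0 \<le> s" "s \<le> 1"
    obtain d where d: "d > 0" "\<forall>t\<le>s+d. {s<..<t} \<inter> P = {}" "\<forall>t\<ge>s-d. {t<..<s} \<inter> P = {}"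
      using finite_gaps[OF P(1)] .
    have r: "\<exists>e>0. \<forall>t. s < t \<and> t \<le> 1 \<and> t < s + e \<longrightarrow> ?Q s t"
    proof (cases "s < 1")
      case True
      define b where "b = min 1 (s + d)"
      have b: "s < b" "b \<le> 1" "b \<le> s + d" using True d(1) by (auto simp: b_def)
      from side[of s b s] s b d(2)
      obtain e where e: "e > 0" "\<And>a' b'. s \<le> a' \<Longrightarrow> s - e \<le> a' \<Longrightarrow> a' \<le> b' \<Longrightarrow> b' \<le> b \<Longrightarrow> b' \<le> s + e \<Longrightarrow> ?Q a' b'"
        by auto
      then show ?thesis using b d(1) by (intro exI[of _ "min e (b - s)"]) auto
    qed (auto intro: zero_less_one)
    have l: "\<exists>e>0. \<forall>t. 0 \<le> t \<and> t < s \<and> s - e < t \<longrightarrow> ?Q t s"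
    proof (cases "0 < s")
      case True
      define a where "a = max 0 (s - d)"
      have a: "a < s" "0 \<le> a" "s - d \<le> a" using True d(1) by (auto simp: a_def)
      from side[of a s s] s a d(3)
      obtain e where e: "e > 0" "\<And>a' b'. a \<le> a' \<Longrightarrow> s - e \<le> a' \<Longrightarrow> a' \<le> b' \<Longrightarrow> b' \<le> s \<Longrightarrow> b' \<le> s + e \<Longrightarrow> ?Q a' b'"
        by auto
      then show ?thesis using a d(1) by (intro exI[of _ "min e (s - a)"]) auto
    qed (auto intro: zero_less_one)
    from r l obtain e1 e2 where "e1 > 0" "\<forall>t. s < t \<and> t \<le> 1 \<and> t < s + e1 \<longrightarrow> ?Q s t"
      "e2 > 0" "\<forall>t. 0 \<le> t \<and> t < s \<and> s - e2 < t \<longrightarrow> ?Q t s" by blast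
    then show "\<exists>d>0. (\<forall>t. s < t \<and> t \<le> 1 \<and> t < s + d \<longrightarrow> ?Q s t) \<and> (\<forall>t. 0 \<le> t \<and> t < s \<and> s - d < t \<longrightarrow> ?Q t s)"
      by (intro exI[of _ "min e1 e2"]) auto
  qed simp
  \<comment> \<open>Shifting the window at \<open>0\<close> by one period gives the velocity at
    \<open>1\<close>. The variation fields at the two ends coincide because every curve of the
    variation is closed.\<close>
  moreover have "\<Phi> 1 = \<Phi> 0"
  proof -
    obtain c d y v where w: "kropina_window \<Delta> \<gamma> 0 c d y v" using win[of 0] by auto
    then have d: "d > 0" "c \<in> \<A>" and yv: "\<And>s. s \<in> {-d<..<d} \<Longrightarrow> \<gamma> s \<in> fst c \<and> snd c (\<gamma> s) = y s \<and> (y has_vector_derivative v s) (at s)"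
      unfolding kropina_window_def by auto
    have pm: "\<gamma> (s - 1) = \<gamma> s" for s using per[of "s - 1"] by simp
    have "velocity \<A> \<gamma> 1 (at 1) = tvec \<A> c (\<gamma> 1) (v 0)"
    proof (rule velocity_eq[OF d(2)])
      show "\<gamma> 1 \<in> fst c" using yv[of 0] d(1) \<gamma>01 by simp
      have "\<gamma> t \<in> fst c" if "t \<in> {1-d<..<1+d}" for t using yv[of "t - 1"] that pm[of t] by simp
      then show "\<forall>\<^sub>F t in at 1. \<gamma> t \<in> fst c"
        unfolding eventually_at_filter
        by (intro eventually_mono[OF eventually_nhds_in_open[of "{1-d<..<1+d}"]]) (use d in auto)
      have "(y has_vector_derivative v 0) (at (1 - 1))" using yv[of 0] d(1) by simp
      from has_vector_derivative_shift[OF this]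
      show "((snd c \<circ> \<gamma>) has_vector_derivative v 0) (at 1)"
      proof (rule has_vector_derivative_transform_within_open[where S="{1-d<..<1+d}"])
        fix t assume "t \<in> {1-d<..<1+d}"
        then show "y (t - 1) = (snd c \<circ> \<gamma>) t" using yv[of "t - 1"] pm[of t] by simp
      qed (use d in auto)
    qed auto
    moreover have "velocity \<A> \<gamma> 0 (at 0) = tvec \<A> c (\<gamma> 0) (v 0)"
      by (rule window_velocity[OF w]) (use d in auto)
    ultimately have "velocity \<A> \<gamma> 1 (at 1) = velocity \<A> \<gamma> 0 (at 0)" using \<gamma>01 by simp
    moreover have "velocity \<A> (\<lambda>r. H r 1) 0 (at 0) = velocity \<A> (\<lambda>r. H r 0) 0 (at 0)"
    proof -
      have "vector_derivative (snd c \<circ> (\<lambda>r. H r 1)) (at 0) = vector_derivative (snd c \<circ> (\<lambda>r. H r 0)) (at 0)" for c :: "('m, 'e) chart"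
      proof (rule vector_derivative_cong_eq)
        show "\<forall>\<^sub>F r in nhds 0. r \<in> UNIV \<longrightarrow> (snd c \<circ> (\<lambda>r. H r 1)) r = (snd c \<circ> (\<lambda>r. H r 0)) r"
          by (rule eventually_mono[OF eventually_nhds_in_open[of "{-\<delta><..<\<delta>}"]]) (use \<delta> loops in auto)
      qed auto
      then show ?thesis unfolding velocity_def using loops[of 0] \<delta> by auto
    qed
    ultimately show ?thesis unfolding \<Phi>_def using \<gamma>01 by simp
  qed
  ultimately have "var_deriv (kropina g \<omega>) H 0 1 0" by simp
  then show "((\<lambda>r. energy \<A> (kropina g \<omega>) (H r)) has_real_derivative 0) (at 0)"
    by (rule energy_has_derivative)
qed

end

section \<open>The limit curve\<close>

text \<open>Continuous induction: a first point outside \<open>V\<close> would be a limit of earlier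
  points, all of them in the closed set \<open>K\<close>, so it would lie in \<open>K\<close> and
  hence in \<open>V\<close>.\<close>

lemma continuous_stay:
  fixes f :: "real \<Rightarrow> 'a::topological_space"
  assumes f: "continuous_on {0..b} f" and V: "open V" and K: "closed K" "K \<subseteq> V"
    and f0: "f 0 \<in> V" and step: "\<And>u. u \<in> {0..b} \<Longrightarrow> (\<And>w. w \<in> {0..u} \<Longrightarrow> f w \<in> V) \<Longrightarrow> f u \<in> K"
    and u: "u \<in> {0..b}"
  shows "f u \<in> K"
proof -
  have "f u \<in> V" if u: "u \<in> {0..b}" for u
  proof (rule ccontr)
    assume nu: "f u \<notin> V"
    define E where "E = {0..b} \<inter> f -` (- V)"
    have "closed E" unfolding E_def by (rule continuous_closed_preimage[OF f]) (use V in auto)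
    moreover have "u \<in> E" "bdd_below E" using u nu by (auto simp: E_def intro: bdd_belowI[of _ 0])
    ultimately have "Inf E \<in> E" and le: "\<And>w. w \<in> E \<Longrightarrow> Inf E \<le> w"
      using closed_contains_Inf[of E] cInf_lower[of _ E] by auto
    define u0 where "u0 = Inf E"
    have u0: "u0 \<in> {0..b}" "f u0 \<notin> V" using \<open>Inf E \<in> E\<close> by (auto simp: E_def u0_def)
    then have pos: "0 < u0" using f0 by (cases "u0 = 0") auto
    have V: "f w \<in> V" if "w \<in> {0..<u0}" for w
      using le[of w] that u0(1) by (auto simp: E_def u0_def)
    have "f w \<in> K" if "w \<in> {0..<u0}" for w using step[of w] V that u0(1) by auto
    then have "f ` {0..<u0} \<subseteq> K" by blast
    moreover have cl: "closure {0..<u0} = {0..u0}" using pos by simp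
    moreover have "continuous_on {0..u0} f" by (rule continuous_on_subset[OF f]) (use u0 in auto)
    ultimately have "f ` {0..u0} \<subseteq> K"
      using image_closure_subset[of "{0..<u0}" f K] K(1) by simp
    then have "f u0 \<in> K" using pos by auto
    then show False using u0(2) K(2) by auto
  qed
  then show ?thesis using step u by auto
qed

context manifold_atlas
begin

text \<open>In coordinates the loop contracts to its base point along straight segments of the
  convex set.\<close>

lemma contractible_in_chart:
  assumes c: "c \<in> \<A>" and B: "convex B" "B \<subseteq> snd c ` fst c" "chart_inv c ` B \<subseteq> U"
    and x: "continuous_on {0..1} x" "x 0 = x 1" "x ` {0..1} \<subseteq> chart_inv c ` B"
  shows "\<exists>a. homotopic_loops U x (\<lambda>_. a)"
proof -
  define z where "z s = snd c (x s)" for s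
  have zB: "z s \<in> B" "x s \<in> fst c" "chart_inv c (z s) = x s" if s: "s \<in> {0..1}" for s
  proof -
    obtain y where y: "y \<in> B" "x s = chart_inv c y" using subsetD[OF x(3) imageI[OF s]] by (elim imageE)
    then have "y \<in> snd c ` fst c" using B(2) by auto
    then show "z s \<in> B" "x s \<in> fst c" "chart_inv c (z s) = x s"
      using y c by (simp_all add: z_def chart_inv_right chart_inv_in)
  qed
  have zc: "continuous_on {0..1} z"
    unfolding z_def by (rule continuous_on_compose2[OF continuous_chart[OF c] x(1)]) (use zB(2) in auto)
  have "homotopic_loops B z (\<lambda>_. z 0)"
  proof (rule homotopic_loops_linear)
    show "closed_segment (z t) (z 0) \<subseteq> B" if "t \<in> {0..1}" for t
      by (rule closed_segment_subset[OF zB(1)[OF that] zB(1) B(1)]) simp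
  qed (use zc x(2) in \<open>auto simp: path_def pathfinish_def pathstart_def z_def\<close>)
  then have 1: "homotopic_loops U (chart_inv c \<circ> z) (chart_inv c \<circ> (\<lambda>_. z 0))"
    by (rule homotopic_loops_continuous_image)
      (use B continuous_on_subset[OF continuous_chart_inv[OF c] B(2)] in auto)
  have "homotopic_loops U x (chart_inv c \<circ> z)"
    by (rule homotopic_loops_eq)
      (use x B(3) zB(3) in \<open>auto simp: path_def path_image_def pathfinish_def pathstart_def\<close>)
  from homotopic_loops_trans[OF this 1] show ?thesis by (auto simp: o_def)
qed

end

context riemannian_atlas
begin

lemma wv_nonzero:
  assumes c: "c \<in> \<A>" "p \<in> fst c" and p: "p \<notin> vanishing_set \<A> \<omega>"
  shows "metric_coords.wv (wc c) (snd c p) \<noteq> 0"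
proof
  interpret M: metric_coords "snd c ` fst c" "Gc c" "wc c" by (rule metric_coords[OF c(1)])
  assume 0: "M.wv (snd c p) = 0"
  obtain u where u: "u \<in> tangent_space \<A> p" "\<omega> p u \<noteq> 0" using p by (auto simp: vanishing_set_def)
  have "u = tvec \<A> c p (u c)" using u(1) c unfolding tangent_space_def by blast
  then have "\<omega> p u = wc c (snd c p) (u c)" using w_tvec[OF c, of "u c"] by simp
  also have "\<dots> = M.wv (snd c p) \<bullet> u c" using M.wv_inner[of "snd c p" "u c"] c by simp
  finally show False using 0 u(2) by simp
qed

context
  fixes \<gamma> \<epsilon> \<Delta>
  assumes \<gamma>: "closed_geodesic \<A> (tangent_bundle \<A>) (randers g \<omega> \<epsilon>) \<gamma>" and \<epsilon>: "\<epsilon> > 0"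
    and \<Delta>: "\<Delta> = curve_length \<A> (randers g \<omega> \<epsilon>) \<gamma>"
begin

lemma per_window:
  obtains c d v where "c \<in> \<A>" "d > 0"
    "\<forall>s\<in>{t-d<..<t+d}. per \<gamma> s \<in> fst c \<and> ((\<lambda>s. snd c (per \<gamma> s)) has_vector_derivative v s) (at s) \<and>
      FRc c \<epsilon> (snd c (per \<gamma> s)) (v s) = \<Delta>"
proof -
  obtain c where c: "c \<in> \<A>" "per \<gamma> t \<in> fst c" using chart_at .
  from randers_regular(2)[OF \<gamma> \<epsilon> c, folded \<Delta>] obtain d v where d: "d > 0" and
    v: "\<forall>s\<in>{t-d<..<t+d}. per \<gamma> s \<in> fst c \<and> ((\<lambda>s. snd c (per \<gamma> s)) has_vector_derivative v s) (at s) \<and>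
      FRc c \<epsilon> (snd c (per \<gamma> s)) (v s) = \<Delta> \<and>
      (\<forall>u. ((\<lambda>s. el_integrand c \<epsilon> (snd c (per \<gamma> s)) (v s) 0 u) has_real_derivative
         el_integrand c \<epsilon> (snd c (per \<gamma> s)) (v s) u 0) (at s))" by (elim exE conjE)
  show ?thesis by (rule that[OF c(1) d, of v]) (use v in blast)
qed

lemma continuous_per: "continuous_on UNIV (per \<gamma>)"
proof -
  have "isCont (per \<gamma>) t" for t
  proof -
    obtain c d v where c: "c \<in> \<A>" and d: "d > 0" and
      v: "\<forall>s\<in>{t-d<..<t+d}. per \<gamma> s \<in> fst c \<and> ((\<lambda>s. snd c (per \<gamma> s)) has_vector_derivative v s) (at s) \<and>
        FRc c \<epsilon> (snd c (per \<gamma> s)) (v s) = \<Delta>" by (rule per_window)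
    let ?O = "{t-d<..<t+d}"
    have "continuous_on ?O (\<lambda>s. snd c (per \<gamma> s))"
      by (rule continuous_at_imp_continuous_on) (use v has_vector_derivative_continuous in blast)
    then have "continuous_on ?O (\<lambda>s. chart_inv c (snd c (per \<gamma> s)))"
      by (rule continuous_on_compose2[OF continuous_chart_inv[OF c]]) (use v in auto)
    then have "continuous_on ?O (per \<gamma>)" by (rule continuous_on_eq) (use v c in auto)
    then show ?thesis using continuous_on_eq_continuous_at[of ?O "per \<gamma>"] d by auto
  qed
  then show ?thesis by (intro continuous_at_imp_continuous_on) auto
qed

lemma per_01: "s \<in> {0..1} \<Longrightarrow> per \<gamma> s = \<gamma> s"
  using per_eq[of \<gamma> 0 s] \<gamma> by (auto simp: closed_geodesic_def loop_space_def)

lemma loop_01: "\<gamma> 0 = \<gamma> 1"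
  using \<gamma> by (auto simp: closed_geodesic_def loop_space_def)

lemma continuous_loop: "continuous_on {0..1} \<gamma>"
  using \<gamma> by (auto simp: closed_geodesic_def loop_space_def piecewise_smooth_def)

text \<open>At length zero the constant speed is zero, hence so is the velocity, and a constant loop
  is contractible.\<close>

lemma randers_length_pos:
  assumes U: "\<gamma> ` {0..1} \<subseteq> U" and nc: "\<not> (\<exists>a. homotopic_loops U \<gamma> (\<lambda>_. a))"
  shows "\<Delta> > 0"
proof (rule ccontr)
  assume "\<not> \<Delta> > 0"
  then have 0: "\<Delta> = 0" using randers_regular(1)[OF \<gamma> \<epsilon>] \<Delta> by simp
  have loc: "\<forall>\<^sub>F s in at t within UNIV. per \<gamma> t = per \<gamma> s" for t
  proof -
    obtain c d v where c: "c \<in> \<A>" and d: "d > 0" and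
      v: "\<forall>s\<in>{t-d<..<t+d}. per \<gamma> s \<in> fst c \<and> ((\<lambda>s. snd c (per \<gamma> s)) has_vector_derivative v s) (at s) \<and>
        FRc c \<epsilon> (snd c (per \<gamma> s)) (v s) = \<Delta>" by (rule per_window)
    interpret M: metric_coords "snd c ` fst c" "Gc c" "wc c" by (rule metric_coords[OF c])
    let ?O = "{t-d<..<t+d}"
    have z: "v s = 0" if "s \<in> ?O" for s
    proof -
      have "FRc c \<epsilon> (snd c (per \<gamma> s)) (v s) = 0" "snd c (per \<gamma> s) \<in> snd c ` fst c" using v that 0 by auto
      then show ?thesis using M.FR_eq_0[OF \<epsilon>] by (simp add: FRc_def)
    qed
    have const: "per \<gamma> t = per \<gamma> s" if s: "s \<in> ?O" for s
    proof -
      have "norm (snd c (per \<gamma> s) - snd c (per \<gamma> t)) \<le> 0 * \<bar>s - t\<bar>"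
      proof (rule vector_derivative_bound[where S="?O" and f'=v and f="\<lambda>s. snd c (per \<gamma> s)"])
        fix r assume "r \<in> ?O"
        then show "((\<lambda>s. snd c (per \<gamma> s)) has_vector_derivative v r) (at r)" using v by blast
      qed (use s d z in auto)
      then have "chart_inv c (snd c (per \<gamma> s)) = chart_inv c (snd c (per \<gamma> t))" by simp
      moreover have "per \<gamma> s \<in> fst c" "per \<gamma> t \<in> fst c" using v s d by auto
      ultimately show ?thesis using c by simp
    qed
    have "t \<in> ?O" using d by simp
    from eventually_nhds_in_open[OF open_greaterThanLessThan this]
    show ?thesis
      unfolding eventually_at_filter by (rule eventually_mono) (intro impI const)
  qed
  have const: "per \<gamma> 0 = per \<gamma> s" for s
    by (rule connected_local_const[of UNIV, OF connected_UNIV UNIV_I UNIV_I ballI[OF loc]])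
  have "homotopic_loops U \<gamma> (\<lambda>_. \<gamma> 0)"
  proof (rule homotopic_loops_eq)
    show "\<gamma> t = \<gamma> 0" if "t \<in> {0..1}" for t
      using const[of t] per_01[OF that] per_01[of 0] by simp
  qed (use continuous_loop loop_01 U in \<open>auto simp: path_def path_image_def pathfinish_def pathstart_def\<close>)
  then show False using nc by blast
qed

end

text \<open>Local constancy would force \<open>v t = 0\<close>, against the negative value of the
  one-form.\<close>

lemma window_nonconstant:
  assumes w: "kropina_window \<Delta> \<gamma> t c d y v" and e: "\<forall>\<^sub>F s in nhds t. \<gamma> s = \<gamma> t"
  shows False
proof -
  have c: "c \<in> \<A>" and d: "d > 0"
    and t: "\<gamma> t \<in> fst c" "snd c (\<gamma> t) = y t" "(y has_vector_derivative v t) (at t)" "wc c (y t) (v t) < 0"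
    and y: "\<And>s. s \<in> {t-d<..<t+d} \<Longrightarrow> snd c (\<gamma> s) = y s"
    using w unfolding kropina_window_def by auto
  interpret M: metric_coords "snd c ` fst c" "Gc c" "wc c" by (rule metric_coords[OF c])
  have "\<forall>\<^sub>F s in nhds t. y s = y t"
  proof (rule eventually_mono[OF eventually_conj[OF e eventually_nhds_in_open[of "{t-d<..<t+d}" t]]])
    fix s assume "\<gamma> s = \<gamma> t \<and> s \<in> {t-d<..<t+d}"
    then show "y s = y t" using y[of s] t(2) by simp
  qed (use d in auto)
  then obtain S where S: "open S" "t \<in> S" "\<forall>s\<in>S. y s = y t" unfolding eventually_nhds by blast
  have "((\<lambda>s. y t) has_vector_derivative 0) (at t)" by simp
  then have "(y has_vector_derivative 0) (at t)"
    by (rule has_vector_derivative_transform_within_open[OF _ S(1,2)]) (use S(3) in auto)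
  then have "v t = 0" using t(3) vector_derivative_unique_at by blast
  moreover have "y t \<in> snd c ` fst c" using imageI[OF t(1), of "snd c"] t(2) by simp
  ultimately show False using t(4) linear_0[OF M.w_lin] by simp
qed

lemma window_shrink:
  assumes "kropina_window \<Delta> \<gamma> t c d y v" "t' \<in> {t-d<..<t+d}"
  shows "kropina_window \<Delta> \<gamma> t' c (d - \<bar>t' - t\<bar>) y v"
proof -
  have s: "{t'-(d - \<bar>t' - t\<bar>)<..<t'+(d - \<bar>t' - t\<bar>)} \<subseteq> {t-d<..<t+d}" by auto
  have "smooth_on y {t'-(d - \<bar>t' - t\<bar>)<..<t'+(d - \<bar>t' - t\<bar>)}"
    by (rule smooth_on_subset[OF _ s]) (use assms(1) in \<open>simp add: kropina_window_def\<close>)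
  moreover have "d - \<bar>t' - t\<bar> > 0" using assms(2) by auto
  moreover have "c \<in> \<A>" using assms(1) by (simp add: kropina_window_def)
  moreover note w = conjunct2[OF conjunct2[OF conjunct2[OF assms(1)[unfolded kropina_window_def]]]]
  ultimately show ?thesis
    unfolding kropina_window_def
    by (intro conjI) (assumption | rule ballI, erule bspec[OF w subsetD[OF s]])+
qed

end

section \<open>Control of the geodesics uniformly in the index\<close>

text \<open>The situation after a first selection of indices: the lengths converge, and \<epsilon>
  lies in the compact parameter range of \<open>hamilton_bounds\<close>.\<close>

locale randers_sequence = riemannian_atlas \<A> g \<omega>
  for \<A> :: "('m::t2_space, 'e::euclidean_space) chart set" and g \<omega> +
  fixes \<epsilon> \<Delta> :: "nat \<Rightarrow> real" and \<Delta>' :: real and x :: "nat \<Rightarrow> real \<Rightarrow> 'm" and C U :: "'m set"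
  assumes eps: "\<epsilon> n > 0" "\<epsilon> n \<le> 1" "\<epsilon> \<longlonglongrightarrow> 0"
    and geodesic: "closed_geodesic \<A> (tangent_bundle \<A>) (randers g \<omega> (\<epsilon> n)) (x n)"
    and length: "\<Delta> n = curve_length \<A> (randers g \<omega> (\<epsilon> n)) (x n)" "\<Delta> \<longlonglongrightarrow> \<Delta>'"
    and C: "compact C" "x n ` {0..1} \<subseteq> C" "C \<subseteq> U" and U: "open U" "U \<subseteq> - vanishing_set \<A> \<omega>"
    and noncontractible: "\<not> (\<exists>a. homotopic_loops U (x n) (\<lambda>_. a))"
begin

definition X where "X n = per (x n)"

lemma X_in: "X n t \<in> C"
  using C(2)[of n] frac_lt_1[of t] frac_ge_0[of t] by (auto simp: X_def per_def intro!: subsetD[OF C(2)[of n]])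

lemma X_01: "s \<in> {0..1} \<Longrightarrow> X n s = x n s"
  unfolding X_def by (rule per_01[OF geodesic eps(1) length(1)])

lemma X_add_1: "X n (t + 1) = X n t"
  using per_add_int[of "x n" t 1] by (simp add: X_def)

lemma continuous_X: "continuous_on S (X n)"
  unfolding X_def by (rule continuous_on_subset[OF continuous_per[OF geodesic eps(1) length(1)]]) simp

lemma length_pos: "\<Delta> n > 0"
  by (rule randers_length_pos[OF geodesic eps(1) length(1) _ noncontractible]) (use C(2,3) in blast)

lemma length_bound: obtains M where "M \<ge> 0" "\<forall>n. \<Delta> n \<le> M"
proof -
  have "Bseq \<Delta>" by (rule convergent_imp_Bseq) (use length(2) in \<open>auto simp: convergent_def\<close>)
  then obtain M where M: "M > 0" "\<forall>n. norm (\<Delta> n) \<le> M" unfolding Bseq_def by blast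
  have "\<Delta> n \<le> M" for n using M(2)[rule_format, of n] by simp
  then show ?thesis using that[of M] M(1) by simp
qed

text \<open>\<open>randers_hamilton\<close> with the velocity expressed by the momentum and the
  common factor \<open>\<Delta> n\<close> cancelled from the constraint, which is the form
  \<open>hamilton_limit\<close> takes.\<close>

lemma hamilton:
  assumes c: "c \<in> \<A>" "X n t \<in> fst c" and wv: "metric_coords.wv (wc c) (snd c (X n t)) \<noteq> 0"
  defines "Y \<equiv> \<lambda>s. snd c (X n s)"
  defines "P \<equiv> \<lambda>s. mom c (\<epsilon> n) (\<Delta> n) (Y s) (vector_derivative Y (at s))"
  shows "P t \<noteq> 0"
    "(Y has_vector_derivative \<Delta> n *\<^sub>R metric_coords.nu (Gc c) (wc c) (\<epsilon> n) (Y t) (P t)) (at t)"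
    "(P has_vector_derivative \<Delta> n *\<^sub>R metric_coords.psi (Gc c) (wc c) (\<epsilon> n) (Y t) (P t)) (at t)"
    "(\<epsilon> n - wc c (Y t) (metric_coords.nu (Gc c) (wc c) (\<epsilon> n) (Y t) (P t))) * metric_coords.nrm (Gc c) (Y t) (P t) =
       metric_coords.rho (Gc c) (wc c) (\<epsilon> n) (Y t)"
proof -
  interpret M: metric_coords "snd c ` fst c" "Gc c" "wc c" by (rule metric_coords[OF c(1)])
  have D: "\<Delta> n > 0" by (rule length_pos)
  note H = randers_hamilton[OF geodesic eps(1), folded length(1), OF D c(1),
      folded X_def, OF c(2) wv]
  show "P t \<noteq> 0" unfolding P_def Y_def by (rule H(4))
  show "(P has_vector_derivative \<Delta> n *\<^sub>R M.psi (\<epsilon> n) (Y t) (P t)) (at t)"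
    unfolding P_def Y_def by (rule H(3))
  have v: "vector_derivative Y (at t) = \<Delta> n *\<^sub>R M.nu (\<epsilon> n) (Y t) (P t)"
    unfolding P_def Y_def by (rule H(2))
  have "(Y has_vector_derivative vector_derivative Y (at t)) (at t)" unfolding Y_def by (rule H(1))
  then show "(Y has_vector_derivative \<Delta> n *\<^sub>R M.nu (\<epsilon> n) (Y t) (P t)) (at t)" unfolding v .
  have "Y t \<in> snd c ` fst c" using c(2) by (simp add: Y_def)
  then have w: "wc c (Y t) (vector_derivative Y (at t)) = \<Delta> n * wc c (Y t) (M.nu (\<epsilon> n) (Y t) (P t))"
    unfolding v by (simp add: M.w_simps)
  have "(\<epsilon> n * \<Delta> n - wc c (Y t) (vector_derivative Y (at t))) * M.nrm (Y t) (P t) = \<Delta> n * M.rho (\<epsilon> n) (Y t)"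
    unfolding P_def Y_def by (rule H(5))
  then have "\<Delta> n * ((\<epsilon> n - wc c (Y t) (M.nu (\<epsilon> n) (Y t) (P t))) * M.nrm (Y t) (P t)) = \<Delta> n * M.rho (\<epsilon> n) (Y t)"
    unfolding w by (simp add: algebra_simps)
  then show "(\<epsilon> n - wc c (Y t) (M.nu (\<epsilon> n) (Y t) (P t))) * M.nrm (Y t) (P t) = M.rho (\<epsilon> n) (Y t)"
    using D by simp
qed

text \<open>Chart, compact set and time span depend on \<open>V\<close> only, not on
  \<open>n\<close> or \<open>t\<close>. So all curves of a subsequence that meet \<open>V\<close> at
  one time can be followed in a common chart.\<close>

definition trap where
  "trap V \<tau> \<longleftrightarrow> (\<exists>c\<in>\<A>. \<exists>K. compact K \<and> K \<subseteq> snd c ` fst c \<and> (\<forall>y\<in>K. metric_coords.wv (wc c) y \<noteq> 0) \<and>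
     (\<forall>n t. X n t \<in> V \<longrightarrow> (\<forall>s. \<bar>s - t\<bar> < \<tau> \<longrightarrow> X n s \<in> fst c \<and> snd c (X n s) \<in> K)))"

lemma trap_mono: "trap V \<tau> \<Longrightarrow> \<tau>' \<le> \<tau> \<Longrightarrow> trap V \<tau>'"
  unfolding trap_def by (meson less_le_trans)

text \<open>The bound on the coordinate speed, uniform in \<open>n\<close>, keeps the curves in a chart ball
  for a time that does not depend on \<open>n\<close>.\<close>

lemma trap_exists:
  assumes p: "p \<in> C"
  obtains V \<tau> where "open V" "p \<in> V" "\<tau> > 0" "trap V \<tau>"
proof -
  obtain c where c: "c \<in> \<A>" "p \<in> fst c" using chart_at .
  interpret M: metric_coords "snd c ` fst c" "Gc c" "wc c" by (rule metric_coords[OF c(1)])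
  define W where "W = snd c ` fst c \<inter> chart_inv c -` U"
  have "open W"
    unfolding W_def by (rule continuous_open_preimage[OF continuous_chart_inv[OF c(1)] open_image[OF c(1)] U(1)])
  moreover have "snd c p \<in> W" using c p C(3) by (auto simp: W_def)
  ultimately obtain e where e: "e > 0" "cball (snd c p) e \<subseteq> W" using open_contains_cball by blast
  define \<rho> where "\<rho> = e / 2"
  have \<rho>: "\<rho> > 0" "cball (snd c p) (2 * \<rho>) \<subseteq> W" using e by (auto simp: \<rho>_def)
  define K where "K = cball (snd c p) (2 * \<rho>)"
  have K: "compact K" "K \<subseteq> snd c ` fst c" "M.wv y \<noteq> 0" if "y \<in> K" for y
  proof -
    have "y \<in> W" using that \<rho>(2) by (auto simp: K_def)
    then have "y \<in> snd c ` fst c" "chart_inv c y \<in> U" by (auto simp: W_def)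
    then show "M.wv y \<noteq> 0"
      using wv_nonzero[OF c(1) chart_inv_in[OF c(1)], of y] U(2) chart_inv_right[OF c(1), of y] by auto
  qed (use \<rho>(2) in \<open>auto simp: K_def W_def\<close>)
  have KW: "K \<subseteq> snd c ` fst c" using \<rho>(2) by (auto simp: K_def W_def)
  obtain B0 where B0: "B0 \<ge> 0" "\<forall>e\<in>{0..1}. \<forall>x\<in>K. \<forall>p. p \<noteq> 0 \<longrightarrow> norm (M.nu e x p) \<le> B0 \<and> norm (M.psi e x p) \<le> B0 * norm p"
    by (rule M.hamilton_bounds[of K]) (use K(3) KW in \<open>auto simp: K_def\<close>)
  obtain M0 where M0: "M0 \<ge> 0" "\<forall>n. \<Delta> n \<le> M0" using length_bound .
  define B where "B = M0 * B0"
  have B: "B \<ge> 0" using B0 M0 by (simp add: B_def)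
  have speed: "((\<lambda>s. snd c (X n s)) has_vector_derivative vector_derivative (\<lambda>s. snd c (X n s)) (at t)) (at t) \<and>
      norm (vector_derivative (\<lambda>s. snd c (X n s)) (at t)) \<le> B"
    if "X n t \<in> fst c" "snd c (X n t) \<in> K" for n t
  proof -
    define Q where "Q = mom c (\<epsilon> n) (\<Delta> n) (snd c (X n t)) (vector_derivative (\<lambda>s. snd c (X n s)) (at t))"
    note H = hamilton[OF c(1) that(1) K(3)[OF that(2)], folded Q_def]
    have "norm (M.nu (\<epsilon> n) (snd c (X n t)) Q) \<le> B0"
      using B0(2) that(2) H(1) eps(1,2)[of n] by (simp add: less_imp_le)
    then have "norm (\<Delta> n *\<^sub>R M.nu (\<epsilon> n) (snd c (X n t)) Q) \<le> B"
      unfolding B_def using M0 length_pos[of n] by (auto intro!: mult_mono)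
    then show ?thesis using H(2) vector_derivative_at[OF H(2)] by simp
  qed
  \<comment> \<open>At speed at most \<open>B\<close> a curve covers less than \<rho> in this time,
    so from the ball of radius \<rho> it cannot leave the ball of radius \<open>2 * \<rho>\<close>;
    the \<open>+ 1\<close> allows for \<open>B = 0\<close>.\<close>
  define \<tau> where "\<tau> = \<rho> / (B + 1)"
  have \<tau>: "\<tau> > 0" "B * \<tau> < \<rho>" using B \<rho>(1) by (auto simp: \<tau>_def field_simps)
  define V where "V r = chart_inv c ` ball (snd c p) r" for r
  have bK: "ball (snd c p) (2 * \<rho>) \<subseteq> snd c ` fst c" using KW by (auto simp: K_def)
  have V: "open (V r)" if "r \<le> 2 * \<rho>" for r
  proof -
    have "ball (snd c p) r \<subseteq> ball (snd c p) (2 * \<rho>)" using that by auto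
    then show ?thesis unfolding V_def using open_chart_inv_image[OF c(1) open_ball] bK by blast
  qed
  have Vin: "q \<in> fst c \<and> snd c q \<in> K" if q: "q \<in> V (2 * \<rho>)" for q
  proof -
    obtain y where y: "y \<in> ball (snd c p) (2 * \<rho>)" "q = chart_inv c y" using q unfolding V_def by (elim imageE)
    then have "y \<in> K" by (auto simp: K_def)
    then show ?thesis using KW y(2) chart_inv_in[OF c(1), of y] chart_inv_right[OF c(1), of y] by auto
  qed
  \<comment> \<open>Compact, hence closed in the Hausdorff space, and inside the larger open ball,
    as \<open>continuous_stay\<close> demands.\<close>
  define K2 where "K2 = chart_inv c ` cball (snd c p) (\<rho> + B * \<tau>)"
  have K2s: "cball (snd c p) (\<rho> + B * \<tau>) \<subseteq> ball (snd c p) (2 * \<rho>)" using \<tau>(2) by auto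
  have "compact K2"
    unfolding K2_def
    by (rule compact_continuous_image[OF continuous_on_subset[OF continuous_chart_inv[OF c(1)]]])
      (use K2s bK in auto)
  then have K2: "closed K2" "K2 \<subseteq> V (2 * \<rho>)" using K2s by (auto simp: K2_def V_def compact_imp_closed)
  have "trap (V \<rho>) \<tau>"
    unfolding trap_def
  proof (intro bexI[OF _ c(1)] exI[of _ K] conjI ballI allI impI)
    fix n t s assume t: "X n t \<in> V \<rho>" and s: "\<bar>s - t\<bar> < \<tau>"
    define f where "f u = X n (t + u * (s - t))" for u
    have t2: "snd c (X n t) \<in> ball (snd c p) \<rho>" "X n t \<in> V (2 * \<rho>)"
    proof -
      obtain y where y: "y \<in> ball (snd c p) \<rho>" "X n t = chart_inv c y" using t unfolding V_def by (elim imageE)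
      then have y2: "y \<in> ball (snd c p) (2 * \<rho>)" using \<rho>(1) by auto
      then show "X n t \<in> V (2 * \<rho>)" using y(2) by (auto simp: V_def)
      show "snd c (X n t) \<in> ball (snd c p) \<rho>" using y chart_inv_right[OF c(1)] bK y2 by auto
    qed
    \<comment> \<open>The speed bound holds only while the curve is in the coordinate ball, and that
      it stays there is the very claim; \<open>continuous_stay\<close> breaks the circle. The
      reparametrisation \<open>f\<close> of the way from \<open>t\<close> to \<open>s\<close> serves
      both time directions.\<close>
    have "f 1 \<in> K2"
    proof (rule continuous_stay[where b=1 and V="V (2 * \<rho>)"])
      show "continuous_on {0..1} f"
        unfolding f_def by (rule continuous_on_compose2[OF continuous_X]) (auto intro!: continuous_intros)
      fix u :: real assume u: "u \<in> {0..1}" and w: "\<And>w. w \<in> {0..u} \<Longrightarrow> f w \<in> V (2 * \<rho>)"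
      let ?S = "closed_segment t (t + u * (s - t))"
      have Sin: "X n r \<in> fst c \<and> snd c (X n r) \<in> K" if r: "r \<in> ?S" for r
      proof -
        obtain a where a: "0 \<le> a" "a \<le> 1" "r = (1 - a) *\<^sub>R t + a *\<^sub>R (t + u * (s - t))"
          using r unfolding closed_segment_def by blast
        then have "r = t + (a * u) * (s - t)" by (simp add: algebra_simps)
        moreover have "a * u \<in> {0..u}" using a(1,2) u by (simp add: mult_left_le_one_le)
        ultimately show ?thesis using Vin[OF w[of "a * u"]] by (simp add: f_def)
      qed
      have "norm (snd c (X n (t + u * (s - t))) - snd c (X n t)) \<le> B * \<bar>(t + u * (s - t)) - t\<bar>"
      proof (rule vector_derivative_bound[OF convex_closed_segment _ _ B])
        show "((\<lambda>s. snd c (X n s)) has_vector_derivative vector_derivative (\<lambda>s. snd c (X n s)) (at r)) (at r)"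
          "norm (vector_derivative (\<lambda>s. snd c (X n s)) (at r)) \<le> B" if "r \<in> ?S" for r
          using speed[of n r] Sin[OF that] by blast+
      qed auto
      also have "\<dots> = B * (u * \<bar>s - t\<bar>)" using u by (simp add: abs_mult)
      also have "\<dots> \<le> B * \<tau>"
      proof (rule mult_left_mono[OF _ B])
        have "u * \<bar>s - t\<bar> \<le> 1 * \<bar>s - t\<bar>" by (rule mult_right_mono) (use u in auto)
        then show "u * \<bar>s - t\<bar> \<le> \<tau>" using s by simp
      qed
      finally have "dist (snd c (X n t)) (snd c (f u)) \<le> B * \<tau>" by (simp add: f_def dist_norm norm_minus_commute)
      then have "dist (snd c p) (snd c (f u)) \<le> \<rho> + B * \<tau>"
        using t2(1) dist_triangle[of "snd c p" "snd c (f u)" "snd c (X n t)"] by simp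
      moreover have "f u \<in> fst c" using Vin[OF w[of u]] u by auto
      ultimately show "f u \<in> K2"
        unfolding K2_def using c(1) by (intro image_eqI[of _ _ "snd c (f u)"]) auto
    qed (use V K2 t2(2) in \<open>auto simp: f_def\<close>)
    then have "X n s \<in> V (2 * \<rho>)" using K2(2) by (auto simp: f_def)
    then show "X n s \<in> fst c" "snd c (X n s) \<in> K" using Vin by auto
  qed (use K(3) KW in \<open>auto simp: K_def\<close>)
  moreover have "p \<in> V \<rho>" unfolding V_def using c \<rho>(1) by (intro image_eqI[of _ _ "snd c p"]) auto
  ultimately show ?thesis using that[of "V \<rho>" \<tau>] V[of \<rho>] \<tau>(1) \<rho>(1) by auto
qed

section \<open>Extraction of a convergent subsequence\<close>

text \<open>The quadratic equation says that \<open>(v, \<Delta>')\<close> is null for the limiting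
  Lorentzian metric \<open>g + 2 \<omega> dt\<close>.\<close>

definition null_char where
  "null_char c y v s \<longleftrightarrow> y s \<in> snd c ` fst c \<and> (y has_vector_derivative v s) (at s) \<and>
     Gc c (y s) (v s) (v s) + 2 * \<Delta>' * wc c (y s) (v s) = 0"

definition kropina_flow where
  "kropina_flow c y v s \<longleftrightarrow> wc c (y s) (v s) < 0 \<and>
     ((\<lambda>s. (1 / - wc c (y s) (v s)) *\<^sub>R (metric_coords.flat (Gc c) (y s) (v s) +
        \<Delta>' *\<^sub>R metric_coords.wv (wc c) (y s))) has_vector_derivative
      (1 / - wc c (y s) (v s)) *\<^sub>R metric_coords.force (Gc c) (wc c) \<Delta>' (y s) (v s)) (at s)"

text \<open>The limit along \<open>q\<close> is either constant on \<open>I\<close> or a Kropina geodesic in Hamiltonian form.\<close>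

definition good :: "(nat \<Rightarrow> nat) \<Rightarrow> real set \<Rightarrow> bool" where
  "good q I \<longleftrightarrow> (\<exists>c\<in>\<A>. \<exists>y v. smooth_on y I \<and> (\<forall>s\<in>I. null_char c y v s) \<and>
     ((\<forall>s\<in>I. v s = 0) \<or> \<Delta>' > 0 \<and> (\<forall>s\<in>I. kropina_flow c y v s)) \<and>
     (\<forall>e>0. \<exists>N. \<forall>n\<ge>N. \<forall>s\<in>I. X (q n) s \<in> fst c \<and> norm (snd c (X (q n) s) - y s) < e))"

lemma good_subset:
  assumes "good q I" "J \<subseteq> I" shows "good q J"
proof -
  from assms(1) obtain c y v where c: "c \<in> \<A>" and 1: "smooth_on y I" "\<forall>s\<in>I. null_char c y v s"
    "(\<forall>s\<in>I. v s = 0) \<or> \<Delta>' > 0 \<and> (\<forall>s\<in>I. kropina_flow c y v s)"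
    "\<forall>e>0. \<exists>N. \<forall>n\<ge>N. \<forall>s\<in>I. X (q n) s \<in> fst c \<and> norm (snd c (X (q n) s) - y s) < e"
    unfolding good_def by (elim bexE exE conjE)
  show ?thesis
    unfolding good_def
  proof (intro bexI[OF _ c] exI conjI)
    show "smooth_on y J" by (rule smooth_on_subset[OF 1(1) assms(2)])
    show "\<forall>s\<in>J. null_char c y v s" using 1(2) assms(2) by blast
    show "(\<forall>s\<in>J. v s = 0) \<or> \<Delta>' > 0 \<and> (\<forall>s\<in>J. kropina_flow c y v s)" using 1(3) assms(2) by blast
    show "\<forall>e>0. \<exists>N. \<forall>n\<ge>N. \<forall>s\<in>J. X (q n) s \<in> fst c \<and> norm (snd c (X (q n) s) - y s) < e"
      using 1(4) assms(2) by (meson subsetD)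
  qed
qed

lemma good_subseq:
  assumes "good q I" "strict_mono r" shows "good (q \<circ> r) I"
proof -
  from assms(1) obtain c y v where c: "c \<in> \<A>" and 1: "smooth_on y I" "\<forall>s\<in>I. null_char c y v s"
    "(\<forall>s\<in>I. v s = 0) \<or> \<Delta>' > 0 \<and> (\<forall>s\<in>I. kropina_flow c y v s)"
    "\<forall>e>0. \<exists>N. \<forall>n\<ge>N. \<forall>s\<in>I. X (q n) s \<in> fst c \<and> norm (snd c (X (q n) s) - y s) < e"
    unfolding good_def by (elim bexE exE conjE)
  have "\<forall>e>0. \<exists>N. \<forall>n\<ge>N. \<forall>s\<in>I. X ((q \<circ> r) n) s \<in> fst c \<and> norm (snd c (X ((q \<circ> r) n) s) - y s) < e"
  proof (intro allI impI)
    fix e :: real assume "e > 0"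
    then obtain N where N: "\<forall>n\<ge>N. \<forall>s\<in>I. X (q n) s \<in> fst c \<and> norm (snd c (X (q n) s) - y s) < e"
      using 1(4) by blast
    have "N \<le> r n" if "n \<ge> N" for n using that seq_suble[OF assms(2), of n] by simp
    then show "\<exists>N. \<forall>n\<ge>N. \<forall>s\<in>I. X ((q \<circ> r) n) s \<in> fst c \<and> norm (snd c (X ((q \<circ> r) n) s) - y s) < e"
      using N by (intro exI[of _ N]) simp
  qed
  with 1(1-3) show ?thesis unfolding good_def by (intro bexI[OF _ c] exI[of _ y] exI[of _ v] conjI)
qed

lemma good_exists:
  assumes q: "strict_mono (q :: nat \<Rightarrow> nat)" and \<tau>: "\<tau> > 0" and c: "c \<in> \<A>"
    and K: "compact K" "K \<subseteq> snd c ` fst c" "\<And>y. y \<in> K \<Longrightarrow> metric_coords.wv (wc c) y \<noteq> 0"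
    and in_K: "\<And>n s. \<bar>s - t\<bar> < \<tau> \<Longrightarrow> X (q n) s \<in> fst c \<and> snd c (X (q n) s) \<in> K"
  shows "\<exists>r. strict_mono r \<and> good (q \<circ> r) {t-\<tau>/2<..<t+\<tau>/2}"
proof -
  interpret M: metric_coords "snd c ` fst c" "Gc c" "wc c" by (rule metric_coords[OF c(1)])
  define Y where "Y n = (\<lambda>s. snd c (X (q n) s))" for n
  define P where "P n = (\<lambda>s. mom c (\<epsilon> (q n)) (\<Delta> (q n)) (Y n s) (vector_derivative (Y n) (at s)))" for n
  have in_K': "X (q n) s \<in> fst c" "Y n s \<in> K" if "s \<in> {t-\<tau><..<t+\<tau>}" for n s
    using in_K[of s n] that by (auto simp: Y_def abs_less_iff)
  have "\<exists>r y v. strict_mono (r :: nat \<Rightarrow> nat) \<and> (\<forall>e>0. \<exists>N. \<forall>n\<ge>N. \<forall>s\<in>{t-\<tau>/2..t+\<tau>/2}. norm (Y (r n) s - y s) < e) \<and>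
    y ` {t-\<tau>/2..t+\<tau>/2} \<subseteq> K \<and> smooth_on y {t-\<tau>/2<..<t+\<tau>/2} \<and>
    (\<forall>s\<in>{t-\<tau>/2<..<t+\<tau>/2}. (y has_vector_derivative v s) (at s) \<and> Gc c (y s) (v s) (v s) + 2 * \<Delta>' * wc c (y s) (v s) = 0) \<and>
    ((\<forall>s\<in>{t-\<tau>/2<..<t+\<tau>/2}. v s = 0) \<or>
     \<Delta>' > 0 \<and> (\<forall>s\<in>{t-\<tau>/2<..<t+\<tau>/2}. wc c (y s) (v s) < 0 \<and>
       ((\<lambda>s. (1 / - wc c (y s) (v s)) *\<^sub>R (M.flat (y s) (v s) + \<Delta>' *\<^sub>R M.wv (y s))) has_vector_derivative
          (1 / - wc c (y s) (v s)) *\<^sub>R M.force \<Delta>' (y s) (v s)) (at s)))"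
  proof (rule M.hamilton_limit[OF K \<tau>, where \<epsilon>="\<lambda>n. \<epsilon> (q n)" and \<Delta>="\<lambda>n. \<Delta> (q n)" and P=P])
    show "(\<lambda>n. \<epsilon> (q n)) \<longlonglongrightarrow> 0" "(\<lambda>n. \<Delta> (q n)) \<longlonglongrightarrow> \<Delta>'"
      using LIMSEQ_subseq_LIMSEQ[OF eps(3) q] LIMSEQ_subseq_LIMSEQ[OF length(2) q] by (simp_all add: o_def)
    fix n s assume s: "s \<in> {t-\<tau><..<t+\<tau>}"
    show "Y n s \<in> K" by (rule in_K'(2)[OF s])
    note H = hamilton[OF c in_K'(1)[OF s] K(3)[OF in_K'(2)[OF s, unfolded Y_def]]]
    show "P n s \<noteq> 0" unfolding P_def Y_def by (rule H(1))
    show "(Y n has_vector_derivative \<Delta> (q n) *\<^sub>R M.nu (\<epsilon> (q n)) (Y n s) (P n s)) (at s)"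
      unfolding P_def Y_def by (rule H(2))
    show "(P n has_vector_derivative \<Delta> (q n) *\<^sub>R M.psi (\<epsilon> (q n)) (Y n s) (P n s)) (at s)"
      unfolding P_def Y_def by (rule H(3))
    show "(\<epsilon> (q n) - wc c (Y n s) (M.nu (\<epsilon> (q n)) (Y n s) (P n s))) * M.nrm (Y n s) (P n s) = M.rho (\<epsilon> (q n)) (Y n s)"
      unfolding P_def Y_def by (rule H(4))
  qed (assumption | rule eps(1,2) length_pos)+
  then obtain r y v where r: "strict_mono (r :: nat \<Rightarrow> nat)"
    and conv: "\<forall>e>0. \<exists>N. \<forall>n\<ge>N. \<forall>s\<in>{t-\<tau>/2..t+\<tau>/2}. norm (Y (r n) s - y s) < e"
    and y: "y ` {t-\<tau>/2..t+\<tau>/2} \<subseteq> K" "smooth_on y {t-\<tau>/2<..<t+\<tau>/2}"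
    "\<forall>s\<in>{t-\<tau>/2<..<t+\<tau>/2}. (y has_vector_derivative v s) (at s) \<and> Gc c (y s) (v s) (v s) + 2 * \<Delta>' * wc c (y s) (v s) = 0"
    "(\<forall>s\<in>{t-\<tau>/2<..<t+\<tau>/2}. v s = 0) \<or>
     \<Delta>' > 0 \<and> (\<forall>s\<in>{t-\<tau>/2<..<t+\<tau>/2}. wc c (y s) (v s) < 0 \<and>
       ((\<lambda>s. (1 / - wc c (y s) (v s)) *\<^sub>R (M.flat (y s) (v s) + \<Delta>' *\<^sub>R M.wv (y s))) has_vector_derivative
          (1 / - wc c (y s) (v s)) *\<^sub>R M.force \<Delta>' (y s) (v s)) (at s))"
    by (elim exE conjE)
  have "good (q \<circ> r) {t-\<tau>/2<..<t+\<tau>/2}"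
    unfolding good_def
  proof (intro bexI[OF _ c] exI conjI)
    show "\<forall>s\<in>{t-\<tau>/2<..<t+\<tau>/2}. null_char c y v s"
    proof
      fix s assume s: "s \<in> {t-\<tau>/2<..<t+\<tau>/2}"
      then have "y s \<in> K" using y(1) by (auto simp: image_subset_iff)
      then show "null_char c y v s" unfolding null_char_def using bspec[OF y(3) s] K(2) by blast
    qed
    show "(\<forall>s\<in>{t-\<tau>/2<..<t+\<tau>/2}. v s = 0) \<or> \<Delta>' > 0 \<and> (\<forall>s\<in>{t-\<tau>/2<..<t+\<tau>/2}. kropina_flow c y v s)"
      using y(4) unfolding kropina_flow_def .
    show "\<forall>e>0. \<exists>N. \<forall>n\<ge>N. \<forall>s\<in>{t-\<tau>/2<..<t+\<tau>/2}.
      X ((q \<circ> r) n) s \<in> fst c \<and> norm (snd c (X ((q \<circ> r) n) s) - y s) < e"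
    proof (intro allI impI)
      fix e :: real assume "e > 0"
      then obtain N where N: "\<forall>n\<ge>N. \<forall>s\<in>{t-\<tau>/2..t+\<tau>/2}. norm (Y (r n) s - y s) < e" using conv by blast
      have "X ((q \<circ> r) n) s \<in> fst c \<and> norm (snd c (X ((q \<circ> r) n) s) - y s) < e"
        if n: "n \<ge> N" and s: "s \<in> {t-\<tau>/2<..<t+\<tau>/2}" for n s
      proof -
        have "s \<in> {t-\<tau><..<t+\<tau>}" "s \<in> {t-\<tau>/2..t+\<tau>/2}" using s \<tau> by auto
        then show ?thesis using in_K'(1) N n by (simp add: Y_def)
      qed
      then show "\<exists>N. \<forall>n\<ge>N. \<forall>s\<in>{t-\<tau>/2<..<t+\<tau>/2}.
        X ((q \<circ> r) n) s \<in> fst c \<and> norm (snd c (X ((q \<circ> r) n) s) - y s) < e" by blast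
    qed
  qed (rule y(2))
  then show ?thesis using r by blast
qed

lemma uniform_trap:
  obtains \<V> \<tau> where "finite \<V>" "C \<subseteq> \<Union>\<V>" "\<tau> > 0" "\<forall>V\<in>\<V>. trap V \<tau>"
proof -
  define \<W> where "\<W> = {V. open V \<and> (\<exists>\<tau>>0. trap V \<tau>)}"
  have "C \<subseteq> \<Union>\<W>"
  proof
    fix p assume "p \<in> C"
    then obtain V \<tau> where "open V" "p \<in> V" "\<tau> > 0" "trap V \<tau>" by (rule trap_exists)
    then show "p \<in> \<Union>\<W>" unfolding \<W>_def by blast
  qed
  then obtain \<V> where \<V>: "\<V> \<subseteq> \<W>" "finite \<V>" "C \<subseteq> \<Union>\<V>"
    using C(1) unfolding compact_eq_Heine_Borel by (metis (no_types, lifting) \<W>_def mem_Collect_eq)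
  have "\<forall>V\<in>\<V>. \<exists>\<tau>>0. trap V \<tau>" using \<V>(1) by (auto simp: \<W>_def)
  then obtain f where f: "\<forall>V\<in>\<V>. f V > 0 \<and> trap V (f V)" by metis
  \<comment> \<open>Inserting \<open>1\<close> keeps the minimum meaningful for an empty
    cover.\<close>
  define \<tau> where "\<tau> = Min (insert 1 (f ` \<V>))"
  have "\<tau> > 0" unfolding \<tau>_def using \<V>(2) f by (subst Min_gr_iff) auto
  moreover have "trap V \<tau>" if "V \<in> \<V>" for V
  proof (rule trap_mono)
    show "\<tau> \<le> f V" unfolding \<tau>_def using \<V>(2) that by (intro Min_le) auto
  qed (use f that in auto)
  ultimately show ?thesis using that \<V>(2,3) by blast
qed

text \<open>At time \<open>t\<close> every curve lies in one of finitely many trapping sets.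
  Infinitely many indices share the same one, and with it the chart and the compact set in which
  \<open>good_exists\<close> works.\<close>

lemma good_step:
  assumes \<V>: "finite \<V>" "C \<subseteq> \<Union>\<V>" "\<tau> > 0" "\<forall>V\<in>\<V>. trap V \<tau>" and q: "strict_mono (q :: nat \<Rightarrow> nat)"
  shows "\<exists>r. strict_mono r \<and> good (q \<circ> r) {t-\<tau>/2<..<t+\<tau>/2}"
proof -
  have "\<exists>V\<in>\<V>. X (q n) t \<in> V" for n using X_in[of "q n" t] \<V>(2) by blast
  then obtain f where f: "\<And>n. f n \<in> \<V> \<and> X (q n) t \<in> f n" by metis
  have "finite (range f)" by (rule finite_subset[OF _ \<V>(1)]) (use f in blast)
  then obtain n0 where "infinite {n \<in> UNIV. f n = f n0}"
    using pigeonhole_infinite[of UNIV f] by auto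
  then obtain r :: "nat \<Rightarrow> nat" where r: "strict_mono r" "\<And>n. r n \<in> {n \<in> UNIV. f n = f n0}"
    using infinite_enumerate by blast
  have V: "trap (f n0) \<tau>" using f \<V>(4) by blast
  then obtain c K where c: "c \<in> \<A>" and K: "compact K" "K \<subseteq> snd c ` fst c" "\<forall>y\<in>K. metric_coords.wv (wc c) y \<noteq> 0"
    and tr: "\<forall>n t. X n t \<in> f n0 \<longrightarrow> (\<forall>s. \<bar>s - t\<bar> < \<tau> \<longrightarrow> X n s \<in> fst c \<and> snd c (X n s) \<in> K)"
    unfolding trap_def by blast
  have "X ((q \<circ> r) n) t \<in> f n0" for n using f[of "r n"] r(2)[of n] by simp
  then have "\<exists>r'. strict_mono r' \<and> good ((q \<circ> r) \<circ> r') {t-\<tau>/2<..<t+\<tau>/2}"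
    by (intro good_exists[OF strict_mono_o[OF q r(1)] \<V>(3) c K(1,2)]) (use K(3) tr in blast)+
  then obtain r' where r': "strict_mono r'" "good (q \<circ> (r \<circ> r')) {t-\<tau>/2<..<t+\<tau>/2}"
    unfolding o_assoc by blast
  show ?thesis by (intro exI[of _ "r \<circ> r'"] conjI strict_mono_o[OF r(1)] r')
qed

lemma good_subsequence:
  obtains q where "strict_mono (q :: nat \<Rightarrow> nat)" "\<forall>t\<in>{0..1}. \<exists>d>0. good q {t-d<..<t+d}"
proof -
  obtain \<V> \<tau> where \<V>: "finite \<V>" "C \<subseteq> \<Union>\<V>" "\<tau> > 0" "\<forall>V\<in>\<V>. trap V \<tau>" by (rule uniform_trap)
  \<comment> \<open>Windows of half width \<open>\<tau>/2\<close> centred at the multiples of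
    \<open>\<tau>/2\<close> overlap, so finitely many of them cover [0,1] and finitely many
    successive refinements suffice.\<close>
  have "\<exists>q. strict_mono (q :: nat \<Rightarrow> nat) \<and> (\<forall>i<k. good q {real i * (\<tau> / 2) - \<tau>/2<..<real i * (\<tau> / 2) + \<tau>/2})" for k
  proof (induction k)
    case 0
    show ?case using strict_mono_id by blast
  next
    case (Suc k)
    then obtain q where q: "strict_mono (q :: nat \<Rightarrow> nat)"
      "\<forall>i<k. good q {real i * (\<tau> / 2) - \<tau>/2<..<real i * (\<tau> / 2) + \<tau>/2}" by blast
    obtain r where r: "strict_mono r" "good (q \<circ> r) {real k * (\<tau> / 2) - \<tau>/2<..<real k * (\<tau> / 2) + \<tau>/2}"
      using good_step[OF \<V> q(1)] by blast
    have "good (q \<circ> r) {real i * (\<tau> / 2) - \<tau>/2<..<real i * (\<tau> / 2) + \<tau>/2}" if "i < Suc k" for i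
      using that r q(2) good_subseq[OF _ r(1)] by (cases "i = k") auto
    then show ?case by (intro exI[of _ "q \<circ> r"] conjI strict_mono_o[OF q(1) r(1)] allI impI)
  qed
  moreover obtain k where k: "real k > 2 / \<tau>" using reals_Archimedean2 by blast
  ultimately obtain q where q: "strict_mono (q :: nat \<Rightarrow> nat)"
      "\<forall>i<Suc k. good q {real i * (\<tau> / 2) - \<tau>/2<..<real i * (\<tau> / 2) + \<tau>/2}" by blast
  have "\<exists>d>0. good q {t-d<..<t+d}" if t: "t \<in> {0..1}" for t
  proof -
    define i where "i = nat \<lfloor>t / (\<tau> / 2)\<rfloor>"
    have "0 \<le> t / (\<tau> / 2)" using t \<V>(3) by simp
    then have fl: "real i \<le> t / (\<tau> / 2)" "t / (\<tau> / 2) < real i + 1" unfolding i_def by linarith+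
    then have i: "real i * (\<tau> / 2) \<le> t" "t < real i * (\<tau> / 2) + \<tau> / 2"
      using \<V>(3) by (simp_all add: field_simps)
    have "t / (\<tau> / 2) \<le> 2 / \<tau>" using t \<V>(3) by (simp add: field_simps)
    then have "i < Suc k" using fl(1) k by linarith
    then have g: "good q {real i * (\<tau> / 2) - \<tau>/2<..<real i * (\<tau> / 2) + \<tau>/2}" using q(2) by blast
    define d where "d = real i * (\<tau> / 2) + \<tau> / 2 - t"
    have "d > 0" "d \<le> \<tau> / 2" using i by (auto simp: d_def)
    then have "{t-d<..<t+d} \<subseteq> {real i * (\<tau> / 2) - \<tau>/2<..<real i * (\<tau> / 2) + \<tau>/2}"
      using i by (auto simp: d_def)
    then show ?thesis using good_subset[OF g] \<open>d > 0\<close> by blast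
  qed
  then show ?thesis using that[OF q(1)] by blast
qed

section \<open>The limit curve and its alternatives\<close>

text \<open>A pointwise limit taken directly in the manifold: it does not depend on the charts of
  the windows, and it is periodic because every \<open>X n\<close> is.\<close>

definition limit_curve :: "(nat \<Rightarrow> nat) \<Rightarrow> real \<Rightarrow> 'm" where
  "limit_curve q t = lim (\<lambda>n. X (q n) t)"

lemma limit_curve_add_1: "limit_curve q (t + 1) = limit_curve q t"
  by (simp add: limit_curve_def X_add_1)

lemma limit_curve_chart:
  assumes c: "c \<in> \<A>" and s: "s \<in> I" "y s \<in> snd c ` fst c"
    and conv: "\<forall>e>0. \<exists>N. \<forall>n\<ge>N. \<forall>s\<in>I. X (q n) s \<in> fst c \<and> norm (snd c (X (q n) s) - y s) < e"
  shows "(\<lambda>n. X (q n) s) \<longlonglongrightarrow> chart_inv c (y s)" "limit_curve q s = chart_inv c (y s)"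
proof -
  have 1: "(\<lambda>n. snd c (X (q n) s)) \<longlonglongrightarrow> y s"
    unfolding LIMSEQ_iff using conv s(1) by meson
  obtain N where "\<forall>n\<ge>N. \<forall>s\<in>I. X (q n) s \<in> fst c \<and> norm (snd c (X (q n) s) - y s) < 1"
    using conv zero_less_one by blast
  then have N: "X (q n) s \<in> fst c" if "n \<ge> N" for n using that s(1) by blast
  have "(\<lambda>n. chart_inv c (snd c (X (q n) s))) \<longlonglongrightarrow> chart_inv c (y s)"
    by (rule continuous_on_tendsto_compose[OF continuous_chart_inv[OF c] 1 s(2)])
      (use N in \<open>auto simp: eventually_sequentially\<close>)
  moreover have "\<forall>\<^sub>F n in sequentially. chart_inv c (snd c (X (q n) s)) = X (q n) s"
    unfolding eventually_sequentially using N c by (intro exI[of _ N]) simp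
  ultimately show "(\<lambda>n. X (q n) s) \<longlonglongrightarrow> chart_inv c (y s)" by (rule Lim_transform_eventually)
  then show "limit_curve q s = chart_inv c (y s)" unfolding limit_curve_def by (rule limI)
qed

lemma limit_curve_tendsto: "good q I \<Longrightarrow> s \<in> I \<Longrightarrow> (\<lambda>n. X (q n) s) \<longlonglongrightarrow> limit_curve q s"
  unfolding good_def null_char_def using limit_curve_chart by metis

lemma limit_curve_dichotomy:
  assumes good: "good q {t-d<..<t+d}" and d: "d > 0"
  shows "(\<forall>s\<in>{t-d<..<t+d}. limit_curve q s = limit_curve q t) \<or>
    \<Delta>' > 0 \<and> (\<exists>c y v. kropina_window \<Delta>' (limit_curve q) t c d y v)"
proof -
  let ?I = "{t-d<..<t+d}"
  from good obtain c y v where c: "c \<in> \<A>" and y: "smooth_on y ?I" "\<forall>s\<in>?I. null_char c y v s"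
    and alt: "(\<forall>s\<in>?I. v s = 0) \<or> \<Delta>' > 0 \<and> (\<forall>s\<in>?I. kropina_flow c y v s)"
    and conv: "\<forall>e>0. \<exists>N. \<forall>n\<ge>N. \<forall>s\<in>?I. X (q n) s \<in> fst c \<and> norm (snd c (X (q n) s) - y s) < e"
    unfolding good_def by (elim bexE exE conjE)
  have yD: "y s \<in> snd c ` fst c" if "s \<in> ?I" for s using y(2) that unfolding null_char_def by blast
  have lc: "limit_curve q s = chart_inv c (y s)" if "s \<in> ?I" for s
    using limit_curve_chart(2)[OF c that yD[OF that] conv] .
  show ?thesis
    using alt
  proof
    assume 0: "\<forall>s\<in>?I. v s = 0"
    have t: "t \<in> ?I" using d by simp
    have b: "norm (y s - y t) \<le> 0 * \<bar>s - t\<bar>" if s: "s \<in> ?I" for s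
    proof (rule vector_derivative_bound[where S="?I" and f'=v])
      show "(y has_vector_derivative v r) (at r)" if "r \<in> ?I" for r
        using y(2) that unfolding null_char_def by blast
    qed (use 0 s t in auto)
    have "limit_curve q s = limit_curve q t" if s: "s \<in> ?I" for s using lc[OF s] lc[OF t] b[OF s] by simp
    then show ?thesis by blast
  next
    assume fl: "\<Delta>' > 0 \<and> (\<forall>s\<in>?I. kropina_flow c y v s)"
    have "kropina_window \<Delta>' (limit_curve q) t c d y v"
      unfolding kropina_window_def
    proof (intro conjI ballI c d y(1))
      fix s assume s: "s \<in> ?I"
      show "limit_curve q s \<in> fst c" "snd c (limit_curve q s) = y s"
        using lc[OF s] chart_inv_in[OF c yD[OF s]] chart_inv_right[OF c yD[OF s]] by simp_all
      have nc: "null_char c y v s" and kf: "kropina_flow c y v s" using y(2) fl s by blast+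
      from nc show "(y has_vector_derivative v s) (at s)" "Gc c (y s) (v s) (v s) + 2 * \<Delta>' * wc c (y s) (v s) = 0"
        unfolding null_char_def by blast+
      from kf show "wc c (y s) (v s) < 0" unfolding kropina_flow_def by blast
      from kf show "((\<lambda>s. (1 / - wc c (y s) (v s)) *\<^sub>R (metric_coords.flat (Gc c) (y s) (v s) +
          \<Delta>' *\<^sub>R metric_coords.wv (wc c) (y s))) has_vector_derivative
        (1 / - wc c (y s) (v s)) *\<^sub>R metric_coords.force (Gc c) (wc c) \<Delta>' (y s) (v s)) (at s)"
        unfolding kropina_flow_def by (rule conjunct2)
    qed
    then show ?thesis using fl by blast
  qed
qed

text \<open>On \<open>J\<close> the coordinate limit is constantly \<open>snd c p\<close>, so
  uniform convergence in the chart of the window becomes uniform convergence to the point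
  \<open>p\<close>.\<close>

lemma good_uniform:
  assumes good: "good q I" and J: "J \<subseteq> I" and p: "\<And>s. s \<in> J \<Longrightarrow> limit_curve q s = p"
    and V: "open V" "p \<in> V"
  shows "\<exists>N. \<forall>n\<ge>N. \<forall>s\<in>J. X (q n) s \<in> V"
proof (cases "J = {}")
  case False
  then obtain s0 where s0: "s0 \<in> J" by blast
  from good obtain c y v where c: "c \<in> \<A>" and y: "\<forall>s\<in>I. null_char c y v s"
    and conv: "\<forall>e>0. \<exists>N. \<forall>n\<ge>N. \<forall>s\<in>I. X (q n) s \<in> fst c \<and> norm (snd c (X (q n) s) - y s) < e"
    unfolding good_def by (elim bexE exE conjE)
  have yD: "y s \<in> snd c ` fst c" if "s \<in> I" for s using y that unfolding null_char_def by blast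
  have lc: "p = chart_inv c (y s)" if s: "s \<in> J" for s
  proof -
    have "s \<in> I" using s J by blast
    then show ?thesis using limit_curve_chart(2)[OF c _ yD conv] p[OF s] by simp
  qed
  have pc: "p \<in> fst c" "snd c p = y s" if s: "s \<in> J" for s
  proof -
    have "s \<in> I" using s J by blast
    then show "p \<in> fst c" "snd c p = y s"
      using lc[OF s] chart_inv_in[OF c yD] chart_inv_right[OF c yD] by simp_all
  qed
  define W where "W = snd c ` fst c \<inter> chart_inv c -` V"
  have "open W"
    unfolding W_def by (rule continuous_open_preimage[OF continuous_chart_inv[OF c] open_image[OF c] V(1)])
  moreover have "snd c p \<in> W" using pc(1)[OF s0] c V(2) by (auto simp: W_def)
  ultimately obtain e where e: "e > 0" "ball (snd c p) e \<subseteq> W" using open_contains_ball by blast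
  obtain N where N: "\<forall>n\<ge>N. \<forall>s\<in>I. X (q n) s \<in> fst c \<and> norm (snd c (X (q n) s) - y s) < e"
    using conv e(1) by blast
  have "X (q n) s \<in> V" if n: "n \<ge> N" and s: "s \<in> J" for n s
  proof -
    have 1: "X (q n) s \<in> fst c" "norm (snd c (X (q n) s) - y s) < e" using N n s J by blast+
    then have "dist (snd c p) (snd c (X (q n) s)) < e" using pc(2)[OF s] by (simp add: dist_norm norm_minus_commute)
    then have "snd c (X (q n) s) \<in> W" using e(2) by auto
    then show ?thesis using 1(1) c by (simp add: W_def)
  qed
  then show ?thesis by blast
qed auto

lemma limit_curve_nonconstant:
  assumes good: "\<forall>t\<in>{0..1}. \<exists>d>0. good q {t-d<..<t+d}"
  shows "\<not> (\<forall>s\<in>{0..1}. limit_curve q s = p)"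
proof
  assume const: "\<forall>s\<in>{0..1}. limit_curve q s = p"
  obtain d0 where "d0 > 0" "good q {0-d0<..<0+d0}" using good by force
  then have "(\<lambda>n. X (q n) 0) \<longlonglongrightarrow> limit_curve q 0" by (intro limit_curve_tendsto) auto
  then have "(\<lambda>n. X (q n) 0) \<longlonglongrightarrow> p" using const by simp
  then have "p \<in> C"
    by (rule Lim_in_closed_set[OF compact_imp_closed[OF C(1)], rotated 2]) (simp_all add: X_in)
  then have pU: "p \<in> U" using C(3) by blast
  obtain c where c: "c \<in> \<A>" "p \<in> fst c" using chart_at .
  define W where "W = snd c ` fst c \<inter> chart_inv c -` U"
  have "open W"
    unfolding W_def by (rule continuous_open_preimage[OF continuous_chart_inv[OF c(1)] open_image[OF c(1)] U(1)])
  moreover have "snd c p \<in> W" using c pU by (auto simp: W_def)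
  ultimately obtain e where e: "e > 0" "ball (snd c p) e \<subseteq> W" using open_contains_ball by blast
  define V where "V = chart_inv c ` ball (snd c p) e"
  have V: "open V"
    unfolding V_def by (rule open_chart_inv_image[OF c(1) open_ball]) (use e(2) W_def in blast)
  have pV: "p \<in> V" unfolding V_def using c e(1) by (intro image_eqI[of _ _ "snd c p"]) auto
  \<comment> \<open>Different windows use different charts. Membership in the fixed set
    \<open>V\<close> is a form of uniform closeness that passes from one window to the next.\<close>
  let ?Q = "\<lambda>a b. \<exists>N. \<forall>n\<ge>N. \<forall>s\<in>{a..b}. X (q n) s \<in> V"
  have "?Q 0 1"
  proof (rule interval_gluing[where P="?Q"])
    fix u v t :: real assume uv: "u < v" "v < t" "?Q u v" "?Q v t"
    then obtain N1 N2 where N: "\<forall>n\<ge>N1. \<forall>s\<in>{u..v}. X (q n) s \<in> V" "\<forall>n\<ge>N2. \<forall>s\<in>{v..t}. X (q n) s \<in> V" by blast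
    have "{u..t} = {u..v} \<union> {v..t}" using uv by auto
    then show "?Q u t" using N by (intro exI[of _ "max N1 N2"]) auto
  next
    fix s :: real assume s: "0 \<le> s" "s \<le> 1"
    then obtain d where d: "d > 0" "good q {s-d<..<s+d}" using good by force
    have "?Q a b" if "0 \<le> a" "b \<le> 1" "s - d < a" "b < s + d" for a b
      by (rule good_uniform[OF d(2) _ _ V pV]) (use that const in auto)
    then show "\<exists>d>0. (\<forall>t. s < t \<and> t \<le> 1 \<and> t < s + d \<longrightarrow> ?Q s t) \<and> (\<forall>t. 0 \<le> t \<and> t < s \<and> s - d < t \<longrightarrow> ?Q t s)"
      using d(1) s by (intro exI[of _ d]) auto
  qed simp
  then obtain N where N: "\<forall>s\<in>{0..1}. X (q N) s \<in> V" by blast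
  have "\<exists>a. homotopic_loops U (x (q N)) (\<lambda>_. a)"
  proof (rule contractible_in_chart[OF c(1) convex_ball])
    show "ball (snd c p) e \<subseteq> snd c ` fst c" "chart_inv c ` ball (snd c p) e \<subseteq> U" using e(2) by (auto simp: W_def)
    show "x (q N) ` {0..1} \<subseteq> chart_inv c ` ball (snd c p) e"
      using N X_01 unfolding V_def by (auto simp: image_subset_iff)
  qed (rule continuous_loop[OF geodesic eps(1) length(1)] loop_01[OF geodesic eps(1) length(1)])+
  then show False using noncontractible by blast
qed

text \<open>Local constancy is an open condition, and so is its failure, since a parameter where it
  fails has a Kropina window all of whose points move. By connectedness of [0,1] one of the two
  holds throughout, and local constancy everywhere would make the limit constant.\<close>

theorem limit_geodesic:
  "\<exists>\<gamma>. closed_geodesic \<A> (kropina_domain \<A> \<omega>) (kropina g \<omega>) \<gamma> \<and> \<not> \<gamma> constant_on {0..1}"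
proof -
  obtain q where "strict_mono (q :: nat \<Rightarrow> nat)" and q: "\<forall>t\<in>{0..1}. \<exists>d>0. good q {t-d<..<t+d}"
    by (rule good_subsequence)
  define \<gamma> where "\<gamma> = limit_curve q"
  define still where "still t \<longleftrightarrow> (\<forall>\<^sub>F s in nhds t. \<gamma> s = \<gamma> t)" for t
  have moving: "\<exists>c d y v. kropina_window \<Delta>' \<gamma> t c d y v" "\<Delta>' > 0" if t: "t \<in> {0..1}" "\<not> still t" for t
  proof -
    obtain d where d: "d > 0" "good q {t-d<..<t+d}" using q t(1) by blast
    have "\<not> (\<forall>s\<in>{t-d<..<t+d}. \<gamma> s = \<gamma> t)"
    proof
      assume "\<forall>s\<in>{t-d<..<t+d}. \<gamma> s = \<gamma> t"
      moreover have "open {t-d<..<t+d}" "t \<in> {t-d<..<t+d}" using d(1) by auto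
      ultimately show False using t(2) unfolding still_def eventually_nhds by blast
    qed
    then show "\<exists>c d y v. kropina_window \<Delta>' \<gamma> t c d y v" "\<Delta>' > 0"
      using limit_curve_dichotomy[OF d(2,1)] unfolding \<gamma>_def by blast+
  qed
  have loc: "\<forall>\<^sub>F s in at t within {0..1}. still t = still s" if t: "t \<in> {0..1}" for t
  proof (cases "still t")
    case True
    then obtain S where S: "open S" "t \<in> S" "\<And>s. s \<in> S \<Longrightarrow> \<gamma> s = \<gamma> t" unfolding still_def eventually_nhds by blast
    have "still s" if s: "s \<in> S" for s
    proof -
      have "\<forall>\<^sub>F r in nhds s. r \<in> S" by (rule eventually_nhds_in_open[OF S(1) s])
      then show ?thesis unfolding still_def
      proof (rule eventually_mono)
        fix r assume "r \<in> S"
        then show "\<gamma> r = \<gamma> s" using S(3)[of r] S(3)[OF s] by metis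
      qed
    qed
    then show ?thesis
      using True S(1,2) unfolding eventually_at_filter eventually_nhds by blast
  next
    case False
    obtain c d y v where w: "kropina_window \<Delta>' \<gamma> t c d y v" using moving(1)[OF t False] by blast
    then have d: "d > 0" by (simp add: kropina_window_def)
    have "\<not> still s" if "s \<in> {t-d<..<t+d}" for s
      using window_nonconstant[OF window_shrink[OF w that]] unfolding still_def by blast
    moreover have "\<forall>\<^sub>F s in nhds t. s \<in> {t-d<..<t+d}" by (rule eventually_nhds_in_open) (use d in auto)
    ultimately show ?thesis
      using False unfolding eventually_at_filter by (auto elim: eventually_mono)
  qed
  have still: "still t = still 0" if "t \<in> {0..1}" for t
    by (rule connected_local_const[of "{0..1}"]) (use that loc in auto)
  have ne: "\<not> (\<forall>s\<in>{0..1}. \<gamma> s = p)" for p unfolding \<gamma>_def by (rule limit_curve_nonconstant[OF q])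
  have "\<not> still 0"
  proof
    assume "still 0"
    then have st: "still t" if "t \<in> {0..1}" for t using still[OF that] by simp
    have "\<gamma> s = \<gamma> 0" if s: "s \<in> {0..1}" for s
    proof (rule connected_local_const[of "{0..1::real}"])
      show "\<forall>a\<in>{0..1}. \<forall>\<^sub>F b in at a within {0..1}. \<gamma> a = \<gamma> b"
      proof
        fix a :: real assume "a \<in> {0..1}"
        from st[OF this] show "\<forall>\<^sub>F b in at a within {0..1}. \<gamma> a = \<gamma> b"
          unfolding still_def eventually_at_filter by (auto elim: eventually_mono)
      qed
    qed (use s in auto)
    then show False using ne by blast
  qed
  then have mv: "\<not> still t" if "t \<in> {0..1}" for t using still[OF that] by simp
  have "closed_geodesic \<A> (kropina_domain \<A> \<omega>) (kropina g \<omega>) \<gamma>"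
  proof (rule kropina_closed_geodesic)
    show "\<exists>c d y v. kropina_window \<Delta>' \<gamma> t c d y v" if "t \<in> {0..1}" for t by (rule moving(1)[OF that mv[OF that]])
    show "\<Delta>' > 0" by (rule moving(2)[of 0]) (use mv[of 0] in auto)
    show "\<gamma> (t + 1) = \<gamma> t" for t unfolding \<gamma>_def by (rule limit_curve_add_1)
  qed
  moreover have "\<not> \<gamma> constant_on {0..1}" using ne unfolding constant_on_def by blast
  ultimately show ?thesis by blast
qed

end

theorem theorem5p3:
  fixes \<A> :: "('m::{t2_space, second_countable_topology}, 'e::euclidean_space) chart set"
    and g\<^sub>0 :: "'m \<Rightarrow> ('m, 'e) tvector \<Rightarrow> ('m, 'e) tvector \<Rightarrow> real"
    and \<omega> :: "'m \<Rightarrow> ('m, 'e) tvector \<Rightarrow> real"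
    and S\<^sub>0 C U :: "'m set"
    and \<epsilon> \<Delta> :: "nat \<Rightarrow> real"
    and x :: "nat \<Rightarrow> real \<Rightarrow> 'm"
  assumes "smooth_atlas \<A>"
    and "connected (UNIV :: 'm set)"
    and "DIM('e) \<ge> 2"
    and "riemannian_metric \<A> g\<^sub>0"
    and "one_form \<A> \<omega>"
    and "S\<^sub>0 = vanishing_set \<A> \<omega>"
    and "\<And>n. \<epsilon> n > 0"
    and "\<epsilon> \<longlonglongrightarrow> 0"
    and "\<And>n. closed_geodesic \<A> (tangent_bundle \<A>) (randers g\<^sub>0 \<omega> (\<epsilon> n)) (x n)"
    and "\<And>n. \<Delta> n = curve_length \<A> (randers g\<^sub>0 \<omega> (\<epsilon> n)) (x n)"
    and "bdd_above (range \<Delta>)"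
    and "compact C"
    and "\<And>n. x n ` {0..1} \<subseteq> C"
    and "C \<subseteq> U"
    and "open U"
    and "U \<subseteq> - S\<^sub>0"
    and "compact (closure U)"
    and "\<And>n. \<not> (\<exists>a. homotopic_loops U (x n) (\<lambda>_. a))"
  shows "\<exists>\<gamma>. closed_geodesic \<A> (kropina_domain \<A> \<omega>) (kropina g\<^sub>0 \<omega>) \<gamma> \<and>
             \<not> \<gamma> constant_on {0..1}"
proof -
  interpret riemannian_atlas \<A> g\<^sub>0 \<omega> by unfold_locales (rule assms(1,4,5))+
  obtain B where B: "\<And>n. \<Delta> n \<le> B" using assms(11) by (auto simp: bdd_above_def)
  \<comment> \<open>The lengths are assumed bounded from above; this supplies the lower
    bound.\<close>
  have "\<Delta> n \<ge> 0" for n unfolding assms(10) by (rule randers_regular(1)[OF assms(9,7)])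
  then have "bounded (range \<Delta>)"
    using B by (intro boundedI[of _ B]) auto
  then obtain \<Delta>' r1 where r1: "strict_mono (r1 :: nat \<Rightarrow> nat)" "(\<Delta> \<circ> r1) \<longlonglongrightarrow> \<Delta>'"
    using bounded_imp_convergent_subsequence by blast
  obtain N where N: "\<And>n. n \<ge> N \<Longrightarrow> \<epsilon> n < 1"
    using order_tendstoD(2)[OF assms(8), of 1] by (auto simp: eventually_sequentially)
  \<comment> \<open>Skipping \<open>N\<close> terms brings \<epsilon> below \<open>1\<close>, as
    \<open>randers_sequence\<close> requires.\<close>
  define r where "r n = r1 (n + N)" for n
  have r: "strict_mono r" using r1(1) by (auto simp: r_def strict_mono_def)
  have "\<epsilon> (r n) \<le> 1" for n
    using N[of "r n"] seq_suble[OF r1(1), of "n + N"] by (simp add: r_def)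
  moreover have "(\<lambda>n. \<epsilon> (r n)) \<longlonglongrightarrow> 0" using LIMSEQ_subseq_LIMSEQ[OF assms(8) r] by (simp add: o_def)
  moreover have "(\<lambda>n. \<Delta> (r n)) \<longlonglongrightarrow> \<Delta>'" using LIMSEQ_ignore_initial_segment[OF r1(2), of N] by (simp add: r_def)
  ultimately interpret randers_sequence \<A> g\<^sub>0 \<omega> "\<lambda>n. \<epsilon> (r n)" "\<lambda>n. \<Delta> (r n)" \<Delta>' "\<lambda>n. x (r n)" C U
    by unfold_locales (use assms in auto)
  show ?thesis by (rule limit_geodesic)
qed

end
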